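(* Let $N\ge 1$. On the bosonic Fock space $\mathcal F$ described in the context, set $c=1$ and define $$\psi^{\pm,j}(z)=e^{H^j_\pm(z)},\qquad j=1,2,\dots,2N,$$ $$X^{\pm,i}(z)=\;:e^{\pm H^i(z;\mp\frac12)}\,Y^{\pm,i}(z):\,F^{\pm,i},\qquad i=1,2,\dots,2N-1,$$ where $$F^{\pm,2k-1}=\prod_{l=1}^{k-1}e^{\pm\sqrt{-1}\pi a^{2l-1}_0},\qquad F^{\pm,2k}=\prod_{l=1}^{k}e^{\mp\sqrt{-1}\pi a^{2l-1}_0},$$ $$Y^{+,2k-1}(z)=e^{c^k(z)},\qquad Y^{-,2k-1}(z)=\frac{1}{z(q-q^{-1})}\left(e^{-c^k(qz)}-e^{-c^k(q^{-1}z)}\right),$$ $$Y^{+,2k}(z)=Y^{-,2k-1}(z)=\frac{1}{z(q-q^{-1})}\left(e^{-c^k(qz)}-e^{-c^k(q^{-1}z)}\right),\qquad Y^{-,2k}(z)=-Y^{+,2k-1}(z)=-e^{c^k(z)},$$ for $k=1,2,\dots,N$ (only those with upper index at most $2N-1$ being used). Then these fields realize the Drinfeld currents of $U_q[\widehat{gl(N|N)}]$ at level one; that is, they satisfy all the defining current relations (R1)--(R8) listed in the context with $c=1$.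
   Context: $q$ is generic (a nonzero complex number that is not a root of unity, with fixed square root), and $[x]_q=(q^x-q^{-x})/(q-q^{-1})$. For homogeneous elements of a $\mathbb Z_2$-graded algebra, $[a,b]_x=ab-(-1)^{[a][b]}x\,ba$ and $[a,b]=[a,b]_1$, where $[a]\in\{0,1\}$ is the parity. Cartan matrix: $a_{jj'}$ ($1\le j,j'\le 2N$) is symmetric with $a_{ll'}=(-1)^{l+1}(\delta_{l,l'-1}-\delta_{l,l'+1})$ for $1\le l,l'\le 2N-1$, $a_{i,2N}=2(-1)^{i+1}$ for $1\le i\le 2N-1$, and $a_{2N,2N}=0$. Drinfeld currents of $U_q[\widehat{gl(N|N)}]$ (non-standard simple root system with all simple roots odd): $X^{\pm,i}(z)=\sum_{n\in\mathbb Z}X^{\pm,i}_nz^{-n-1}$ ($1\le i\le 2N-1$, all $X^{\pm,i}_n$ odd), $\psi^{\pm,j}(z)=\sum_{n}\psi^{\pm,j}_nz^{-n}=q^{\pm H^j_0}\exp\left(\pm(q-q^{-1})\sum_{n>0}H^j_{\pm n}z^{\mp n}\right)$ ($1\le j\le 2N$, even), and $c$ central. With $\delta(x)=\sum_{n\in\mathbb Z}x^n$, the defining current relations are (rational functions multiplying products with $\psi^{+}(z)$ on the left are expanded in powers of $w/z$, those with $\psi^-(z)$ on the left in powers of $z/w$): (R1) $\psi^{\pm,j}(z)\psi^{\pm,j'}(w)=\psi^{\pm,j'}(w)\psi^{\pm,j}(z)$. (R2) $\psi^{+,j}(z)\psi^{-,j'}(w)=\dfrac{(z-wq^{c+a_{jj'}})(z-wq^{-c-a_{jj'}})}{(z-wq^{c-a_{jj'}})(z-wq^{-c+a_{jj'}})}\psi^{-,j'}(w)\psi^{+,j}(z)$.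 (R3) $\psi^{+,j}(z)X^{\pm,i}(w)=q^{\pm a_{ij}}\dfrac{z-wq^{\mp\frac c2\mp a_{ij}}}{z-wq^{\mp\frac c2\pm a_{ij}}}X^{\pm,i}(w)\psi^{+,j}(z)$. (R4) $\psi^{-,j}(z)X^{\pm,i}(w)=q^{\pm a_{ij}}\dfrac{z-wq^{\pm\frac c2\mp a_{ij}}}{z-wq^{\pm\frac c2\pm a_{ij}}}X^{\pm,i}(w)\psi^{-,j}(z)$. (R5) $[X^{+,i}(z),X^{-,i'}(w)]=\dfrac{\delta_{ii'}}{(q-q^{-1})zw}\left(\delta(\tfrac wzq^c)\psi^{+,i}(wq^{\frac c2})-\delta(\tfrac wzq^{-c})\psi^{-,i}(wq^{-\frac c2})\right)$. (R6) $X^{\pm,i}(z)X^{\pm,i'}(w)+X^{\pm,i'}(w)X^{\pm,i}(z)=0$ if $a_{ii'}=0$. (R7) $(z-wq^{\pm a_{ii'}})X^{\pm,i}(z)X^{\pm,i'}(w)+(zq^{\pm a_{ii'}}-w)X^{\pm,i'}(w)X^{\pm,i}(z)=0$. (R8) For $l=2,\dots,2N-2$, the expression $[[X^{\pm,l}(z_1),X^{\pm,l-1}(z)]_{q^{(-1)^l}},[X^{\pm,l}(z_2),X^{\pm,l+1}(w)]_{q^{(-1)^{l+1}}}]$ plus the same expression with $z_1\leftrightarrow z_2$ equals $0$. Free bosons: $a^j_n,Q_{a^j}$ ($1\le j\le 2N$) and $c^l_n,Q_{c^l}$ ($1\le l\le N$), $n\in\mathbb Z$, with $[a^j_n,a^{j'}_m]=(-1)^{j+1}\delta_{jj'}\delta_{n+m,0}\frac{[n]_q^2}{n}$,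 $[a^j_0,Q_{a^{j'}}]=(-1)^{j+1}\delta_{jj'}$, $[c^l_n,c^{l'}_m]=\delta_{ll'}\delta_{n+m,0}\frac{[n]_q^2}{n}$, $[c^l_0,Q_{c^{l'}}]=\delta_{ll'}$ (the right-hand sides of the mode relations are $0$ when $n=0$), all other commutators being zero. Put, for $1\le i\le 2N-1$, $A^i_n=(-1)^{i+1}(a^i_n+a^{i+1}_n)$, $A^{2N}_n=\frac{q^n+q^{-n}}{2}\sum_{l=1}^{2N}(-1)^{l+1}a^l_n$, $Q_{A^i}=(-1)^{i+1}(Q_{a^i}+Q_{a^{i+1}})$, $Q_{A^{2N}}=\sum_{l=1}^{2N}(-1)^{l+1}Q_{a^l}$. Currents: $H^j(z;\kappa)=Q_{A^j}+A^j_0\ln z-\sum_{n\ne0}\frac{A^j_n}{[n]_q}q^{\kappa|n|}z^{-n}$, $\;c^l(z)=Q_{c^l}+c^l_0\ln z-\sum_{n\neq0}\frac{c^l_n}{[n]_q}z^{-n}$, $H^j_\pm(z)=H^j(q^{\pm\frac12}z;-\tfrac12)-H^j(q^{\mp\frac12}z;\tfrac12)=\pm(q-q^{-1})\sum_{n>0}A^j_{\pm n}z^{\mp n}\pm A^j_0\ln q$. Normal ordering $:\ :$ places negative modes and the $Q$'s to the left of positive modes and zero modes. Fock space $\mathcal F$: the direct sum, over all $(\alpha,\beta)$ with $\alpha\in\mathbb C^{2N}$ such that $\alpha_i+\alpha_{i+1}\in\mathbb Z$ ($1\le i\le 2N-1$) and $\beta\in\mathbb Z^N$, of the Fock modules generated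 by a vacuum killed by all positive modes on which $a^j_0$ and $c^l_0$ have eigenvalues $\alpha_j$ and $\beta_l$; the operators $e^{Q}$ (for $Q$ a linear combination of $Q_{a^j},Q_{c^l}$) commute with the nonzero modes, shift the eigenvalues according to the commutation relations, and send vacuum to vacuum. Fields are formal distributions with coefficients operators on $\mathcal F$. *)

theory Defs
  imports
    Complex_Main
    "HOL-Library.Multiset"
    "HOL-Library.Poly_Mapping"
    "HOL-Computational_Algebra.Formal_Power_Series"
begin

section \<open>q-numbers\<close>

text \<open>
  Complex powers of \<open>q\<close> occur (for instance in \<open>q\<close> raised to the zero mode of the current
  with index \<open>2N\<close>), so a logarithm \<open>h\<close> of \<open>q\<close> is fixed throughout: \<open>q = exp h\<close>.  This also fixes
  the square root \<open>exp (h / 2)\<close> of \<open>q\<close>, and every square root arises from some \<open>h\<close>.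
\<close>

definition qpow :: "complex \<Rightarrow> complex \<Rightarrow> complex"
  where "qpow h x = exp (h * x)"

definition qnum :: "complex \<Rightarrow> complex \<Rightarrow> complex"
  where "qnum h x = (qpow h x - qpow h (- x)) / (qpow h 1 - qpow h (- 1))"

datatype pm = Plus | Minus

fun sg :: "pm \<Rightarrow> complex"
  where "sg Plus = 1" | "sg Minus = - 1"

definition cartan :: "nat \<Rightarrow> nat \<Rightarrow> nat \<Rightarrow> int" where
  "cartan N j j' =
    (if j = 2 * N \<and> j' = 2 * N then 0
     else if j' = 2 * N then 2 * (- 1) ^ (j + 1)
     else if j = 2 * N then 2 * (- 1) ^ (j' + 1)
     else (- 1) ^ (j + 1) * (of_bool (j + 1 = j') - of_bool (j = j' + 1)))"


section \<open>Bosons and the Fock space\<close>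

text \<open>\<open>Ab j\<close> stands for the family \<open>a\<^sup>j\<close> and \<open>Cb l\<close> for the family \<open>c\<^sup>l\<close>.\<close>

datatype boson = Ab nat | Cb nat

definition bosons :: "nat \<Rightarrow> boson set"
  where "bosons N = Ab ` {1..2 * N} \<union> Cb ` {1..N}"

fun bsign :: "boson \<Rightarrow> complex" where
  "bsign (Ab j) = (- 1) ^ (j + 1)"
| "bsign (Cb l) = 1"

text \<open>
  A basis state \<open>(p, M)\<close> has zero mode eigenvalues \<open>p\<close>, and is obtained from the vacuum of that
  momentum by applying the creation operator \<open>b\<^sub>-\<^sub>n\<close> once for each occurrence of \<open>(b, n)\<close> in \<open>M\<close>.
  As the creation operators commute and act freely, these states form a basis.
\<close>

type_synonym state = "(boson \<Rightarrow> complex) \<times> (boson \<times> nat) multiset"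
type_synonym fvec = "state \<Rightarrow>\<^sub>0 complex"
type_synonym fop = "fvec \<Rightarrow> fvec"

definition cscale :: "complex \<Rightarrow> fvec \<Rightarrow> fvec"
  where "cscale x v = Poly_Mapping.map ((*) x) v"

definition lin :: "(state \<Rightarrow> fvec) \<Rightarrow> fop"
  where "lin g v = (\<Sum>k\<in>Poly_Mapping.keys v. cscale (Poly_Mapping.lookup v k) (g k))"

definition states :: "nat \<Rightarrow> state set" where
  "states N = {(p, M).
      (\<forall>b. b \<notin> bosons N \<longrightarrow> p b = 0) \<and>
      (\<forall>i\<in>{1..2 * N - 1}. p (Ab i) + p (Ab (i + 1)) \<in> \<int>) \<and>
      (\<forall>l\<in>{1..N}. p (Cb l) \<in> \<int>) \<and>
      set_mset M \<subseteq> bosons N \<times> {1..}}"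

definition fock :: "nat \<Rightarrow> fvec set"
  where "fock N = {v. Poly_Mapping.keys v \<subseteq> states N}"

definition bmode :: "complex \<Rightarrow> boson \<Rightarrow> int \<Rightarrow> fop" where
  "bmode h b n = lin (\<lambda>(p, M).
     if n < 0 then Poly_Mapping.single (p, add_mset (b, nat (- n)) M) 1
     else if n = 0 then Poly_Mapping.single (p, M) (p b)
     else Poly_Mapping.single (p, M - {#(b, nat n)#})
            (of_nat (count M (b, nat n)) * bsign b * (qnum h (of_int n))\<^sup>2 / of_int n))"

text \<open>
  For coefficients \<open>x\<close> on the bosons: \<open>exp_Q x\<close> is the exponential of \<open>\<Sum>b. x b * Q\<^sub>b\<close>,
  \<open>exp_zero N x\<close> the exponential of \<open>\<Sum>b. x b * b\<^sub>0\<close>, and \<open>zpow_zero N x k\<close> the coefficient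
  of \<open>z ^ k\<close> in \<open>z\<close> to the power \<open>\<Sum>b. x b * b\<^sub>0\<close>.
\<close>

definition exp_Q :: "(boson \<Rightarrow> complex) \<Rightarrow> fop"
  where "exp_Q x = lin (\<lambda>(p, M). Poly_Mapping.single (\<lambda>b. p b + bsign b * x b, M) 1)"

definition exp_zero :: "nat \<Rightarrow> (boson \<Rightarrow> complex) \<Rightarrow> fop"
  where "exp_zero N x = lin (\<lambda>(p, M). Poly_Mapping.single (p, M) (exp (\<Sum>b\<in>bosons N. x b * p b)))"

definition zpow_zero :: "nat \<Rightarrow> (boson \<Rightarrow> complex) \<Rightarrow> int \<Rightarrow> fop"
  where "zpow_zero N x k = lin (\<lambda>(p, M).
     Poly_Mapping.single (p, M) (of_bool ((\<Sum>b\<in>bosons N. x b * p b) = of_int k)))"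


section \<open>Boson fields and their normally ordered exponentials\<close>

text \<open>
  A boson field \<open>\<Phi>(z)\<close> is a formal linear combination of the symbols \<open>Q\<^sub>b\<close> (\<open>QQ b\<close>),
  \<open>b\<^sub>0 ln z\<close> (\<open>LogZ b\<close>), \<open>b\<^sub>0\<close> (\<open>Zero b\<close>) and \<open>b\<^sub>n z\<^sup>-\<^sup>n\<close>, \<open>n \<noteq> 0\<close> (\<open>Mode b n\<close>), given by its
  coefficients.
\<close>

datatype sym = QQ boson | LogZ boson | Zero boson | Mode boson int

type_synonym bfield = "sym \<Rightarrow> complex"

text \<open>\<open>bdilate h x \<Phi>\<close> is \<open>\<Phi>(q\<^sup>x z)\<close>, where \<open>ln (q\<^sup>x z) = x h + ln z\<close>.\<close>

fun bdilate :: "complex \<Rightarrow> complex \<Rightarrow> bfield \<Rightarrow> bfield" where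
  "bdilate h x \<Phi> (QQ b) = \<Phi> (QQ b)"
| "bdilate h x \<Phi> (LogZ b) = \<Phi> (LogZ b)"
| "bdilate h x \<Phi> (Zero b) = \<Phi> (Zero b) + x * h * \<Phi> (LogZ b)"
| "bdilate h x \<Phi> (Mode b n) = qpow h (- x * of_int n) * \<Phi> (Mode b n)"

text \<open>The coefficients of \<open>A\<^sup>j\<^sub>n\<close> with respect to the \<open>b\<^sub>n\<close>, and of \<open>Q\<close> for \<open>A\<^sup>j\<close> with respect to the \<open>Q\<^sub>b\<close>.\<close>

definition Acoef :: "complex \<Rightarrow> nat \<Rightarrow> nat \<Rightarrow> int \<Rightarrow> boson \<Rightarrow> complex" where
  "Acoef h N j n b =
    (if j = 2 * N
     then (qpow h (of_int n) + qpow h (- of_int n)) / 2 *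
          (\<Sum>l = 1..2 * N. (- 1) ^ (l + 1) * of_bool (b = Ab l))
     else (- 1) ^ (j + 1) * (of_bool (b = Ab j) + of_bool (b = Ab (j + 1))))"

definition QAcoef :: "nat \<Rightarrow> nat \<Rightarrow> boson \<Rightarrow> complex" where
  "QAcoef N j b =
    (if j = 2 * N
     then (\<Sum>l = 1..2 * N. (- 1) ^ (l + 1) * of_bool (b = Ab l))
     else (- 1) ^ (j + 1) * (of_bool (b = Ab j) + of_bool (b = Ab (j + 1))))"

fun Hfield :: "complex \<Rightarrow> nat \<Rightarrow> nat \<Rightarrow> complex \<Rightarrow> bfield" where
  "Hfield h N j \<kappa> (QQ b) = QAcoef N j b"
| "Hfield h N j \<kappa> (LogZ b) = Acoef h N j 0 b"
| "Hfield h N j \<kappa> (Zero b) = 0"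
| "Hfield h N j \<kappa> (Mode b n) =
     (if n = 0 then 0
      else - Acoef h N j n b / qnum h (of_int n) * qpow h (\<kappa> * of_int \<bar>n\<bar>))"

fun cfield :: "complex \<Rightarrow> nat \<Rightarrow> bfield" where
  "cfield h l (QQ b) = of_bool (b = Cb l)"
| "cfield h l (LogZ b) = of_bool (b = Cb l)"
| "cfield h l (Zero b) = 0"
| "cfield h l (Mode b n) = (if n = 0 then 0 else - of_bool (b = Cb l) / qnum h (of_int n))"

definition Hpm :: "complex \<Rightarrow> nat \<Rightarrow> pm \<Rightarrow> nat \<Rightarrow> bfield" where
  "Hpm h N s j = (\<lambda>y. bdilate h (sg s / 2) (Hfield h N j (- 1 / 2)) y
                    - bdilate h (- sg s / 2) (Hfield h N j (1 / 2)) y)"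

text \<open>
  A formal distribution \<open>D(z)\<close> with operator coefficients is the function sending \<open>m\<close> to its
  coefficient of \<open>z ^ m\<close>.
\<close>

type_synonym fdist = "int \<Rightarrow> fop"

text \<open>
  \<open>opser_power B k m\<close> and \<open>opser_exp B m\<close> are the coefficients of \<open>t ^ m\<close> in the \<open>k\<close>-th power and
  in the exponential of the operator series \<open>\<Sum>n\<ge>1. B n * t ^ n\<close>.  The constant term being zero, only
  the powers with \<open>k \<le> m\<close> contribute.
\<close>

fun opser_power :: "(nat \<Rightarrow> fop) \<Rightarrow> nat \<Rightarrow> nat \<Rightarrow> fop" where
  "opser_power B 0 m v = (if m = 0 then v else 0)"
| "opser_power B (Suc k) m v = (\<Sum>n = 1..m. B n (opser_power B k (m - n) v))"

definition opser_exp :: "(nat \<Rightarrow> fop) \<Rightarrow> nat \<Rightarrow> fop"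
  where "opser_exp B m v = (\<Sum>k\<le>m. cscale (1 / fact k) (opser_power B k m v))"

definition modes :: "complex \<Rightarrow> nat \<Rightarrow> bfield \<Rightarrow> int \<Rightarrow> fop"
  where "modes h N \<Phi> n v = (\<Sum>b\<in>bosons N. cscale (\<Phi> (Mode b n)) (bmode h b n v))"

text \<open>
  The normally ordered exponential of \<open>\<Phi>(z)\<close>: from left to right, the exponential of the negative
  modes, of the \<open>Q\<close>'s, of the zero modes, and of the positive modes.  In the coefficient of \<open>z ^ m\<close>
  the negative modes contribute \<open>z ^ r\<close>, the positive modes \<open>z ^ (- s)\<close>, and the zero modes the
  remaining power; only finitely many \<open>(r, s)\<close> act non-trivially on a given vector, since the
  positive modes are locally nilpotent.
\<close>

definition normal_exp :: "complex \<Rightarrow> nat \<Rightarrow> bfield \<Rightarrow> fdist" where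
  "normal_exp h N \<Phi> m v = Sum_any (\<lambda>(r :: nat, s :: nat).
     opser_exp (\<lambda>n. modes h N \<Phi> (- int n)) r
       (exp_Q (\<lambda>b. \<Phi> (QQ b))
         (exp_zero N (\<lambda>b. \<Phi> (Zero b))
           (zpow_zero N (\<lambda>b. \<Phi> (LogZ b)) (m - int r + int s)
             (opser_exp (\<lambda>n. modes h N \<Phi> (int n)) s v)))))"

text \<open>
  A list of triples \<open>(x, e, \<Phi>)\<close> represents the sum of the terms \<open>x z\<^sup>e exp \<Phi>(z)\<close> inside a normal
  ordered product, where all bosons are treated as commuting.
\<close>

type_synonym expsum = "(complex \<times> int \<times> bfield) list"

definition normal_expsum :: "complex \<Rightarrow> nat \<Rightarrow> expsum \<Rightarrow> fdist" where
  "normal_expsum h N T m v = (\<Sum>(x, e, \<Phi>)\<leftarrow>T. cscale x (normal_exp h N \<Phi> (m - e) v))"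


section \<open>The free field currents at level one\<close>

text \<open>
  \<open>Hpm\<close> contains no \<open>Q\<close> and only modes of one sign, all of which commute, so the normal ordering
  in the following exponential is vacuous.
\<close>

definition psi_cur :: "complex \<Rightarrow> nat \<Rightarrow> pm \<Rightarrow> nat \<Rightarrow> fdist"
  where "psi_cur h N s j = normal_exp h N (Hpm h N s j)"

definition Yc :: "complex \<Rightarrow> nat \<Rightarrow> expsum"
  where "Yc h k = [(1, 0, cfield h k)]"

definition Yd :: "complex \<Rightarrow> nat \<Rightarrow> expsum" where
  "Yd h k = [(1 / (qpow h 1 - qpow h (- 1)), - 1, \<lambda>y. - bdilate h 1 (cfield h k) y),
             (- 1 / (qpow h 1 - qpow h (- 1)), - 1, \<lambda>y. - bdilate h (- 1) (cfield h k) y)]"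

definition Ycur :: "complex \<Rightarrow> pm \<Rightarrow> nat \<Rightarrow> expsum" where
  "Ycur h s i = (let k = (i + 1) div 2 in
     if odd i then (case s of Plus \<Rightarrow> Yc h k | Minus \<Rightarrow> Yd h k)
     else (case s of Plus \<Rightarrow> Yd h k | Minus \<Rightarrow> map (\<lambda>(x, e, \<Phi>). (- x, e, \<Phi>)) (Yc h k)))"

definition Fcocycle :: "nat \<Rightarrow> pm \<Rightarrow> nat \<Rightarrow> fop" where
  "Fcocycle N s i = (let k = (i + 1) div 2 in
     if odd i
     then foldr (\<lambda>l A. exp_zero N (\<lambda>b. sg s * \<i> * of_real pi * of_bool (b = Ab (2 * l - 1))) \<circ> A)
            [1..<k] id
     else foldr (\<lambda>l A. exp_zero N (\<lambda>b. - sg s * \<i> * of_real pi * of_bool (b = Ab (2 * l - 1))) \<circ> A)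
            [1..<k + 1] id)"

definition X_cur :: "complex \<Rightarrow> nat \<Rightarrow> pm \<Rightarrow> nat \<Rightarrow> fdist" where
  "X_cur h N s i m =
     normal_expsum h N
       (map (\<lambda>(x, e, \<Phi>). (x, e, \<lambda>y. sg s * Hfield h N i (- sg s / 2) y + \<Phi> y)) (Ycur h s i)) m
     \<circ> Fcocycle N s i"


section \<open>The current relations\<close>

text \<open>The bracket of homogeneous operators \<open>A\<close>, \<open>B\<close> of parities \<open>da\<close>, \<open>db\<close>, with parameter \<open>x\<close>.\<close>

definition sbracket :: "nat \<Rightarrow> nat \<Rightarrow> complex \<Rightarrow> fop \<Rightarrow> fop \<Rightarrow> fop"
  where "sbracket da db x A B v = A (B v) - cscale ((- 1) ^ (da * db) * x) (B (A v))"

definition endo_on :: "fvec set \<Rightarrow> fop \<Rightarrow> bool" where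
  "endo_on V A \<longleftrightarrow>
     (\<forall>v\<in>V. A v \<in> V) \<and>
     (\<forall>u\<in>V. \<forall>v\<in>V. A (u + v) = A u + A v) \<and>
     (\<forall>x. \<forall>v\<in>V. A (cscale x v) = cscale x (A v))"

definition finsums :: "(nat \<Rightarrow> fvec) \<Rightarrow> fvec \<Rightarrow> bool"
  where "finsums f t \<longleftrightarrow> finite {k. f k \<noteq> 0} \<and> t = (\<Sum>k | f k \<noteq> 0. f k)"

definition dilate :: "complex \<Rightarrow> fdist \<Rightarrow> fdist"
  where "dilate u D m v = cscale (u powi m) (D m v)"

text \<open>The coefficient of \<open>z ^ m * w ^ n\<close> in \<open>\<delta>(u w / z) D(w)\<close>.\<close>

definition delta_times :: "complex \<Rightarrow> fdist \<Rightarrow> int \<Rightarrow> int \<Rightarrow> fop"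
  where "delta_times u D m n v = cscale (u powi (- m)) (D (n + m) v)"

text \<open>
  The relations between the currents on a space \<open>V\<close> on which the central element acts as the
  scalar \<open>c\<close>, stated for all coefficients \<open>z ^ m * w ^ n\<close> (so that the mode with index \<open>m\<close> of an
  \<open>X\<close>-current is the coefficient at \<open>- m - 1\<close>).  A rational function in front of a product is given
  as a power series in \<open>x = w / z\<close> when the left factor is \<open>\<psi>\<^sup>+(z)\<close>, where
  \<open>(z - \<alpha> w) / (z - \<beta> w) = (1 - \<alpha> x) / (1 - \<beta> x)\<close>, and in \<open>y = z / w\<close> when it is
  \<open>\<psi>\<^sup>-(z)\<close>, where \<open>(z - \<alpha> w) / (z - \<beta> w) = (y - \<alpha>) / (y - \<beta>)\<close>.
\<close>

locale drinfeld_currents =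
  fixes h :: complex and N :: nat and c :: complex and V :: "fvec set"
    and psi :: "pm \<Rightarrow> nat \<Rightarrow> fdist" and X :: "pm \<Rightarrow> nat \<Rightarrow> fdist"
  assumes psi_endo: "\<And>s j m. j \<in> {1..2 * N} \<Longrightarrow> endo_on V (psi s j m)"
    and X_endo: "\<And>s i m. i \<in> {1..2 * N - 1} \<Longrightarrow> endo_on V (X s i m)"
    and psi_psi: "\<And>s j j' m n v. j \<in> {1..2 * N} \<Longrightarrow> j' \<in> {1..2 * N} \<Longrightarrow> v \<in> V \<Longrightarrow>
      psi s j m (psi s j' n v) = psi s j' n (psi s j m v)"
    and psi_plus_psi_minus: "\<And>j j' m n v. j \<in> {1..2 * N} \<Longrightarrow> j' \<in> {1..2 * N} \<Longrightarrow> v \<in> V \<Longrightarrow>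
      (let a = of_int (cartan N j j');
           R = (1 - fps_const (qpow h (c + a)) * fps_X) * (1 - fps_const (qpow h (- c - a)) * fps_X)
             / ((1 - fps_const (qpow h (c - a)) * fps_X) * (1 - fps_const (qpow h (- c + a)) * fps_X))
       in finsums (\<lambda>k. cscale (fps_nth R k) (psi Minus j' (n - int k) (psi Plus j (m + int k) v)))
            (psi Plus j m (psi Minus j' n v)))"
    and psi_plus_X: "\<And>s j i m n v. j \<in> {1..2 * N} \<Longrightarrow> i \<in> {1..2 * N - 1} \<Longrightarrow> v \<in> V \<Longrightarrow>
      (let a = sg s * of_int (cartan N i j);
           R = fps_const (qpow h a) * ((1 - fps_const (qpow h (- sg s * c / 2 - a)) * fps_X)
             / (1 - fps_const (qpow h (- sg s * c / 2 + a)) * fps_X))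
       in finsums (\<lambda>k. cscale (fps_nth R k) (X s i (n - int k) (psi Plus j (m + int k) v)))
            (psi Plus j m (X s i n v)))"
    and psi_minus_X: "\<And>s j i m n v. j \<in> {1..2 * N} \<Longrightarrow> i \<in> {1..2 * N - 1} \<Longrightarrow> v \<in> V \<Longrightarrow>
      (let a = sg s * of_int (cartan N i j);
           R = fps_const (qpow h a) * ((fps_X - fps_const (qpow h (sg s * c / 2 - a)))
             / (fps_X - fps_const (qpow h (sg s * c / 2 + a))))
       in finsums (\<lambda>k. cscale (fps_nth R k) (X s i (n + int k) (psi Minus j (m - int k) v)))
            (psi Minus j m (X s i n v)))"
    and X_plus_X_minus: "\<And>i i' m n v. i \<in> {1..2 * N - 1} \<Longrightarrow> i' \<in> {1..2 * N - 1} \<Longrightarrow> v \<in> V \<Longrightarrow>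
      sbracket 1 1 1 (X Plus i m) (X Minus i' n) v =
      cscale (of_bool (i = i') / (qpow h 1 - qpow h (- 1)))
        (delta_times (qpow h c) (dilate (qpow h (c / 2)) (psi Plus i)) (m + 1) (n + 1) v
         - delta_times (qpow h (- c)) (dilate (qpow h (- c / 2)) (psi Minus i)) (m + 1) (n + 1) v)"
    and X_X_zero: "\<And>s i i' m n v. i \<in> {1..2 * N - 1} \<Longrightarrow> i' \<in> {1..2 * N - 1} \<Longrightarrow> v \<in> V \<Longrightarrow>
      cartan N i i' = 0 \<Longrightarrow> X s i m (X s i' n v) + X s i' n (X s i m v) = 0"
    and X_X: "\<And>s i i' m n v. i \<in> {1..2 * N - 1} \<Longrightarrow> i' \<in> {1..2 * N - 1} \<Longrightarrow> v \<in> V \<Longrightarrow>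
      (let qa = qpow h (sg s * of_int (cartan N i i'))
       in X s i (m - 1) (X s i' n v) - cscale qa (X s i m (X s i' (n - 1) v))
        + (cscale qa (X s i' n (X s i (m - 1) v)) - X s i' (n - 1) (X s i m v)) = 0)"
    and X_serre: "\<And>s l m1 m2 m n v. l \<in> {2..2 * N - 2} \<Longrightarrow> v \<in> V \<Longrightarrow>
      (let S = (\<lambda>k1 k2. sbracket 0 0 1
             (sbracket 1 1 (qpow h ((- 1) ^ l)) (X s l k1) (X s (l - 1) m))
             (sbracket 1 1 (qpow h ((- 1) ^ (l + 1))) (X s l k2) (X s (l + 1) n)) v)
       in S m1 m2 + S m2 m1 = 0)"

end

theory Submission
  imports Defs
begin

text \<open>
  All currents are sums of vertex operators, with the factors \<open>F\<close> absorbed into the zero modes.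
  A product of two vertex operators is, in either order, a normally ordered product times an
  expansion of a rational function, and these functions are of the form \<open>1\<close>, \<open>1 - a x\<close>,
  \<open>1 / (1 - a x)\<close> or \<open>(1 - a x) / (1 - b x)\<close>.  Where they agree up to sign, the relation is
  immediate; where the two expansions of a simple pole differ by a delta function, the residue is
  \<open>\<psi>\<^sup>+\<close> or \<open>\<psi>\<^sup>-\<close>, which gives (R5).

  For the Serre relation, let \<open>C\<close> and \<open>D\<close> be the neighbours of \<open>X\<close> which do and do not share its
  field \<open>c\<^sup>k\<close>.  They exchange trivially with each other, and ordering every word with respect to
  \<open>C\<close> only turns the symmetrised commutator into
  \<open>(u\<^sup>2 - 1) \<delta>\<^sub>1 \<delta>\<^sub>2 ((z\<^sub>1 - z\<^sub>2) (X\<^sub>1 X\<^sub>2 D + D X\<^sub>1 X\<^sub>2) + (u z\<^sub>1 - z\<^sub>2 / u) X\<^sub>1 D X\<^sub>2 + (u z\<^sub>2 - z\<^sub>1 / u) X\<^sub>2 D X\<^sub>1)\<close>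
  inserted into \<open>C\<close>, where \<open>X\<^sub>i = X(z\<^sub>i)\<close>, \<open>u = q\<^sup>\<plusminus>\<^sup>1\<close>, and \<open>\<delta>\<^sub>i\<close> is an expansion of the pole of \<open>X\<^sub>i C\<close>.
  The second factor vanishes by the exchange relation of \<open>X\<close> and \<open>D\<close>.  The product with
  \<open>\<delta>\<^sub>1 \<delta>\<^sub>2\<close> is well defined although these may be expanded in opposite directions, since then the
  zero of \<open>X\<^sub>1 X\<^sub>2\<close> cancels the poles with \<open>D\<close>.
\<close>

section \<open>Linear operators on the Fock space\<close>

text \<open>Products are ordered one-sidedly: a single vertex operator \<open>V \<Psi>\<close> is
  split into its creation part and the rest, and an arbitrary operator \<open>W\<close> may stand
  between them (\<open>Ins \<Psi> W\<close>). Both orders of a product then become combinations of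
  the same operators \<open>Ins \<Psi> (V \<Phi> m) n\<close>, so a relation is an identity between
  coefficients. The construction applies again when \<open>W\<close> is itself a product, as in the
  Serre relation. The obstacle throughout is that the expansions are infinite sums of operators,
  meaningful only because they are finite on each vector, while \<open>Sum_any\<close> is 0 on
  infinite support. Every interchange of sums needs a finiteness argument, which rests on the local
  nilpotency of the annihilation operators. Integrality of the zero mode eigenvalues enters the
  relations only in (R5), where the two variables are set equal. The brackets in (R8) have
  parameters t and t' in {q, 1/q}; the cancellation uses t t' = 1 and t + t' = q + 1/q, which does
  not change with the sign of the currents.\<close>

lemma lookup_cscale [simp]: "Poly_Mapping.lookup (cscale x v) k = x * Poly_Mapping.lookup v k"
  by (simp add: cscale_def Poly_Mapping.map.rep_eq when_def)

interpretation fv: vector_space cscale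
  by standard (auto intro!: poly_mapping_eqI simp: lookup_add algebra_simps)

text \<open>Linearity is required on all vectors, not only on \<open>fock N\<close>: every operator
  here is total, and an identity between two of them may be checked on single basis states
  (\<open>clin_eqI\<close>).\<close>

definition clin :: "fop \<Rightarrow> bool" where
  "clin A \<longleftrightarrow> (\<forall>u v. A (u + v) = A u + A v) \<and> (\<forall>x v. A (cscale x v) = cscale x (A v))"

lemma clinI: "(\<And>u v. A (u + v) = A u + A v) \<Longrightarrow> (\<And>x v. A (cscale x v) = cscale x (A v)) \<Longrightarrow> clin A"
  by (simp add: clin_def)

lemma clin_add: "clin A \<Longrightarrow> A (u + v) = A u + A v"
  and clin_scale: "clin A \<Longrightarrow> A (cscale x v) = cscale x (A v)"
  by (simp_all add: clin_def)

lemma clin_zero: "clin A \<Longrightarrow> A 0 = 0"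
  using clin_scale[of A 0 0] by simp

lemma clin_diff: "clin A \<Longrightarrow> A (u - v) = A u - A v"
  by (metis clin_add diff_add_cancel add_diff_cancel_right')

lemma clin_minus: "clin A \<Longrightarrow> A (- v) = - A v"
  using clin_diff[of A 0 v] clin_zero[of A] by simp

lemma clin_sum: "clin A \<Longrightarrow> A (\<Sum>i\<in>I. f i) = (\<Sum>i\<in>I. A (f i))"
  by (induction I rule: infinite_finite_induct) (auto simp: clin_zero clin_add)

lemma clin_Sum_any:
  assumes "clin A" "finite {i. f i \<noteq> 0}"
  shows "A (Sum_any f) = Sum_any (\<lambda>i. A (f i))"
proof -
  have "{i. A (f i) \<noteq> 0} \<subseteq> {i. f i \<noteq> 0}" using clin_zero[OF assms(1)] by auto
  then show ?thesis
    using assms by (simp add: Sum_any.expand_set[of f] Sum_any.expand_superset[of "{i. f i \<noteq> 0}"] clin_sum)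
qed

lemma cscale_Sum_any: "cscale x (Sum_any f) = Sum_any (\<lambda>i. cscale x (f i))"
proof (cases "x = 0")
  case False
  then have "{i. cscale x (f i) \<noteq> 0} = {i. f i \<noteq> 0}" by auto
  then show ?thesis by (simp add: Sum_any.expand_set fv.scale_sum_right)
qed simp

lemma clin_ident: "clin (\<lambda>v. v)" "clin id" and clin_0: "clin (\<lambda>v. 0)"
  by (simp_all add: clin_def)

lemma clin_comp: "clin A \<Longrightarrow> clin B \<Longrightarrow> clin (\<lambda>v. A (B v))"
  by (simp add: clin_def)

lemma clin_plus: "clin A \<Longrightarrow> clin B \<Longrightarrow> clin (\<lambda>v. A v + B v)"
  by (simp add: clin_def fv.scale_right_distrib)

lemma clin_cscale: "clin A \<Longrightarrow> clin (\<lambda>v. cscale x (A v))"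
  by (simp add: clin_def fv.scale_right_distrib mult.commute)

lemma clin_sumI: "(\<And>i. i \<in> I \<Longrightarrow> clin (A i)) \<Longrightarrow> clin (\<lambda>v. \<Sum>i\<in>I. A i v)"
  by (simp add: clin_def sum.distrib fv.scale_sum_right)

lemma clin_Sum_anyI:
  assumes "\<And>i. clin (A i)" "\<And>v. finite {i. A i v \<noteq> 0}"
  shows "clin (\<lambda>v. Sum_any (\<lambda>i. A i v))"
proof (rule clinI)
  fix u v show "Sum_any (\<lambda>i. A i (u + v)) = Sum_any (\<lambda>i. A i u) + Sum_any (\<lambda>i. A i v)"
    using assms by (simp add: clin_add Sum_any.distrib)
next
  fix x v show "Sum_any (\<lambda>i. A i (cscale x v)) = cscale x (Sum_any (\<lambda>i. A i v))"
    using assms by (simp add: clin_scale cscale_Sum_any)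
qed

lemma lin_superset:
  assumes "finite K" "Poly_Mapping.keys v \<subseteq> K"
  shows "lin g v = (\<Sum>k\<in>K. cscale (Poly_Mapping.lookup v k) (g k))"
  unfolding lin_def
  by (rule sum.mono_neutral_left) (use assms in \<open>auto simp: in_keys_iff\<close>)

lemma clin_lin: "clin (lin g)"
proof (rule clinI)
  fix u v :: fvec
  let ?K = "Poly_Mapping.keys u \<union> Poly_Mapping.keys v"
  have "Poly_Mapping.keys (u + v) \<subseteq> ?K" by (rule keys_add)
  then show "lin g (u + v) = lin g u + lin g v"
    by (simp add: lin_superset[of ?K] lookup_add fv.scale_left_distrib sum.distrib)
next
  fix x and v :: fvec
  have "Poly_Mapping.keys (cscale x v) \<subseteq> Poly_Mapping.keys v"
    by (auto simp: in_keys_iff)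
  then show "lin g (cscale x v) = cscale x (lin g v)"
    by (simp add: lin_superset[of "Poly_Mapping.keys v"] fv.scale_sum_right)
qed

lemma lin_single [simp]: "lin g (Poly_Mapping.single k x) = cscale x (g k)"
  by (cases "x = 0") (simp_all add: lin_def)

lemma fvec_decomp: "v = (\<Sum>k\<in>Poly_Mapping.keys v. cscale (Poly_Mapping.lookup v k) (Poly_Mapping.single k 1))"
proof (rule poly_mapping_eqI)
  fix j
  have "(\<Sum>k\<in>Poly_Mapping.keys v. Poly_Mapping.lookup v k * Poly_Mapping.lookup (Poly_Mapping.single k 1) j)
      = (\<Sum>k\<in>Poly_Mapping.keys v. if k = j then Poly_Mapping.lookup v k else 0)"
    by (rule sum.cong) (auto simp: lookup_single when_def)
  also have "\<dots> = Poly_Mapping.lookup v j"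
    by (auto simp: in_keys_iff)
  finally show "Poly_Mapping.lookup v j = Poly_Mapping.lookup (\<Sum>k\<in>Poly_Mapping.keys v. cscale (Poly_Mapping.lookup v k) (Poly_Mapping.single k 1)) j"
    by (simp add: lookup_sum)
qed

lemma clin_eqI:
  assumes "clin A" "clin B" "\<And>p M. A (Poly_Mapping.single (p, M) 1) = B (Poly_Mapping.single (p, M) 1)"
  shows "A v = B v"
proof -
  have "A v = A (\<Sum>k\<in>Poly_Mapping.keys v. cscale (Poly_Mapping.lookup v k) (Poly_Mapping.single k 1))"
    using fvec_decomp[of v] by simp
  also have "\<dots> = (\<Sum>k\<in>Poly_Mapping.keys v. cscale (Poly_Mapping.lookup v k) (A (Poly_Mapping.single k 1)))"
    by (simp add: clin_sum clin_scale assms)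
  also have "\<dots> = (\<Sum>k\<in>Poly_Mapping.keys v. cscale (Poly_Mapping.lookup v k) (B (Poly_Mapping.single k 1)))"
    by (rule sum.cong) (auto simp: assms(3))
  also have "\<dots> = B (\<Sum>k\<in>Poly_Mapping.keys v. cscale (Poly_Mapping.lookup v k) (Poly_Mapping.single k 1))"
    by (simp add: clin_sum clin_scale assms)
  also have "\<dots> = B v" using fvec_decomp[of v] by simp
  finally show ?thesis .
qed

section \<open>Exponentials of operator series\<close>

text \<open>Integer indices with value 0 below 0 let later index shifts go through without truncated
  subtraction.\<close>

definition oexp :: "(nat \<Rightarrow> fop) \<Rightarrow> int \<Rightarrow> fop" where
  "oexp B r v = (if r < 0 then 0 else opser_exp B (nat r) v)"

lemma oexp_neg [simp]: "r < 0 \<Longrightarrow> oexp B r v = 0"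
  by (simp add: oexp_def)

lemma oexp_0 [simp]: "oexp B 0 v = v"
  by (simp add: oexp_def opser_exp_def)

lemma tri_swap:
  fixes f :: "nat \<Rightarrow> nat \<Rightarrow> 'a::comm_monoid_add"
  shows "(\<Sum>n = 1..m. \<Sum>k = 1..m - n. f n k) = (\<Sum>k = 1..m. \<Sum>n = 1..m - k. f n k)"
  unfolding sum.Sigma[OF finite_atLeastAtMost ballI[OF finite_atLeastAtMost]]
  by (rule sum.reindex_bij_witness[of _ "\<lambda>(a, b). (b, a)" "\<lambda>(a, b). (b, a)"]) auto

locale commuting_ops =
  fixes B :: "nat \<Rightarrow> fop"
  assumes lin [simp]: "clin (B n)"
    and comm: "n > 0 \<Longrightarrow> m > 0 \<Longrightarrow> B n (B m v) = B m (B n v)"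
begin

lemma clin_power: "clin (opser_power B k m)"
proof (induction k arbitrary: m)
  case (Suc k)
  have "clin (\<lambda>v. \<Sum>n = 1..m. B n (opser_power B k (m - n) v))"
    by (rule clin_sumI, rule clin_comp) (auto intro: Suc)
  then show ?case by (simp add: clin_def)
qed (simp add: clin_def)

lemma clin_exp: "clin (opser_exp B m)"
proof -
  have "clin (\<lambda>v. \<Sum>k\<le>m. cscale (1 / fact k) (opser_power B k m v))"
    by (intro clin_sumI clin_cscale clin_power)
  then show ?thesis by (simp add: clin_def opser_exp_def)
qed

lemma clin_oexp [simp]: "clin (oexp B r)"
  using clin_exp by (simp add: clin_def oexp_def)

lemma power_commute:
  assumes "clin T" "\<And>n v. n > 0 \<Longrightarrow> T (B n v) = B n (T v)"
  shows "T (opser_power B k m v) = opser_power B k m (T v)"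
proof (induction k arbitrary: m)
  case (Suc k)
  then show ?case by (simp add: clin_sum assms)
qed (simp add: clin_zero assms)

lemma oexp_commute:
  assumes "clin T" "\<And>n v. n > 0 \<Longrightarrow> T (B n v) = B n (T v)"
  shows "T (oexp B r v) = oexp B r (T v)"
  by (simp add: oexp_def opser_exp_def clin_sum clin_scale clin_zero assms power_commute)

lemma power_high: "k > m \<Longrightarrow> opser_power B k m v = 0"
proof (induction k arbitrary: m)
  case (Suc k)
  have "(\<Sum>n = 1..m. B n (opser_power B k (m - n) v)) = 0"
    by (rule sum.neutral) (use Suc in \<open>auto simp: clin_zero[OF lin]\<close>)
  then show ?case by simp
qed simp

text \<open>This is t d/dt B(t)^(k+1) = (k+1) (t B'(t)) B(t)^k at t^m; because the coefficients
  commute, all terms of the Leibniz rule agree.\<close>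

lemma power_rec:
  "cscale (of_nat m) (opser_power B (Suc k) m v) =
   cscale (of_nat (Suc k)) (\<Sum>n = 1..m. cscale (of_nat n) (B n (opser_power B k (m - n) v)))"
proof (induction k arbitrary: m)
  case 0
  have "cscale (of_nat m) (B n (opser_power B 0 (m - n) v)) = cscale (of_nat n) (B n (opser_power B 0 (m - n) v))"
    if "n \<in> {1..m}" for n
    using that by (cases "n = m") (auto simp: clin_zero[OF lin])
  then have "(\<Sum>n = 1..m. cscale (of_nat m) (B n (opser_power B 0 (m - n) v))) =
    (\<Sum>n = 1..m. cscale (of_nat n) (B n (opser_power B 0 (m - n) v)))"
    by (rule sum.cong[OF refl])
  then show ?case by (simp add: fv.scale_sum_right)
next
  case (Suc k)
  have "cscale (of_nat m) (opser_power B (Suc (Suc k)) m v) =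
    (\<Sum>n = 1..m. cscale (of_nat m) (B n (opser_power B (Suc k) (m - n) v)))"
    by (simp add: fv.scale_sum_right)
  \<comment> \<open>Splitting m = n + (m - n) differentiates the first factor and the remaining
    power separately.\<close>
  also have "\<dots> = (\<Sum>n = 1..m. cscale (of_nat n) (B n (opser_power B (Suc k) (m - n) v)) +
      B n (cscale (of_nat (m - n)) (opser_power B (Suc k) (m - n) v)))"
    by (rule sum.cong) (auto simp: clin_scale[OF lin] fv.scale_left_distrib[symmetric] simp del: opser_power.simps)
  also have "\<dots> = (\<Sum>n = 1..m. cscale (of_nat n) (B n (opser_power B (Suc k) (m - n) v))) +
      cscale (of_nat (Suc k)) (\<Sum>n = 1..m. \<Sum>n' = 1..m - n. cscale (of_nat n') (B n (B n' (opser_power B k (m - n - n') v))))"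
    by (simp only: Suc sum.distrib clin_scale[OF lin] clin_sum[OF lin] fv.scale_sum_right)
  also have "(\<Sum>n = 1..m. \<Sum>n' = 1..m - n. cscale (of_nat n') (B n (B n' (opser_power B k (m - n - n') v)))) =
     (\<Sum>n' = 1..m. \<Sum>n = 1..m - n'. cscale (of_nat n') (B n' (B n (opser_power B k (m - n' - n) v))))"
    by (subst tri_swap) (intro sum.cong refl, auto simp: comm add.commute)
  also have "\<dots> = (\<Sum>n' = 1..m. cscale (of_nat n') (B n' (opser_power B (Suc k) (m - n') v)))"
    by (simp add: clin_sum[OF lin] fv.scale_sum_right)
  finally have *: "cscale (of_nat m) (opser_power B (Suc (Suc k)) m v) =
      cscale 1 (\<Sum>n = 1..m. cscale (of_nat n) (B n (opser_power B (Suc k) (m - n) v))) +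
      cscale (of_nat (Suc k)) (\<Sum>n = 1..m. cscale (of_nat n) (B n (opser_power B (Suc k) (m - n) v)))"
    by (simp del: opser_power.simps of_nat_Suc)
  show ?case
    unfolding * by (simp only: fv.scale_left_distrib[symmetric] of_nat_Suc[of "Suc k"])
qed

text \<open>The differential equation t d/dt exp B(t) = (t B'(t)) exp B(t), read off at t^m. Later
  identities between exponentials are proved through this recursion.\<close>

lemma exp_rec:
  "cscale (of_nat m) (opser_exp B m v) = (\<Sum>n = 1..m. cscale (of_nat n) (B n (opser_exp B (m - n) v)))"
proof (cases m)
  case (Suc m')
  have "cscale (of_nat m) (opser_exp B m v) =
     (\<Sum>k\<le>Suc m'. cscale (1 / fact k) (cscale (of_nat m) (opser_power B k m v)))"
    by (simp add: opser_exp_def Suc fv.scale_sum_right mult.commute del: sum.atMost_Suc)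
  also have "\<dots> = (\<Sum>k\<le>m'. cscale (1 / fact (Suc k)) (cscale (of_nat m) (opser_power B (Suc k) m v)))"
    by (subst sum.atMost_Suc_shift) (simp add: Suc)
  also have "\<dots> = (\<Sum>k\<le>m'. \<Sum>n = 1..m. cscale (of_nat n) (B n (cscale (1 / fact k) (opser_power B k (m - n) v))))"
    unfolding power_rec
    by (intro sum.cong refl) (simp add: fv.scale_sum_right clin_scale[OF lin] mult.commute del: of_nat_Suc)
  also have "\<dots> = (\<Sum>n = 1..m. cscale (of_nat n) (B n (\<Sum>k\<le>m'. cscale (1 / fact k) (opser_power B k (m - n) v))))"
    by (subst sum.swap) (simp add: clin_sum[OF lin] fv.scale_sum_right)
  also have "\<dots> = (\<Sum>n = 1..m. cscale (of_nat n) (B n (opser_exp B (m - n) v)))"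
  proof (intro sum.cong refl, goal_cases)
    case (1 n)
    have "(\<Sum>k\<le>m'. cscale (1 / fact k) (opser_power B k (m - n) v)) = opser_exp B (m - n) v"
      unfolding opser_exp_def
      by (rule sum.mono_neutral_right) (use 1 Suc in \<open>auto simp: power_high\<close>)
    then show ?case by simp
  qed
  finally show ?thesis .
qed simp

text \<open>The free upper bound \<open>K\<close> lets sums for different r share one range; surplus
  terms have a negative index.\<close>

lemma oexp_rec:
  assumes "r \<le> int K"
  shows "cscale (of_int r) (oexp B r v) = (\<Sum>n = 1..K. cscale (of_nat n) (B n (oexp B (r - int n) v)))"
proof (cases "r < 0")
  case True
  then show ?thesis by (simp add: clin_zero[OF lin])
next
  case False
  then obtain m where m: "r = int m" by (metis nat_0_le not_less)
  have "(\<Sum>n = 1..K. cscale (of_nat n) (B n (oexp B (r - int n) v))) =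
    (\<Sum>n = 1..m. cscale (of_nat n) (B n (oexp B (r - int n) v)))"
    by (rule sum.mono_neutral_right) (use assms m in \<open>auto simp: clin_zero[OF lin]\<close>)
  also have "\<dots> = (\<Sum>n = 1..m. cscale (of_nat n) (B n (opser_exp B (m - n) v)))"
    by (rule sum.cong) (auto simp: m oexp_def nat_diff_distrib)
  finally show ?thesis using exp_rec[of m v] by (simp add: m oexp_def)
qed

text \<open>The factor r on the left is invertible for r > 0, so the recursion fixes every
  coefficient from the one at 0.\<close>

lemma oexp_unique:
  assumes "\<And>r. r < 0 \<Longrightarrow> W r = 0" "W 0 = v"
    and "\<And>r K. 0 < r \<Longrightarrow> r \<le> int K \<Longrightarrow> cscale (of_int r) (W r) = (\<Sum>n = 1..K. cscale (of_nat n) (B n (W (r - int n))))"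
  shows "W r = oexp B r v"
proof (cases "r \<ge> 0")
  case True
  have "W (int m) = oexp B (int m) v" for m
  proof (induction m rule: less_induct)
    case (less m)
    show ?case
    proof (cases "m = 0")
      case False
      have "cscale (of_int (int m)) (W (int m)) = (\<Sum>n = 1..m. cscale (of_nat n) (B n (W (int m - int n))))"
        by (rule assms(3)) (use False in auto)
      also have "\<dots> = (\<Sum>n = 1..m. cscale (of_nat n) (B n (oexp B (int m - int n) v)))"
        by (intro sum.cong refl) (use less in \<open>auto simp: of_nat_diff[symmetric] simp del: of_nat_diff\<close>)
      also have "\<dots> = cscale (of_int (int m)) (oexp B (int m) v)"
        by (rule oexp_rec[symmetric]) simp
      finally show ?thesis using False by simp
    qed (use assms(2) in simp)
  qed
  from this[of "nat r"] True show ?thesis by simp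
qed (use assms(1) in simp)

end

text \<open>\<open>is_contr \<beta> C\<close> says that \<open>C\<close> is the exponential of the power series with coefficients \<open>\<beta> n\<close>, \<open>n \<ge> 1\<close>.\<close>

definition is_contr :: "(nat \<Rightarrow> complex) \<Rightarrow> complex fps \<Rightarrow> bool" where
  "is_contr \<beta> C \<longleftrightarrow> fps_nth C 0 = 1 \<and>
     fps_deriv C = Abs_fps (\<lambda>n. of_nat (Suc n) * \<beta> (Suc n)) * C"

text \<open>The scalar analogue of \<open>exp_rec\<close>, padded with zeros up to a common bound
  \<open>K\<close>.\<close>

lemma is_contr_rec:
  assumes "is_contr \<beta> C" "k \<le> K"
  shows "of_nat k * fps_nth C k = (\<Sum>n = 1..K. if n \<le> k then of_nat n * \<beta> n * fps_nth C (k - n) else 0)"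
proof (cases k)
  case (Suc k')
  have "of_nat k * fps_nth C k = fps_nth (fps_deriv C) k'" by (simp add: Suc)
  also have "\<dots> = (\<Sum>i = 0..k'. of_nat (Suc i) * \<beta> (Suc i) * fps_nth C (k' - i))"
    using assms(1) by (simp add: is_contr_def fps_mult_nth del: of_nat_Suc)
  also have "\<dots> = (\<Sum>n = 1..k. of_nat n * \<beta> n * fps_nth C (k - n))"
    unfolding One_nat_def Suc sum.atLeast_Suc_atMost_Suc_shift by simp
  also have "\<dots> = (\<Sum>n = 1..K. if n \<le> k then of_nat n * \<beta> n * fps_nth C (k - n) else 0)"
    by (rule sum.mono_neutral_cong_left) (use assms in auto)
  finally show ?thesis .
qed simp

lemma is_contr_one: "(\<And>n. n > 0 \<Longrightarrow> \<beta> n = 0) \<Longrightarrow> is_contr \<beta> 1"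
  unfolding is_contr_def by (auto intro!: fps_ext)

lemma is_contr_mult:
  assumes "is_contr \<beta> C" "is_contr \<beta>' C'"
  shows "is_contr (\<lambda>n. \<beta> n + \<beta>' n) (C * C')"
proof -
  have "Abs_fps (\<lambda>n. of_nat (Suc n) * (\<beta> (Suc n) + \<beta>' (Suc n))) =
     Abs_fps (\<lambda>n. of_nat (Suc n) * \<beta> (Suc n)) + Abs_fps (\<lambda>n. of_nat (Suc n) * \<beta>' (Suc n))"
    by (rule fps_ext) (simp add: algebra_simps)
  then show ?thesis using assms by (simp add: is_contr_def algebra_simps)
qed

lemma is_contr_cong: "is_contr \<beta> C \<Longrightarrow> (\<And>n. n > 0 \<Longrightarrow> \<beta> n = \<beta>' n) \<Longrightarrow> is_contr \<beta>' C"
  by (simp add: is_contr_def)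

definition geo :: "complex \<Rightarrow> complex fps" where "geo a = Abs_fps (\<lambda>n. a ^ n)"

lemma geo_nth [simp]: "fps_nth (geo a) n = a ^ n"
  by (simp add: geo_def)

lemma geo_mult: "(1 - fps_const a * fps_X) * geo a = 1"
proof (rule fps_ext)
  fix n show "fps_nth ((1 - fps_const a * fps_X) * geo a) n = fps_nth 1 n"
    by (cases n) (simp_all add: left_diff_distrib mult.assoc)
qed

text \<open>The coefficients a^n / n are those of - log (1 - a x). Every nontrivial contraction in
  the proof is a product of series of this kind and of the kind in
  \<open>is_contr_lin\<close>.\<close>

lemma is_contr_geo: "is_contr (\<lambda>n. a ^ n / of_nat n) (geo a)"
proof -
  have "fps_nth (Abs_fps (\<lambda>n. of_nat (Suc n) * (a ^ Suc n / of_nat (Suc n))) * geo a) k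
      = fps_nth (fps_deriv (geo a)) k" for k
  proof -
    have "fps_nth (Abs_fps (\<lambda>n. of_nat (Suc n) * (a ^ Suc n / of_nat (Suc n))) * geo a) k
       = (\<Sum>i = 0..k. a ^ Suc i * a ^ (k - i))"
      by (simp add: fps_mult_nth del: of_nat_Suc power_Suc)
    also have "\<dots> = (\<Sum>i = 0..k. a ^ Suc k)"
      by (rule sum.cong) (auto simp: power_add[symmetric] simp del: power_Suc)
    finally show ?thesis by (simp del: power_Suc)
  qed
  then show ?thesis unfolding is_contr_def by (auto intro!: fps_ext)
qed

lemma is_contr_lin: "is_contr (\<lambda>n. - (a ^ n) / of_nat n) (1 - fps_const a * fps_X)"
proof -
  have "Abs_fps (\<lambda>n. of_nat (Suc n) * (- (a ^ Suc n) / of_nat (Suc n))) = - fps_const a * geo a"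
    by (rule fps_ext) (simp del: of_nat_Suc)
  moreover have "fps_deriv (1 - fps_const a * fps_X) = - fps_const a * ((1 - fps_const a * fps_X) * geo a)"
    unfolding geo_mult by simp
  ultimately show ?thesis unfolding is_contr_def by (simp add: mult_ac)
qed

text \<open>Heisenberg commutation: \<open>B\<close> plays the annihilation and \<open>D\<close> the
  creation operators, their commutators being scalars.\<close>

locale exchange_ops = B: commuting_ops B + D: commuting_ops D for B D +
  fixes \<beta> :: "nat \<Rightarrow> complex" and C :: "complex fps"
  assumes contr: "is_contr \<beta> C"
    and BD: "n > 0 \<Longrightarrow> m > 0 \<Longrightarrow> B n (D m v) = D m (B n v) + cscale (if n = m then \<beta> n else 0) v"
begin

text \<open>Since the commutator of \<open>B n\<close> with D(t) is the scalar \<beta> n t^n,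
  commuting with \<open>B n\<close> multiplies exp D(t) by that scalar.\<close>

lemma B_oexp_D:
  assumes "n > 0"
  shows "B n (oexp D r v) = oexp D r (B n v) + cscale (\<beta> n) (oexp D (r - int n) v)"
proof -
  have "B n (oexp D (int r) v) = oexp D (int r) (B n v) + cscale (\<beta> n) (oexp D (int r - int n) v)" for r
  proof (induction r rule: less_induct)
    case (less r)
    show ?case
    proof (cases "r = 0")
      case False
      \<comment> \<open>Large enough for the recursions at r and at r - n, and for the range to
        contain k = n.\<close>
      define K where "K = r + n"
      define E where "E = oexp D"
      have E_lin: "clin (E j)" for j by (simp add: E_def)
      have IH: "B n (E (int r - int k) v) = E (int r - int k) (B n v) + cscale (\<beta> n) (E (int r - int k - int n) v)"
        if "k > 0" for k
      proof (cases "k \<le> r")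
        case True
        then show ?thesis using less[of "r - k"] that by (simp add: E_def)
      qed (use assms in \<open>simp add: E_def clin_zero[OF B.lin]\<close>)
      have "cscale (of_int (int r)) (B n (E (int r) v)) =
          B n (\<Sum>k = 1..K. cscale (of_nat k) (D k (E (int r - int k) v)))"
        by (subst D.oexp_rec[symmetric, folded E_def]) (simp_all add: K_def clin_scale[OF B.lin])
      also have "\<dots> = (\<Sum>k = 1..K. cscale (of_nat k) (D k (B n (E (int r - int k) v))) +
           (if k = n then cscale (of_nat n) (cscale (\<beta> n) (E (int r - int n) v)) else 0))"
        unfolding clin_sum[OF B.lin]
        by (intro sum.cong refl) (use assms in \<open>auto simp: BD clin_scale[OF B.lin] fv.scale_right_distrib\<close>)
      also have "\<dots> = (\<Sum>k = 1..K. cscale (of_nat k) (D k (E (int r - int k) (B n v)))) +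
           cscale (\<beta> n) (\<Sum>k = 1..K. cscale (of_nat k) (D k (E (int r - int n - int k) v))) +
           cscale (of_nat n) (cscale (\<beta> n) (E (int r - int n) v))"
        using assms
        by (simp add: sum.distrib IH clin_add[OF D.lin] clin_scale[OF D.lin] fv.scale_right_distrib
              fv.scale_sum_right K_def mult.commute diff_diff_eq add.commute)
      also have "(\<Sum>k = 1..K. cscale (of_nat k) (D k (E (int r - int k) (B n v)))) = cscale (of_int (int r)) (E (int r) (B n v))"
        by (rule D.oexp_rec[symmetric, folded E_def]) (simp add: K_def)
      also have "(\<Sum>k = 1..K. cscale (of_nat k) (D k (E (int r - int n - int k) v))) = cscale (of_int (int r - int n)) (E (int r - int n) v)"
        by (rule D.oexp_rec[symmetric, folded E_def]) (simp add: K_def)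
      also have "cscale (of_int (int r)) (E (int r) (B n v)) +
           cscale (\<beta> n) (cscale (of_int (int r - int n)) (E (int r - int n) v)) +
           cscale (of_nat n) (cscale (\<beta> n) (E (int r - int n) v)) =
           cscale (of_int (int r)) (E (int r) (B n v) + cscale (\<beta> n) (E (int r - int n) v))"
        by (rule poly_mapping_eqI) (simp add: lookup_add algebra_simps)
      finally show ?thesis
        using False by (simp add: E_def)
    qed (use assms in simp)
  qed
  from this[of "nat r"] show ?thesis
    using assms by (cases "r \<ge> 0") (auto simp: clin_zero[OF B.lin])
qed

text \<open>The Baker-Campbell-Hausdorff formula for scalar commutators, exp B(x) exp D(y) = C(x y)
  exp D(y) exp B(x). The induction on s runs through the recursion for exp B.\<close>

lemma oexp_exchange:
  assumes "s \<le> int K"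
  shows "oexp B s (oexp D r v) = (\<Sum>k = 0..K. cscale (fps_nth C k) (oexp D (r - int k) (oexp B (s - int k) v)))"
proof (cases "s \<ge> 0")
  case True
  have "oexp B (int s) (oexp D r v) = (\<Sum>k = 0..K. cscale (fps_nth C k) (oexp D (r - int k) (oexp B (int s - int k) v)))"
    if "s \<le> K" for s
    using that
  proof (induction s rule: less_induct)
    case (less s)
    show ?case
    proof (cases "s = 0")
      case True
      have "(\<Sum>k = 0..K. cscale (fps_nth C k) (oexp D (r - int k) (oexp B (int s - int k) v))) =
         (\<Sum>k \<in> {0}. cscale (fps_nth C k) (oexp D (r - int k) (oexp B (int s - int k) v)))"
        by (rule sum.mono_neutral_right) (use True in \<open>auto simp: clin_zero[OF D.clin_oexp]\<close>)
      then show ?thesis using True contr by (simp add: is_contr_def)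
    next
      case False
      define G where "G k = oexp D (r - int k) (oexp B (int s - int k) v)" for k
      have G0: "G k = 0" if "k > s" for k
        using that by (simp add: G_def clin_zero[OF D.clin_oexp])
      have IH: "oexp B (int s - int n) (oexp D r v) =
         (\<Sum>k = 0..K. cscale (fps_nth C k) (oexp D (r - int k) (oexp B (int s - int n - int k) v)))" if "n > 0" for n
      proof (cases "n \<le> s")
        case True
        then show ?thesis using less.IH[of "s - n"] less.prems that False by simp
      qed (simp add: clin_zero[OF D.clin_oexp])
      have "cscale (of_int (int s)) (oexp B (int s) (oexp D r v)) =
         (\<Sum>n = 1..K. cscale (of_nat n) (B n (oexp B (int s - int n) (oexp D r v))))"
        by (rule B.oexp_rec) (use less in simp)
      also have "\<dots> = (\<Sum>n = 1..K. \<Sum>k = 0..K. cscale (of_nat n * fps_nth C k) (oexp D (r - int k) (B n (oexp B (int s - int k - int n) v)))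
          + cscale (of_nat n * \<beta> n * fps_nth C k) (G (n + k)))"
      proof (intro sum.cong refl, goal_cases)
        case (1 n)
        then have n: "n > 0" by simp
        have "B n (oexp B (int s - int n) (oexp D r v)) = 
          (\<Sum>k = 0..K. cscale (fps_nth C k) (B n (oexp D (r - int k) (oexp B (int s - int n - int k) v))))"
          by (simp add: IH[OF n] clin_sum[OF B.lin] clin_scale[OF B.lin])
        also have "\<dots> = (\<Sum>k = 0..K. cscale (fps_nth C k) (oexp D (r - int k) (B n (oexp B (int s - int k - int n) v))
            + cscale (\<beta> n) (G (n + k))))"
          by (intro sum.cong refl) (simp add: B_oexp_D[OF n] G_def diff_diff_eq add.commute)
        finally show ?case
          by (simp add: fv.scale_sum_right fv.scale_right_distrib mult_ac)
      qed
      also have "\<dots> = (\<Sum>k = 0..K. cscale (fps_nth C k) (oexp D (r - int k) (\<Sum>n = 1..K. cscale (of_nat n) (B n (oexp B (int s - int k - int n) v)))))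
          + (\<Sum>n = 1..K. \<Sum>k = 0..K. cscale (of_nat n * \<beta> n * fps_nth C k) (G (n + k)))"
        unfolding sum.distrib
        by (subst sum.swap) (simp add: clin_sum[OF D.clin_oexp] clin_scale[OF D.clin_oexp] fv.scale_sum_right mult.commute)
      \<comment> \<open>Collecting by n + k turns the commutator terms into the recursion for the
        coefficients of \<open>C\<close>.\<close>
      also have "(\<Sum>n = 1..K. \<Sum>k = 0..K. cscale (of_nat n * \<beta> n * fps_nth C k) (G (n + k))) =
         (\<Sum>n = 1..K. \<Sum>k = 0..K. cscale (if n \<le> k then of_nat n * \<beta> n * fps_nth C (k - n) else 0) (G k))"
      proof (rule sum.cong[OF refl], goal_cases)
        case (1 n)
        have "(\<Sum>k = 0..K. cscale (of_nat n * \<beta> n * fps_nth C k) (G (n + k))) =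
          (\<Sum>k\<in>{n..n+K}. cscale (if n \<le> k then of_nat n * \<beta> n * fps_nth C (k - n) else 0) (G k))"
          by (rule sum.reindex_bij_witness[of _ "\<lambda>k. k - n" "\<lambda>k. k + n"]) (auto simp: add.commute)
        also have "\<dots> = (\<Sum>k\<in>{0..n+K}. cscale (if n \<le> k then of_nat n * \<beta> n * fps_nth C (k - n) else 0) (G k))"
          by (rule sum.mono_neutral_left) auto
        also have "\<dots> = (\<Sum>k = 0..K. cscale (if n \<le> k then of_nat n * \<beta> n * fps_nth C (k - n) else 0) (G k))"
          by (rule sum.mono_neutral_right) (use less.prems in \<open>auto simp: G0\<close>)
        finally show ?case .
      qed
      also have "\<dots> = (\<Sum>k = 0..K. cscale (of_nat k * fps_nth C k) (G k))"
        by (subst sum.swap) (intro sum.cong refl, subst is_contr_rec[OF contr, of _ K], simp_all add: fv.scale_sum_left)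
      also have "(\<Sum>k = 0..K. cscale (fps_nth C k) (oexp D (r - int k) (\<Sum>n = 1..K. cscale (of_nat n) (B n (oexp B (int s - int k - int n) v)))))
        = (\<Sum>k = 0..K. cscale (fps_nth C k * of_int (int s - int k)) (G k))"
        by (intro sum.cong refl, subst B.oexp_rec[symmetric])
           (use less.prems in \<open>auto simp: clin_scale[OF D.clin_oexp] G_def\<close>)
      \<comment> \<open>The weight s - k from exp B and the weight k from \<open>C\<close> add up to
        s.\<close>
      also have "(\<Sum>k = 0..K. cscale (fps_nth C k * of_int (int s - int k)) (G k)) + (\<Sum>k = 0..K. cscale (of_nat k * fps_nth C k) (G k))
         = cscale (of_int (int s)) (\<Sum>k = 0..K. cscale (fps_nth C k) (G k))"
        unfolding fv.scale_sum_right sum.distrib[symmetric] fv.scale_left_distrib[symmetric] fv.scale_scale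
        by (intro sum.cong refl arg_cong2[where f = cscale]) (simp add: algebra_simps)
      finally show ?thesis using False by (simp add: G_def)
    qed
  qed
  from this[of "nat s"] assms True show ?thesis by simp
next
  case False
  then show ?thesis by (simp add: clin_zero[OF D.clin_oexp])
qed

end

section \<open>Modes and zero modes\<close>

lemma clin_bmode [simp]: "clin (bmode h b n)"
  by (simp add: bmode_def clin_lin)

lemma bmode_neg_single:
  "n > 0 \<Longrightarrow> bmode h b (- int n) (Poly_Mapping.single (p, M) 1) = Poly_Mapping.single (p, add_mset (b, n) M) 1"
  by (simp add: bmode_def)

lemma bmode_pos_single:
  "n > 0 \<Longrightarrow> bmode h b (int n) (Poly_Mapping.single (p, M) 1) =
    cscale (of_nat (count M (b, n)) * bsign b * (qnum h (of_nat n))\<^sup>2 / of_nat n) (Poly_Mapping.single (p, M - {#(b, n)#}) 1)"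
  by (auto simp: bmode_def intro!: poly_mapping_eqI simp: lookup_single when_def)

lemma bmode_commute_neg:
  assumes "n > 0" "m > 0"
  shows "bmode h b (- int n) (bmode h b' (- int m) v) = bmode h b' (- int m) (bmode h b (- int n) v)"
  by (rule clin_eqI) (use assms in \<open>simp_all add: clin_comp[OF clin_bmode clin_bmode] bmode_neg_single add_mset_commute\<close>)

lemma bmode_commute_pos:
  assumes "n > 0" "m > 0"
  shows "bmode h b (int n) (bmode h b' (int m) v) = bmode h b' (int m) (bmode h b (int n) v)"
proof (rule clin_eqI[where A = "\<lambda>v. bmode h b (int n) (bmode h b' (int m) v)" and B = "\<lambda>v. bmode h b' (int m) (bmode h b (int n) v)"])
  fix p M
  show "bmode h b (int n) (bmode h b' (int m) (Poly_Mapping.single (p, M) 1)) =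
        bmode h b' (int m) (bmode h b (int n) (Poly_Mapping.single (p, M) 1))"
    using assms
  proof (cases "(b, n) = (b', m)")
    case False
    then have "count (M - {#(b', m)#}) (b, n) = count M (b, n)" "count (M - {#(b, n)#}) (b', m) = count M (b', m)"
      by auto
    then show ?thesis
      using assms diff_right_commute[of M "{#(b, n)#}" "{#(b', m)#}"]
      by (simp add: bmode_pos_single clin_scale[OF clin_bmode] mult_ac)
  qed auto
qed (rule clin_comp[OF clin_bmode clin_bmode])+

lemma bmode_exchange:
  assumes "n > 0" "m > 0"
  shows "bmode h b (int n) (bmode h b' (- int m) v) = bmode h b' (- int m) (bmode h b (int n) v) +
     cscale (if b = b' \<and> n = m then bsign b * (qnum h (of_nat n))\<^sup>2 / of_nat n else 0) v"
proof (rule clin_eqI[where A = "\<lambda>v. bmode h b (int n) (bmode h b' (- int m) v)"])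
  fix p M
  let ?s = "Poly_Mapping.single (p, M) 1 :: fvec"
  show "bmode h b (int n) (bmode h b' (- int m) ?s) = bmode h b' (- int m) (bmode h b (int n) ?s) +
     cscale (if b = b' \<and> n = m then bsign b * (qnum h (of_nat n))\<^sup>2 / of_nat n else 0) ?s"
  proof (cases "(b, n) = (b', m)")
    case True
    show ?thesis
    proof (cases "(b, n) \<in># M")
      case in_M: True
      then have "add_mset (b, n) (M - {#(b, n)#}) = M" by simp
      then show ?thesis using True assms
        by (auto simp: bmode_pos_single bmode_neg_single clin_scale[OF clin_bmode] fv.scale_left_distrib[symmetric]
             intro!: arg_cong2[where f = cscale] simp: field_simps)
    next
      case False
      then have "count M (b, n) = 0" by (simp add: not_in_iff)
      then show ?thesis using True assms
        by (auto simp: bmode_pos_single bmode_neg_single clin_scale[OF clin_bmode] clin_zero[OF clin_bmode])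
    qed
  next
    case False
    show ?thesis
    proof (cases "(b, n) \<in># M")
      case True
      have "add_mset (b', m) M - {#(b, n)#} = add_mset (b', m) (M - {#(b, n)#})"
        using False by (metis diff_union_swap)
      then show ?thesis using False assms
        by (auto simp: bmode_pos_single bmode_neg_single clin_scale[OF clin_bmode])
    next
      case notin: False
      then have "count M (b, n) = 0" by (simp add: not_in_iff)
      moreover have "count (add_mset (b', m) M) (b, n) = 0" using False calculation by auto
      ultimately show ?thesis using False assms
        by (auto simp: bmode_pos_single bmode_neg_single clin_scale[OF clin_bmode] clin_zero[OF clin_bmode])
    qed
  qed
qed (intro clin_comp[OF clin_bmode clin_bmode] clin_plus clin_cscale clin_ident)+

lemma finite_bosons [simp]: "finite (bosons N)"
  by (simp add: bosons_def)

lemma clin_modes [simp]: "clin (modes h N \<Phi> n)"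
proof -
  have "clin (\<lambda>v. \<Sum>b\<in>bosons N. cscale (\<Phi> (Mode b n)) (bmode h b n v))"
    by (intro clin_sumI clin_cscale clin_bmode)
  then show ?thesis by (simp add: clin_def modes_def)
qed

text \<open>The scalar commutator of the mode n of \<Phi> with the mode -n of \<Psi>; its
  exponential series is the contraction of the two fields.\<close>

definition mpair :: "complex \<Rightarrow> nat \<Rightarrow> bfield \<Rightarrow> bfield \<Rightarrow> nat \<Rightarrow> complex" where
  "mpair h N \<Phi> \<Psi> n = (\<Sum>b\<in>bosons N. \<Phi> (Mode b (int n)) * \<Psi> (Mode b (- int n)) * bsign b) * (qnum h (of_nat n))\<^sup>2 / of_nat n"

lemma modes_commute:
  assumes "\<And>b b' v. bmode h b n (bmode h b' m v) = bmode h b' m (bmode h b n v)"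
  shows "modes h N \<Phi> n (modes h N \<Psi> m v) = modes h N \<Psi> m (modes h N \<Phi> n v)"
proof -
  have "modes h N \<Phi> n (modes h N \<Psi> m v) =
    (\<Sum>b\<in>bosons N. \<Sum>b'\<in>bosons N. cscale (\<Phi> (Mode b n) * \<Psi> (Mode b' m)) (bmode h b n (bmode h b' m v)))"
    by (simp add: modes_def clin_sum[OF clin_bmode] clin_scale[OF clin_bmode] fv.scale_sum_right)
  also have "\<dots> = (\<Sum>b'\<in>bosons N. \<Sum>b\<in>bosons N. cscale (\<Phi> (Mode b n) * \<Psi> (Mode b' m)) (bmode h b' m (bmode h b n v)))"
    by (subst sum.swap) (simp add: assms)
  also have "\<dots> = modes h N \<Psi> m (modes h N \<Phi> n v)"
    by (simp add: modes_def clin_sum[OF clin_bmode] clin_scale[OF clin_bmode] fv.scale_sum_right mult.commute)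
  finally show ?thesis .
qed

lemma modes_exchange:
  assumes "n > 0" "m > 0"
  shows "modes h N \<Phi> (int n) (modes h N \<Psi> (- int m) v) = modes h N \<Psi> (- int m) (modes h N \<Phi> (int n) v) +
    cscale (if n = m then mpair h N \<Phi> \<Psi> n else 0) v"
proof -
  have "modes h N \<Phi> (int n) (modes h N \<Psi> (- int m) v) =
    (\<Sum>b\<in>bosons N. \<Sum>b'\<in>bosons N. cscale (\<Phi> (Mode b (int n)) * \<Psi> (Mode b' (- int m))) (bmode h b (int n) (bmode h b' (- int m) v)))"
    by (simp add: modes_def clin_sum[OF clin_bmode] clin_scale[OF clin_bmode] fv.scale_sum_right)
  also have "\<dots> = (\<Sum>b\<in>bosons N. \<Sum>b'\<in>bosons N. cscale (\<Phi> (Mode b (int n)) * \<Psi> (Mode b' (- int m))) (bmode h b' (- int m) (bmode h b (int n) v)))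
     + (\<Sum>b\<in>bosons N. \<Sum>b'\<in>bosons N. if b = b' then cscale (if n = m then \<Phi> (Mode b (int n)) * \<Psi> (Mode b (- int m)) * bsign b * (qnum h (of_nat n))\<^sup>2 / of_nat n else 0) v else 0)"
    unfolding sum.distrib[symmetric]
    by (intro sum.cong refl) (use assms in \<open>auto simp: bmode_exchange fv.scale_right_distrib mult.assoc\<close>)
  also have "(\<Sum>b\<in>bosons N. \<Sum>b'\<in>bosons N. cscale (\<Phi> (Mode b (int n)) * \<Psi> (Mode b' (- int m))) (bmode h b' (- int m) (bmode h b (int n) v)))
     = modes h N \<Psi> (- int m) (modes h N \<Phi> (int n) v)"
    by (subst sum.swap) (simp add: modes_def clin_sum[OF clin_bmode] clin_scale[OF clin_bmode] fv.scale_sum_right mult.commute)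
  also have "(\<Sum>b\<in>bosons N. \<Sum>b'\<in>bosons N. if b = b' then cscale (if n = m then \<Phi> (Mode b (int n)) * \<Psi> (Mode b (- int m)) * bsign b * (qnum h (of_nat n))\<^sup>2 / of_nat n else 0) v else 0)
     = cscale (if n = m then mpair h N \<Phi> \<Psi> n else 0) v"
    by (simp add: mpair_def fv.scale_sum_left sum_distrib_right sum_divide_distrib)
  finally show ?thesis .
qed

lemma commuting_neg: "commuting_ops (\<lambda>n. modes h N \<Phi> (- int n))"
  by standard (auto intro!: modes_commute bmode_commute_neg)

lemma commuting_pos: "commuting_ops (\<lambda>n. modes h N \<Phi> (int n))"
  by standard (auto intro!: modes_commute bmode_commute_pos)

section \<open>Vertex operators\<close>

lemma Sum_any_sum:
  assumes "finite I" "\<And>i. i \<in> I \<Longrightarrow> finite {s. f i s \<noteq> 0}"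
  shows "Sum_any (\<lambda>s. \<Sum>i\<in>I. f i s) = (\<Sum>i\<in>I. Sum_any (f i))"
proof -
  let ?S = "\<Union>i\<in>I. {s. f i s \<noteq> 0}"
  have fin: "finite ?S" using assms by auto
  have "Sum_any (\<lambda>s. \<Sum>i\<in>I. f i s) = (\<Sum>s\<in>?S. \<Sum>i\<in>I. f i s)"
    by (rule Sum_any.expand_superset[OF fin]) (auto intro: ccontr sum.neutral)
  also have "\<dots> = (\<Sum>i\<in>I. \<Sum>s\<in>?S. f i s)" by (rule sum.swap)
  also have "\<dots> = (\<Sum>i\<in>I. Sum_any (f i))"
    by (intro sum.cong refl Sum_any.expand_superset[symmetric] fin) auto
  finally show ?thesis .
qed

lemma Sum_any_swap:
  assumes "finite {(a, b). g a b \<noteq> 0}"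
  shows "Sum_any (\<lambda>a. Sum_any (g a)) = Sum_any (\<lambda>b. Sum_any (\<lambda>a. g a b))"
proof (rule Sum_any.swap)
  have "{a. \<exists>b. g a b \<noteq> 0} = fst ` {(a, b). g a b \<noteq> 0}" "{b. \<exists>a. g a b \<noteq> 0} = snd ` {(a, b). g a b \<noteq> 0}"
    by force+
  then show "finite ({a. \<exists>b. g a b \<noteq> 0} \<times> {b. \<exists>a. g a b \<noteq> 0})" using assms by simp
qed simp

lemma Sum_any_pair:
  assumes "finite {(a, b). g a b \<noteq> 0}"
  shows "Sum_any (\<lambda>(a, b). g a b) = Sum_any (\<lambda>a. Sum_any (g a))"
proof (rule Sum_any.cartesian_product[symmetric])
  have "{a. \<exists>b. g a b \<noteq> 0} = fst ` {(a, b). g a b \<noteq> 0}" "{b. \<exists>a. g a b \<noteq> 0} = snd ` {(a, b). g a b \<noteq> 0}"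
    by force+
  then show "finite ({a. \<exists>b. g a b \<noteq> 0} \<times> {b. \<exists>a. g a b \<noteq> 0})" using assms by simp
qed simp

lemma Sum_any_reindex: "bij l \<Longrightarrow> Sum_any (\<lambda>x. f (l x)) = Sum_any f"
  by (rule Sum_any.reindex_cong[symmetric, of l]) auto

lemma bij_int: "bij (\<lambda>s::int. s + c)" "bij (\<lambda>s::int. s - c)" "bij (\<lambda>s::int. c - s)"
  unfolding bij_def inj_def surj_def by presburger+

lemma Sum_any_shift:
  "Sum_any (\<lambda>s::int. f (s + c)) = Sum_any f" "Sum_any (\<lambda>s::int. f (s - c)) = Sum_any f"
  "Sum_any (\<lambda>s::int. f (c - s)) = Sum_any f"
  by (rule Sum_any_reindex, rule bij_int)+

lemma Sum_any_nat_int: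
  assumes "\<And>i. i < 0 \<Longrightarrow> f i = 0"
  shows "Sum_any (\<lambda>r::nat. f (int r)) = Sum_any f"
proof -
  have eq: "{i. f i \<noteq> 0} = int ` {r. f (int r) \<noteq> 0}"
  proof (intro equalityI subsetI)
    fix i assume i: "i \<in> {i. f i \<noteq> 0}"
    then have "i \<ge> 0" using assms by (force simp: not_less[symmetric])
    then show "i \<in> int ` {r. f (int r) \<noteq> 0}" using i by (auto intro!: image_eqI[of _ _ "nat i"])
  qed auto
  show ?thesis
    unfolding Sum_any.expand_set eq by (subst sum.reindex) auto
qed

lemma finite_supp_comp: "finite {s. f s \<noteq> 0} \<Longrightarrow> inj l \<Longrightarrow> finite {s. f (l s) \<noteq> 0}"
  using finite_vimageI[of "{s. f s \<noteq> 0}" l] by (simp add: vimage_def)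

lemma finite_supp_shift:
  assumes "finite {s::int. f s \<noteq> 0}"
  shows "finite {s. f (s + c) \<noteq> 0}" "finite {s. f (s - c) \<noteq> 0}" "finite {s. f (c - s) \<noteq> 0}"
  by (rule finite_supp_comp[OF assms]; simp add: inj_def)+

lemma finite_supp_clin: "finite {s. f s \<noteq> 0} \<Longrightarrow> (\<And>s. clin (A s)) \<Longrightarrow> finite {s. A s (f s) \<noteq> 0}"
  by (erule rev_finite_subset) (auto simp: clin_zero)

locale free_bosons =
  fixes h :: complex and N :: nat
begin

text \<open>The commutator of the coefficient of ln z in \<Phi> with the Q part of \<Psi>: moving
  the zero mode power of z past the exponential of Q produces z to this power. \<open>zpair\<close>
  does the same for the constant zero modes and produces a scalar.\<close>

definition qpair :: "bfield \<Rightarrow> bfield \<Rightarrow> complex" where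
  "qpair \<Phi> \<Psi> = (\<Sum>b\<in>bosons N. \<Phi> (LogZ b) * bsign b * \<Psi> (QQ b))"

definition zpair :: "bfield \<Rightarrow> bfield \<Rightarrow> complex" where
  "zpair \<Phi> \<Psi> = (\<Sum>b\<in>bosons N. \<Phi> (Zero b) * bsign b * \<Psi> (QQ b))"

definition Em :: "bfield \<Rightarrow> int \<Rightarrow> fop" where
  "Em \<Phi> = oexp (\<lambda>n. modes h N \<Phi> (- int n))"

definition Ep :: "bfield \<Rightarrow> int \<Rightarrow> fop" where
  "Ep \<Phi> = oexp (\<lambda>n. modes h N \<Phi> (int n))"

definition T :: "bfield \<Rightarrow> int \<Rightarrow> fop" where
  "T \<Phi> j v = exp_Q (\<lambda>b. \<Phi> (QQ b)) (exp_zero N (\<lambda>b. \<Phi> (Zero b)) (zpow_zero N (\<lambda>b. \<Phi> (LogZ b)) j v))"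

abbreviation V :: "bfield \<Rightarrow> int \<Rightarrow> fop" where "V \<equiv> normal_exp h N"

text \<open>\<open>Ap \<Phi> j\<close> is the coefficient of \<open>z ^ j\<close> in the product of the factors other than the negative modes.\<close>

definition Ap :: "bfield \<Rightarrow> int \<Rightarrow> fop" where
  "Ap \<Phi> j v = Sum_any (\<lambda>s::int. T \<Phi> (j + s) (Ep \<Phi> s v))"

lemma clin_Em [simp]: "clin (Em \<Phi> r)" and clin_Ep [simp]: "clin (Ep \<Phi> r)"
  by (simp_all add: Em_def Ep_def commuting_ops.clin_oexp commuting_neg commuting_pos)

lemma clin_T [simp]: "clin (T \<Phi> j)"
  unfolding T_def[abs_def] exp_Q_def exp_zero_def zpow_zero_def
  by (rule clin_comp[OF clin_lin clin_comp[OF clin_lin clin_lin]])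

lemma Em_neg [simp]: "r < 0 \<Longrightarrow> Em \<Phi> r v = 0" and Ep_neg [simp]: "r < 0 \<Longrightarrow> Ep \<Phi> r v = 0"
  by (simp_all add: Em_def Ep_def)

lemma single_cscale: "Poly_Mapping.single k x = cscale x (Poly_Mapping.single k 1)"
  by (rule poly_mapping_eqI) (simp add: lookup_single when_def)

lemma T_single: "T \<Phi> j (Poly_Mapping.single (p, M) 1) =
   cscale (if (\<Sum>b\<in>bosons N. \<Phi> (LogZ b) * p b) = of_int j then exp (\<Sum>b\<in>bosons N. \<Phi> (Zero b) * p b) else 0)
     (Poly_Mapping.single (\<lambda>b. p b + bsign b * \<Phi> (QQ b), M) 1)"
proof -
  have "zpow_zero N (\<lambda>b. \<Phi> (LogZ b)) j (Poly_Mapping.single (p, M) 1) =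
      cscale (if (\<Sum>b\<in>bosons N. \<Phi> (LogZ b) * p b) = of_int j then 1 else 0) (Poly_Mapping.single (p, M) 1)"
    by (simp add: zpow_zero_def)
  moreover have "exp_zero N x (cscale y (Poly_Mapping.single (p, M) 1)) =
      cscale (y * exp (\<Sum>b\<in>bosons N. x b * p b)) (Poly_Mapping.single (p, M) 1)" for x y
    unfolding exp_zero_def clin_scale[OF clin_lin] lin_single prod.case
    by (subst single_cscale) simp
  moreover have "exp_Q x (cscale y (Poly_Mapping.single (p, M) 1)) =
      cscale y (Poly_Mapping.single (\<lambda>b. p b + bsign b * x b, M) 1)" for x y
    unfolding exp_Q_def clin_scale[OF clin_lin] lin_single by simp
  ultimately show ?thesis
    by (simp add: T_def)
qed

text \<open>A vector involves finitely many momenta, and each momentum allows at most one power of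
  z.\<close>

lemma T_finite: "finite {j. T \<Phi> j v \<noteq> 0}"
proof -
  define L where "L k = (\<Sum>b\<in>bosons N. \<Phi> (LogZ b) * fst k b)" for k :: state
  have zero: "T \<Phi> j v = 0" if "\<And>k. k \<in> Poly_Mapping.keys v \<Longrightarrow> L k \<noteq> of_int j" for j
  proof -
    have "T \<Phi> j v = T \<Phi> j (\<Sum>k\<in>Poly_Mapping.keys v. cscale (Poly_Mapping.lookup v k) (Poly_Mapping.single k 1))"
      using fvec_decomp[of v] by simp
    also have "\<dots> = (\<Sum>k\<in>Poly_Mapping.keys v. cscale (Poly_Mapping.lookup v k) (T \<Phi> j (Poly_Mapping.single k 1)))"
      by (simp add: clin_sum clin_scale)
    also have "\<dots> = 0"
    proof (rule sum.neutral, rule ballI)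
      fix k assume "k \<in> Poly_Mapping.keys v"
      then have "L k \<noteq> of_int j" by (rule that)
      then show "cscale (Poly_Mapping.lookup v k) (T \<Phi> j (Poly_Mapping.single k 1)) = 0"
        by (cases k) (simp add: T_single L_def)
    qed
    finally show ?thesis .
  qed
  have "{j. T \<Phi> j v \<noteq> 0} \<subseteq> (\<Union>k\<in>Poly_Mapping.keys v. {j. of_int j = L k})"
  proof
    fix j assume "j \<in> {j. T \<Phi> j v \<noteq> 0}"
    then have "\<not> (\<forall>k\<in>Poly_Mapping.keys v. L k \<noteq> of_int j)" using zero[of j] by blast
    then obtain k where "k \<in> Poly_Mapping.keys v" "L k = of_int j" by blast
    then show "j \<in> (\<Union>k\<in>Poly_Mapping.keys v. {j. of_int j = L k})" by (intro UN_I[of k]) simp_all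
  qed
  moreover have "finite {j. of_int j = L k}" for k
  proof (cases "\<exists>j. of_int j = L k")
    case True
    then obtain j0 where "of_int j0 = L k" by auto
    then have "{j. of_int j = L k} \<subseteq> {j0}" by (auto dest: sym)
    then show ?thesis by (rule finite_subset) simp
  next
    case False
    then have "{j. of_int j = L k} = {}" by blast
    then show ?thesis by simp
  qed
  ultimately show ?thesis by (meson finite_UN_I finite_keys finite_subset)
qed

lemma T_bmode:
  assumes "n \<noteq> 0"
  shows "T \<Phi> j (bmode h b n v) = bmode h b n (T \<Phi> j v)"
proof (rule clin_eqI[where A = "\<lambda>v. T \<Phi> j (bmode h b n v)"])
  fix p M
  show "T \<Phi> j (bmode h b n (Poly_Mapping.single (p, M) 1)) = bmode h b n (T \<Phi> j (Poly_Mapping.single (p, M) 1))"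
  proof (cases "n > 0")
    case True
    then obtain k where "n = int k" "k > 0" by (metis zero_less_imp_eq_int)
    then show ?thesis
      by (simp add: T_single bmode_pos_single clin_scale mult.commute)
  next
    case False
    then obtain k where "n = - int k" "k > 0" using assms
      by (metis neg_0_less_iff_less not_less_iff_gr_or_eq zero_less_imp_eq_int minus_minus)
    then show ?thesis
      by (simp add: T_single bmode_neg_single clin_scale)
  qed
qed (rule clin_comp[OF clin_T clin_bmode] clin_comp[OF clin_bmode clin_T])+

lemma T_modes: "n \<noteq> 0 \<Longrightarrow> T \<Phi> j (modes h N \<Psi> n v) = modes h N \<Psi> n (T \<Phi> j v)"
  by (simp add: modes_def clin_sum clin_scale T_bmode)

lemma T_Em: "T \<Phi> j (Em \<Psi> r v) = Em \<Psi> r (T \<Phi> j v)" and T_Ep: "T \<Phi> j (Ep \<Psi> r v) = Ep \<Psi> r (T \<Phi> j v)"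
  unfolding Em_def Ep_def
  by (rule commuting_ops.oexp_commute[OF commuting_neg]; simp add: T_modes)
     (rule commuting_ops.oexp_commute[OF commuting_pos]; simp add: T_modes)

lemma Em_Em: "Em \<Phi> r (Em \<Psi> s v) = Em \<Psi> s (Em \<Phi> r v)"
  unfolding Em_def
  by (rule commuting_ops.oexp_commute[OF commuting_neg] commuting_ops.clin_oexp[OF commuting_neg])+
     (rule commuting_ops.oexp_commute[OF commuting_neg, symmetric],
      auto intro!: modes_commute bmode_commute_neg)

lemma Ep_Ep: "Ep \<Phi> r (Ep \<Psi> s v) = Ep \<Psi> s (Ep \<Phi> r v)"
  unfolding Ep_def
  by (rule commuting_ops.oexp_commute[OF commuting_pos] commuting_ops.clin_oexp[OF commuting_pos])+
     (rule commuting_ops.oexp_commute[OF commuting_pos, symmetric],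
      auto intro!: modes_commute bmode_commute_pos)

subsection \<open>Local nilpotency of the positive modes\<close>

definition mdeg :: "(boson \<times> nat) multiset \<Rightarrow> nat" where "mdeg M = (\<Sum>x\<in>#M. snd x)"

text \<open>Energy filtration with an integer bound: the annihilation mode n lowers the bound by n,
  and below 0 only the zero vector is left.\<close>

definition filt :: "int \<Rightarrow> fvec set" where
  "filt d = {v. \<forall>(p, M)\<in>Poly_Mapping.keys v. int (mdeg M) \<le> d}"

lemma filt_add: "u \<in> filt d \<Longrightarrow> v \<in> filt d \<Longrightarrow> u + v \<in> filt d"
  using keys_add[of u v] by (fastforce simp: filt_def)

lemma filt_scale: "v \<in> filt d \<Longrightarrow> cscale x v \<in> filt d"
  by (auto simp: filt_def in_keys_iff)

lemma filt_zero [simp]: "0 \<in> filt d"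
  by (simp add: filt_def)

lemma filt_sum: "(\<And>i. i \<in> I \<Longrightarrow> f i \<in> filt d) \<Longrightarrow> sum f I \<in> filt d"
  by (induction I rule: infinite_finite_induct) (auto simp: filt_add)

lemma filt_neg:
  assumes "v \<in> filt d" "d < 0"
  shows "v = 0"
proof (rule ccontr)
  assume "v \<noteq> 0"
  then obtain k where "Poly_Mapping.lookup v k \<noteq> 0" by (metis lookup_zero poly_mapping_eqI)
  then obtain p M where "(p, M) \<in> Poly_Mapping.keys v" by (cases k) (auto simp: in_keys_iff)
  then show False using assms by (auto simp: filt_def)
qed

lemma filt_clin:
  assumes "clin A" "v \<in> filt d"
    and "\<And>p M. int (mdeg M) \<le> d \<Longrightarrow> A (Poly_Mapping.single (p, M) 1) \<in> filt d'"
  shows "A v \<in> filt d'"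
proof -
  have "A v = A (\<Sum>k\<in>Poly_Mapping.keys v. cscale (Poly_Mapping.lookup v k) (Poly_Mapping.single k 1))"
    using fvec_decomp[of v] by simp
  also have "\<dots> = (\<Sum>k\<in>Poly_Mapping.keys v. cscale (Poly_Mapping.lookup v k) (A (Poly_Mapping.single k 1)))"
    by (simp add: clin_sum clin_scale assms)
  also have "\<dots> \<in> filt d'"
  proof (intro filt_sum filt_scale)
    fix k assume "k \<in> Poly_Mapping.keys v"
    then show "A (Poly_Mapping.single k 1) \<in> filt d'"
      using assms(2) by (cases k) (auto intro!: assms(3) simp: filt_def[of d])
  qed
  finally show ?thesis .
qed

lemma filt_bmode:
  assumes "n > 0" "v \<in> filt d"
  shows "bmode h b (int n) v \<in> filt (d - int n)"
proof (rule filt_clin[OF clin_bmode assms(2)])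
  fix p M assume M: "int (mdeg M) \<le> d"
  show "bmode h b (int n) (Poly_Mapping.single (p, M) 1) \<in> filt (d - int n)"
  proof (cases "(b, n) \<in># M")
    case True
    then obtain M' where "M = add_mset (b, n) M'" by (metis multi_member_split)
    with M have "int (mdeg (M - {#(b, n)#})) \<le> d - int n" by (simp add: mdeg_def)
    then show ?thesis using assms(1) by (auto simp: bmode_pos_single intro!: filt_scale) (simp add: filt_def)
  next
    case False
    then have "count M (b, n) = 0" by (simp add: not_in_iff)
    then show ?thesis using assms(1) by (simp add: bmode_pos_single)
  qed
qed

lemma filt_modes: "n > 0 \<Longrightarrow> v \<in> filt d \<Longrightarrow> modes h N \<Phi> (int n) v \<in> filt (d - int n)"
  unfolding modes_def by (intro filt_sum filt_scale filt_bmode)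

lemma filt_Ep:
  assumes "v \<in> filt d"
  shows "Ep \<Phi> s v \<in> filt (d - s)"
proof (cases "s \<ge> 0")
  case True
  have "Ep \<Phi> (int s) v \<in> filt (d - int s)" for s
  proof (induction s rule: less_induct)
    case (less s)
    show ?case
    proof (cases "s = 0")
      case False
      have "cscale (of_int (int s)) (Ep \<Phi> (int s) v) =
         (\<Sum>n = 1..s. cscale (of_nat n) (modes h N \<Phi> (int n) (Ep \<Phi> (int s - int n) v)))"
        unfolding Ep_def by (rule commuting_ops.oexp_rec[OF commuting_pos]) simp
      also have "\<dots> \<in> filt (d - int s)"
      proof (intro filt_sum filt_scale)
        fix n assume n: "n \<in> {1..s}"
        have "modes h N \<Phi> (int n) (Ep \<Phi> (int (s - n)) v) \<in> filt (d - int (s - n) - int n)"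
          by (rule filt_modes, use n in simp, rule less) (use n in simp)
        then show "modes h N \<Phi> (int n) (Ep \<Phi> (int s - int n) v) \<in> filt (d - int s)"
          using n by (simp add: of_nat_diff)
      qed
      finally have "cscale (1 / of_int (int s)) (cscale (of_int (int s)) (Ep \<Phi> (int s) v)) \<in> filt (d - int s)"
        by (rule filt_scale)
      then show ?thesis using False by simp
    qed (use assms in \<open>simp add: Ep_def\<close>)
  qed
  from this[of "nat s"] True show ?thesis by simp
qed simp

lemma Ep_finite: "finite {s. Ep \<Phi> s v \<noteq> 0}"
proof -
  define d where "d = int (Max (insert 0 ((\<lambda>k. mdeg (snd k)) ` Poly_Mapping.keys v)))"
  have "v \<in> filt d" unfolding filt_def d_def
    by (auto intro!: Max_ge simp del: Max_insert) (force simp: image_iff)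
  then have "Ep \<Phi> s v = 0" if "s > d" for s
    using filt_neg[OF filt_Ep] that by fastforce
  then have "{s. Ep \<Phi> s v \<noteq> 0} \<subseteq> {0..d}"
    by (force simp: not_less[symmetric])
  then show ?thesis by (rule finite_subset) simp
qed

lemma TE_finite: "finite {(j, s). T \<Phi> (j + s) (Ep \<Psi> s v) \<noteq> 0}"
proof -
  have "{(j, s). T \<Phi> (j + s) (Ep \<Psi> s v) \<noteq> 0} \<subseteq>
     (\<lambda>(s, j). (j, s)) ` (SIGMA s:{s. Ep \<Psi> s v \<noteq> 0}. {j. T \<Phi> (j + s) (Ep \<Psi> s v) \<noteq> 0})"
    by (auto simp: clin_zero image_iff)
  moreover have "finite {j. T \<Phi> (j + s) (Ep \<Psi> s v) \<noteq> 0}" for s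
    by (rule finite_supp_shift(1)[OF T_finite])
  ultimately show ?thesis
    by (elim finite_subset) (intro finite_imageI finite_SigmaI Ep_finite)
qed

lemma TE_finite': "finite {s. T \<Phi> (f s) (Ep \<Psi> s v) \<noteq> 0}"
  by (rule finite_supp_clin[OF Ep_finite]) simp

lemma clin_Ap [simp]: "clin (Ap \<Phi> j)"
  unfolding Ap_def[abs_def]
  by (rule clin_Sum_anyI) (auto intro: clin_comp TE_finite')

lemma Ap_finite: "finite {j. Ap \<Phi> j v \<noteq> 0}"
proof -
  have "{j. Ap \<Phi> j v \<noteq> 0} \<subseteq> fst ` {(j, s). T \<Phi> (j + s) (Ep \<Phi> s v) \<noteq> 0}"
  proof
    fix j assume "j \<in> {j. Ap \<Phi> j v \<noteq> 0}"
    then obtain s where "T \<Phi> (j + s) (Ep \<Phi> s v) \<noteq> 0"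
      unfolding Ap_def by (auto elim: Sum_any.not_neutral_obtains_not_neutral)
    then show "j \<in> fst ` {(j, s). T \<Phi> (j + s) (Ep \<Phi> s v) \<noteq> 0}" by (intro image_eqI[of _ _ "(j, s)"]) simp_all
  qed
  then show ?thesis by (rule finite_subset) (simp add: TE_finite)
qed

lemma EmAp_finite: "finite {j. Em \<Phi> (f j) (W j (Ap \<Psi> j v)) \<noteq> 0}" if "\<And>j. clin (W j)"
  by (rule finite_supp_clin[OF finite_supp_clin[OF Ap_finite]]) (auto simp: that)

text \<open>Summing over s collects the zero mode and annihilation factors into \<open>Ap\<close>,
  which leaves only the creation exponential outside.\<close>

lemma V_expand: "V \<Phi> m v = Sum_any (\<lambda>j. Em \<Phi> (m - j) (Ap \<Phi> j v))"
proof -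
  define f where "f r s = Em \<Phi> r (T \<Phi> (m - r + s) (Ep \<Phi> s v))" for r s :: int
  have fin: "finite {(r, s). f r s \<noteq> 0}"
  proof -
    have "{(r, s). f r s \<noteq> 0} \<subseteq> (\<lambda>(j, s). (m - j, s)) ` {(j, s). T \<Phi> (j + s) (Ep \<Phi> s v) \<noteq> 0}"
    proof safe
      fix r s assume "f r s \<noteq> 0"
      then have "T \<Phi> (m - r + s) (Ep \<Phi> s v) \<noteq> 0" by (auto simp: f_def clin_zero)
      then show "(r, s) \<in> (\<lambda>(j, s). (m - j, s)) ` {(j, s). T \<Phi> (j + s) (Ep \<Phi> s v) \<noteq> 0}"
        by (auto simp: image_iff intro!: exI[of _ "m - r"])
    qed
    then show ?thesis by (rule finite_subset) (simp add: TE_finite)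
  qed
  have fin': "finite {(r, s). f (int r) (int s) \<noteq> 0}"
  proof -
    have "finite ((\<lambda>(r, s). (int r, int s)) -` {(r, s). f r s \<noteq> 0})"
      by (rule finite_vimageI[OF fin]) (auto simp: inj_def)
    then show ?thesis by (simp add: vimage_def case_prod_unfold)
  qed
  have "V \<Phi> m v = Sum_any (\<lambda>(r, s). f (int r) (int s))"
    unfolding normal_exp_def f_def Em_def Ep_def T_def oexp_def by simp
  also have "\<dots> = Sum_any (\<lambda>r. Sum_any (\<lambda>s. f (int r) (int s)))"
    by (rule Sum_any_pair[OF fin'])
  also have "\<dots> = Sum_any (\<lambda>r. Sum_any (f (int r)))"
    by (intro Sum_any.cong Sum_any_nat_int) (simp add: f_def clin_zero)
  also have "\<dots> = Sum_any (\<lambda>r. Sum_any (f r))"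
    by (rule Sum_any_nat_int) (simp add: f_def)
  also have "\<dots> = Sum_any (\<lambda>r. Em \<Phi> r (Ap \<Phi> (m - r) v))"
    by (simp add: f_def Ap_def clin_Sum_any[OF clin_Em] TE_finite')
  also have "\<dots> = Sum_any (\<lambda>j. Em \<Phi> (m - j) (Ap \<Phi> j v))"
    by (subst Sum_any_shift(3)[of _ m, symmetric]) simp
  finally show ?thesis .
qed

text \<open>For \<open>W\<close> a product of vertex operators, \<open>Ins \<Psi> W\<close> is the product of \<open>W\<close> and \<open>V \<Psi>\<close>, normally ordered
  with respect to \<open>\<Psi>\<close> only.\<close>

definition Ins :: "bfield \<Rightarrow> fop \<Rightarrow> int \<Rightarrow> fop" where
  "Ins \<Psi> W n v = Sum_any (\<lambda>j. Em \<Psi> (n - j) (W (Ap \<Psi> j v)))"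

lemma V_Ins_id: "V \<Psi> n v = Ins \<Psi> (\<lambda>v. v) n v"
  by (simp add: V_expand Ins_def)

lemma Ins_finite: "clin W \<Longrightarrow> finite {j. Em \<Psi> (f j) (W (Ap \<Psi> j v)) \<noteq> 0}"
  by (rule EmAp_finite)

lemma clin_Ins: "clin W \<Longrightarrow> clin (Ins \<Psi> W n)"
  unfolding Ins_def[abs_def]
  by (rule clin_Sum_anyI) (auto intro: clin_comp[OF clin_Em clin_comp[OF _ clin_Ap]] Ins_finite)

lemma clin_V [simp]: "clin (V \<Phi> m)"
  using clin_Ins[OF clin_ident(1)] by (simp add: clin_def V_Ins_id)

end

section \<open>Power series acting on finitely supported sequences\<close>

lemma Sum_any_supp:
  "finite A \<Longrightarrow> (\<And>a. a \<notin> A \<Longrightarrow> f a = 0) \<Longrightarrow> Sum_any f = sum f A"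
  by (rule Sum_any.expand_superset) auto

lemma Sum_any_upto: "(\<And>k. k > K \<Longrightarrow> f k = 0) \<Longrightarrow> Sum_any f = (\<Sum>k = 0..K::nat. f k)"
  by (rule Sum_any_supp) auto

lemma Sum_any_Suc:
  assumes "finite {k. f k \<noteq> 0}"
  shows "Sum_any f = f 0 + Sum_any (\<lambda>k. f (Suc k))"
proof -
  obtain K where K: "\<And>k. k > K \<Longrightarrow> f k = 0"
    using assms by (metis (mono_tags, lifting) finite_nat_set_iff_bounded_le mem_Collect_eq not_less)
  have "Sum_any f = (\<Sum>k = 0..Suc K. f k)" by (rule Sum_any_upto) (simp add: K)
  also have "\<dots> = f 0 + (\<Sum>k = 0..K. f (Suc k))" by (simp only: sum.atLeast0_atMost_Suc_shift o_def)
  also have "(\<Sum>k = 0..K. f (Suc k)) = Sum_any (\<lambda>k. f (Suc k))" by (rule Sum_any_upto[symmetric]) (simp add: K)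
  finally show ?thesis .
qed

lemma finite_supp_Suc: "finite {k. f k \<noteq> 0} \<Longrightarrow> finite {k. f (Suc k) \<noteq> 0}"
  by (rule finite_supp_comp) simp_all

lemma finite_supp_cscale: "finite {k. f k \<noteq> 0} \<Longrightarrow> finite {k. cscale (x k) (f k) \<noteq> 0}"
  by (erule rev_finite_subset) auto

lemma Sum_any_diff:
  fixes f g :: "'a \<Rightarrow> fvec"
  assumes "finite {a. f a \<noteq> 0}" "finite {a. g a \<noteq> 0}"
  shows "Sum_any (\<lambda>a. f a - g a) = Sum_any f - Sum_any g"
proof -
  have "Sum_any (\<lambda>a. f a - g a) = (\<Sum>a\<in>{a. f a \<noteq> 0} \<union> {a. g a \<noteq> 0}. f a - g a)"
    by (rule Sum_any_supp) (use assms in auto)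
  moreover have "Sum_any f = (\<Sum>a\<in>{a. f a \<noteq> 0} \<union> {a. g a \<noteq> 0}. f a)"
    by (rule Sum_any_supp) (use assms in auto)
  moreover have "Sum_any g = (\<Sum>a\<in>{a. f a \<noteq> 0} \<union> {a. g a \<noteq> 0}. g a)"
    by (rule Sum_any_supp) (use assms in auto)
  ultimately show ?thesis by (simp add: sum_subtractf)
qed

text \<open>With \<open>f k\<close> paired with x^k, multiplication of the series by x shifts
  \<open>f\<close>; a factor 1 - a x therefore becomes a difference of two sums. This is how poles
  are cleared later.\<close>

lemma Sum_any_fps_lin:
  assumes "finite {k. f k \<noteq> 0}"
  shows "Sum_any (\<lambda>k. cscale (fps_nth ((1 - fps_const a * fps_X) * D) k) (f k)) =
     Sum_any (\<lambda>k. cscale (fps_nth D k) (f k)) - cscale a (Sum_any (\<lambda>k. cscale (fps_nth D k) (f (Suc k))))"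
proof -
  have eq: "fps_nth ((1 - fps_const a * fps_X) * D) k = fps_nth D k - (case k of 0 \<Rightarrow> 0 | Suc j \<Rightarrow> a * fps_nth D j)" for k
    by (cases k) (simp_all add: left_diff_distrib mult.assoc)
  have "Sum_any (\<lambda>k. cscale (fps_nth ((1 - fps_const a * fps_X) * D) k) (f k)) =
    Sum_any (\<lambda>k. cscale (fps_nth D k) (f k) - cscale (case k of 0 \<Rightarrow> 0 | Suc j \<Rightarrow> a * fps_nth D j) (f k))"
    by (simp only: eq fv.scale_left_diff_distrib)
  also have "\<dots> = Sum_any (\<lambda>k. cscale (fps_nth D k) (f k)) - Sum_any (\<lambda>k. cscale (case k of 0 \<Rightarrow> 0 | Suc j \<Rightarrow> a * fps_nth D j) (f k))"
    by (rule Sum_any_diff) (rule finite_supp_cscale[OF assms])+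
  also have "Sum_any (\<lambda>k. cscale (case k of 0 \<Rightarrow> 0 | Suc j \<Rightarrow> a * fps_nth D j) (f k)) =
     cscale a (Sum_any (\<lambda>k. cscale (fps_nth D k) (f (Suc k))))"
    by (subst Sum_any_Suc[OF finite_supp_cscale[OF assms]]) (simp add: cscale_Sum_any)
  finally show ?thesis .
qed

lemma Sum_any_fps_one: "Sum_any (\<lambda>k. cscale (fps_nth 1 k) (f k)) = f 0"
  by (subst Sum_any_supp[of "{0}"]) auto

text \<open>The convolution on the right satisfies the recursion of the exponential on the left, so
  \<open>oexp_unique\<close> gives exp (B + D) = exp D exp B.\<close>

lemma oexp_add:
  assumes B: "commuting_ops B" and D: "commuting_ops D"
    and BD: "\<And>n m v. n > 0 \<Longrightarrow> m > 0 \<Longrightarrow> B n (D m v) = D m (B n v)"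
  shows "oexp (\<lambda>n v. B n v + D n v) r v = Sum_any (\<lambda>k. oexp D (r - k) (oexp B k v))"
proof -
  interpret B: commuting_ops B by (rule B)
  interpret D: commuting_ops D by (rule D)
  interpret S: commuting_ops "\<lambda>n v. B n v + D n v"
    by standard (auto simp: clin_plus clin_add[OF B.lin] clin_add[OF D.lin] B.comm D.comm BD algebra_simps)
  define f where "f r k = oexp D (r - k) (oexp B k v)" for r k
  have supp: "f r k = 0" if "k \<notin> {0..r}" for r k
    using that by (auto simp: f_def clin_zero[OF D.clin_oexp])
  have fin: "finite {k. f r k \<noteq> 0}" for r
    by (rule finite_subset[of _ "{0..r}"]) (use supp in blast, simp)
  have fin': "finite {k. oexp D r (f s k) \<noteq> 0}" "finite {k. B n (f s k) \<noteq> 0}" "finite {k. D n (f s k) \<noteq> 0}" for r s n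
    by (rule finite_supp_clin[OF fin], simp)+
  have BoD: "B n (oexp D s u) = oexp D s (B n u)" if "n > 0" for n s u
    by (rule D.oexp_commute) (use that BD in auto)
  have "Sum_any (f r) = oexp (\<lambda>n v. B n v + D n v) r v"
  proof (rule S.oexp_unique[where W = "\<lambda>r. Sum_any (f r)"])
    fix r :: int assume "r < 0"
    then have "f r k = 0" for k by (intro supp) auto
    then show "Sum_any (f r) = 0" by simp
  next
    have "Sum_any (f 0) = sum (f 0) {0}" by (rule Sum_any_supp) (auto intro!: supp)
    then show "Sum_any (f 0) = v" by (simp add: f_def)
  next
    fix r :: int and K assume r: "0 < r" "r \<le> int K"
    have "cscale (of_int r) (f r k) = (\<Sum>n = 1..K. cscale (of_nat n) (D n (f (r - int n) k)) + cscale (of_nat n) (B n (f (r - int n) (k - int n))))"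
      for k
    proof (cases "k \<in> {0..r}")
      case True
      \<comment> \<open>Splitting r = (r - k) + k distributes the derivative over the two
        exponentials.\<close>
      have "cscale (of_int r) (f r k) = cscale (of_int (r - k)) (f r k) + oexp D (r - k) (cscale (of_int k) (oexp B k v))"
        by (simp add: clin_scale[OF D.clin_oexp] f_def fv.scale_left_distrib[symmetric])
      also have "cscale (of_int (r - k)) (f r k) = (\<Sum>n = 1..K. cscale (of_nat n) (D n (f (r - int n) k)))"
        unfolding f_def by (subst D.oexp_rec[of _ K]) (use True r in \<open>auto simp: algebra_simps\<close>)
      also have "oexp D (r - k) (cscale (of_int k) (oexp B k v)) = (\<Sum>n = 1..K. cscale (of_nat n) (B n (f (r - int n) (k - int n))))"
        unfolding f_def by (subst B.oexp_rec[of _ K])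
          (use True r in \<open>auto simp: clin_sum[OF D.clin_oexp] clin_scale[OF D.clin_oexp] BoD algebra_simps\<close>)
      finally show ?thesis by (simp add: sum.distrib)
    next
      case False
      have "f (r - int n) k = 0" "f (r - int n) (k - int n) = 0" for n
        using False by (auto intro!: supp)
      then show ?thesis using False by (simp add: supp clin_zero[OF B.lin] clin_zero[OF D.lin])
    qed
    then have "cscale (of_int r) (Sum_any (f r)) =
       Sum_any (\<lambda>k. \<Sum>n = 1..K. cscale (of_nat n) (D n (f (r - int n) k)) + cscale (of_nat n) (B n (f (r - int n) (k - int n))))"
      by (simp add: cscale_Sum_any)
    also have "\<dots> = (\<Sum>n = 1..K. Sum_any (\<lambda>k. cscale (of_nat n) (D n (f (r - int n) k)) + cscale (of_nat n) (B n (f (r - int n) (k - int n)))))"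
    proof (rule Sum_any_sum)
      fix n show "finite {k. cscale (of_nat n) (D n (f (r - int n) k)) + cscale (of_nat n) (B n (f (r - int n) (k - int n))) \<noteq> 0}"
      proof (rule finite_subset)
        show "finite ({k. D n (f (r - int n) k) \<noteq> 0} \<union> {k. B n (f (r - int n) (k - int n)) \<noteq> 0})"
          using fin'(2,3) finite_supp_shift(2)[OF fin'(2)] by simp
      qed auto
    qed simp
    also have "\<dots> = (\<Sum>n = 1..K. cscale (of_nat n) (B n (Sum_any (f (r - int n))) + D n (Sum_any (f (r - int n)))))"
    proof (rule sum.cong[OF refl], goal_cases)
      case (1 n)
      have "Sum_any (\<lambda>k. cscale (of_nat n) (D n (f (r - int n) k)) + cscale (of_nat n) (B n (f (r - int n) (k - int n)))) =
        Sum_any (\<lambda>k. cscale (of_nat n) (D n (f (r - int n) k))) + Sum_any (\<lambda>k. cscale (of_nat n) (B n (f (r - int n) (k - int n))))"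
        by (rule Sum_any.distrib; rule finite_supp_cscale)
           (rule fin'(3), rule finite_supp_shift(2)[OF fin'(2)])
      also have "Sum_any (\<lambda>k. cscale (of_nat n) (B n (f (r - int n) (k - int n)))) = Sum_any (\<lambda>k. cscale (of_nat n) (B n (f (r - int n) k)))"
        by (rule Sum_any_shift(2))
      finally show ?case
        by (simp add: cscale_Sum_any[symmetric] clin_Sum_any[OF B.lin fin, symmetric] clin_Sum_any[OF D.lin fin, symmetric]
            fv.scale_right_distrib add.commute)
    qed
    finally show "cscale (of_int r) (Sum_any (f r)) = (\<Sum>n = 1..K. cscale (of_nat n) (B n (Sum_any (f (r - int n))) + D n (Sum_any (f (r - int n)))))" .
  qed
  then show ?thesis by (simp add: f_def)
qed

text \<open>The weights exp (c n) amount to substituting exp c times t for t.\<close>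

lemma oexp_scale:
  assumes "commuting_ops B" and a: "\<And>n. n > 0 \<Longrightarrow> a n = exp (c * of_nat n)"
  shows "oexp (\<lambda>n v. cscale (a n) (B n v)) r v = cscale (exp (c * of_int r)) (oexp B r v)"
proof -
  interpret B: commuting_ops B by (rule assms)
  interpret S: commuting_ops "\<lambda>n v. cscale (a n) (B n v)"
    by standard (auto simp: clin_cscale clin_scale[OF B.lin] B.comm mult.commute)
  show ?thesis
  proof (rule S.oexp_unique[where W = "\<lambda>r. cscale (exp (c * of_int r)) (oexp B r v)", symmetric])
    fix r :: int and K assume r: "0 < r" "r \<le> int K"
    have "cscale (of_int r) (cscale (exp (c * of_int r)) (oexp B r v)) =
       cscale (exp (c * of_int r)) (\<Sum>n = 1..K. cscale (of_nat n) (B n (oexp B (r - int n) v)))"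
      by (subst B.oexp_rec[OF r(2), symmetric]) (simp add: mult.commute)
    also have "\<dots> = (\<Sum>n = 1..K. cscale (of_nat n) (cscale (a n) (B n (cscale (exp (c * of_int (r - int n))) (oexp B (r - int n) v)))))"
      unfolding fv.scale_sum_right
    proof (rule sum.cong[OF refl], goal_cases)
      case (1 n)
      have "exp (c * of_int r) = a n * exp (c * of_int (r - int n))"
        using a[of n] 1 by (simp add: exp_add[symmetric] algebra_simps)
      then show ?case by (simp add: clin_scale[OF B.lin] mult_ac)
    qed
    finally show "cscale (of_int r) (cscale (exp (c * of_int r)) (oexp B r v)) =
      (\<Sum>n = 1..K. cscale (of_nat n) (cscale (a n) (B n (cscale (exp (c * of_int (r - int n))) (oexp B (r - int n) v)))))" .
  qed auto
qed

context free_bosons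
begin

section \<open>Moving vertex operators through an insertion\<close>

abbreviation contr :: "bfield \<Rightarrow> bfield \<Rightarrow> complex fps \<Rightarrow> bool" where
  "contr \<Phi> \<Psi> \<equiv> is_contr (mpair h N \<Phi> \<Psi>)"

lemma Ep_Em:
  assumes "contr \<Phi> \<Psi> C" "r \<le> int K"
  shows "Ep \<Phi> s (Em \<Psi> r v) = (\<Sum>k = 0..K. cscale (fps_nth C k) (Em \<Psi> (r - int k) (Ep \<Phi> (s - int k) v)))"
proof -
  interpret exchange_ops "\<lambda>n. modes h N \<Phi> (int n)" "\<lambda>n. modes h N \<Psi> (- int n)" "mpair h N \<Phi> \<Psi>" C
    by (intro exchange_ops.intro commuting_pos commuting_neg exchange_ops_axioms.intro assms(1) modes_exchange)
  \<comment> \<open>\<open>oexp_exchange\<close> asks for a bound on s, whereas \<open>K\<close>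
    bounds r; the range is enlarged and then cut, since \<open>Em\<close> vanishes at negative
    indices.\<close>
  have "Ep \<Phi> s (Em \<Psi> r v) = (\<Sum>k = 0..K + nat s. cscale (fps_nth C k) (Em \<Psi> (r - int k) (Ep \<Phi> (s - int k) v)))"
    unfolding Em_def Ep_def by (rule oexp_exchange) simp
  also have "\<dots> = (\<Sum>k = 0..K. cscale (fps_nth C k) (Em \<Psi> (r - int k) (Ep \<Phi> (s - int k) v)))"
    by (rule sum.mono_neutral_right) (use assms(2) in auto)
  finally show ?thesis .
qed

text \<open>The zero mode part of \<Phi> commutes with all nonzero modes, so only the annihilation
  part contracts with the creation part of \<Psi>.\<close>

lemma Ap_Em:
  assumes "contr \<Phi> \<Psi> C" "r \<le> int K"
  shows "Ap \<Phi> j (Em \<Psi> r v) = (\<Sum>k = 0..K. cscale (fps_nth C k) (Em \<Psi> (r - int k) (Ap \<Phi> (j + int k) v)))"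
proof -
  have fin: "finite {s. cscale (fps_nth C k) (Em \<Psi> (r - int k) (T \<Phi> (j + s) (Ep \<Phi> (s - int k) v))) \<noteq> 0}" for k
    by (rule finite_supp_cscale, rule finite_supp_clin, rule finite_supp_clin,
        rule finite_supp_shift(2)[OF Ep_finite]) auto
  have "Ap \<Phi> j (Em \<Psi> r v) = Sum_any (\<lambda>s. \<Sum>k = 0..K. cscale (fps_nth C k) (Em \<Psi> (r - int k) (T \<Phi> (j + s) (Ep \<Phi> (s - int k) v))))"
    unfolding Ap_def by (subst Ep_Em[OF assms]) (simp add: clin_sum clin_scale T_Em)
  also have "\<dots> = (\<Sum>k = 0..K. Sum_any (\<lambda>s. cscale (fps_nth C k) (Em \<Psi> (r - int k) (T \<Phi> (j + s) (Ep \<Phi> (s - int k) v)))))"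
    by (rule Sum_any_sum[OF _ fin]) simp
  also have "\<dots> = (\<Sum>k = 0..K. cscale (fps_nth C k) (Em \<Psi> (r - int k) (Ap \<Phi> (j + int k) v)))"
  proof (rule sum.cong[OF refl])
    fix k
    have finT: "finite {s. T \<Phi> (j + s) (Ep \<Phi> (s - int k) v) \<noteq> 0}"
      by (rule finite_supp_clin, rule finite_supp_shift(2)[OF Ep_finite]) simp
    have "Sum_any (\<lambda>s. T \<Phi> (j + s) (Ep \<Phi> (s - int k) v)) = Sum_any (\<lambda>s. T \<Phi> (j + (s + int k)) (Ep \<Phi> (s + int k - int k) v))"
      by (rule Sum_any_shift(1)[symmetric])
    then have "Ap \<Phi> (j + int k) v = Sum_any (\<lambda>s. T \<Phi> (j + s) (Ep \<Phi> (s - int k) v))"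
      by (simp add: Ap_def algebra_simps)
    then show "Sum_any (\<lambda>s. cscale (fps_nth C k) (Em \<Psi> (r - int k) (T \<Phi> (j + s) (Ep \<Phi> (s - int k) v)))) =
       cscale (fps_nth C k) (Em \<Psi> (r - int k) (Ap \<Phi> (j + int k) v))"
      by (simp add: cscale_Sum_any clin_Sum_any[OF clin_Em finT])
  qed
  finally show ?thesis .
qed

lemma V_Em:
  assumes "contr \<Phi> \<Psi> C" "r \<le> int K"
  shows "V \<Phi> m (Em \<Psi> r v) = (\<Sum>k = 0..K. cscale (fps_nth C k) (Em \<Psi> (r - int k) (V \<Phi> (m + int k) v)))"
proof -
  have "V \<Phi> m (Em \<Psi> r v) = Sum_any (\<lambda>i. \<Sum>k = 0..K. cscale (fps_nth C k) (Em \<Psi> (r - int k) (Em \<Phi> (m - i) (Ap \<Phi> (i + int k) v))))"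
    unfolding V_expand by (subst Ap_Em[OF assms]) (simp add: clin_sum clin_scale Em_Em[of \<Phi>])
  also have "\<dots> = (\<Sum>k = 0..K. Sum_any (\<lambda>i. cscale (fps_nth C k) (Em \<Psi> (r - int k) (Em \<Phi> (m - i) (Ap \<Phi> (i + int k) v)))))"
    by (rule Sum_any_sum, simp, rule finite_supp_cscale, rule finite_supp_clin, rule finite_supp_clin,
        rule finite_supp_shift(1)[OF Ap_finite]) auto
  also have "\<dots> = (\<Sum>k = 0..K. cscale (fps_nth C k) (Em \<Psi> (r - int k) (V \<Phi> (m + int k) v)))"
  proof (rule sum.cong[OF refl])
    fix k
    have finA: "finite {i. Em \<Phi> (m - i) (Ap \<Phi> (i + int k) v) \<noteq> 0}"
      by (rule finite_supp_clin, rule finite_supp_shift(1)[OF Ap_finite]) simp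
    have "Sum_any (\<lambda>i. Em \<Phi> (m - i) (Ap \<Phi> (i + int k) v)) = Sum_any (\<lambda>i. Em \<Phi> (m - (i - int k)) (Ap \<Phi> (i - int k + int k) v))"
      by (rule Sum_any_shift(2)[symmetric])
    then have "V \<Phi> (m + int k) v = Sum_any (\<lambda>i. Em \<Phi> (m - i) (Ap \<Phi> (i + int k) v))"
      by (simp add: V_expand algebra_simps)
    then show "Sum_any (\<lambda>i. cscale (fps_nth C k) (Em \<Psi> (r - int k) (Em \<Phi> (m - i) (Ap \<Phi> (i + int k) v)))) =
       cscale (fps_nth C k) (Em \<Psi> (r - int k) (V \<Phi> (m + int k) v))"
      by (simp add: cscale_Sum_any clin_Sum_any[OF clin_Em finA])
  qed
  finally show ?thesis .
qed

lemma Ap_bounds: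
  obtains B B' where "\<And>j. j < B \<Longrightarrow> Ap \<Psi> j v = 0" "\<And>j. j > B' \<Longrightarrow> Ap \<Psi> j v = 0"
proof -
  have "finite {j. Ap \<Psi> j v \<noteq> 0}" by (rule Ap_finite)
  then have "bdd_below {j. Ap \<Psi> j v \<noteq> 0}" "bdd_above {j. Ap \<Psi> j v \<noteq> 0}" by auto
  then obtain B B' where "\<And>j. Ap \<Psi> j v \<noteq> 0 \<Longrightarrow> B \<le> j" "\<And>j. Ap \<Psi> j v \<noteq> 0 \<Longrightarrow> j \<le> B'"
    by (auto simp: bdd_below_def bdd_above_def)
  then show ?thesis by (intro that[of B B']) (force simp: not_less[symmetric])+
qed

text \<open>The bound is uniform in \<open>W\<close>: finitely many \<open>Ap \<Psi> j v\<close> are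
  nonzero, and \<open>Em\<close> has no coefficients at negative indices.\<close>

lemma Ins_below:
  obtains B where "\<And>W n. clin W \<Longrightarrow> n < B \<Longrightarrow> Ins \<Psi> W n v = 0"
proof -
  obtain B B' where B: "\<And>j. j < B \<Longrightarrow> Ap \<Psi> j v = 0" by (rule Ap_bounds[of \<Psi> v]) blast
  have "Ins \<Psi> W n v = 0" if "clin W" "n < B" for W n
  proof -
    have "Em \<Psi> (n - j) (W (Ap \<Psi> j v)) = 0" for j
      using that B[of j] by (cases "j < B") (auto simp: clin_zero)
    then show ?thesis by (simp add: Ins_def)
  qed
  then show ?thesis by (rule that)
qed

lemma V_below: obtains B where "\<And>n. n < B \<Longrightarrow> V \<Psi> n v = 0"
  using Ins_below[of \<Psi> v] clin_ident(1) unfolding V_Ins_id by metis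

lemma finite_below:
  fixes f :: "int \<Rightarrow> fvec"
  assumes "\<And>n. n < B \<Longrightarrow> f n = 0"
  shows "finite {k::nat. f (n - int k) \<noteq> 0}"
proof (rule finite_subset)
  show "{k::nat. f (n - int k) \<noteq> 0} \<subseteq> {..nat (n - B)}"
    using assms by (force simp: not_less[symmetric])
qed simp

lemma Ins_nat_finite: "(\<And>k. clin (W k)) \<Longrightarrow> finite {k::nat. Ins \<Psi> (W k) (n - int k) v \<noteq> 0}"
proof -
  assume W: "\<And>k. clin (W k)"
  obtain B where B: "\<And>W n. clin W \<Longrightarrow> n < B \<Longrightarrow> Ins \<Psi> W n v = 0" by (rule Ins_below[of \<Psi> v]) blast
  show ?thesis
  proof (rule finite_subset)
    show "{k::nat. Ins \<Psi> (W k) (n - int k) v \<noteq> 0} \<subseteq> {..nat (n - B)}"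
      using B[OF W] by (force simp: not_less[symmetric])
  qed simp
qed

lemma Ins_sum:
  assumes "clin W" "finite J" "\<And>j. j \<notin> J \<Longrightarrow> Ap \<Psi> j v = 0"
  shows "Ins \<Psi> W n v = (\<Sum>j\<in>J. Em \<Psi> (n - j) (W (Ap \<Psi> j v)))"
  unfolding Ins_def by (rule Sum_any_supp) (use assms in \<open>auto simp: clin_zero\<close>)

text \<open>Only the creation part of \<Psi> stands between \<open>V \<Phi>\<close> and
  \<open>W\<close>. Passing it costs the contraction of \<Phi> with \<Psi>, after which
  \<open>V \<Phi>\<close> has joined the inside of the insertion.\<close>

lemma V_Ins:
  assumes "contr \<Phi> \<Psi> C" "clin W"
  shows "V \<Phi> m (Ins \<Psi> W n v) = Sum_any (\<lambda>k. cscale (fps_nth C k) (Ins \<Psi> (\<lambda>v. V \<Phi> (m + int k) (W v)) (n - int k) v))"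
proof -
  define J where "J = {j. Ap \<Psi> j v \<noteq> 0}"
  have J: "finite J" "\<And>j. j \<notin> J \<Longrightarrow> Ap \<Psi> j v = 0" by (simp_all add: J_def Ap_finite)
  define K where "K = nat (Max (insert 0 ((\<lambda>j. n - j) ` J)))"
  have K: "n - j \<le> int K" if "j \<in> J" for j
  proof -
    have "n - j \<le> Max (insert 0 ((\<lambda>j. n - j) ` J))" by (rule Max_ge) (use J that in auto)
    then show ?thesis by (simp add: K_def)
  qed
  have "V \<Phi> m (Ins \<Psi> W n v) = (\<Sum>j\<in>J. \<Sum>k = 0..K. cscale (fps_nth C k) (Em \<Psi> (n - j - int k) (V \<Phi> (m + int k) (W (Ap \<Psi> j v)))))"
    by (simp add: Ins_sum[OF assms(2) J] clin_sum V_Em[OF assms(1) K])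
  also have "\<dots> = (\<Sum>k = 0..K. cscale (fps_nth C k) (Ins \<Psi> (\<lambda>v. V \<Phi> (m + int k) (W v)) (n - int k) v))"
    by (subst sum.swap) (simp add: Ins_sum[OF clin_comp[OF clin_V assms(2)] J] fv.scale_sum_right algebra_simps)
  also have "\<dots> = Sum_any (\<lambda>k. cscale (fps_nth C k) (Ins \<Psi> (\<lambda>v. V \<Phi> (m + int k) (W v)) (n - int k) v))"
  proof (rule Sum_any_upto[symmetric])
    fix k assume "k > K"
    then have "Em \<Psi> (n - int k - j) w = 0" if "j \<in> J" for j w using K[OF that] by simp
    then show "cscale (fps_nth C k) (Ins \<Psi> (\<lambda>v. V \<Phi> (m + int k) (W v)) (n - int k) v) = 0"
      by (simp add: Ins_sum[OF clin_comp[OF clin_V assms(2)] J])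
  qed
  finally show ?thesis .
qed

text \<open>The scalar relating the two orders of the constant zero mode factors; powers of the
  variables are accounted for separately by the shift g.\<close>

definition phase :: "bfield \<Rightarrow> bfield \<Rightarrow> complex" where
  "phase \<Psi> \<Phi> = exp (zpair \<Psi> \<Phi> - zpair \<Phi> \<Psi>)"

text \<open>One order produces the g-th power of the variable of \<Psi>, the other the g-th power of
  the variable of \<Phi>; the shifted indices remove both.\<close>

lemma T_T:
  assumes "qpair \<Phi> \<Psi> = of_int g" "qpair \<Psi> \<Phi> = of_int g"
  shows "T \<Psi> (j + g) (T \<Phi> i v) = cscale (phase \<Psi> \<Phi>) (T \<Phi> (i + g) (T \<Psi> j v))"
proof (rule clin_eqI[where A = "\<lambda>v. T \<Psi> (j + g) (T \<Phi> i v)"])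
  fix p M
  define L where "L \<Phi> = (\<Sum>b\<in>bosons N. \<Phi> (LogZ b) * p b)" for \<Phi> :: bfield
  define cubic_word where "cubic_word \<Phi> = (\<Sum>b\<in>bosons N. \<Phi> (Zero b) * p b)" for \<Phi> :: bfield
  have L: "(\<Sum>b\<in>bosons N. \<Psi> (LogZ b) * (p b + bsign b * \<Phi> (QQ b))) = L \<Psi> + qpair \<Psi> \<Phi>" for \<Psi> \<Phi>
    by (simp add: L_def qpair_def algebra_simps sum.distrib)
  have cubic_word: "(\<Sum>b\<in>bosons N. \<Psi> (Zero b) * (p b + bsign b * \<Phi> (QQ b))) = cubic_word \<Psi> + zpair \<Psi> \<Phi>" for \<Psi> \<Phi>
    by (simp add: cubic_word_def zpair_def algebra_simps sum.distrib)
  show "T \<Psi> (j + g) (T \<Phi> i (Poly_Mapping.single (p, M) 1)) = cscale (phase \<Psi> \<Phi>) (T \<Phi> (i + g) (T \<Psi> j (Poly_Mapping.single (p, M) 1)))"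
    by (simp add: T_single clin_scale L cubic_word assms L_def[symmetric] cubic_word_def[symmetric] phase_def exp_add exp_diff)
       (auto simp: algebra_simps intro!: arg_cong2[where f = cscale] arg_cong2[where f = Poly_Mapping.single])
qed (intro clin_cscale clin_comp[OF clin_T clin_T])+

text \<open>Annihilation exponentials commute, so either one may act on v directly, and
  \<open>Ep_finite\<close> bounds each index independently.\<close>

lemma EpEp_finite: "finite {(s, s'). A s s' (Ep \<Psi> s (Ep \<Phi> s' v)) \<noteq> 0}" if "\<And>s s'. clin (A s s')"
proof (rule finite_subset)
  show "{(s, s'). A s s' (Ep \<Psi> s (Ep \<Phi> s' v)) \<noteq> 0} \<subseteq> {s. Ep \<Psi> s v \<noteq> 0} \<times> {s'. Ep \<Phi> s' v \<noteq> 0}"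
  proof clarsimp
    fix s s' assume A: "A s s' (Ep \<Psi> s (Ep \<Phi> s' v)) \<noteq> 0"
    have "Ep \<Psi> s (Ep \<Phi> s' v) = Ep \<Phi> s' (Ep \<Psi> s v)" by (rule Ep_Ep)
    with A show "Ep \<Psi> s v \<noteq> 0 \<and> Ep \<Phi> s' v \<noteq> 0" using that clin_zero by (metis clin_Ep)
  qed
qed (simp add: Ep_finite)

lemma Ap_Ap_expand:
  "Ap \<Psi> j (Ap \<Phi> i v) = Sum_any (\<lambda>s. Sum_any (\<lambda>s'. T \<Psi> (j + s) (T \<Phi> (i + s') (Ep \<Psi> s (Ep \<Phi> s' v)))))"
  unfolding Ap_def
  by (intro Sum_any.cong, subst clin_Sum_any[OF clin_Ep TE_finite'],
      subst clin_Sum_any[OF clin_T finite_supp_clin[OF TE_finite' clin_Ep]])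
     (simp add: T_Ep)

lemma Ap_Ap:
  assumes "qpair \<Phi> \<Psi> = of_int g" "qpair \<Psi> \<Phi> = of_int g"
  shows "Ap \<Psi> (j + g) (Ap \<Phi> i v) = cscale (phase \<Psi> \<Phi>) (Ap \<Phi> (i + g) (Ap \<Psi> j v))"
proof -
  have "Ap \<Psi> (j + g) (Ap \<Phi> i v) = Sum_any (\<lambda>s. Sum_any (\<lambda>s'. T \<Psi> (j + g + s) (T \<Phi> (i + s') (Ep \<Psi> s (Ep \<Phi> s' v)))))"
    by (rule Ap_Ap_expand)
  also have "\<dots> = Sum_any (\<lambda>s'. Sum_any (\<lambda>s. T \<Psi> (j + g + s) (T \<Phi> (i + s') (Ep \<Psi> s (Ep \<Phi> s' v)))))"
    by (rule Sum_any_swap) (rule EpEp_finite[where A = "\<lambda>s s' v. T \<Psi> (j + g + s) (T \<Phi> (i + s') v)", OF clin_comp[OF clin_T clin_T]])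
  also have "\<dots> = Sum_any (\<lambda>s'. Sum_any (\<lambda>s. cscale (phase \<Psi> \<Phi>) (T \<Phi> (i + g + s') (T \<Psi> (j + s) (Ep \<Phi> s' (Ep \<Psi> s v))))))"
  proof (intro Sum_any.cong)
    fix s' s
    have "T \<Psi> (j + g + s) (T \<Phi> (i + s') w) = cscale (phase \<Psi> \<Phi>) (T \<Phi> (i + g + s') (T \<Psi> (j + s) w))" for w
      using T_T[OF assms, of "j + s" "i + s'" w] by (simp add: algebra_simps)
    then show "T \<Psi> (j + g + s) (T \<Phi> (i + s') (Ep \<Psi> s (Ep \<Phi> s' v))) =
       cscale (phase \<Psi> \<Phi>) (T \<Phi> (i + g + s') (T \<Psi> (j + s) (Ep \<Phi> s' (Ep \<Psi> s v))))"
      by (simp add: Ep_Ep[of \<Psi> s])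
  qed
  also have "\<dots> = cscale (phase \<Psi> \<Phi>) (Ap \<Phi> (i + g) (Ap \<Psi> j v))"
    by (simp add: Ap_Ap_expand cscale_Sum_any)
  finally show ?thesis .
qed

lemma phase_nz [simp]: "phase \<Psi> \<Phi> \<noteq> 0"
  by (simp add: phase_def)

lemma Ap_V_finite: "finite {k::nat. V \<Phi> (f k) (Ap \<Psi> (j + int k) v) \<noteq> 0}"
proof -
  obtain B B' where B: "\<And>j. j > B' \<Longrightarrow> Ap \<Psi> j v = 0" by (rule Ap_bounds[of \<Psi> v]) blast
  show ?thesis
  proof (rule finite_subset)
    show "{k::nat. V \<Phi> (f k) (Ap \<Psi> (j + int k) v) \<noteq> 0} \<subseteq> {..nat (B' - j)}"
    proof clarsimp
      fix k assume "V \<Phi> (f k) (Ap \<Psi> (j + int k) v) \<noteq> 0"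
      then have "Ap \<Psi> (j + int k) v \<noteq> 0" by (auto simp: clin_zero)
      then have "j + int k \<le> B'" using B by (force simp: not_less[symmetric])
      then show "k \<le> nat (B' - j)" by simp
    qed
  qed simp
qed

text \<open>The annihilation part of \<Psi> contracts with the creation part of \<Phi>, and the zero
  modes contribute the phase and, through \<open>T_T\<close>, the shift by g.\<close>

lemma Ap_V:
  assumes C: "contr \<Psi> \<Phi> C" and g: "qpair \<Phi> \<Psi> = of_int g" "qpair \<Psi> \<Phi> = of_int g"
  shows "Ap \<Psi> j (V \<Phi> m v) = Sum_any (\<lambda>k. cscale (phase \<Psi> \<Phi> * fps_nth C k) (V \<Phi> (m + g - int k) (Ap \<Psi> (j - g + int k) v)))"
proof -
  define I where "I = {i. Ap \<Phi> i v \<noteq> 0}"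
  have I: "finite I" "\<And>i. i \<notin> I \<Longrightarrow> Ap \<Phi> i v = 0" by (simp_all add: I_def Ap_finite)
  define K where "K = nat (Max (insert 0 ((\<lambda>i. m - i) ` I)))"
  have K: "m - i \<le> int K" if "i \<in> I" for i
  proof -
    have "m - i \<le> Max (insert 0 ((\<lambda>i. m - i) ` I))" by (rule Max_ge) (use I that in auto)
    then show ?thesis by (simp add: K_def)
  qed
  have V: "cscale (phase \<Psi> \<Phi>) (V \<Phi> (m + g - int k) (Ap \<Psi> (j - g + int k) v)) = (\<Sum>i\<in>I. Em \<Phi> (m - i - int k) (Ap \<Psi> (j + int k) (Ap \<Phi> i v)))" for k
  proof -
    have Ap: "cscale (phase \<Psi> \<Phi>) (Ap \<Phi> (i + g) (Ap \<Psi> (j - g + int k) v)) = Ap \<Psi> (j + int k) (Ap \<Phi> i v)" for i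
      using Ap_Ap[OF g, of "j - g + int k" i v] by (simp add: algebra_simps)
    have "cscale (phase \<Psi> \<Phi>) (V \<Phi> (m + g - int k) (Ap \<Psi> (j - g + int k) v)) =
       cscale (phase \<Psi> \<Phi>) (Sum_any (\<lambda>i. Em \<Phi> (m + g - int k - (i + g)) (Ap \<Phi> (i + g) (Ap \<Psi> (j - g + int k) v))))"
      by (simp only: V_expand Sum_any_shift(1)[of "\<lambda>i. Em \<Phi> (m + g - int k - i) (Ap \<Phi> i (Ap \<Psi> (j - g + int k) v))" g])
    also have "\<dots> = Sum_any (\<lambda>i. Em \<Phi> (m - i - int k) (cscale (phase \<Psi> \<Phi>) (Ap \<Phi> (i + g) (Ap \<Psi> (j - g + int k) v))))"
      by (simp add: cscale_Sum_any clin_scale algebra_simps)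
    also have "\<dots> = (\<Sum>i\<in>I. Em \<Phi> (m - i - int k) (Ap \<Psi> (j + int k) (Ap \<Phi> i v)))"
      unfolding Ap by (rule Sum_any_supp) (use I in \<open>auto simp: clin_zero\<close>)
    finally show ?thesis .
  qed
  have "Ap \<Psi> j (V \<Phi> m v) = Ap \<Psi> j (\<Sum>i\<in>I. Em \<Phi> (m - i) (Ap \<Phi> i v))"
    unfolding V_expand by (subst Sum_any_supp[OF I(1)]) (use I in \<open>auto simp: clin_zero\<close>)
  also have "\<dots> = (\<Sum>i\<in>I. \<Sum>k = 0..K. cscale (fps_nth C k) (Em \<Phi> (m - i - int k) (Ap \<Psi> (j + int k) (Ap \<Phi> i v))))"
    by (simp add: clin_sum Ap_Em[OF C K])
  also have "\<dots> = (\<Sum>k = 0..K. cscale (phase \<Psi> \<Phi> * fps_nth C k) (V \<Phi> (m + g - int k) (Ap \<Psi> (j - g + int k) v)))"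
    by (subst sum.swap) (simp add: V[symmetric] fv.scale_sum_right[symmetric] mult.commute)
  also have "\<dots> = Sum_any (\<lambda>k. cscale (phase \<Psi> \<Phi> * fps_nth C k) (V \<Phi> (m + g - int k) (Ap \<Psi> (j - g + int k) v)))"
  proof (rule Sum_any_upto[symmetric])
    fix k assume "k > K"
    then have "Em \<Phi> (m - i - int k) w = 0" if "i \<in> I" for i w using K[OF that] by simp
    then have "cscale (phase \<Psi> \<Phi>) (V \<Phi> (m + g - int k) (Ap \<Psi> (j - g + int k) v)) = 0"
      unfolding V by simp
    then show "cscale (phase \<Psi> \<Phi> * fps_nth C k) (V \<Phi> (m + g - int k) (Ap \<Psi> (j - g + int k) v)) = 0" by simp
  qed
  finally show ?thesis .
qed

lemma Ins_V_finite: "clin W \<Longrightarrow> finite {k::nat. Ins \<Psi> (\<lambda>v. W (V \<Phi> (m - int k) v)) (f k) v \<noteq> 0}"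
proof -
  assume W: "clin W"
  define J where "J = {j. Ap \<Psi> j v \<noteq> 0}"
  have J: "finite J" "\<And>j. j \<notin> J \<Longrightarrow> Ap \<Psi> j v = 0" by (simp_all add: J_def Ap_finite)
  have "finite {k::nat. V \<Phi> (m - int k) (Ap \<Psi> j v) \<noteq> 0}" for j
    by (rule V_below[of \<Phi> "Ap \<Psi> j v"]) (rule finite_below)
  then have "finite (\<Union>j\<in>J. {k::nat. V \<Phi> (m - int k) (Ap \<Psi> j v) \<noteq> 0})" using J by auto
  moreover have "{k::nat. Ins \<Psi> (\<lambda>v. W (V \<Phi> (m - int k) v)) (f k) v \<noteq> 0} \<subseteq> (\<Union>j\<in>J. {k::nat. V \<Phi> (m - int k) (Ap \<Psi> j v) \<noteq> 0})"
  proof clarsimp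
    fix k assume "Ins \<Psi> (\<lambda>v. W (V \<Phi> (m - int k) v)) (f k) v \<noteq> 0"
    moreover have "Ins \<Psi> (\<lambda>v. W (V \<Phi> (m - int k) v)) (f k) v = (\<Sum>j\<in>J. Em \<Psi> (f k - j) (W (V \<Phi> (m - int k) (Ap \<Psi> j v))))"
      by (rule Ins_sum[OF clin_comp[OF W clin_V] J])
    ultimately have "\<not> (\<forall>j\<in>J. Em \<Psi> (f k - j) (W (V \<Phi> (m - int k) (Ap \<Psi> j v))) = 0)"
      by (intro notI) (simp only: sum.neutral simp_thms)
    then obtain j where "j \<in> J" "Em \<Psi> (f k - j) (W (V \<Phi> (m - int k) (Ap \<Psi> j v))) \<noteq> 0" by blast
    then show "\<exists>j\<in>J. V \<Phi> (m - int k) (Ap \<Psi> j v) \<noteq> 0" using clin_zero[OF W] by (intro bexI[of _ j]) (auto simp: clin_zero)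
  qed
  ultimately show ?thesis by (rule rev_finite_subset)
qed

text \<open>The mirror image of \<open>V_Ins\<close>: the part of \<Psi> standing right of
  \<open>W\<close> has to pass \<open>V \<Phi>\<close>. Hence the contraction of \<Psi> with \<Phi>,
  in powers of the inverse ratio of the variables, and the phase.\<close>

lemma Ins_V:
  assumes C: "contr \<Psi> \<Phi> C" and g: "qpair \<Phi> \<Psi> = of_int g" "qpair \<Psi> \<Phi> = of_int g" and W: "clin W"
  shows "Ins \<Psi> W n (V \<Phi> m v) = Sum_any (\<lambda>k. cscale (phase \<Psi> \<Phi> * fps_nth C k) (Ins \<Psi> (\<lambda>v. W (V \<Phi> (m + g - int k) v)) (n - g + int k) v))"
proof -
  define f where "f j k = cscale (phase \<Psi> \<Phi> * fps_nth C k) (Em \<Psi> (n - j) (W (V \<Phi> (m + g - int k) (Ap \<Psi> (j - g + int k) v))))" for j and k :: nat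
  define J where "J = {j. Ap \<Psi> j v \<noteq> 0}"
  have J: "finite J" "\<And>j. j \<notin> J \<Longrightarrow> Ap \<Psi> j v = 0" by (simp_all add: J_def Ap_finite)
  have fV: "finite {k::nat. V \<Phi> (m + g - int k) (Ap \<Psi> j v) \<noteq> 0}" for j
    by (rule V_below[of \<Phi> "Ap \<Psi> j v"]) (rule finite_below)
  have fin: "finite {(j, k). f j k \<noteq> 0}"
  proof (rule finite_subset)
    show "{(j, k). f j k \<noteq> 0} \<subseteq> (\<lambda>(j, k). (j + g - int k, k)) ` (SIGMA j:J. {k. V \<Phi> (m + g - int k) (Ap \<Psi> j v) \<noteq> 0})"
    proof clarify
      fix j k assume "f j k \<noteq> 0"
      then have "V \<Phi> (m + g - int k) (Ap \<Psi> (j - g + int k) v) \<noteq> 0" using clin_zero[OF W] by (auto simp: f_def clin_zero)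
      moreover then have "j - g + int k \<in> J" using J(2) by (metis clin_V clin_zero)
      ultimately show "(j, k) \<in> (\<lambda>(j, k). (j + g - int k, k)) ` (SIGMA j:J. {k. V \<Phi> (m + g - int k) (Ap \<Psi> j v) \<noteq> 0})"
        by (intro image_eqI[of _ _ "(j - g + int k, k)"]) auto
    qed
  qed (use J fV in auto)
  have "Ins \<Psi> W n (V \<Phi> m v) = Sum_any (\<lambda>j. Sum_any (f j))"
    unfolding Ins_def f_def
  proof (intro Sum_any.cong)
    fix j
    show "Em \<Psi> (n - j) (W (Ap \<Psi> j (V \<Phi> m v))) = Sum_any (\<lambda>k. cscale (phase \<Psi> \<Phi> * fps_nth C k)
         (Em \<Psi> (n - j) (W (V \<Phi> (m + g - int k) (Ap \<Psi> (j - g + int k) v)))))"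
      by (subst Ap_V[OF C g], subst clin_Sum_any[OF W finite_supp_cscale[OF Ap_V_finite]],
          subst clin_Sum_any[OF clin_Em finite_supp_clin[OF finite_supp_cscale[OF Ap_V_finite] W]])
         (simp add: clin_scale[OF W] clin_scale)
  qed
  also have "\<dots> = Sum_any (\<lambda>k. Sum_any (\<lambda>j. f j k))" by (rule Sum_any_swap[OF fin])
  also have "\<dots> = Sum_any (\<lambda>k. cscale (phase \<Psi> \<Phi> * fps_nth C k) (Ins \<Psi> (\<lambda>v. W (V \<Phi> (m + g - int k) v)) (n - g + int k) v))"
  proof (intro Sum_any.cong)
    fix k
    have "Sum_any (\<lambda>j. f j k) = Sum_any (\<lambda>j. f (j + (g - int k)) k)" by (rule Sum_any_shift(1)[symmetric])
    also have "\<dots> = cscale (phase \<Psi> \<Phi> * fps_nth C k) (Ins \<Psi> (\<lambda>v. W (V \<Phi> (m + g - int k) v)) (n - g + int k) v)"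
      by (simp add: f_def Ins_def cscale_Sum_any algebra_simps)
    finally show "Sum_any (\<lambda>j. f j k) = cscale (phase \<Psi> \<Phi> * fps_nth C k) (Ins \<Psi> (\<lambda>v. W (V \<Phi> (m + g - int k) v)) (n - g + int k) v)" .
  qed
  finally show ?thesis .
qed

end

lemma Sum_any_int_split:
  assumes "finite {k::int. f k \<noteq> 0}"
  shows "Sum_any f = Sum_any (\<lambda>k::nat. f (int k)) + Sum_any (\<lambda>k::nat. f (- 1 - int k))"
proof -
  let ?p = "\<lambda>k. if k \<ge> 0 then f k else 0" and ?n = "\<lambda>k. if k \<ge> 0 then 0 else f k"
  have "Sum_any f = Sum_any (\<lambda>k. ?p k + ?n k)" by (rule Sum_any.cong) simp
  also have "\<dots> = Sum_any ?p + Sum_any ?n"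
    by (rule Sum_any.distrib; rule finite_subset[OF _ assms]) auto
  also have "Sum_any ?p = Sum_any (\<lambda>k::nat. ?p (int k))" by (rule Sum_any_nat_int[symmetric]) simp
  also have "Sum_any ?n = Sum_any (\<lambda>k. ?n (- 1 - k))" by (rule Sum_any_shift(3)[symmetric])
  also have "\<dots> = Sum_any (\<lambda>k::nat. ?n (- 1 - int k))" by (rule Sum_any_nat_int[symmetric]) simp
  finally show ?thesis by simp
qed

context free_bosons
begin

subsection \<open>Dilation\<close>

lemma Em_bdilate: "Em (bdilate h x \<Phi>) r v = cscale (exp (h * x * of_int r)) (Em \<Phi> r v)"
proof -
  have "(\<lambda>n. modes h N (bdilate h x \<Phi>) (- int n)) = (\<lambda>n v. cscale (exp (h * x * of_nat n)) (modes h N \<Phi> (- int n) v))"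
    by (intro ext) (simp add: modes_def qpow_def fv.scale_sum_right mult_ac)
  then show ?thesis unfolding Em_def by (simp add: oexp_scale[OF commuting_neg])
qed

lemma Ep_bdilate: "Ep (bdilate h x \<Phi>) r v = cscale (exp (- h * x * of_int r)) (Ep \<Phi> r v)"
proof -
  have "(\<lambda>n. modes h N (bdilate h x \<Phi>) (int n)) = (\<lambda>n v. cscale (exp (- h * x * of_nat n)) (modes h N \<Phi> (int n) v))"
    by (intro ext) (simp add: modes_def qpow_def fv.scale_sum_right mult_ac)
  moreover have "oexp (\<lambda>n v. cscale (exp (- h * x * of_nat n)) (modes h N \<Phi> (int n) v)) r v =
     cscale (exp (- h * x * of_int r)) (oexp (\<lambda>n. modes h N \<Phi> (int n)) r v)"
    by (rule oexp_scale[OF commuting_pos]) simp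
  ultimately show ?thesis unfolding Ep_def by simp
qed

lemma T_bdilate: "T (bdilate h x \<Phi>) j v = cscale (exp (h * x * of_int j)) (T \<Phi> j v)"
proof (rule clin_eqI[OF clin_T clin_cscale[OF clin_T]])
  fix p M
  have "(\<Sum>b\<in>bosons N. (\<Phi> (Zero b) + x * h * \<Phi> (LogZ b)) * p b) =
     (\<Sum>b\<in>bosons N. \<Phi> (Zero b) * p b) + h * x * (\<Sum>b\<in>bosons N. \<Phi> (LogZ b) * p b)"
    by (simp add: algebra_simps sum.distrib sum_distrib_left)
  then show "T (bdilate h x \<Phi>) j (Poly_Mapping.single (p, M) 1) = cscale (exp (h * x * of_int j)) (T \<Phi> j (Poly_Mapping.single (p, M) 1))"
    by (simp add: T_single exp_add mult_ac)
qed

lemma Ap_bdilate: "Ap (bdilate h x \<Phi>) j v = cscale (exp (h * x * of_int j)) (Ap \<Phi> j v)"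
  unfolding Ap_def cscale_Sum_any
  by (rule Sum_any.cong) (simp add: T_bdilate Ep_bdilate clin_scale exp_add[symmetric] algebra_simps)

lemma V_bdilate: "V (bdilate h x \<Phi>) m v = cscale (qpow h (x * of_int m)) (V \<Phi> m v)"
  unfolding V_expand cscale_Sum_any
  by (rule Sum_any.cong) (simp add: Em_bdilate Ap_bdilate clin_scale exp_add[symmetric] qpow_def algebra_simps)

subsection \<open>Fusion\<close>

lemma modes_add: "modes h N (\<lambda>y. \<Phi> y + \<Psi> y) n = (\<lambda>v. modes h N \<Phi> n v + modes h N \<Psi> n v)"
  by (rule ext) (simp add: modes_def fv.scale_left_distrib sum.distrib)

lemma Em_add: "Em (\<lambda>y. \<Phi> y + \<Psi> y) r v = Sum_any (\<lambda>k. Em \<Psi> (r - k) (Em \<Phi> k v))"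
  unfolding Em_def modes_add
  by (rule oexp_add[OF commuting_neg commuting_neg]) (intro modes_commute bmode_commute_neg)

lemma Ep_add: "Ep (\<lambda>y. \<Phi> y + \<Psi> y) r v = Sum_any (\<lambda>k. Ep \<Psi> (r - k) (Ep \<Phi> k v))"
  unfolding Ep_def modes_add
  by (rule oexp_add[OF commuting_pos commuting_pos]) (intro modes_commute bmode_commute_pos)

text \<open>On a state with nonintegral exponent \<open>zpow_zero\<close> has no nonzero
  coefficient, so \<open>V \<Psi>\<close> kills it although the exponent of a sum \<Phi> + \<Psi>
  may be integral. Fusing two exponentials requires this case to be excluded.\<close>

definition integral :: "bfield \<Rightarrow> fvec \<Rightarrow> bool" where
  "integral \<Psi> v \<longleftrightarrow> (\<forall>k\<in>Poly_Mapping.keys v. (\<Sum>b\<in>bosons N. \<Psi> (LogZ b) * fst k b) \<in> \<int>)"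

lemma T_T_finite: "finite {j. T \<Phi> (f j) (T \<Psi> j v) \<noteq> 0}"
  by (rule finite_supp_clin[OF T_finite]) simp

text \<open>On a basis state only one j survives, the exponent of \<Psi>; the Q part of \<Psi> then
  shifts the exponent of \<Phi> by g and its constant part by \<open>zpair\<close>.\<close>

lemma T_fuse:
  assumes "qpair \<Phi> \<Psi> = of_int g" "integral \<Psi> v"
  shows "Sum_any (\<lambda>j. T \<Phi> (J - j + g) (T \<Psi> j v)) = cscale (exp (zpair \<Phi> \<Psi>)) (T (\<lambda>y. \<Phi> y + \<Psi> y) J v)"
proof -
  have basis: "Sum_any (\<lambda>j. T \<Phi> (J - j + g) (T \<Psi> j (Poly_Mapping.single k 1))) =
     cscale (exp (zpair \<Phi> \<Psi>)) (T (\<lambda>y. \<Phi> y + \<Psi> y) J (Poly_Mapping.single k 1))"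
    if k: "k \<in> Poly_Mapping.keys v" for k
  proof -
    obtain p M where pM: "k = (p, M)" by (cases k)
    define L where "L \<Phi> = (\<Sum>b\<in>bosons N. \<Phi> (LogZ b) * p b)" for \<Phi> :: bfield
    define cubic_word where "cubic_word \<Phi> = (\<Sum>b\<in>bosons N. \<Phi> (Zero b) * p b)" for \<Phi> :: bfield
    have L: "(\<Sum>b\<in>bosons N. \<Phi> (LogZ b) * (p b + bsign b * \<Psi> (QQ b))) = L \<Phi> + of_int g"
      by (simp add: L_def assms(1)[symmetric] qpair_def algebra_simps sum.distrib)
    have cubic_word: "(\<Sum>b\<in>bosons N. \<Phi> (Zero b) * (p b + bsign b * \<Psi> (QQ b))) = cubic_word \<Phi> + zpair \<Phi> \<Psi>"
      by (simp add: cubic_word_def zpair_def algebra_simps sum.distrib)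
    have LZ: "(\<Sum>b\<in>bosons N. (\<Phi> (LogZ b) + \<Psi> (LogZ b)) * p b) = L \<Phi> + L \<Psi>"
      "(\<Sum>b\<in>bosons N. (\<Phi> (Zero b) + \<Psi> (Zero b)) * p b) = cubic_word \<Phi> + cubic_word \<Psi>"
      by (simp_all add: L_def cubic_word_def algebra_simps sum.distrib)
    have "L \<Psi> \<in> \<int>"
      using assms(2) k unfolding integral_def L_def pM by fastforce
    then obtain l where l: "L \<Psi> = of_int l" by (rule Ints_cases)
    have "Sum_any (\<lambda>j. T \<Phi> (J - j + g) (T \<Psi> j (Poly_Mapping.single (p, M) 1))) =
       (\<Sum>j\<in>{l}. T \<Phi> (J - j + g) (T \<Psi> j (Poly_Mapping.single (p, M) 1)))"
      by (rule Sum_any_supp) (auto simp: T_single l L_def[symmetric] clin_zero)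
    also have "\<dots> = cscale (exp (zpair \<Phi> \<Psi>)) (T (\<lambda>y. \<Phi> y + \<Psi> y) J (Poly_Mapping.single (p, M) 1))"
      by (simp add: T_single L_def[symmetric] cubic_word_def[symmetric] l clin_scale L cubic_word LZ exp_add)
         (auto simp: algebra_simps intro!: arg_cong2[where f = cscale])
    finally show ?thesis by (simp add: pM)
  qed
  let ?K = "Poly_Mapping.keys v" and ?c = "Poly_Mapping.lookup v"
  have v: "A v = (\<Sum>k\<in>?K. cscale (?c k) (A (Poly_Mapping.single k 1)))" if "clin A" for A
    using fvec_decomp[of v] clin_sum[OF that, of "\<lambda>k. cscale (?c k) (Poly_Mapping.single k 1)" ?K]
    by (simp add: clin_scale[OF that])
  have "Sum_any (\<lambda>j. T \<Phi> (J - j + g) (T \<Psi> j v)) =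
    Sum_any (\<lambda>j. \<Sum>k\<in>?K. cscale (?c k) (T \<Phi> (J - j + g) (T \<Psi> j (Poly_Mapping.single k 1))))"
    by (intro Sum_any.cong v clin_comp[OF clin_T clin_T])
  also have "\<dots> = (\<Sum>k\<in>?K. cscale (?c k) (Sum_any (\<lambda>j. T \<Phi> (J - j + g) (T \<Psi> j (Poly_Mapping.single k 1)))))"
    by (subst Sum_any_sum) (auto intro!: finite_supp_cscale T_T_finite simp: cscale_Sum_any)
  also have "\<dots> = (\<Sum>k\<in>?K. cscale (?c k) (cscale (exp (zpair \<Phi> \<Psi>)) (T (\<lambda>y. \<Phi> y + \<Psi> y) J (Poly_Mapping.single k 1))))"
    by (rule sum.cong) (simp_all add: basis del: fv.scale_scale)
  also have "\<dots> = cscale (exp (zpair \<Phi> \<Psi>)) (T (\<lambda>y. \<Phi> y + \<Psi> y) J v)"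
    by (rule v[OF clin_cscale[OF clin_T], symmetric])
  finally show ?thesis .
qed

lemma Ap_fuse:
  assumes "qpair \<Phi> \<Psi> = of_int g" "integral \<Psi> v"
  shows "Sum_any (\<lambda>j. Ap \<Phi> (J - j + g) (Ap \<Psi> j v)) = cscale (exp (zpair \<Phi> \<Psi>)) (Ap (\<lambda>y. \<Phi> y + \<Psi> y) J v)"
proof -
  let ?e = "exp (zpair \<Phi> \<Psi>)" and ?S = "\<lambda>y. \<Phi> y + \<Psi> y"
  define S where "S = {s. Ep \<Phi> s v \<noteq> 0}"
  define S' where "S' = {s. Ep \<Psi> s v \<noteq> 0}"
  have S: "finite S" "finite S'" by (simp_all add: S_def S'_def Ep_finite)
  have zero: "Ep \<Phi> s (Ep \<Psi> s' (A v)) = 0"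
    if "s \<notin> S \<or> s' \<notin> S'" "clin A" "\<And>\<Phi> s v. A (Ep \<Phi> s v) = Ep \<Phi> s (A v)" for s s' A
  proof -
    have "A (Ep \<Phi> s (Ep \<Psi> s' v)) = A 0"
      using that(1) Ep_Ep[of \<Phi> s \<Psi> s' v] by (auto simp: S_def S'_def clin_zero)
    then show ?thesis using that by (simp add: clin_zero)
  qed
  have Ap2: "Ap \<Phi> i (Ap \<Psi> j v) = (\<Sum>s\<in>S. \<Sum>s'\<in>S'. Ep \<Phi> s (Ep \<Psi> s' (T \<Phi> (i + s) (T \<Psi> (j + s') v))))" for i j
  proof -
    have "Ap \<Phi> i (Ap \<Psi> j v) = Sum_any (\<lambda>s. Sum_any (\<lambda>s'. Ep \<Phi> s (Ep \<Psi> s' (T \<Phi> (i + s) (T \<Psi> (j + s') v)))))"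
      by (simp add: Ap_Ap_expand T_Ep)
    also have "\<dots> = (\<Sum>s\<in>S. Sum_any (\<lambda>s'. Ep \<Phi> s (Ep \<Psi> s' (T \<Phi> (i + s) (T \<Psi> (j + s') v)))))"
      by (rule Sum_any_supp[OF S(1)]) (simp add: zero[of _ _ "\<lambda>v. T \<Phi> (i + _) (T \<Psi> (j + _) v)"] clin_comp[OF clin_T clin_T] T_Ep)
    also have "\<dots> = (\<Sum>s\<in>S. \<Sum>s'\<in>S'. Ep \<Phi> s (Ep \<Psi> s' (T \<Phi> (i + s) (T \<Psi> (j + s') v))))"
      by (intro sum.cong refl Sum_any_supp S)
         (simp add: zero[of _ _ "\<lambda>v. T \<Phi> (i + _) (T \<Psi> (j + _) v)"] clin_comp[OF clin_T clin_T] T_Ep)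
    finally show ?thesis .
  qed
  have finT: "finite {j. T \<Phi> (J - j + g + s) (T \<Psi> (j + s') v) \<noteq> 0}" for s s'
    by (rule finite_supp_clin[OF finite_supp_shift(1)[OF T_finite]]) simp
  have "Sum_any (\<lambda>j. Ap \<Phi> (J - j + g) (Ap \<Psi> j v)) =
     (\<Sum>s\<in>S. \<Sum>s'\<in>S'. Sum_any (\<lambda>j. Ep \<Phi> s (Ep \<Psi> s' (T \<Phi> (J - j + g + s) (T \<Psi> (j + s') v)))))"
  proof -
    have fin: "finite {j. Ep \<Phi> s (Ep \<Psi> s' (T \<Phi> (J - j + g + s) (T \<Psi> (j + s') v))) \<noteq> 0}" for s s'
      by (rule finite_supp_clin[OF finite_supp_clin[OF finT]]) simp_all
    have fin2: "finite {j. (\<Sum>s'\<in>S'. Ep \<Phi> s (Ep \<Psi> s' (T \<Phi> (J - j + g + s) (T \<Psi> (j + s') v)))) \<noteq> 0}" for s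
      by (rule finite_subset[of _ "\<Union>s'\<in>S'. {j. Ep \<Phi> s (Ep \<Psi> s' (T \<Phi> (J - j + g + s) (T \<Psi> (j + s') v))) \<noteq> 0}"])
         (use fin S in \<open>auto intro: ccontr sum.neutral\<close>)
    show ?thesis unfolding Ap2
      by (subst Sum_any_sum[OF S(1) fin2]) (intro sum.cong refl Sum_any_sum[OF S(2) fin])
  qed
  also have "\<dots> = (\<Sum>s\<in>S. \<Sum>s'\<in>S'. Ep \<Phi> s (Ep \<Psi> s' (cscale ?e (T ?S (J + s + s') v))))"
  proof (intro sum.cong refl)
    fix s s'
    have "Sum_any (\<lambda>j. T \<Phi> (J - j + g + s) (T \<Psi> (j + s') v)) = Sum_any (\<lambda>j. T \<Phi> (J - (j - s') + g + s) (T \<Psi> (j - s' + s') v))"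
      by (rule Sum_any_shift(2)[symmetric])
    also have "\<dots> = Sum_any (\<lambda>j. T \<Phi> (J + s + s' - j + g) (T \<Psi> j v))"
      by (simp add: algebra_simps)
    also have "\<dots> = cscale ?e (T ?S (J + s + s') v)" by (rule T_fuse[OF assms])
    finally show "Sum_any (\<lambda>j. Ep \<Phi> s (Ep \<Psi> s' (T \<Phi> (J - j + g + s) (T \<Psi> (j + s') v)))) = Ep \<Phi> s (Ep \<Psi> s' (cscale ?e (T ?S (J + s + s') v)))"
      by (simp add: clin_Sum_any[OF clin_Ep finite_supp_clin[OF finT clin_Ep], symmetric] clin_Sum_any[OF clin_Ep finT, symmetric])
  qed
  also have "\<dots> = cscale ?e (\<Sum>s\<in>S. \<Sum>s'\<in>S'. T ?S (J + s + s') (Ep \<Psi> s' (Ep \<Phi> s v)))"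
    by (simp add: clin_scale fv.scale_sum_right T_Ep Ep_Ep[of \<Phi>])
  also have "(\<Sum>s\<in>S. \<Sum>s'\<in>S'. T ?S (J + s + s') (Ep \<Psi> s' (Ep \<Phi> s v))) = Sum_any (\<lambda>s. Sum_any (\<lambda>s'. T ?S (J + s + s') (Ep \<Psi> s' (Ep \<Phi> s v))))"
  proof -
    have z: "T ?S (J + s + s') (Ep \<Psi> s' (Ep \<Phi> s v)) = 0" if "s \<notin> S \<or> s' \<notin> S'" for s s'
      using zero[OF that, of "T ?S (J + s + s')"] by (simp add: T_Ep Ep_Ep[of \<Phi>])
    have "Sum_any (\<lambda>s. Sum_any (\<lambda>s'. T ?S (J + s + s') (Ep \<Psi> s' (Ep \<Phi> s v)))) = (\<Sum>s\<in>S. Sum_any (\<lambda>s'. T ?S (J + s + s') (Ep \<Psi> s' (Ep \<Phi> s v))))"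
      by (rule Sum_any_supp[OF S(1)]) (simp add: z)
    also have "\<dots> = (\<Sum>s\<in>S. \<Sum>s'\<in>S'. T ?S (J + s + s') (Ep \<Psi> s' (Ep \<Phi> s v)))"
      by (intro sum.cong refl Sum_any_supp S) (simp add: z)
    finally show ?thesis by simp
  qed
  also have "\<dots> = Sum_any (\<lambda>s. Sum_any (\<lambda>R. T ?S (J + R) (Ep \<Psi> (R - s) (Ep \<Phi> s v))))"
  proof (rule Sum_any.cong)
    fix s
    have "Sum_any (\<lambda>R. T ?S (J + R) (Ep \<Psi> (R - s) (Ep \<Phi> s v))) = Sum_any (\<lambda>s'. T ?S (J + (s' + s)) (Ep \<Psi> (s' + s - s) (Ep \<Phi> s v)))"
      by (rule Sum_any_shift(1)[symmetric])
    then show "Sum_any (\<lambda>s'. T ?S (J + s + s') (Ep \<Psi> s' (Ep \<Phi> s v))) = Sum_any (\<lambda>R. T ?S (J + R) (Ep \<Psi> (R - s) (Ep \<Phi> s v)))"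
      by (simp add: algebra_simps)
  qed
  also have "\<dots> = Sum_any (\<lambda>R. Sum_any (\<lambda>s. T ?S (J + R) (Ep \<Psi> (R - s) (Ep \<Phi> s v))))"
  proof (rule Sum_any_swap, rule finite_subset)
    show "{(s, R). T ?S (J + R) (Ep \<Psi> (R - s) (Ep \<Phi> s v)) \<noteq> 0} \<subseteq> (\<lambda>(s, s'). (s, s + s')) ` (S \<times> S')"
    proof clarify
      fix s R assume "T ?S (J + R) (Ep \<Psi> (R - s) (Ep \<Phi> s v)) \<noteq> 0"
      then have "Ep \<Phi> s (Ep \<Psi> (R - s) v) \<noteq> 0" by (auto simp: clin_zero Ep_Ep[of \<Phi>])
      then have "s \<in> S" "R - s \<in> S'" using zero[of s "R - s" "\<lambda>v. v"] clin_ident by auto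
      then show "(s, R) \<in> (\<lambda>(s, s'). (s, s + s')) ` (S \<times> S')" by (intro image_eqI[of _ _ "(s, R - s)"]) auto
    qed
  qed (use S in simp)
  also have "\<dots> = Ap ?S J v"
    unfolding Ap_def Ep_add
    by (intro Sum_any.cong clin_Sum_any[symmetric] clin_T finite_supp_clin[OF Ep_finite] clin_Ep)
  finally show ?thesis .
qed

text \<open>Summing over all coefficients of equal total degree sets the two variables equal. The
  g-th power and the scalar come from bringing the zero modes of \<Phi> past the Q part of
  \<Psi>.\<close>

lemma fuse:
  assumes "qpair \<Phi> \<Psi> = of_int g" "integral \<Psi> v"
  shows "Sum_any (\<lambda>k. Ins \<Psi> (V \<Phi> k) (M - k) v) = cscale (exp (zpair \<Phi> \<Psi>)) (V (\<lambda>y. \<Phi> y + \<Psi> y) (M - g) v)"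
proof -
  let ?e = "exp (zpair \<Phi> \<Psi>)" and ?S = "\<lambda>y. \<Phi> y + \<Psi> y"
  define w where "w i j = Ap \<Phi> i (Ap \<Psi> j v)" for i j
  define P where "P = {(j, i). w i j \<noteq> 0}"
  have P: "finite P"
  proof (rule finite_subset)
    show "P \<subseteq> (SIGMA j:{j. Ap \<Psi> j v \<noteq> 0}. {i. Ap \<Phi> i (Ap \<Psi> j v) \<noteq> 0})"
      by (auto simp: P_def w_def clin_zero)
  qed (auto simp: Ap_finite)
  have fin: "finite {(j, i). A j i (w i j) \<noteq> 0}" if "\<And>i j. clin (A j i)" for A
    by (rule finite_subset[OF _ P]) (auto simp: P_def that clin_zero)
  have pairs: "Sum_any (\<lambda>j. Sum_any (\<lambda>i. A j i (w i j))) = (\<Sum>(j, i)\<in>P. A j i (w i j))" if "\<And>i j. clin (A j i)" for A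
  proof -
    have "Sum_any (\<lambda>j. Sum_any (\<lambda>i. A j i (w i j))) = Sum_any (\<lambda>(j, i). A j i (w i j))"
      by (rule Sum_any_pair[symmetric], rule fin[OF that])
    also have "\<dots> = (\<Sum>(j, i)\<in>P. A j i (w i j))"
      by (rule Sum_any_supp[OF P]) (auto simp: P_def that clin_zero)
    finally show ?thesis .
  qed
  have I: "Ins \<Psi> (V \<Phi> k) (M - k) v = (\<Sum>(j, i)\<in>P. Em \<Psi> (M - k - j) (Em \<Phi> (k - i) (w i j)))" for k
  proof -
    have "Ins \<Psi> (V \<Phi> k) (M - k) v = Sum_any (\<lambda>j. Sum_any (\<lambda>i. Em \<Psi> (M - k - j) (Em \<Phi> (k - i) (w i j))))"
      unfolding Ins_def V_expand w_def
      by (intro Sum_any.cong clin_Sum_any clin_Em finite_supp_clin[OF Ap_finite])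
    also have "\<dots> = (\<Sum>(j, i)\<in>P. Em \<Psi> (M - k - j) (Em \<Phi> (k - i) (w i j)))"
      by (rule pairs[of "\<lambda>j i v. Em \<Psi> (M - k - j) (Em \<Phi> (k - i) v)", OF clin_comp[OF clin_Em clin_Em]])
    finally show ?thesis .
  qed
  have "Sum_any (\<lambda>k. Ins \<Psi> (V \<Phi> k) (M - k) v) = (\<Sum>x\<in>P. Sum_any (\<lambda>k. case x of (j, i) \<Rightarrow> Em \<Psi> (M - k - j) (Em \<Phi> (k - i) (w i j))))"
    unfolding I
  proof (rule Sum_any_sum[OF P])
    fix x assume "x \<in> P"
    obtain j i where x: "x = (j, i)" by (cases x)
    have "{k. Em \<Psi> (M - k - j) (Em \<Phi> (k - i) (w i j)) \<noteq> 0} \<subseteq> {i..M - j}"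
      by (force simp: clin_zero not_less[symmetric])
    then show "finite {k. (case x of (j, i) \<Rightarrow> Em \<Psi> (M - k - j) (Em \<Phi> (k - i) (w i j))) \<noteq> 0}"
      unfolding x by (simp add: finite_subset)
  qed
  also have "\<dots> = (\<Sum>(j, i)\<in>P. Em ?S (M - j - i) (w i j))"
  proof (rule sum.cong[OF refl], clarify)
    fix j i
    have "Sum_any (\<lambda>k. Em \<Psi> (M - k - j) (Em \<Phi> (k - i) (w i j))) = Sum_any (\<lambda>k. Em \<Psi> (M - (k + i) - j) (Em \<Phi> (k + i - i) (w i j)))"
      by (rule Sum_any_shift(1)[symmetric])
    then show "Sum_any (\<lambda>k. Em \<Psi> (M - k - j) (Em \<Phi> (k - i) (w i j))) = Em ?S (M - j - i) (w i j)"
      by (simp add: Em_add algebra_simps)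
  qed
  also have "\<dots> = Sum_any (\<lambda>j. Sum_any (\<lambda>i. Em ?S (M - j - i) (w i j)))"
    by (rule pairs[symmetric]) simp
  also have "\<dots> = Sum_any (\<lambda>j. Sum_any (\<lambda>J. Em ?S (M - g - J) (w (J - j + g) j)))"
  proof (rule Sum_any.cong)
    fix j
    have "Sum_any (\<lambda>i. Em ?S (M - j - i) (w i j)) = Sum_any (\<lambda>J. Em ?S (M - j - (J + (g - j))) (w (J + (g - j)) j))"
      by (rule Sum_any_shift(1)[symmetric])
    then show "Sum_any (\<lambda>i. Em ?S (M - j - i) (w i j)) = Sum_any (\<lambda>J. Em ?S (M - g - J) (w (J - j + g) j))"
      by (simp add: algebra_simps)
  qed
  also have "\<dots> = Sum_any (\<lambda>J. Sum_any (\<lambda>j. Em ?S (M - g - J) (w (J - j + g) j)))"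
  proof (rule Sum_any_swap, rule finite_subset)
    show "{(j, J). Em ?S (M - g - J) (w (J - j + g) j) \<noteq> 0} \<subseteq> (\<lambda>(j, i). (j, i + j - g)) ` P"
    proof clarify
      fix j J assume "Em ?S (M - g - J) (w (J - j + g) j) \<noteq> 0"
      then have "(j, J - j + g) \<in> P" by (auto simp: P_def clin_zero)
      then show "(j, J) \<in> (\<lambda>(j, i). (j, i + j - g)) ` P" by (rule rev_image_eqI) simp
    qed
  qed (use P in simp)
  also have "\<dots> = Sum_any (\<lambda>J. Em ?S (M - g - J) (Sum_any (\<lambda>j. w (J - j + g) j)))"
    unfolding w_def by (intro Sum_any.cong clin_Sum_any[symmetric] clin_Em finite_supp_clin[OF Ap_finite] clin_Ap)
  also have "\<dots> = cscale ?e (V ?S (M - g) v)"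
    unfolding w_def Ap_fuse[OF assms] V_expand by (simp add: clin_scale cscale_Sum_any)
  finally show ?thesis .
qed

text \<open>The weight q^(x k) evaluates \<Phi> at q^x w instead of w, as needed for the residue at
  a pole z = q^x w.\<close>

lemma fuse_dilated:
  assumes "qpair \<Phi> \<Psi> = of_int g" "integral \<Psi> v"
  shows "Sum_any (\<lambda>k. cscale (qpow h (x * of_int k)) (Ins \<Psi> (V \<Phi> k) (M - k) v)) =
    cscale (exp (zpair (bdilate h x \<Phi>) \<Psi>)) (V (\<lambda>y. bdilate h x \<Phi> y + \<Psi> y) (M - g) v)"
proof -
  have "qpair (bdilate h x \<Phi>) \<Psi> = of_int g" using assms(1) by (simp add: qpair_def)
  from fuse[OF this assms(2), of M] show ?thesis
    by (simp add: Ins_def V_bdilate clin_scale cscale_Sum_any)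
qed

subsection \<open>Products of two vertex operators\<close>

lemma VV_left:
  assumes "contr \<Phi> \<Psi> C"
  shows "V \<Phi> m (V \<Psi> n v) = Sum_any (\<lambda>k. cscale (fps_nth C k) (Ins \<Psi> (V \<Phi> (m + int k)) (n - int k) v))"
  using V_Ins[OF assms clin_ident(1), of m n v] by (simp add: V_Ins_id[symmetric])

lemma VV_right:
  assumes "contr \<Psi> \<Phi> C" "qpair \<Phi> \<Psi> = of_int g" "qpair \<Psi> \<Phi> = of_int g"
  shows "V \<Psi> n (V \<Phi> m v) = cscale (phase \<Psi> \<Phi>) (Sum_any (\<lambda>k. cscale (fps_nth C k) (Ins \<Psi> (V \<Phi> (m + g - int k)) (n - g + int k) v)))"
  using Ins_V[OF assms clin_ident(1), of n m v] by (simp add: V_Ins_id[symmetric] cscale_Sum_any)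

lemma Ins_left_finite: "finite {k::nat. Ins \<Psi> (V \<Phi> (m + int k)) (n - int k) v \<noteq> 0}"
  by (rule Ins_nat_finite) simp

lemma Ins_right_finite: "finite {k::nat. Ins \<Psi> (V \<Phi> (m - int k)) (n + int k) v \<noteq> 0}"
  using Ins_V_finite[OF clin_ident(1), of \<Psi> \<Phi> m "\<lambda>k. n + int k" v] by simp

end

section \<open>The fields of the currents\<close>

lemma qpow_add: "qpow h (x + y) = qpow h x * qpow h y"
  by (simp add: qpow_def algebra_simps exp_add)

lemma qpow_diff: "qpow h (x - y) = qpow h x / qpow h y"
  by (simp add: qpow_def algebra_simps exp_diff)

lemma qpow_minus: "qpow h (- x) = inverse (qpow h x)"
  by (simp add: qpow_def exp_minus)

lemma qpow_0 [simp]: "qpow h 0 = 1"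
  by (simp add: qpow_def)

lemma qpow_nz [simp]: "qpow h x \<noteq> 0"
  by (simp add: qpow_def)

lemma qpow_mult_nat: "qpow h (x * of_nat n) = qpow h x ^ n"
  by (simp add: qpow_def exp_of_nat_mult[symmetric] mult_ac)

lemma qnum_minus: "qnum h (- x) = - qnum h x"
  by (simp add: qnum_def minus_divide_left)

text \<open>This is (1 - a x)^g for the exponents -1, 0 and 1, the only ones that occur.\<close>

definition pw :: "int \<Rightarrow> complex \<Rightarrow> complex fps" where
  "pw g a = (if g = 1 then 1 - fps_const a * fps_X else if g = -1 then geo a else 1)"

lemma is_contr_pw:
  assumes "g \<in> {-1, 0, 1}"
  shows "is_contr (\<lambda>n. - of_int g * a ^ n / of_nat n) (pw g a)"
  using assms is_contr_lin[of a] is_contr_geo[of a] by (auto simp: pw_def is_contr_one)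

fun sgi :: "pm \<Rightarrow> int" where "sgi Plus = 1" | "sgi Minus = - 1"

lemma sg_sgi: "sg s = of_int (sgi s)"
  by (cases s) simp_all

lemma sgi_sq [simp]: "sgi s * sgi s = 1"
  by (cases s) simp_all

locale currents = free_bosons +
  assumes gen: "\<And>n::nat. n > 0 \<Longrightarrow> exp h ^ n \<noteq> 1" and N: "N \<ge> 1"
begin

lemma q_neq: "n > 0 \<Longrightarrow> qpow h (of_nat n) \<noteq> qpow h (- of_nat n)"
proof
  assume n: "n > 0" and eq: "qpow h (of_nat n) = qpow h (- of_nat n)"
  have "exp h ^ (2 * n) = qpow h (of_nat n) * qpow h (of_nat n)"
    by (simp add: qpow_def exp_of_nat2_mult mult_2 power_add)
  also have "\<dots> = 1" unfolding eq by (subst (2) eq[symmetric]) (simp add: qpow_minus)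
  finally show False using gen[of "2 * n"] n by simp
qed

definition qd :: complex where "qd = qpow h 1 - qpow h (- 1)"

lemma qd_nz [simp]: "qd \<noteq> 0"
  using q_neq[of 1] by (simp add: qd_def)

lemma qnum_nz: "n > 0 \<Longrightarrow> qnum h (of_nat n) \<noteq> 0"
  using q_neq[of n] qd_nz unfolding qd_def by (simp add: qnum_def)

lemma qnum_qd: "qnum h x * qd = qpow h x - qpow h (- x)"
  using qd_nz unfolding qd_def by (simp add: qnum_def)

lemma sum_bosons: "(\<Sum>b\<in>bosons N. f b) = (\<Sum>j = 1..2 * N. f (Ab j)) + (\<Sum>l = 1..N. f (Cb l))"
proof -
  have "(\<Sum>b\<in>bosons N. f b) = (\<Sum>b\<in>Ab ` {1..2 * N}. f b) + (\<Sum>b\<in>Cb ` {1..N}. f b)"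
    unfolding bosons_def by (rule sum.union_disjoint) auto
  then show ?thesis by (simp add: sum.reindex inj_on_def)
qed

text \<open>The commutator of A^j_n with A^i_(-n), stripped of the common factor [n]^2 / n.\<close>

definition aform :: "nat \<Rightarrow> nat \<Rightarrow> int \<Rightarrow> complex" where
  "aform j i n = (\<Sum>b\<in>bosons N. Acoef h N j n b * bsign b * Acoef h N i (- n) b)"

lemma Acoef_Cb [simp]: "Acoef h N j n (Cb l) = 0"
  by (simp add: Acoef_def)

lemma Acoef_low: "j \<noteq> 2 * N \<Longrightarrow> Acoef h N j n b = Acoef h N j 0 b"
  by (simp add: Acoef_def)

lemma Acoef_top: "Acoef h N (2 * N) (- n) b = Acoef h N (2 * N) n b"
  by (simp add: Acoef_def add.commute)

lemma Acoef_Ab: "k \<in> {1..2 * N} \<Longrightarrow> Acoef h N j n (Ab k) =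
   (if j = 2 * N then (qpow h (of_int n) + qpow h (- of_int n)) / 2 * (- 1) ^ (k + 1)
    else (- 1) ^ (j + 1) * (of_bool (k = j) + of_bool (k = j + 1)))"
  by (auto simp: Acoef_def sum.delta' of_bool_def if_distrib[of "\<lambda>x. _ * x"] cong: if_cong)

lemma sum_pick: "k \<in> {1..2 * N} \<Longrightarrow> (\<Sum>j = 1..2 * N. of_bool (j = k) * f j) = (f k :: complex)"
  by (simp add: of_bool_def if_distrib[of "\<lambda>x. x * _"] cong: if_cong)

lemma aform_expand: "aform i j n = (\<Sum>k = 1..2 * N. Acoef h N i n (Ab k) * (- 1) ^ (k + 1) * Acoef h N j (- n) (Ab k))"
  by (simp add: aform_def sum_bosons)

lemma aform_low:
  assumes "i \<in> {1..2 * N - 1}" "j \<in> {1..2 * N - 1}"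
  shows "aform i j n = of_int (cartan N i j)"
proof -
  have ij: "i \<noteq> 2 * N" "j \<noteq> 2 * N" "i \<in> {1..2 * N}" "i + 1 \<in> {1..2 * N}" using assms by auto
  have "aform i j n = (\<Sum>k = 1..2 * N. of_bool (k = i) * ((- 1) ^ (i + 1) * (- 1) ^ (k + 1) * (- 1) ^ (j + 1) * (of_bool (k = j) + of_bool (k = j + 1))))
     + (\<Sum>k = 1..2 * N. of_bool (k = i + 1) * ((- 1) ^ (i + 1) * (- 1) ^ (k + 1) * (- 1) ^ (j + 1) * (of_bool (k = j) + of_bool (k = j + 1))))"
    unfolding aform_expand sum.distrib[symmetric]
    by (rule sum.cong[OF refl]) (simp add: Acoef_Ab ij ring_distribs add_divide_distrib)
  also have "\<dots> = (- 1) ^ (i + 1) * (- 1) ^ (i + 1) * (- 1) ^ (j + 1) * (of_bool (i = j) + of_bool (i = j + 1)) +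
     (- 1) ^ (i + 1) * (- 1) ^ (i + 1 + 1) * (- 1) ^ (j + 1) * (of_bool (i + 1 = j) + of_bool (i + 1 = j + 1))"
    by (simp only: sum_pick[OF ij(3)] sum_pick[OF ij(4)])
  also have "\<dots> = of_int (cartan N i j)"
    using ij by (auto simp: cartan_def of_bool_def power_add[symmetric])
  finally show ?thesis .
qed

text \<open>The alternating signs in A^(2N) cancel the signs of the boson commutators, so the two
  bosons of A^i contribute equally, which gives the Cartan entries 2 and -2.\<close>

lemma aform_high:
  assumes "i \<in> {1..2 * N - 1}"
  shows "aform i (2 * N) n = (qpow h (of_int n) + qpow h (- of_int n)) / 2 * of_int (cartan N i (2 * N))"
    and "aform (2 * N) i n = (qpow h (of_int n) + qpow h (- of_int n)) / 2 * of_int (cartan N (2 * N) i)"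
proof -
  have ij: "i \<noteq> 2 * N" "i \<in> {1..2 * N}" "i + 1 \<in> {1..2 * N}" using assms by auto
  let ?Q = "(qpow h (of_int n) + qpow h (- of_int n)) / 2"
  have *: "aform i (2 * N) n = (\<Sum>k = 1..2 * N. of_bool (k = i) * ((- 1) ^ (i + 1) * (- 1) ^ (k + 1) * (?Q * (- 1) ^ (k + 1))))
     + (\<Sum>k = 1..2 * N. of_bool (k = i + 1) * ((- 1) ^ (i + 1) * (- 1) ^ (k + 1) * (?Q * (- 1) ^ (k + 1))))"
    unfolding aform_expand sum.distrib[symmetric]
    by (rule sum.cong[OF refl]) (simp add: Acoef_Ab ij ring_distribs add_divide_distrib)
  have e: "(- 1 :: complex) ^ (k + 1) * (?Q * (- 1) ^ (k + 1)) = ?Q" for k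
    by (simp add: power_add[symmetric])
  show 1: "aform i (2 * N) n = ?Q * of_int (cartan N i (2 * N))"
    unfolding * sum_pick[OF ij(2)] sum_pick[OF ij(3)] mult.assoc e
    using ij by (simp add: cartan_def)
  have "aform (2 * N) i n = aform i (2 * N) n"
    unfolding aform_expand Acoef_top Acoef_low[OF ij(1), of n] Acoef_low[OF ij(1), of "- n"]
    by (rule sum.cong[OF refl]) (simp add: mult_ac)
  moreover have "cartan N (2 * N) i = cartan N i (2 * N)" using ij by (simp add: cartan_def)
  ultimately show "aform (2 * N) i n = ?Q * of_int (cartan N (2 * N) i)" using 1 by simp
qed

lemma aform_top: "aform (2 * N) (2 * N) n = 0"
proof -
  have "(\<Sum>k = 1..2 * M. (- 1 :: complex) ^ (k + 1)) = 0" for M :: nat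
    by (induction M) simp_all
  moreover have "aform (2 * N) (2 * N) n = ((qpow h (of_int n) + qpow h (- of_int n)) / 2)\<^sup>2 * (\<Sum>k = 1..2 * N. (- 1) ^ (k + 1))"
    unfolding aform_expand sum_distrib_left Acoef_top
  proof (rule sum.cong[OF refl])
    fix k assume "k \<in> {1..2 * N}"
    then have "Acoef h N (2 * N) n (Ab k) = (qpow h (of_int n) + qpow h (- of_int n)) / 2 * (- 1) ^ (k + 1)"
      by (simp add: Acoef_Ab)
    moreover have "(- 1 :: complex) ^ (k + 1) * (- 1) ^ (k + 1) = 1" by (simp add: power_add[symmetric])
    moreover have "(x * e) * e * (x * e) = x\<^sup>2 * e" if "e * e = 1" for x e :: complex
      using that by (metis mult.assoc mult.commute mult.right_neutral power2_eq_square)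
    ultimately show "Acoef h N (2 * N) n (Ab k) * (- 1) ^ (k + 1) * Acoef h N (2 * N) n (Ab k) =
      ((qpow h (of_int n) + qpow h (- of_int n)) / 2)\<^sup>2 * (- 1) ^ (k + 1)" by metis
  qed
  ultimately show ?thesis by simp
qed

lemma cartan_vals: "i \<in> {1..2 * N - 1} \<Longrightarrow> j \<in> {1..2 * N - 1} \<Longrightarrow> cartan N i j \<in> {-1, 0, 1}"
  by (cases "even i") (auto simp: cartan_def)

text \<open>The form is [a n] / [n]. For the entries 2 and -2 this is q^n + q^(-n) up to sign, the
  origin of the factor (q^n + q^(-n)) / 2 in A^(2N); for 0, 1 and -1 it is independent of n.\<close>

lemma aform_qn:
  assumes "i \<in> {1..2 * N}" "j \<in> {1..2 * N}" "n > 0"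
  shows "aform i j (int n) * (qpow h (of_nat n) - qpow h (- of_nat n)) =
     qpow h (of_int (cartan N i j) * of_nat n) - qpow h (- of_int (cartan N i j) * of_nat n)"
proof -
  let ?q = "qpow h (of_nat n)"
  have q2: "qpow h (2 * of_nat n) = ?q * ?q" "qpow h (- (2 * of_nat n)) = inverse ?q * inverse ?q"
    by (simp_all add: qpow_add[symmetric] qpow_minus[symmetric])
  have high: "(?q + inverse ?q) / 2 * of_int c * (?q - inverse ?q) = qpow h (of_int c * of_nat n) - qpow h (- of_int c * of_nat n)"
    if "c \<in> {2, -2}" for c :: int
  proof -
    have "(x + y) / 2 * of_int c * (x - y) = of_int c / 2 * (x * x - y * y)" for x y :: complex
      by (simp add: field_simps)
    from this[of ?q "inverse ?q"] that q2 show ?thesis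
      by (elim insertE) (simp_all only: of_int_numeral of_int_minus, simp_all)
  qed
  consider "i = 2 * N" "j = 2 * N" | "i = 2 * N" "j \<in> {1..2 * N - 1}" | "i \<in> {1..2 * N - 1}" "j = 2 * N"
    | "i \<in> {1..2 * N - 1}" "j \<in> {1..2 * N - 1}" using assms by fastforce
  then show ?thesis
  proof cases
    case 1
    then show ?thesis by (simp add: aform_top cartan_def)
  next
    case 2
    then have "cartan N (2 * N) j \<in> {2, -2}" by (cases "even j") (auto simp: cartan_def)
    from high[OF this] show ?thesis unfolding 2 aform_high(2)[OF 2(2)] by (simp add: qpow_minus)
  next
    case 3
    then have "cartan N i (2 * N) \<in> {2, -2}" by (cases "even i") (auto simp: cartan_def)
    from high[OF this] show ?thesis unfolding 3 aform_high(1)[OF 3(1)] by (simp add: qpow_minus)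
  next
    case 4
    from cartan_vals[OF this] show ?thesis unfolding aform_low[OF 4] by auto
  qed
qed

lemma aform_0:
  assumes "i \<in> {1..2 * N}" "j \<in> {1..2 * N}"
  shows "aform i j 0 = of_int (cartan N i j)"
proof -
  consider "i = 2 * N" "j = 2 * N" | "i = 2 * N" "j \<in> {1..2 * N - 1}" | "i \<in> {1..2 * N - 1}" "j = 2 * N"
    | "i \<in> {1..2 * N - 1}" "j \<in> {1..2 * N - 1}" using assms by fastforce
  then show ?thesis
  proof cases
    case 1
    then show ?thesis by (simp add: aform_top cartan_def)
  next
    case 2
    then show ?thesis using aform_high(2)[OF 2(2), of 0] by simp
  next
    case 3
    then show ?thesis using aform_high(1)[OF 3(1), of 0] by simp
  next
    case 4
    then show ?thesis by (rule aform_low)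
  qed
qed

lemma QAcoef_eq: "QAcoef N j b = Acoef h N j 0 b"
  by (simp add: QAcoef_def Acoef_def)

subsection \<open>The fields of the odd currents\<close>

text \<open>\<open>ctype s i\<close> says that the factor \<open>Y\<close> of the current is plus or minus the exponential of \<open>c\<^sup>k(z)\<close>;
  otherwise it is the difference of two terms, indexed by \<open>\<epsilon> = 1\<close> and \<open>\<epsilon> = - 1\<close>.\<close>

definition ctype :: "pm \<Rightarrow> nat \<Rightarrow> bool" where "ctype s i \<longleftrightarrow> (odd i \<longleftrightarrow> s = Plus)"

definition ysgn :: "pm \<Rightarrow> nat \<Rightarrow> int" where "ysgn s i = (if ctype s i then 1 else - 1)"

definition yshift :: "pm \<Rightarrow> nat \<Rightarrow> int \<Rightarrow> int" where "yshift s i e = (if ctype s i then 0 else e)"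

definition half :: "nat \<Rightarrow> nat" where "half i = (i + 1) div 2"

text \<open>\<open>XF s i e\<close> is the exponent of the term \<open>e\<close> of the current.  The factor \<open>F\<close> is absorbed into its
  zero modes, so that it contributes only to \<open>zpair\<close>, and there the signs \<open>eta\<close>.\<close>

fun XF :: "pm \<Rightarrow> nat \<Rightarrow> int \<Rightarrow> bfield" where
  "XF s i e (QQ b) = sg s * Acoef h N i 0 b + of_int (ysgn s i) * of_bool (b = Cb (half i))"
| "XF s i e (LogZ b) = sg s * Acoef h N i 0 b + of_int (ysgn s i) * of_bool (b = Cb (half i))"
| "XF s i e (Zero b) = of_int (ysgn s i) * of_int (yshift s i e) * h * of_bool (b = Cb (half i))
     + sg s * (- 1) ^ (i + 1) * \<i> * of_real pi * of_bool (\<exists>j. odd j \<and> j < i \<and> b = Ab j)"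
| "XF s i e (Mode b n) = (if n = 0 then 0 else
     - sg s * Acoef h N i n b / qnum h (of_int n) * qpow h (- sg s / 2 * of_int \<bar>n\<bar>)
     - of_int (ysgn s i) * of_bool (b = Cb (half i)) / qnum h (of_int n) * qpow h (- of_int (yshift s i e) * of_int n))"

text \<open>The sign that the factor F of index i picks up from the Q of index i': exactly one of
  the two bosons in A^i' has odd index, and F contains the odd ones below i.\<close>

definition eta :: "nat \<Rightarrow> nat \<Rightarrow> complex" where
  "eta i i' = (if (if odd i' then i' else i' + 1) < i then - 1 else 1)"

lemma half_range: "i \<in> {1..2 * N - 1} \<Longrightarrow> half i \<in> {1..N}"
  by (auto simp: half_def)

text \<open>The exponent of the contraction of the two c fields, nonzero only if both currents use
  the same c^k.\<close>

definition ypair :: "pm \<Rightarrow> nat \<Rightarrow> pm \<Rightarrow> nat \<Rightarrow> int" where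
  "ypair s i s' i' = (if half i = half i' then ysgn s i * ysgn s' i' else 0)"

lemma ypair_vals: "ypair s i s' i' \<in> {-1, 0, 1}"
  by (auto simp: ypair_def ysgn_def)

lemma sum_Cb: "k \<in> {1..N} \<Longrightarrow> (\<Sum>l = 1..N. f l * of_bool (l = k)) = (f k :: complex)"
  by (simp add: of_bool_def if_distrib[of "\<lambda>x. _ * x"] cong: if_cong)

lemma qpair_XX:
  assumes "i \<in> {1..2 * N - 1}" "i' \<in> {1..2 * N - 1}"
  shows "qpair (XF s i e) (XF s' i' e') = of_int (sgi s * sgi s' * cartan N i i' + ypair s i s' i')"
proof -
  have "qpair (XF s i e) (XF s' i' e') = sg s * sg s' * aform i i' 0 +
     (\<Sum>l = 1..N. (of_int (ysgn s i) * of_int (ysgn s' i') * of_bool (l = half i')) * of_bool (l = half i))"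
    unfolding qpair_def aform_def sum_bosons by (simp add: sum_distrib_left algebra_simps)
  also have "\<dots> = of_int (sgi s * sgi s' * cartan N i i' + ypair s i s' i')"
    unfolding sum_Cb[OF half_range[OF assms(1)]]
    using assms by (simp add: aform_low sg_sgi ypair_def)
  finally show ?thesis .
qed

text \<open>The factors 1 / [n] of the two fields cancel [n]^2, leaving the logarithm of one linear
  factor for the a bosons and of one for the c bosons. Their positions come from the two values of
  \<kappa> and from the difference of the dilations.\<close>

lemma mpair_XX:
  assumes "i \<in> {1..2 * N - 1}" "i' \<in> {1..2 * N - 1}" "n > 0"
  shows "mpair h N (XF s i e) (XF s' i' e') n =
    - of_int (sgi s * sgi s' * cartan N i i') * qpow h (- (sg s + sg s') / 2) ^ n / of_nat n
    + - of_int (ypair s i s' i') * qpow h (of_int (yshift s' i' e' - yshift s i e)) ^ n / of_nat n"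
proof -
  let ?n = "qnum h (of_nat n)" and ?a = "- sg s / 2 * of_nat n" and ?a' = "- sg s' / 2 * of_nat n"
    and ?b = "- of_int (yshift s i e) * of_nat n" and ?b' = "of_int (yshift s' i' e') * of_nat n"
  have n: "?n \<noteq> 0" using qnum_nz assms by simp
  have "(\<Sum>b\<in>bosons N. XF s i e (Mode b (int n)) * XF s' i' e' (Mode b (- int n)) * bsign b) =
     - (sg s * sg s' * aform i i' (int n) * (qpow h ?a * qpow h ?a') +
     (\<Sum>l = 1..N. (of_int (ysgn s i) * of_int (ysgn s' i') * (qpow h ?b * qpow h ?b') * of_bool (l = half i')) * of_bool (l = half i))) / ?n\<^sup>2"
    unfolding aform_def sum_bosons using assms(3) n
    by (simp add: qnum_minus sum_distrib_left sum_distrib_right sum_divide_distrib sum_negf[symmetric] power2_eq_square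
        add_divide_distrib mult_ac)
  also have "\<dots> = - (of_int (sgi s * sgi s' * cartan N i i') * (qpow h ?a * qpow h ?a') + of_int (ypair s i s' i') * (qpow h ?b * qpow h ?b')) / ?n\<^sup>2"
    unfolding sum_Cb[OF half_range[OF assms(1)]]
    using assms by (simp add: aform_low sg_sgi ypair_def)
  also have "qpow h ?a * qpow h ?a' = qpow h (- (sg s + sg s') / 2) ^ n"
    by (simp add: qpow_mult_nat[symmetric] qpow_add[symmetric] algebra_simps add_divide_distrib diff_divide_distrib)
  also have "qpow h ?b * qpow h ?b' = qpow h (of_int (yshift s' i' e' - yshift s i e)) ^ n"
    by (simp add: qpow_mult_nat[symmetric] qpow_add[symmetric] algebra_simps)
  finally have sum: "(\<Sum>b\<in>bosons N. XF s i e (Mode b (int n)) * XF s' i' e' (Mode b (- int n)) * bsign b) =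
     - (of_int (sgi s * sgi s' * cartan N i i') * qpow h (- (sg s + sg s') / 2) ^ n
        + of_int (ypair s i s' i') * qpow h (of_int (yshift s' i' e' - yshift s i e)) ^ n) / ?n\<^sup>2" .
  show ?thesis
    unfolding mpair_def sum using n assms(3) by (simp add: divide_simps algebra_simps)
qed

lemma contr_XX:
  assumes "i \<in> {1..2 * N - 1}" "i' \<in> {1..2 * N - 1}"
  shows "contr (XF s i e) (XF s' i' e')
    (pw (sgi s * sgi s' * cartan N i i') (qpow h (- (sg s + sg s') / 2)) *
     pw (ypair s i s' i') (qpow h (of_int (yshift s' i' e' - yshift s i e))))"
proof -
  have "sgi s * sgi s' * cartan N i i' \<in> {-1, 0, 1}"
    using cartan_vals[OF assms] by (cases s; cases s') auto
  from is_contr_mult[OF is_contr_pw[OF this] is_contr_pw[OF ypair_vals]] show ?thesis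
    by (rule is_contr_cong) (simp add: mpair_XX[OF assms])
qed

lemma exp_zpair_XX:
  assumes "i \<in> {1..2 * N - 1}" "i' \<in> {1..2 * N - 1}"
  shows "exp (zpair (XF s i e) (XF s' i' e')) = eta i i' * qpow h (of_int (ypair s i s' i' * yshift s i e))"
proof -
  let ?f = "\<lambda>k. if odd k \<and> k < i then (1::complex) else 0"
  have ii: "i' \<noteq> 2 * N" "i' \<in> {1..2 * N}" "i' + 1 \<in> {1..2 * N}" using assms by auto
  have f: "of_bool (odd k \<and> k < i) = ?f k" for k by simp
  have "zpair (XF s i e) (XF s' i' e') = sg s * sg s' * (- 1) ^ (i + 1) * \<i> * of_real pi *
       (\<Sum>k = 1..2 * N. ?f k * (- 1) ^ (k + 1) * Acoef h N i' 0 (Ab k)) +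
     (\<Sum>l = 1..N. (of_int (ysgn s i) * of_int (yshift s i e) * h * of_int (ysgn s' i') * of_bool (l = half i')) * of_bool (l = half i))"
    unfolding zpair_def sum_bosons by (simp add: f sum_distrib_left mult_ac cong: sum.cong)
  also have "(\<Sum>k = 1..2 * N. ?f k * (- 1) ^ (k + 1) * Acoef h N i' 0 (Ab k)) =
     (\<Sum>k = 1..2 * N. of_bool (k = i') * (?f k * (- 1) ^ (k + 1) * (- 1) ^ (i' + 1))) +
     (\<Sum>k = 1..2 * N. of_bool (k = i' + 1) * (?f k * (- 1) ^ (k + 1) * (- 1) ^ (i' + 1)))"
    unfolding sum.distrib[symmetric] using ii
    by (intro sum.cong refl) (simp add: Acoef_Ab algebra_simps)
  also have "\<dots> = (?f i' + ?f (i' + 1)) * (- 1) ^ (i' + 1)"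
    unfolding sum_pick[OF ii(2)] sum_pick[OF ii(3)] by (auto simp: algebra_simps)
  also have "?f i' + ?f (i' + 1) = (if (if odd i' then i' else i' + 1) < i then 1 else 0)" by auto
  finally have z: "zpair (XF s i e) (XF s' i' e') =
     (sg s * sg s' * (- 1) ^ (i + 1) * (- 1) ^ (i' + 1)) * (if (if odd i' then i' else i' + 1) < i then 1 else 0) * (\<i> * of_real pi) +
     h * of_int (ypair s i s' i' * yshift s i e)"
    unfolding sum_Cb[OF half_range[OF assms(1)]] by (simp add: ypair_def mult_ac)
  \<comment> \<open>S is a sign, and exp (i pi) and exp (- i pi) are both -1, so only the comparison
    of indices is left.\<close>
  define S where "S = sg s * sg s' * (- 1) ^ (i + 1) * (- 1) ^ (i' + 1)"
  have "S \<in> {1, - 1}"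
    unfolding S_def by (cases s; cases s'; cases "even i"; cases "even i'") auto
  moreover have "exp (\<i> * of_real pi) = (- 1 :: complex)" "exp (- (\<i> * of_real pi)) = (- 1 :: complex)"
    by (simp_all add: exp_minus)
  ultimately show ?thesis
    unfolding z S_def[symmetric] exp_add eta_def qpow_def by auto
qed

lemma phase_XX:
  assumes "i \<in> {1..2 * N - 1}" "i' \<in> {1..2 * N - 1}"
  shows "phase (XF s' i' e') (XF s i e) =
    eta i i' * eta i' i * qpow h (of_int (ypair s i s' i' * (yshift s' i' e' - yshift s i e)))"
proof -
  have "phase (XF s' i' e') (XF s i e) = eta i' i * qpow h (of_int (ypair s' i' s i * yshift s' i' e')) /
     (eta i i' * qpow h (of_int (ypair s i s' i' * yshift s i e)))"
    unfolding phase_def exp_diff by (simp only: exp_zpair_XX assms)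
  moreover have "ypair s' i' s i = ypair s i s' i'" by (simp add: ypair_def mult.commute)
  moreover have "1 / eta i i' = eta i i'" by (simp add: eta_def)
  ultimately show ?thesis
    by (simp add: qpow_diff algebra_simps) (simp add: eta_def)
qed

end

subsection \<open>The Fock space is invariant\<close>

lemma fock_zero [simp]: "0 \<in> fock N"
  by (simp add: fock_def)

lemma fock_add: "u \<in> fock N \<Longrightarrow> v \<in> fock N \<Longrightarrow> u + v \<in> fock N"
  using keys_add[of u v] by (auto simp: fock_def)

lemma fock_scale: "v \<in> fock N \<Longrightarrow> cscale x v \<in> fock N"
  by (auto simp: fock_def in_keys_iff)

lemma fock_sum: "(\<And>i. i \<in> I \<Longrightarrow> f i \<in> fock N) \<Longrightarrow> sum f I \<in> fock N"
  by (induction I rule: infinite_finite_induct) (auto simp: fock_add)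

lemma fock_Sum_any: "(\<And>i. f i \<in> fock N) \<Longrightarrow> Sum_any f \<in> fock N"
  by (simp add: Sum_any.expand_set fock_sum)

lemma fock_single: "k \<in> states N \<Longrightarrow> Poly_Mapping.single k x \<in> fock N"
  by (simp add: fock_def)

lemma fock_clin:
  assumes "clin A" "v \<in> fock N"
    and "\<And>p M. (p, M) \<in> states N \<Longrightarrow> A (Poly_Mapping.single (p, M) 1) \<in> fock N"
  shows "A v \<in> fock N"
proof -
  have "A v = A (\<Sum>k\<in>Poly_Mapping.keys v. cscale (Poly_Mapping.lookup v k) (Poly_Mapping.single k 1))"
    using fvec_decomp[of v] by simp
  also have "\<dots> = (\<Sum>k\<in>Poly_Mapping.keys v. cscale (Poly_Mapping.lookup v k) (A (Poly_Mapping.single k 1)))"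
    by (simp add: clin_sum clin_scale assms)
  also have "\<dots> \<in> fock N"
  proof (intro fock_sum fock_scale)
    fix k assume "k \<in> Poly_Mapping.keys v"
    then have "k \<in> states N" using assms(2) by (auto simp: fock_def)
    then show "A (Poly_Mapping.single k 1) \<in> fock N"
      by (cases k) (auto intro!: assms(3))
  qed
  finally show ?thesis .
qed

lemma fock_bmode:
  assumes "b \<in> bosons N" "n \<noteq> 0" "v \<in> fock N"
  shows "bmode h b n v \<in> fock N"
proof (rule fock_clin[OF clin_bmode assms(3)])
  fix p M assume pM: "(p, M) \<in> states N"
  show "bmode h b n (Poly_Mapping.single (p, M) 1) \<in> fock N"
  proof (cases "n > 0")
    case True
    then obtain k where k: "n = int k" "k > 0" by (metis zero_less_imp_eq_int)
    have "set_mset (M - {#(b, k)#}) \<subseteq> set_mset M" by (rule set_mset_mono) simp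
    then have "(p, M - {#(b, k)#}) \<in> states N" using pM by (auto simp: states_def)
    then show ?thesis using k by (auto simp: bmode_pos_single intro!: fock_scale fock_single)
  next
    case False
    then obtain k where k: "n = - int k" "k > 0" using assms(2)
      by (metis neg_0_less_iff_less not_less_iff_gr_or_eq zero_less_imp_eq_int minus_minus)
    have "(p, add_mset (b, k) M) \<in> states N" using pM assms(1) k by (auto simp: states_def)
    then show ?thesis using k by (auto simp: bmode_neg_single intro!: fock_single)
  qed
qed

lemma fock_modes: "n \<noteq> 0 \<Longrightarrow> v \<in> fock N \<Longrightarrow> modes h N \<Phi> n v \<in> fock N"
  unfolding modes_def by (intro fock_sum fock_scale fock_bmode)

lemma fock_opser_power:
  assumes "\<And>n v. n > 0 \<Longrightarrow> v \<in> fock N \<Longrightarrow> B n v \<in> fock N" "v \<in> fock N"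
  shows "opser_power B k m v \<in> fock N"
  by (induction k arbitrary: m) (auto intro!: fock_sum assms)

lemma fock_oexp:
  assumes "\<And>n v. n > 0 \<Longrightarrow> v \<in> fock N \<Longrightarrow> B n v \<in> fock N" "v \<in> fock N"
  shows "oexp B r v \<in> fock N"
  by (auto simp: oexp_def opser_exp_def intro!: fock_sum fock_scale fock_opser_power assms)

context free_bosons
begin

text \<open>The exponential of Q has to shift each zero mode eigenvalue by an integer; this
  preserves the condition on sums of neighbouring eigenvalues.\<close>

definition fock_field :: "bfield \<Rightarrow> bool" where
  "fock_field \<Phi> \<longleftrightarrow> (\<forall>b. b \<notin> bosons N \<longrightarrow> \<Phi> (QQ b) = 0) \<and>
    (\<forall>i. bsign (Ab i) * \<Phi> (QQ (Ab i)) \<in> \<int>) \<and> (\<forall>l. \<Phi> (QQ (Cb l)) \<in> \<int>)"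

lemma fock_T:
  assumes "fock_field \<Phi>" "v \<in> fock N"
  shows "T \<Phi> j v \<in> fock N"
proof (rule fock_clin[OF clin_T assms(2)])
  fix p M assume pM: "(p, M) \<in> states N"
  have "(\<lambda>b. p b + bsign b * \<Phi> (QQ b), M) \<in> states N"
    unfolding states_def mem_Collect_eq prod.case
  proof (intro conjI ballI allI impI)
    fix i assume i: "i \<in> {1..2 * N - 1}"
    have "(p (Ab i) + p (Ab (i + 1))) + bsign (Ab i) * \<Phi> (QQ (Ab i)) + bsign (Ab (i + 1)) * \<Phi> (QQ (Ab (i + 1))) \<in> \<int>"
      using pM i assms(1) by (intro Ints_add[OF Ints_add]) (auto simp: states_def fock_field_def simp del: bsign.simps)
    then show "p (Ab i) + bsign (Ab i) * \<Phi> (QQ (Ab i)) + (p (Ab (i + 1)) + bsign (Ab (i + 1)) * \<Phi> (QQ (Ab (i + 1)))) \<in> \<int>"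
      by (simp only: add_ac)
  qed (use pM assms(1) in \<open>auto simp: states_def fock_field_def intro!: Ints_add simp del: bsign.simps(1)\<close>)
  then show "T \<Phi> j (Poly_Mapping.single (p, M) 1) \<in> fock N"
    unfolding T_single by (intro fock_scale fock_single)
qed

lemma fock_V:
  assumes "fock_field \<Phi>" "v \<in> fock N"
  shows "V \<Phi> m v \<in> fock N"
  unfolding V_expand Ap_def Em_def Ep_def
  by (intro fock_Sum_any fock_oexp fock_T fock_modes assms) auto

lemma fock_endo:
  assumes "clin A" "\<And>v. v \<in> fock N \<Longrightarrow> A v \<in> fock N"
  shows "endo_on (fock N) A"
  using assms by (simp add: endo_on_def clin_add clin_scale)

subsection \<open>Scalar exponentials of zero modes\<close>

fun zf :: "(boson \<Rightarrow> complex) \<Rightarrow> bfield" where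
  "zf x (Zero b) = x b"
| "zf x (QQ b) = 0"
| "zf x (LogZ b) = 0"
| "zf x (Mode b n) = 0"

lemma exp_zero_T: "exp_zero N x v = T (zf x) 0 v"
proof (rule clin_eqI[OF _ clin_T])
  show "clin (exp_zero N x)" by (simp add: exp_zero_def clin_lin)
  fix p M show "exp_zero N x (Poly_Mapping.single (p, M) 1) = T (zf x) 0 (Poly_Mapping.single (p, M) 1)"
    unfolding T_single exp_zero_def lin_single by (simp add: single_cscale[symmetric])
qed

lemma T_zf: "T \<Phi> j (T (zf x) 0 v) = T (\<lambda>y. \<Phi> y + zf x y) j v"
proof (rule clin_eqI[OF clin_comp[OF clin_T clin_T] clin_T])
  fix p M show "T \<Phi> j (T (zf x) 0 (Poly_Mapping.single (p, M) 1)) = T (\<lambda>y. \<Phi> y + zf x y) j (Poly_Mapping.single (p, M) 1)"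
    by (simp add: T_single clin_scale algebra_simps sum.distrib exp_add)
qed

text \<open>A zero mode exponential on the right commutes with the annihilation part and carries no
  Q, so it merges with the zero modes without producing a scalar. This absorbs the factors
  F.\<close>

lemma V_zf: "V \<Phi> m (exp_zero N x v) = V (\<lambda>y. \<Phi> y + zf x y) m v"
proof -
  have "modes h N (\<lambda>y. \<Phi> y + zf x y) = modes h N \<Phi>" by (intro ext) (simp add: modes_def)
  then have "Em (\<lambda>y. \<Phi> y + zf x y) = Em \<Phi>" "Ep (\<lambda>y. \<Phi> y + zf x y) = Ep \<Phi>"
    by (simp_all add: Em_def Ep_def)
  then show ?thesis
    by (simp add: V_expand Ap_def exp_zero_T T_Ep[symmetric] T_zf)
qed

lemma exp_zero_exp_zero: "exp_zero N x (exp_zero N y v) = exp_zero N (\<lambda>b. x b + y b) v"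
proof -
  have "(\<lambda>b. zf x b + zf y b) = zf (\<lambda>b. x b + y b)"
  proof
    fix s show "zf x s + zf y s = zf (\<lambda>b. x b + y b) s" by (cases s) auto
  qed
  then show ?thesis by (simp add: exp_zero_T T_zf)
qed

lemma exp_zero_0: "exp_zero N (\<lambda>b. 0) v = v"
  by (rule clin_eqI[of _ "\<lambda>v. v"]) (simp_all add: exp_zero_def clin_lin clin_ident)

lemma foldr_exp_zero:
  "foldr (\<lambda>l A. exp_zero N (f l) \<circ> A) ls id v = exp_zero N (\<lambda>b. \<Sum>l\<leftarrow>ls. f l b) v"
  by (induction ls) (simp_all add: exp_zero_exp_zero exp_zero_0)

end

lemma of_bool_disj_excl: "P \<longleftrightarrow> Q \<or> R \<Longrightarrow> \<not> (Q \<and> R) \<Longrightarrow> of_bool P = of_bool Q + (of_bool R :: complex)"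
  by auto

lemma sum_list_of_bool:
  "(\<Sum>l\<leftarrow>[1..<k]. c * of_bool (b = Ab (2 * l - 1))) = (c::complex) * of_bool (\<exists>j. odd j \<and> j < 2 * k - 1 \<and> b = Ab j)"
proof (induction k)
  case (Suc k)
  show ?case
  proof (cases "k = 0")
    case False
    have "(\<exists>j. odd j \<and> j < 2 * Suc k - 1 \<and> b = Ab j) \<longleftrightarrow> (\<exists>j. odd j \<and> j < 2 * k - 1 \<and> b = Ab j) \<or> b = Ab (2 * k - 1)"
    proof (intro iffI)
      assume "\<exists>j. odd j \<and> j < 2 * Suc k - 1 \<and> b = Ab j"
      then obtain j where j: "odd j" "j < 2 * Suc k - 1" "b = Ab j" by blast
      then have "j < 2 * k - 1 \<or> j = 2 * k - 1" by presburger
      then show "(\<exists>j. odd j \<and> j < 2 * k - 1 \<and> b = Ab j) \<or> b = Ab (2 * k - 1)" using j by blast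
    next
      assume "(\<exists>j. odd j \<and> j < 2 * k - 1 \<and> b = Ab j) \<or> b = Ab (2 * k - 1)"
      then show "\<exists>j. odd j \<and> j < 2 * Suc k - 1 \<and> b = Ab j"
      proof
        assume "b = Ab (2 * k - 1)"
        then show ?thesis using False by (intro exI[of _ "2 * k - 1"]) auto
      qed fastforce
    qed
    moreover have "\<not> ((\<exists>j. odd j \<and> j < 2 * k - 1 \<and> b = Ab j) \<and> b = Ab (2 * k - 1))" by auto
    ultimately have "of_bool (\<exists>j. odd j \<and> j < 2 * Suc k - 1 \<and> b = Ab j) =
       of_bool (\<exists>j. odd j \<and> j < 2 * k - 1 \<and> b = Ab j) + (of_bool (b = Ab (2 * k - 1)) :: complex)"
      by (rule of_bool_disj_excl)
    then show ?thesis using False Suc by (simp add: distrib_left)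
  qed auto
qed simp

text \<open>In both parities the product runs over exactly the odd indices 2 l - 1 < i; the parity
  survives only in the sign.\<close>

lemma Fcocycle_exp_zero:
  "Fcocycle N s i v = exp_zero N (\<lambda>b. sg s * (- 1) ^ (i + 1) * \<i> * of_real pi * of_bool (\<exists>j. odd j \<and> j < i \<and> b = Ab j)) v"
proof (cases "odd i")
  case True
  define k where "k = (i + 1) div 2"
  have k: "2 * k - 1 = i" using True unfolding k_def by presburger
  have "Fcocycle N s i v = foldr (\<lambda>l A. exp_zero N (\<lambda>b. sg s * \<i> * of_real pi * of_bool (b = Ab (2 * l - 1))) \<circ> A) [1..<k] id v"
    unfolding Fcocycle_def Let_def k_def[symmetric] using True by (simp only: if_True not_False_eq_True)
  then show ?thesis using True
    by (simp only: free_bosons.foldr_exp_zero sum_list_of_bool k) simp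
next
  case False
  define k where "k = (i + 1) div 2"
  have "(\<exists>j. odd j \<and> j < 2 * (k + 1) - 1 \<and> b = Ab j) \<longleftrightarrow> (\<exists>j. odd j \<and> j < i \<and> b = Ab j)" for b
  proof -
    have "j < 2 * (k + 1) - 1 \<longleftrightarrow> j < i" if "odd j" for j using that False unfolding k_def by presburger
    then show ?thesis by blast
  qed
  note k = this
  have "Fcocycle N s i v = foldr (\<lambda>l A. exp_zero N (\<lambda>b. - sg s * \<i> * of_real pi * of_bool (b = Ab (2 * l - 1))) \<circ> A) [1..<k + 1] id v"
    unfolding Fcocycle_def Let_def k_def[symmetric] using False by (simp only: if_False not_True_eq_False not_not)
  then show ?thesis using False
    by (simp only: free_bosons.foldr_exp_zero sum_list_of_bool k) simp
qed

context currents
begin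

subsection \<open>The currents as sums of vertex operators\<close>

text \<open>\<open>terms\<close>, \<open>xcoef\<close> and \<open>xexp\<close> encode the factor Y:
  a signed exponential, or a difference divided by q - 1/q, where the prefactor 1 / z makes
  \<open>xexp\<close> equal to 1.\<close>

definition terms :: "pm \<Rightarrow> nat \<Rightarrow> int set" where "terms s i = (if ctype s i then {0} else {1, - 1})"

definition xcoef :: "pm \<Rightarrow> nat \<Rightarrow> int \<Rightarrow> complex" where
  "xcoef s i e = (if ctype s i then sg s else of_int e / qd)"

definition xexp :: "pm \<Rightarrow> nat \<Rightarrow> int" where "xexp s i = (if ctype s i then 0 else 1)"

lemma finite_terms [simp]: "finite (terms s i)"
  by (simp add: terms_def)

lemma XF_eq_c:
  assumes "ctype s i" "i \<noteq> 2 * N"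
  shows "(\<lambda>y. sg s * Hfield h N i (- sg s / 2) y + cfield h (half i) y +
     zf (\<lambda>b. sg s * (- 1) ^ (i + 1) * \<i> * of_real pi * of_bool (\<exists>j. odd j \<and> j < i \<and> b = Ab j)) y) = XF s i e"
proof
  fix y show "sg s * Hfield h N i (- sg s / 2) y + cfield h (half i) y +
     zf (\<lambda>b. sg s * (- 1) ^ (i + 1) * \<i> * of_real pi * of_bool (\<exists>j. odd j \<and> j < i \<and> b = Ab j)) y = XF s i e y"
    using assms by (cases y) (simp_all add: QAcoef_eq ysgn_def yshift_def)
qed

lemma XF_eq_d:
  assumes "\<not> ctype s i" "i \<noteq> 2 * N"
  shows "(\<lambda>y. sg s * Hfield h N i (- sg s / 2) y + - bdilate h (of_int e) (cfield h (half i)) y +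
     zf (\<lambda>b. sg s * (- 1) ^ (i + 1) * \<i> * of_real pi * of_bool (\<exists>j. odd j \<and> j < i \<and> b = Ab j)) y) = XF s i e"
proof
  fix y show "sg s * Hfield h N i (- sg s / 2) y + - bdilate h (of_int e) (cfield h (half i)) y +
     zf (\<lambda>b. sg s * (- 1) ^ (i + 1) * \<i> * of_real pi * of_bool (\<exists>j. odd j \<and> j < i \<and> b = Ab j)) y = XF s i e y"
    using assms by (cases y) (simp_all add: QAcoef_eq ysgn_def yshift_def)
qed

lemma X_cur_expand:
  assumes "i \<in> {1..2 * N - 1}"
  shows "X_cur h N s i m v = (\<Sum>e\<in>terms s i. cscale (xcoef s i e) (V (XF s i e) (m + xexp s i) v))"
proof -
  have i: "i \<noteq> 2 * N" using assms by auto
  have k: "(i + 1) div 2 = half i" by (simp add: half_def)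
  have "(1::int) \<noteq> - 1" by simp
  consider "ctype s i" "s = Plus" "odd i" | "ctype s i" "s = Minus" "even i"
    | "\<not> ctype s i" "s = Minus" "odd i" | "\<not> ctype s i" "s = Plus" "even i"
    by (cases s; cases "odd i") (auto simp: ctype_def)
  then show ?thesis
  proof cases
    case 1
    then have "Ycur h s i = Yc h (half i)" by (simp add: Ycur_def Let_def k[symmetric])
    then have "X_cur h N s i m v = V (XF s i 0) m v"
      using XF_eq_c[OF 1(1) i, of 0]
      by (simp add: X_cur_def normal_expsum_def Yc_def Fcocycle_exp_zero V_zf)
    then show ?thesis using 1 by (simp add: terms_def xcoef_def xexp_def)
  next
    case 2
    then have "Ycur h s i = map (\<lambda>(x, e, \<Phi>). (- x, e, \<Phi>)) (Yc h (half i))" by (simp add: Ycur_def Let_def k[symmetric])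
    then have "X_cur h N s i m v = - V (XF s i 0) m v"
      using XF_eq_c[OF 2(1) i, of 0]
      by (simp add: X_cur_def normal_expsum_def Yc_def Fcocycle_exp_zero V_zf)
    then show ?thesis using 2 by (simp add: terms_def xcoef_def xexp_def)
  next
    case 3
    then have "Ycur h s i = Yd h (half i)" by (simp add: Ycur_def Let_def k[symmetric])
    then have "X_cur h N s i m v = cscale (1 / qd) (V (XF s i 1) (m + 1) v) - cscale (1 / qd) (V (XF s i (- 1)) (m + 1) v)"
      using XF_eq_d[OF 3(1) i, of 1] XF_eq_d[OF 3(1) i, of "- 1"]
      by (simp add: X_cur_def normal_expsum_def Yd_def Fcocycle_exp_zero V_zf qd_def)
    then show ?thesis using 3 by (simp add: terms_def xcoef_def xexp_def)
  next
    case 4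
    then have "Ycur h s i = Yd h (half i)" by (simp add: Ycur_def Let_def k[symmetric])
    then have "X_cur h N s i m v = cscale (1 / qd) (V (XF s i 1) (m + 1) v) - cscale (1 / qd) (V (XF s i (- 1)) (m + 1) v)"
      using XF_eq_d[OF 4(1) i, of 1] XF_eq_d[OF 4(1) i, of "- 1"]
      by (simp add: X_cur_def normal_expsum_def Yd_def Fcocycle_exp_zero V_zf qd_def)
    then show ?thesis using 4 by (simp add: terms_def xcoef_def xexp_def)
  qed
qed

lemma fock_field_XF:
  assumes "i \<in> {1..2 * N - 1}"
  shows "fock_field (XF s i e)"
proof -
  have i: "i \<noteq> 2 * N" using assms by auto
  have s: "sg s \<in> \<int>" by (cases s) auto
  have "half i \<in> {1..N}" by (rule half_range[OF assms])
  then show ?thesis using i s assms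
    by (auto simp: fock_field_def Acoef_def bosons_def image_iff intro!: Ints_mult Ints_add Ints_power)
qed

lemma clin_X_cur: "i \<in> {1..2 * N - 1} \<Longrightarrow> clin (X_cur h N s i m)"
  using clin_sumI[of "terms s i" "\<lambda>e v. cscale (xcoef s i e) (V (XF s i e) (m + xexp s i) v)", OF clin_cscale[OF clin_V]]
  by (simp add: clin_def X_cur_expand)

lemma X_cur_endo: "i \<in> {1..2 * N - 1} \<Longrightarrow> endo_on (fock N) (X_cur h N s i m)"
  by (rule fock_endo[OF clin_X_cur]) (auto simp: X_cur_expand intro!: fock_sum fock_scale fock_V fock_field_XF)

lemma Hpm_QQ [simp]: "Hpm h N s j (QQ b) = 0" and Hpm_LogZ [simp]: "Hpm h N s j (LogZ b) = 0"
  and Hpm_Zero [simp]: "Hpm h N s j (Zero b) = sg s * h * Acoef h N j 0 b"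
  by (simp_all add: Hpm_def)

text \<open>On modes of one sign the dilations cancel the factors q^(\<kappa> |n|), so the two
  copies of H^j agree and drop out; on the other sign they leave [n] (q - 1/q).\<close>

lemma Hpm_pos: "n > 0 \<Longrightarrow> Hpm h N s j (Mode b (int n)) = (if s = Plus then qd * Acoef h N j (int n) b else 0)"
proof -
  assume n: "n > 0"
  have "qpow h (- (sg s / 2) * of_nat n) * qpow h (- 1 / 2 * of_nat n) = qpow h (if s = Plus then - of_nat n else 0)"
    "qpow h (sg s / 2 * of_nat n) * qpow h (1 / 2 * of_nat n) = qpow h (if s = Plus then of_nat n else 0)"
    unfolding qpow_add[symmetric] by (cases s; simp add: field_simps)+
  then have "Hpm h N s j (Mode b (int n)) = Acoef h N j (int n) b / qnum h (of_nat n) *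
     (qpow h (if s = Plus then of_nat n else 0) - qpow h (if s = Plus then - of_nat n else 0))"
    using n by (simp add: Hpm_def algebra_simps)
  then show ?thesis using qnum_nz[OF n]
    by (cases s) (simp_all add: qnum_qd[symmetric])
qed

lemma Hpm_neg: "n > 0 \<Longrightarrow> Hpm h N s j (Mode b (- int n)) = (if s = Minus then - qd * Acoef h N j (- int n) b else 0)"
proof -
  assume n: "n > 0"
  have "qpow h (sg s / 2 * of_nat n) * qpow h (- 1 / 2 * of_nat n) = qpow h (if s = Minus then - of_nat n else 0)"
    "qpow h (- (sg s / 2) * of_nat n) * qpow h (1 / 2 * of_nat n) = qpow h (if s = Minus then of_nat n else 0)"
    unfolding qpow_add[symmetric] by (cases s; simp add: field_simps)+
  then have "Hpm h N s j (Mode b (- int n)) = - Acoef h N j (- int n) b / qnum h (of_nat n) *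
     (qpow h (if s = Minus then of_nat n else 0) - qpow h (if s = Minus then - of_nat n else 0))"
    using n by (simp add: Hpm_def qnum_minus algebra_simps)
  then show ?thesis using qnum_nz[OF n]
    by (cases s) (simp_all add: qnum_qd[symmetric])
qed

lemma psi_endo: "endo_on (fock N) (psi_cur h N s j m)"
  unfolding psi_cur_def
  by (rule fock_endo[OF clin_V], rule fock_V) (auto simp: fock_field_def)

lemma cartan_sym: "i \<in> {1..2 * N} \<Longrightarrow> j \<in> {1..2 * N} \<Longrightarrow> cartan N i j = cartan N j i"
  by (auto simp: cartan_def)

lemma qpair_psi: "qpair (Hpm h N s j) \<Phi> = 0" "qpair \<Phi> (Hpm h N s j) = 0" "zpair \<Phi> (Hpm h N s j) = 0"
  by (simp_all add: qpair_def zpair_def)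

text \<open>\<psi>^- has creation modes only and \<psi>^+ annihilation modes only, so these orders
  of a product do not contract.\<close>

lemma contr_trivial:
  "contr (Hpm h N Minus j) \<Phi> 1" "contr \<Phi> (Hpm h N Plus j) 1"
  by (rule is_contr_one; simp add: mpair_def Hpm_pos Hpm_neg)+

lemma zpair_psi:
  assumes "j \<in> {1..2 * N}" "i \<in> {1..2 * N - 1}"
  shows "zpair (Hpm h N s j) (XF s' i e) = h * (sg s * sg s' * of_int (cartan N i j))"
proof -
  have "zpair (Hpm h N s j) (XF s' i e) = h * (sg s * sg s' * aform j i 0)"
    by (simp add: zpair_def aform_def sum_bosons sum_distrib_left mult_ac)
  also have "aform j i 0 = of_int (cartan N i j)"
    using assms by (subst aform_0) (auto simp: cartan_sym[of i j])
  finally show ?thesis .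
qed

lemma phase_psi:
  assumes "j \<in> {1..2 * N}" "i \<in> {1..2 * N - 1}"
  shows "phase (Hpm h N s j) (XF s' i e) = qpow h (sg s * sg s' * of_int (cartan N i j))"
    and "phase (XF s' i e) (Hpm h N s j) = qpow h (- (sg s * sg s' * of_int (cartan N i j)))"
  using assms by (simp_all add: phase_def zpair_psi qpair_psi qpow_def)

lemma qpow_pow: "x * of_nat n = y + z \<Longrightarrow> qpow h x ^ n = qpow h y * qpow h z"
  by (metis qpow_mult_nat qpow_add)

text \<open>The difference of two powers of q splits the logarithm into those of a numerator and a
  denominator; the sign of the current exchanges a with -a.\<close>

lemma contr_ratio:
  assumes "\<And>n. n > 0 \<Longrightarrow> \<beta> n = sg s * (qpow h (a * of_nat n) - qpow h (- a * of_nat n)) * qpow h (- sg s / 2 * of_nat n) / of_nat n"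
  shows "is_contr \<beta> ((1 - fps_const (qpow h (- sg s / 2 - sg s * a)) * fps_X) * geo (qpow h (- sg s / 2 + sg s * a)))"
proof (rule is_contr_cong[OF is_contr_mult[OF is_contr_lin is_contr_geo]])
  fix n :: nat assume n: "n > 0"
  have "sg s * (qpow h (a * of_nat n) - qpow h (- a * of_nat n)) = qpow h (sg s * a * of_nat n) - qpow h (- (sg s * a) * of_nat n)"
    by (cases s) simp_all
  then have "\<beta> n = (qpow h (sg s * a * of_nat n) - qpow h (- (sg s * a) * of_nat n)) * qpow h (- sg s / 2 * of_nat n) / of_nat n"
    using assms[OF n] by simp
  also have "\<dots> = - (qpow h (- sg s / 2 - sg s * a) ^ n) / of_nat n + qpow h (- sg s / 2 + sg s * a) ^ n / of_nat n"
  proof -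
    have "(- sg s / 2 - sg s * a) * of_nat n = - (sg s * a) * of_nat n + (- sg s / 2 * of_nat n)"
      "(- sg s / 2 + sg s * a) * of_nat n = sg s * a * of_nat n + (- sg s / 2 * of_nat n)"
      by (simp_all add: algebra_simps)
    then have "qpow h (- sg s / 2 - sg s * a) ^ n = qpow h (- (sg s * a) * of_nat n) * qpow h (- sg s / 2 * of_nat n)"
      "qpow h (- sg s / 2 + sg s * a) ^ n = qpow h (sg s * a * of_nat n) * qpow h (- sg s / 2 * of_nat n)"
      by (auto intro: qpow_pow)
    moreover have "(x - y) * z / n = - (y * z) / n + x * z / n" for x y z n :: complex
      by (simp add: left_diff_distrib diff_divide_distrib)
    ultimately show ?thesis by (simp only:)
  qed
  finally show "- (qpow h (- sg s / 2 - sg s * a) ^ n) / of_nat n + qpow h (- sg s / 2 + sg s * a) ^ n / of_nat n = \<beta> n" by simp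
qed

lemma contr_psi_plus_X:
  assumes "j \<in> {1..2 * N}" "i \<in> {1..2 * N - 1}"
  defines "a \<equiv> of_int (cartan N i j)"
  shows "contr (Hpm h N Plus j) (XF s i e)
    ((1 - fps_const (qpow h (- sg s / 2 - sg s * a)) * fps_X) * geo (qpow h (- sg s / 2 + sg s * a)))"
proof (rule contr_ratio)
  fix n :: nat assume n: "n > 0"
  have "mpair h N (Hpm h N Plus j) (XF s i e) n = sg s * (aform j i (int n) * (qnum h (of_nat n) * qd)) * qpow h (- sg s / 2 * of_nat n) / of_nat n"
    using n qnum_nz[OF n]
    by (simp add: mpair_def sum_bosons Hpm_pos aform_expand qnum_minus sum_distrib_left sum_distrib_right
        sum_divide_distrib power2_eq_square mult_ac)
  also have "aform j i (int n) * (qnum h (of_nat n) * qd) = qpow h (a * of_nat n) - qpow h (- a * of_nat n)"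
    unfolding qnum_qd using assms n by (subst aform_qn) (auto simp: cartan_sym[of i j])
  finally show "mpair h N (Hpm h N Plus j) (XF s i e) n =
     sg s * (qpow h (a * of_nat n) - qpow h (- a * of_nat n)) * qpow h (- sg s / 2 * of_nat n) / of_nat n" .
qed

lemma contr_X_psi_minus:
  assumes "j \<in> {1..2 * N}" "i \<in> {1..2 * N - 1}"
  defines "a \<equiv> of_int (cartan N i j)"
  shows "contr (XF s i e) (Hpm h N Minus j)
    ((1 - fps_const (qpow h (- sg s / 2 - sg s * a)) * fps_X) * geo (qpow h (- sg s / 2 + sg s * a)))"
proof (rule contr_ratio)
  fix n :: nat assume n: "n > 0"
  have "mpair h N (XF s i e) (Hpm h N Minus j) n = sg s * (aform i j (int n) * (qnum h (of_nat n) * qd)) * qpow h (- sg s / 2 * of_nat n) / of_nat n"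
    using n qnum_nz[OF n]
    by (simp add: mpair_def sum_bosons Hpm_neg aform_expand qnum_minus sum_distrib_left sum_distrib_right
        sum_divide_distrib power2_eq_square mult_ac)
  also have "aform i j (int n) * (qnum h (of_nat n) * qd) = qpow h (a * of_nat n) - qpow h (- a * of_nat n)"
    unfolding qnum_qd using assms n by (subst aform_qn) auto
  finally show "mpair h N (XF s i e) (Hpm h N Minus j) n =
     sg s * (qpow h (a * of_nat n) - qpow h (- a * of_nat n)) * qpow h (- sg s / 2 * of_nat n) / of_nat n" .
qed

text \<open>(q^(a n) - q^(-a n)) (q^n - q^(-n)) expands into four powers of q, one for each linear
  factor of (R2).\<close>

lemma contr_psi_psi:
  assumes "j \<in> {1..2 * N}" "j' \<in> {1..2 * N}"
  defines "a \<equiv> of_int (cartan N j j')"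
  shows "contr (Hpm h N Plus j) (Hpm h N Minus j')
    (((1 - fps_const (qpow h (1 + a)) * fps_X) * (1 - fps_const (qpow h (- 1 - a)) * fps_X)) *
     (geo (qpow h (1 - a)) * geo (qpow h (- 1 + a))))"
proof (rule is_contr_cong[OF is_contr_mult[OF is_contr_mult[OF is_contr_lin is_contr_lin] is_contr_mult[OF is_contr_geo is_contr_geo]]])
  fix n :: nat assume n: "n > 0"
  have "mpair h N (Hpm h N Plus j) (Hpm h N Minus j') n = - (aform j j' (int n) * (qnum h (of_nat n) * qd)) * (qnum h (of_nat n) * qd) / of_nat n"
    using n
    by (simp add: mpair_def sum_bosons Hpm_neg Hpm_pos aform_expand sum_distrib_left sum_distrib_right
        sum_divide_distrib power2_eq_square sum_negf mult_ac)
  also have "\<dots> = - (qpow h (a * of_nat n) - qpow h (- a * of_nat n)) * (qpow h (of_nat n) - qpow h (- of_nat n)) / of_nat n"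
    unfolding qnum_qd using assms aform_qn[of j j' n] n by simp
  also have "\<dots> = (- (qpow h (a * of_nat n) * qpow h (of_nat n)) - qpow h (- a * of_nat n) * qpow h (- of_nat n)
      + qpow h (a * of_nat n) * qpow h (- of_nat n) + qpow h (- a * of_nat n) * qpow h (of_nat n)) / of_nat n"
    by (simp add: algebra_simps)
  also have "\<dots> = - (qpow h (1 + a) ^ n) / of_nat n + - (qpow h (- 1 - a) ^ n) / of_nat n +
     (qpow h (1 - a) ^ n / of_nat n + qpow h (- 1 + a) ^ n / of_nat n)"
    unfolding qpow_mult_nat[symmetric] qpow_add[symmetric]
    by (simp add: diff_divide_distrib add_divide_distrib distrib_right left_diff_distrib add.commute)
  finally show "- (qpow h (1 + a) ^ n) / of_nat n + - (qpow h (- 1 - a) ^ n) / of_nat n +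
     (qpow h (1 - a) ^ n / of_nat n + qpow h (- 1 + a) ^ n / of_nat n) = mpair h N (Hpm h N Plus j) (Hpm h N Minus j') n" by simp
qed

subsection \<open>Relations with the even currents\<close>

lemma finsums_Sum_any: "finite {k. f k \<noteq> 0} \<Longrightarrow> t = Sum_any f \<Longrightarrow> finsums f t"
  by (simp add: finsums_def Sum_any.expand_set)

lemma finsums_sum:
  assumes "finite I" "\<And>i. i \<in> I \<Longrightarrow> finsums (f i) (t i)"
  shows "finsums (\<lambda>k. \<Sum>i\<in>I. f i k) (\<Sum>i\<in>I. t i)"
proof (rule finsums_Sum_any)
  have fin: "finite {k. f i k \<noteq> 0}" "t i = Sum_any (f i)" if "i \<in> I" for i
    using assms(2)[OF that] by (simp_all add: finsums_def Sum_any.expand_set)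
  show "finite {k. (\<Sum>i\<in>I. f i k) \<noteq> 0}"
    by (rule finite_subset[of _ "\<Union>i\<in>I. {k. f i k \<noteq> 0}"]) (use fin assms(1) in \<open>auto intro: ccontr sum.neutral\<close>)
  show "(\<Sum>i\<in>I. t i) = Sum_any (\<lambda>k. \<Sum>i\<in>I. f i k)"
    by (subst Sum_any_sum) (use fin assms(1) in auto)
qed

lemma finsums_scale: "finsums f t \<Longrightarrow> finsums (\<lambda>k. cscale x (f k)) (cscale x t)"
  by (rule finsums_Sum_any) (auto simp: finsums_def Sum_any.expand_set[symmetric] cscale_Sum_any intro: finite_supp_cscale)

lemma VV_right_trivial:
  assumes "contr \<Psi> \<Phi> 1" "qpair \<Phi> \<Psi> = 0" "qpair \<Psi> \<Phi> = 0"
  shows "V \<Psi> n (V \<Phi> m v) = cscale (phase \<Psi> \<Phi>) (Ins \<Psi> (V \<Phi> m) n v)"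
  using VV_right[OF assms(1), of 0 n m v] assms(2,3) Sum_any_fps_one[of "\<lambda>k. Ins \<Psi> (V \<Phi> (m - int k)) (n + int k) v"] by simp

text \<open>The product with \<Psi> on the left has trivial contraction, so the insertions in the
  expansion of the other order are themselves products, up to the phase.\<close>

lemma exchange_left:
  assumes "contr \<Phi> \<Psi> C" "contr \<Psi> \<Phi> 1" "qpair \<Phi> \<Psi> = 0" "qpair \<Psi> \<Phi> = 0"
  shows "finsums (\<lambda>k. cscale (fps_nth C k / phase \<Psi> \<Phi>) (V \<Psi> (n - int k) (V \<Phi> (m + int k) v))) (V \<Phi> m (V \<Psi> n v))"
  unfolding VV_right_trivial[OF assms(2-4)] VV_left[OF assms(1)]
  by (rule finsums_Sum_any) (auto intro: finite_supp_cscale Ins_left_finite)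

lemma Sum_any_fps_mult:
  assumes "finite {k. f k \<noteq> 0}"
  shows "Sum_any (\<lambda>k. cscale (fps_nth D k) (Sum_any (\<lambda>l. cscale (fps_nth C l) (f (k + l))))) = Sum_any (\<lambda>k. cscale (fps_nth (D * C) k) (f k))"
proof -
  obtain K where K: "\<And>k. k > K \<Longrightarrow> f k = 0"
    using assms by (metis (mono_tags, lifting) finite_nat_set_iff_bounded_le mem_Collect_eq not_less)
  have "Sum_any (\<lambda>k. cscale (fps_nth D k) (Sum_any (\<lambda>l. cscale (fps_nth C l) (f (k + l))))) =
     (\<Sum>k\<le>K. \<Sum>l\<le>K - k. cscale (fps_nth D k * fps_nth C l) (f (k + l)))"
  proof -
    have "Sum_any (\<lambda>l. cscale (fps_nth C l) (f (k + l))) = (\<Sum>l\<le>K - k. cscale (fps_nth C l) (f (k + l)))" for k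
      unfolding atMost_atLeast0 by (rule Sum_any_upto) (simp add: K)
    moreover have "Sum_any (\<lambda>k. cscale (fps_nth D k) (\<Sum>l\<le>K - k. cscale (fps_nth C l) (f (k + l)))) =
       (\<Sum>k\<le>K. cscale (fps_nth D k) (\<Sum>l\<le>K - k. cscale (fps_nth C l) (f (k + l))))"
      unfolding atMost_atLeast0 by (rule Sum_any_upto) (simp add: K)
    ultimately show ?thesis by (simp add: fv.scale_sum_right)
  qed
  also have "\<dots> = (\<Sum>k\<le>K. \<Sum>l\<le>k. cscale (fps_nth D l * fps_nth C (k - l)) (f k))"
    unfolding sum.Sigma[OF finite_atMost ballI[OF finite_atMost]]
    by (rule sum.reindex_bij_witness[of _ "\<lambda>(k, l). (l, k - l)" "\<lambda>(k, l). (k + l, k)"]) auto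
  also have "\<dots> = (\<Sum>k\<le>K. cscale (fps_nth (D * C) k) (f k))"
    by (simp add: fps_mult_nth fv.scale_sum_left atMost_atLeast0)
  also have "\<dots> = Sum_any (\<lambda>k. cscale (fps_nth (D * C) k) (f k))"
    unfolding atMost_atLeast0 by (rule Sum_any_upto[symmetric]) (simp add: K)
  finally show ?thesis .
qed

text \<open>Here the contraction sits in the product on the right-hand side of the relation, so its
  series has to be inverted before the other order can be expressed through it.\<close>

lemma exchange_right:
  assumes "contr \<Phi> \<Psi> C" "contr \<Psi> \<Phi> 1" "qpair \<Phi> \<Psi> = 0" "qpair \<Psi> \<Phi> = 0" "D * C = 1"
  shows "finsums (\<lambda>k. cscale (phase \<Psi> \<Phi> * fps_nth D k) (V \<Phi> (n + int k) (V \<Psi> (m - int k) v))) (V \<Psi> m (V \<Phi> n v))"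
proof (rule finsums_Sum_any)
  show "finite {k. cscale (phase \<Psi> \<Phi> * fps_nth D k) (V \<Phi> (n + int k) (V \<Psi> (m - int k) v)) \<noteq> 0}"
    by (rule finite_supp_cscale, rule finite_supp_clin, rule V_below[of \<Psi> v], rule finite_below, assumption, simp)
  have "Sum_any (\<lambda>k. cscale (fps_nth D k) (V \<Phi> (n + int k) (V \<Psi> (m - int k) v))) =
     Sum_any (\<lambda>k. cscale (fps_nth D k) (Sum_any (\<lambda>l. cscale (fps_nth C l) (Ins \<Psi> (V \<Phi> (n + int (k + l))) (m - int (k + l)) v))))"
    unfolding VV_left[OF assms(1)] by (simp add: algebra_simps)
  also have "\<dots> = Ins \<Psi> (V \<Phi> n) m v"
    by (subst Sum_any_fps_mult[OF Ins_left_finite]) (simp add: assms(5) Sum_any_fps_one del: fps_one_nth)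
  finally show "V \<Psi> m (V \<Phi> n v) = Sum_any (\<lambda>k. cscale (phase \<Psi> \<Phi> * fps_nth D k) (V \<Phi> (n + int k) (V \<Psi> (m - int k) v)))"
    by (simp add: VV_right_trivial[OF assms(2-4)] fv.scale_scale[symmetric] cscale_Sum_any[symmetric] del: fv.scale_scale)
qed

lemma geo_divide: "f / (1 - fps_const a * fps_X) = f * geo a"
proof -
  have "inverse (1 - fps_const a * fps_X) = geo a"
    by (rule fps_inverse_unique[OF geo_mult])
  then show ?thesis by (simp add: fps_divide_unit)
qed

lemma geo_cross: "((1 - fps_const a * fps_X) * geo b) * ((1 - fps_const b * fps_X) * geo a) = 1"
proof -
  have "((1 - fps_const a * fps_X) * geo b) * ((1 - fps_const b * fps_X) * geo a) =
     ((1 - fps_const a * fps_X) * geo a) * ((1 - fps_const b * fps_X) * geo b)"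
    by (simp only: mult_ac)
  then show ?thesis by (simp only: geo_mult mult_1)
qed

lemma geo_mult2: "((1 - fps_const a * fps_X) * (1 - fps_const b * fps_X)) * (geo a * geo b) = 1"
proof -
  have "((1 - fps_const a * fps_X) * (1 - fps_const b * fps_X)) * (geo a * geo b) =
     ((1 - fps_const a * fps_X) * geo a) * ((1 - fps_const b * fps_X) * geo b)"
    by (simp only: mult_ac)
  then show ?thesis by (simp only: geo_mult mult_1)
qed

lemma psi_psi_rel: "psi_cur h N s j m (psi_cur h N s j' n v) = psi_cur h N s j' n (psi_cur h N s j m v)"
proof -
  let ?A = "Hpm h N s j" and ?B = "Hpm h N s j'"
  have c: "contr ?A ?B 1" "contr ?B ?A 1" using contr_trivial by (cases s; simp)+
  have z: "phase ?B ?A = 1" by (simp add: phase_def qpair_psi)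
  have "V ?A m (V ?B n v) = Ins ?B (V ?A m) n v"
    using VV_left[OF c(1), of m n v] Sum_any_fps_one[of "\<lambda>k. Ins ?B (V ?A (m + int k)) (n - int k) v"] by simp
  then show ?thesis
    using VV_right_trivial[OF c(2), of n m v] by (simp add: psi_cur_def qpair_psi z)
qed

lemma psi_plus_psi_minus_rel:
  assumes "j \<in> {1..2 * N}" "j' \<in> {1..2 * N}"
  defines "a \<equiv> of_int (cartan N j j')"
  defines "R \<equiv> (1 - fps_const (qpow h (1 + a)) * fps_X) * (1 - fps_const (qpow h (- 1 - a)) * fps_X)
             / ((1 - fps_const (qpow h (1 - a)) * fps_X) * (1 - fps_const (qpow h (- 1 + a)) * fps_X))"
  shows "finsums (\<lambda>k. cscale (fps_nth R k) (psi_cur h N Minus j' (n - int k) (psi_cur h N Plus j (m + int k) v)))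
            (psi_cur h N Plus j m (psi_cur h N Minus j' n v))"
proof -
  have "inverse ((1 - fps_const (qpow h (1 - a)) * fps_X) * (1 - fps_const (qpow h (- 1 + a)) * fps_X)) =
     geo (qpow h (1 - a)) * geo (qpow h (- 1 + a))"
    by (rule fps_inverse_unique[OF geo_mult2])
  then have R: "R = ((1 - fps_const (qpow h (1 + a)) * fps_X) * (1 - fps_const (qpow h (- 1 - a)) * fps_X)) *
     (geo (qpow h (1 - a)) * geo (qpow h (- 1 + a)))"
    unfolding R_def by (subst fps_divide_unit) simp_all
  have "phase (Hpm h N Minus j') (Hpm h N Plus j) = 1" by (simp add: phase_def qpair_psi)
  with exchange_left[OF contr_psi_psi[OF assms(1,2)] contr_trivial(1) qpair_psi(1) qpair_psi(1), of n m v]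
  show ?thesis by (simp add: R a_def psi_cur_def)
qed

lemma psi_plus_X_rel:
  fixes s :: pm
  assumes "j \<in> {1..2 * N}" "i \<in> {1..2 * N - 1}"
  defines "a \<equiv> sg s * of_int (cartan N i j)"
  defines "R \<equiv> fps_const (qpow h a) * ((1 - fps_const (qpow h (- sg s / 2 - a)) * fps_X) / (1 - fps_const (qpow h (- sg s / 2 + a)) * fps_X))"
  shows "finsums (\<lambda>k. cscale (fps_nth R k) (X_cur h N s i (n - int k) (psi_cur h N Plus j (m + int k) v)))
            (psi_cur h N Plus j m (X_cur h N s i n v))"
proof -
  let ?C = "(1 - fps_const (qpow h (- sg s / 2 - a)) * fps_X) * geo (qpow h (- sg s / 2 + a))"
  have ph: "phase (XF s i e) (Hpm h N Plus j) = inverse (qpow h a)" for e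
    using phase_psi(2)[OF assms(1,2), of s e Plus] by (simp add: a_def qpow_minus)
  have R: "fps_nth R k = fps_nth ?C k / phase (XF s i e) (Hpm h N Plus j)" for k e
    unfolding R_def geo_divide ph by (simp only: fps_mult_left_const_nth divide_inverse inverse_inverse_eq mult.commute)
  have "finsums (\<lambda>k. cscale (fps_nth R k) (V (XF s i e) (n' - int k) (V (Hpm h N Plus j) (m + int k) v))) (V (Hpm h N Plus j) m (V (XF s i e) n' v))"
    for e n'
    unfolding R[of _ e] using contr_psi_plus_X[OF assms(1,2), of s e]
    by (intro exchange_left) (simp_all add: contr_trivial qpair_psi a_def)
  then have "finsums (\<lambda>k. \<Sum>e\<in>terms s i. cscale (xcoef s i e) (cscale (fps_nth R k) (V (XF s i e) (n + xexp s i - int k) (V (Hpm h N Plus j) (m + int k) v))))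
     (\<Sum>e\<in>terms s i. cscale (xcoef s i e) (V (Hpm h N Plus j) m (V (XF s i e) (n + xexp s i) v)))"
    by (intro finsums_sum finsums_scale) simp_all
  then show ?thesis
    by (simp add: X_cur_expand[OF assms(2)] psi_cur_def clin_sum clin_scale fv.scale_sum_right algebra_simps)
qed

lemma psi_minus_X_rel:
  fixes s :: pm
  assumes "j \<in> {1..2 * N}" "i \<in> {1..2 * N - 1}"
  defines "a \<equiv> sg s * of_int (cartan N i j)"
  defines "R \<equiv> fps_const (qpow h a) * ((fps_X - fps_const (qpow h (sg s / 2 - a))) / (fps_X - fps_const (qpow h (sg s / 2 + a))))"
  shows "finsums (\<lambda>k. cscale (fps_nth R k) (X_cur h N s i (n + int k) (psi_cur h N Minus j (m - int k) v)))
            (psi_cur h N Minus j m (X_cur h N s i n v))"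
proof -
  let ?C = "(1 - fps_const (qpow h (- sg s / 2 - a)) * fps_X) * geo (qpow h (- sg s / 2 + a))"
  let ?D = "(1 - fps_const (qpow h (- sg s / 2 + a)) * fps_X) * geo (qpow h (- sg s / 2 - a))"
  have DC: "?D * ?C = 1" by (rule geo_cross)
  \<comment> \<open>Pulling out -x leaves a linear factor with constant term 1, the form in which
    contractions appear.\<close>
  have lin: "fps_X - fps_const x = - fps_const x * (1 - fps_const y * fps_X)" if "x * y = 1" for x y :: complex
  proof -
    have "fps_const x * fps_const y = (1 :: complex fps)" using that by (simp add: fps_const_mult)
    moreover have "- a * (1 - b * f) = (a * b) * f - a" for a b f :: "complex fps" by (simp add: algebra_simps)
    ultimately show ?thesis by (simp only: mult_1)
  qed
  have l1: "fps_X - fps_const (qpow h (sg s / 2 - a)) = - fps_const (qpow h (sg s / 2 - a)) * (1 - fps_const (qpow h (- sg s / 2 + a)) * fps_X)"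
    by (rule lin) (simp add: qpow_add[symmetric])
  have l2: "(fps_X - fps_const (qpow h (sg s / 2 + a))) * (- fps_const (qpow h (- sg s / 2 - a)) * geo (qpow h (- sg s / 2 - a))) = 1"
  proof -
    have "fps_X - fps_const (qpow h (sg s / 2 + a)) = - fps_const (qpow h (sg s / 2 + a)) * (1 - fps_const (qpow h (- sg s / 2 - a)) * fps_X)"
      by (rule lin) (simp add: qpow_add[symmetric])
    moreover have "fps_const (qpow h (sg s / 2 + a)) * fps_const (qpow h (- sg s / 2 - a)) = (1 :: complex fps)"
      by (simp add: fps_const_mult qpow_add[symmetric])
    moreover have "(- y * p) * (- z * g) = (y * z) * (p * g)" for y p z g :: "complex fps" by (simp add: mult_ac)
    ultimately show ?thesis by (simp only: geo_mult mult_1)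
  qed
  have "R = fps_const (qpow h a) * (fps_X - fps_const (qpow h (sg s / 2 - a))) * (- fps_const (qpow h (- sg s / 2 - a)) * geo (qpow h (- sg s / 2 - a)))"
    unfolding R_def by (subst fps_divide_unit, simp, subst fps_inverse_unique[OF l2]) (simp add: mult_ac)
  also have "\<dots> = (fps_const (qpow h a) * fps_const (qpow h (sg s / 2 - a)) * fps_const (qpow h (- sg s / 2 - a))) * ?D"
    unfolding l1 by (simp add: mult_ac)
  \<comment> \<open>The three constants combine to q^(-a), the phase between \<psi>^- and X.\<close>
  also have "fps_const (qpow h a) * fps_const (qpow h (sg s / 2 - a)) * fps_const (qpow h (- sg s / 2 - a)) = fps_const (qpow h (- a))"
    by (simp add: fps_const_mult qpow_add[symmetric])
  finally have R': "R = fps_const (qpow h (- a)) * ?D" .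
  have R: "fps_nth R k = phase (Hpm h N Minus j) (XF s i e) * fps_nth ?D k" for k e
    unfolding R' using phase_psi(1)[OF assms(1,2)] by (simp add: a_def)
  have "finsums (\<lambda>k. cscale (fps_nth R k) (V (XF s i e) (n' + int k) (V (Hpm h N Minus j) (m - int k) v))) (V (Hpm h N Minus j) m (V (XF s i e) n' v))"
    for e n'
    unfolding R[of _ e] using contr_X_psi_minus[OF assms(1,2), of s e] DC
    by (intro exchange_right) (simp_all add: contr_trivial qpair_psi a_def)
  then have "finsums (\<lambda>k. \<Sum>e\<in>terms s i. cscale (xcoef s i e) (cscale (fps_nth R k) (V (XF s i e) (n + xexp s i + int k) (V (Hpm h N Minus j) (m - int k) v))))
     (\<Sum>e\<in>terms s i. cscale (xcoef s i e) (V (Hpm h N Minus j) m (V (XF s i e) (n + xexp s i) v)))"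
    by (intro finsums_sum finsums_scale) simp_all
  then show ?thesis
    by (simp add: X_cur_expand[OF assms(2)] psi_cur_def clin_sum clin_scale fv.scale_sum_right algebra_simps)
qed

end

section \<open>Relations among the odd currents\<close>

lemma add_diff_eq_0:
  fixes a :: "'a::ab_group_add"
  assumes "a - x = c" "b - y = c"
  shows "a - x + (y - b) = 0"
proof -
  have "a - x + (y - b) = (a - x) - (b - y)" by simp
  then show ?thesis using assms by simp
qed

context free_bosons
begin

text \<open>Multiplying by 1 - a w / z clears the simple pole and leaves an identity between
  finitely many coefficients.\<close>

lemma VV_geo_left:
  assumes "contr \<Phi> \<Psi> (geo a)"
  shows "V \<Phi> m (V \<Psi> n v) - cscale a (V \<Phi> (m + 1) (V \<Psi> (n - 1) v)) = Ins \<Psi> (V \<Phi> m) n v"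
proof -
  have "Sum_any (\<lambda>k. cscale (fps_nth ((1 - fps_const a * fps_X) * geo a) k) (Ins \<Psi> (V \<Phi> (m + int k)) (n - int k) v)) =
     V \<Phi> m (V \<Psi> n v) - cscale a (V \<Phi> (m + 1) (V \<Psi> (n - 1) v))"
    unfolding VV_left[OF assms] by (subst Sum_any_fps_lin[OF Ins_left_finite]) (simp add: algebra_simps)
  then show ?thesis unfolding geo_mult Sum_any_fps_one by simp
qed

lemma VV_ratio_left:
  assumes "contr \<Phi> \<Psi> ((1 - fps_const b * fps_X) * geo a)"
  shows "V \<Phi> m (V \<Psi> n v) - cscale a (V \<Phi> (m + 1) (V \<Psi> (n - 1) v)) =
    Ins \<Psi> (V \<Phi> m) n v - cscale b (Ins \<Psi> (V \<Phi> (m + 1)) (n - 1) v)"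
proof -
  let ?b = "1 - fps_const b * fps_X"
  let ?f = "\<lambda>k. Ins \<Psi> (V \<Phi> (m + int k)) (n - int k) v"
  have "Sum_any (\<lambda>k. cscale (fps_nth ((1 - fps_const a * fps_X) * (?b * geo a)) k) (?f k)) =
     V \<Phi> m (V \<Psi> n v) - cscale a (V \<Phi> (m + 1) (V \<Psi> (n - 1) v))"
    unfolding VV_left[OF assms] by (subst Sum_any_fps_lin[OF Ins_left_finite]) (simp add: algebra_simps)
  moreover have "(1 - fps_const a * fps_X) * (?b * geo a) = ?b * 1"
    by (subst geo_mult[of a, symmetric]) (simp only: mult_ac)
  ultimately show ?thesis
    by (simp only: Sum_any_fps_lin[OF Ins_left_finite] Sum_any_fps_one) simp
qed

lemma VV_lin_left:
  assumes "contr \<Phi> \<Psi> (1 - fps_const a * fps_X)"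
  shows "V \<Phi> m (V \<Psi> n v) = Ins \<Psi> (V \<Phi> m) n v - cscale a (Ins \<Psi> (V \<Phi> (m + 1)) (n - 1) v)"
proof -
  have "V \<Phi> m (V \<Psi> n v) = Sum_any (\<lambda>k. cscale (fps_nth ((1 - fps_const a * fps_X) * 1) k) (Ins \<Psi> (V \<Phi> (m + int k)) (n - int k) v))"
    unfolding VV_left[OF assms] by simp
  then show ?thesis
    by (simp only: Sum_any_fps_lin[OF Ins_left_finite] Sum_any_fps_one) simp
qed

lemma VV_one_left:
  assumes "contr \<Phi> \<Psi> 1"
  shows "V \<Phi> m (V \<Psi> n v) = Ins \<Psi> (V \<Phi> m) n v"
  unfolding VV_left[OF assms] Sum_any_fps_one by simp

context
  fixes \<Phi> \<Psi> :: bfield and g :: int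
  assumes g: "qpair \<Phi> \<Psi> = of_int g" "qpair \<Psi> \<Phi> = of_int g"
begin

lemma VV_geo_right:
  assumes "contr \<Psi> \<Phi> (geo a)"
  shows "V \<Psi> n (V \<Phi> m v) - cscale a (V \<Psi> (n + 1) (V \<Phi> (m - 1) v)) = cscale (phase \<Psi> \<Phi>) (Ins \<Psi> (V \<Phi> (m + g)) (n - g) v)"
proof -
  let ?f = "\<lambda>k. Ins \<Psi> (V \<Phi> (m + g - int k)) (n - g + int k) v"
  have "cscale (phase \<Psi> \<Phi>) (Sum_any (\<lambda>k. cscale (fps_nth ((1 - fps_const a * fps_X) * geo a) k) (?f k))) =
     V \<Psi> n (V \<Phi> m v) - cscale a (V \<Psi> (n + 1) (V \<Phi> (m - 1) v))"
    unfolding VV_right[OF assms g] by (subst Sum_any_fps_lin[OF Ins_right_finite])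
      (simp add: algebra_simps fv.scale_right_diff_distrib)
  then show ?thesis unfolding geo_mult Sum_any_fps_one by simp
qed

lemma VV_ratio_right:
  assumes "contr \<Psi> \<Phi> ((1 - fps_const b * fps_X) * geo a)"
  shows "V \<Psi> n (V \<Phi> m v) - cscale a (V \<Psi> (n + 1) (V \<Phi> (m - 1) v)) =
    cscale (phase \<Psi> \<Phi>) (Ins \<Psi> (V \<Phi> (m + g)) (n - g) v - cscale b (Ins \<Psi> (V \<Phi> (m + g - 1)) (n - g + 1) v))"
proof -
  let ?b = "1 - fps_const b * fps_X"
  let ?f = "\<lambda>k. Ins \<Psi> (V \<Phi> (m + g - int k)) (n - g + int k) v"
  have "cscale (phase \<Psi> \<Phi>) (Sum_any (\<lambda>k. cscale (fps_nth ((1 - fps_const a * fps_X) * (?b * geo a)) k) (?f k))) =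
     V \<Psi> n (V \<Phi> m v) - cscale a (V \<Psi> (n + 1) (V \<Phi> (m - 1) v))"
    unfolding VV_right[OF assms g] by (subst Sum_any_fps_lin[OF Ins_right_finite])
      (simp add: algebra_simps fv.scale_right_diff_distrib)
  moreover have "(1 - fps_const a * fps_X) * (?b * geo a) = ?b * 1"
    by (subst geo_mult[of a, symmetric]) (simp only: mult_ac)
  ultimately show ?thesis
    by (simp only: Sum_any_fps_lin[OF Ins_right_finite] Sum_any_fps_one) simp
qed

lemma VV_lin_right:
  assumes "contr \<Psi> \<Phi> (1 - fps_const a * fps_X)"
  shows "V \<Psi> n (V \<Phi> m v) = cscale (phase \<Psi> \<Phi>)
    (Ins \<Psi> (V \<Phi> (m + g)) (n - g) v - cscale a (Ins \<Psi> (V \<Phi> (m + g - 1)) (n - g + 1) v))"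
proof -
  let ?f = "\<lambda>k. Ins \<Psi> (V \<Phi> (m + g - int k)) (n - g + int k) v"
  have "V \<Psi> n (V \<Phi> m v) = cscale (phase \<Psi> \<Phi>) (Sum_any (\<lambda>k. cscale (fps_nth ((1 - fps_const a * fps_X) * 1) k) (?f k)))"
    unfolding VV_right[OF assms g] by simp
  then show ?thesis
    by (simp only: Sum_any_fps_lin[OF Ins_right_finite] Sum_any_fps_one) simp
qed

lemma VV_one_right:
  assumes "contr \<Psi> \<Phi> 1"
  shows "V \<Psi> n (V \<Phi> m v) = cscale (phase \<Psi> \<Phi>) (Ins \<Psi> (V \<Phi> (m + g)) (n - g) v)"
  unfolding VV_right[OF assms g] Sum_any_fps_one by simp

lemma anti_one:
  assumes "contr \<Phi> \<Psi> 1" "contr \<Psi> \<Phi> 1" "g = 0" "phase \<Psi> \<Phi> = - 1"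
  shows "V \<Phi> m (V \<Psi> n v) + V \<Psi> n (V \<Phi> m v) = 0"
  unfolding VV_one_left[OF assms(1)] VV_one_right[OF assms(2)] using assms(3,4) by simp

text \<open>a (w / z) (1 - z / (a w)) = - (1 - a w / z): the phase a and the shift g = 1 turn one
  order into minus the other.\<close>

lemma anti_lin:
  assumes "contr \<Phi> \<Psi> (1 - fps_const a * fps_X)" "contr \<Psi> \<Phi> (1 - fps_const (inverse a) * fps_X)" "g = 1"
    and "phase \<Psi> \<Phi> = a" "a \<noteq> 0"
  shows "V \<Phi> m (V \<Psi> n v) + V \<Psi> n (V \<Phi> m v) = 0"
  unfolding VV_lin_left[OF assms(1)] VV_lin_right[OF assms(2)] using assms(3,4,5)
  by (simp add: fv.scale_right_diff_distrib)

text \<open>The two expansions of \<open>1 / (z - a w)\<close> differ by a delta function.\<close>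

lemma delta_geo:
  assumes "contr \<Phi> \<Psi> (geo (qpow h x))" "contr \<Psi> \<Phi> (geo (qpow h (- x)))" "g = - 1"
    and "phase \<Psi> \<Phi> = qpow h (- x)" "integral \<Psi> v"
  shows "V \<Phi> m (V \<Psi> n v) + V \<Psi> n (V \<Phi> m v) =
    cscale (qpow h (- x * of_int m) * exp (zpair (bdilate h x \<Phi>) \<Psi>)) (V (\<lambda>y. bdilate h x \<Phi> y + \<Psi> y) (m + n + 1) v)"
proof -
  define f where "f k = cscale (qpow h (x * of_int k)) (Ins \<Psi> (V \<Phi> k) (m + n - k) v)" for k
  have fin1: "finite {k::nat. f (m + int k) \<noteq> 0}"
    using Ins_left_finite[of \<Psi> \<Phi> m n v] by (simp add: f_def)
  have fin2: "finite {k::nat. f (m - 1 - int k) \<noteq> 0}"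
    using Ins_right_finite[of \<Psi> \<Phi> "m - 1" "n + 1" v] by (simp add: f_def algebra_simps)
  have fin: "finite {k. f (k + m) \<noteq> 0}"
  proof (rule finite_subset)
    show "{k. f (k + m) \<noteq> 0} \<subseteq> int ` {k::nat. f (m + int k) \<noteq> 0} \<union> (\<lambda>k. - 1 - int k) ` {k::nat. f (m - 1 - int k) \<noteq> 0}"
    proof
      fix k assume k: "k \<in> {k. f (k + m) \<noteq> 0}"
      show "k \<in> int ` {k::nat. f (m + int k) \<noteq> 0} \<union> (\<lambda>k. - 1 - int k) ` {k::nat. f (m - 1 - int k) \<noteq> 0}"
      proof (cases "k \<ge> 0")
        case True
        then show ?thesis using k by (intro UnI1 image_eqI[of _ _ "nat k"]) (auto simp: add.commute)
      next
        case False
        then show ?thesis using k by (intro UnI2 image_eqI[of _ _ "nat (- 1 - k)"]) (auto simp: add.commute)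
      qed
    qed
  qed (use fin1 fin2 in simp)
  have q: "qpow h (x * of_int (m + k)) = qpow h (x * of_int m) * qpow h (x * of_int k)" for k
    by (simp add: qpow_add[symmetric] algebra_simps)
  have "V \<Phi> m (V \<Psi> n v) = cscale (qpow h (- x * of_int m)) (Sum_any (\<lambda>k::nat. f (m + int k)))"
    unfolding VV_left[OF assms(1)] cscale_Sum_any
    by (rule Sum_any.cong) (simp add: f_def qpow_add[symmetric] qpow_mult_nat[symmetric] algebra_simps)
  moreover have "V \<Psi> n (V \<Phi> m v) = cscale (qpow h (- x * of_int m)) (Sum_any (\<lambda>k::nat. f (m - 1 - int k)))"
    unfolding VV_right[OF assms(2) g] cscale_Sum_any assms(3,4)
    by (rule Sum_any.cong) (simp add: f_def qpow_add[symmetric] qpow_mult_nat[symmetric] algebra_simps)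
  \<comment> \<open>With g = -1 the two expansions occupy the indices from m upwards and from m - 1
    downwards, covering every integer exactly once.\<close>
  moreover have "Sum_any (\<lambda>k::nat. f (m + int k)) + Sum_any (\<lambda>k::nat. f (m - 1 - int k)) = Sum_any f"
  proof -
    have "Sum_any f = Sum_any (\<lambda>k. f (k + m))" by (rule Sum_any_shift(1)[symmetric])
    also have "\<dots> = Sum_any (\<lambda>k::nat. f (int k + m)) + Sum_any (\<lambda>k::nat. f (- 1 - int k + m))"
      by (rule Sum_any_int_split[OF fin])
    finally show ?thesis by (simp add: algebra_simps)
  qed
  moreover have "Sum_any f = cscale (exp (zpair (bdilate h x \<Phi>) \<Psi>)) (V (\<lambda>y. bdilate h x \<Phi> y + \<Psi> y) (m + n + 1) v)"
    unfolding f_def using fuse_dilated[OF g(1) assms(5), of x "m + n"] assms(3) by simp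
  ultimately show ?thesis
    by (simp add: fv.scale_right_distrib[symmetric] fv.scale_scale[symmetric] del: fv.scale_scale)
qed

text \<open>The same for \<open>(z - a w) / (z - w)\<close>.\<close>

lemma delta_ratio:
  assumes "contr \<Phi> \<Psi> ((1 - fps_const a * fps_X) * geo 1)" "contr \<Psi> \<Phi> ((1 - fps_const (inverse a) * fps_X) * geo 1)" "g = 0"
    and "phase \<Psi> \<Phi> = - a" "a \<noteq> 0" "integral \<Psi> v"
  shows "V \<Phi> m (V \<Psi> n v) + V \<Psi> n (V \<Phi> m v) =
    cscale ((1 - a) * exp (zpair \<Phi> \<Psi>)) (V (\<lambda>y. \<Phi> y + \<Psi> y) (m + n) v)"
proof -
  define f where "f k = Ins \<Psi> (V \<Phi> k) (m + n - k) v" for k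
  have fin1: "finite {k::nat. f (m + int k) \<noteq> 0}"
    using Ins_left_finite[of \<Psi> \<Phi> m n v] by (simp add: f_def)
  have fin2: "finite {k::nat. f (m - int k) \<noteq> 0}"
    using Ins_right_finite[of \<Psi> \<Phi> m n v] by (simp add: f_def algebra_simps)
  have fin2': "finite {k::nat. f (m - 1 - int k) \<noteq> 0}"
    using finite_supp_Suc[OF fin2] by (simp add: algebra_simps)
  have fin: "finite {k. f (k + m) \<noteq> 0}"
  proof (rule finite_subset)
    show "{k. f (k + m) \<noteq> 0} \<subseteq> int ` {k::nat. f (m + int k) \<noteq> 0} \<union> (\<lambda>k. - 1 - int k) ` {k::nat. f (m - 1 - int k) \<noteq> 0}"
    proof
      fix k assume k: "k \<in> {k. f (k + m) \<noteq> 0}"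
      show "k \<in> int ` {k::nat. f (m + int k) \<noteq> 0} \<union> (\<lambda>k. - 1 - int k) ` {k::nat. f (m - 1 - int k) \<noteq> 0}"
      proof (cases "k \<ge> 0")
        case True
        then show ?thesis using k by (intro UnI1 image_eqI[of _ _ "nat k"]) (auto simp: add.commute)
      next
        case False
        then show ?thesis using k by (intro UnI2 image_eqI[of _ _ "nat (- 1 - k)"]) (auto simp: add.commute)
      qed
    qed
  qed (use fin1 fin2' in simp)
  define P where "P = Sum_any (\<lambda>k::nat. f (m + int k))"
  define M where "M = Sum_any (\<lambda>k::nat. f (m - 1 - int k))"
  have P1: "Sum_any (\<lambda>k::nat. f (m + int (Suc k))) = P - f m"
    unfolding P_def by (subst Sum_any_Suc[OF fin1]) simp
  have M1: "Sum_any (\<lambda>k::nat. f (m - int k)) = f m + M"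
    unfolding M_def by (subst Sum_any_Suc[OF fin2]) (simp add: algebra_simps)
  have geo1: "cscale (fps_nth (geo 1) k) u = u" for k and u :: fvec by simp
  have F: "V \<Phi> m (V \<Psi> n v) = P - cscale a (P - f m)"
  proof -
    have "V \<Phi> m (V \<Psi> n v) = Sum_any (\<lambda>k. cscale (fps_nth ((1 - fps_const a * fps_X) * geo 1) k) (f (m + int k)))"
      unfolding VV_left[OF assms(1)] by (simp add: f_def)
    also have "\<dots> = P - cscale a (P - f m)"
      unfolding Sum_any_fps_lin[OF fin1] geo1 P1 P_def[symmetric] ..
    finally show ?thesis .
  qed
  have G: "V \<Psi> n (V \<Phi> m v) = cscale (- a) (f m + M - cscale (inverse a) M)"
  proof -
    have "V \<Psi> n (V \<Phi> m v) = cscale (- a) (Sum_any (\<lambda>k. cscale (fps_nth ((1 - fps_const (inverse a) * fps_X) * geo 1) k) (f (m - int k))))"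
      unfolding VV_right[OF assms(2) g] assms(3,4) by (simp add: f_def algebra_simps)
    also have "Sum_any (\<lambda>k. cscale (fps_nth ((1 - fps_const (inverse a) * fps_X) * geo 1) k) (f (m - int k))) =
       f m + M - cscale (inverse a) M"
      unfolding Sum_any_fps_lin[OF fin2] geo1 M1 by (simp add: M_def algebra_simps)
    finally show ?thesis .
  qed
  \<comment> \<open>Both halves acquire the factor 1 - a, and the boundary terms in
    \<open>f m\<close> cancel.\<close>
  have "V \<Phi> m (V \<Psi> n v) + V \<Psi> n (V \<Phi> m v) = cscale (1 - a) (P + M)"
    unfolding F G using assms(5)
    by (intro poly_mapping_eqI) (simp add: lookup_add lookup_minus algebra_simps)
  also have "P + M = Sum_any f"
  proof -
    have "Sum_any f = Sum_any (\<lambda>k. f (k + m))" by (rule Sum_any_shift(1)[symmetric])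
    also have "\<dots> = Sum_any (\<lambda>k::nat. f (int k + m)) + Sum_any (\<lambda>k::nat. f (- 1 - int k + m))"
      by (rule Sum_any_int_split[OF fin])
    finally show ?thesis by (simp add: P_def M_def algebra_simps)
  qed
  also have "Sum_any f = cscale (exp (zpair \<Phi> \<Psi>)) (V (\<lambda>y. \<Phi> y + \<Psi> y) (m + n) v)"
    unfolding f_def using fuse[OF g(1) assms(6), of "m + n"] assms(3) by simp
  finally show ?thesis by simp
qed

end

end

context currents
begin

section \<open>Contractions between pairs of odd currents\<close>

lemma half_eq: "half i = half i' \<longleftrightarrow> i = i' \<or> (odd i \<and> i' = i + 1) \<or> (odd i' \<and> i = i' + 1)"
  unfolding half_def by presburger

text \<open>Such fields do not contract; only the F of the larger index sees the other current, and
  its sign makes the two currents anticommute. This is the purpose of the factors F.\<close>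

lemma far_data:
  assumes "i \<in> {1..2 * N - 1}" "i' \<in> {1..2 * N - 1}" "i' + 1 < i \<or> i + 1 < i'"
  shows "cartan N i i' = 0" "half i \<noteq> half i'" "eta i i' * eta i' i = - 1"
proof -
  show "cartan N i i' = 0" using assms by (auto simp: cartan_def)
  show "half i \<noteq> half i'" using assms(3) by (auto simp: half_eq)
  show "eta i i' * eta i' i = - 1"
  proof (cases "i' + 1 < i")
    case True
    then have "(if odd i' then i' else i' + 1) < i" "\<not> (if odd i then i else i + 1) < i'" by auto
    then show ?thesis by (simp add: eta_def)
  next
    case False
    then have "\<not> (if odd i' then i' else i' + 1) < i" "(if odd i then i else i + 1) < i'" using assms(3) by auto
    then show ?thesis by (simp add: eta_def)
  qed
qed

lemma same_data: "i \<in> {1..2 * N - 1} \<Longrightarrow> cartan N i i = 0" "eta i i * eta i i = 1"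
  by (auto simp: cartan_def eta_def)

text \<open>Neighbours sharing c^k are an odd index and the even index after it; their F factors
  contribute -1, those of the other neighbours 1.\<close>

lemma near_data:
  assumes "i \<in> {1..2 * N - 1}" "i' \<in> {1..2 * N - 1}" "i \<noteq> i'" "half i = half i'"
  shows "cartan N i i' = 1" "eta i i' * eta i' i = - 1"
  using assms unfolding half_eq by (auto simp: cartan_def eta_def)

lemma next_data:
  assumes "i \<in> {1..2 * N - 1}" "i' \<in> {1..2 * N - 1}" "i = i' + 1 \<or> i' = i + 1" "half i \<noteq> half i'"
  shows "cartan N i i' = - 1" "eta i i' * eta i' i = 1"
proof -
  have "(i = i' + 1 \<and> even i') \<or> (i' = i + 1 \<and> even i)" using assms(3,4) unfolding half_eq by auto
  then show "cartan N i i' = - 1" "eta i i' * eta i' i = 1"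
    using assms(1,2) by (auto simp: cartan_def eta_def)
qed

lemma XX_qpair:
  assumes "i \<in> {1..2 * N - 1}" "i' \<in> {1..2 * N - 1}"
  shows "qpair (XF s i e) (XF s' i' e') = of_int (sgi s * sgi s' * cartan N i i' + ypair s i s' i')"
    and "qpair (XF s' i' e') (XF s i e) = of_int (sgi s * sgi s' * cartan N i i' + ypair s i s' i')"
proof -
  show "qpair (XF s i e) (XF s' i' e') = of_int (sgi s * sgi s' * cartan N i i' + ypair s i s' i')"
    by (rule qpair_XX[OF assms])
  have "cartan N i' i = cartan N i i'" using assms by (intro cartan_sym) auto
  then show "qpair (XF s' i' e') (XF s i e) = of_int (sgi s * sgi s' * cartan N i i' + ypair s i s' i')"
    unfolding qpair_XX[OF assms(2,1)] by (simp add: ypair_def mult_ac)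
qed

lemma XX_contr:
  assumes "i \<in> {1..2 * N - 1}" "i' \<in> {1..2 * N - 1}"
  shows "contr (XF s i e) (XF s' i' e')
      (pw (sgi s * sgi s' * cartan N i i') (qpow h (- (sg s + sg s') / 2)) *
       pw (ypair s i s' i') (qpow h (of_int (yshift s' i' e' - yshift s i e))))"
    and "contr (XF s' i' e') (XF s i e)
      (pw (sgi s * sgi s' * cartan N i i') (qpow h (- (sg s + sg s') / 2)) *
       pw (ypair s i s' i') (qpow h (- of_int (yshift s' i' e' - yshift s i e))))"
proof -
  show "contr (XF s i e) (XF s' i' e')
      (pw (sgi s * sgi s' * cartan N i i') (qpow h (- (sg s + sg s') / 2)) *
       pw (ypair s i s' i') (qpow h (of_int (yshift s' i' e' - yshift s i e))))"
    by (rule contr_XX[OF assms])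
  have "cartan N i' i = cartan N i i'" using assms by (intro cartan_sym) auto
  moreover have "ypair s' i' s i = ypair s i s' i'" by (simp add: ypair_def mult.commute)
  ultimately show "contr (XF s' i' e') (XF s i e)
      (pw (sgi s * sgi s' * cartan N i i') (qpow h (- (sg s + sg s') / 2)) *
       pw (ypair s i s' i') (qpow h (- of_int (yshift s' i' e' - yshift s i e))))"
    using contr_XX[OF assms(2,1), of s' e' s e] by (simp add: mult.commute add.commute)
qed

lemma XX_far:
  assumes "i \<in> {1..2 * N - 1}" "i' \<in> {1..2 * N - 1}" "i' + 1 < i \<or> i + 1 < i'"
  shows "qpair (XF s i e) (XF s' i' e') = of_int 0" "qpair (XF s' i' e') (XF s i e) = of_int 0"
    "contr (XF s i e) (XF s' i' e') 1" "contr (XF s' i' e') (XF s i e) 1"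
    "phase (XF s' i' e') (XF s i e) = - 1"
proof -
  note d = far_data[OF assms]
  have y: "ypair s i s' i' = 0" using d(2) by (simp add: ypair_def)
  show "contr (XF s i e) (XF s' i' e') 1" "contr (XF s' i' e') (XF s i e) 1"
    using XX_contr[OF assms(1,2), where s = s and e = e and s' = s' and e' = e'] d(1) y by (simp_all add: pw_def)
  show "qpair (XF s i e) (XF s' i' e') = of_int 0" "qpair (XF s' i' e') (XF s i e) = of_int 0"
    unfolding XX_qpair[OF assms(1,2)] using d(1) y by simp_all
  show "phase (XF s' i' e') (XF s i e) = - 1"
    unfolding phase_XX[OF assms(1,2)] d(3) y by simp
qed

lemma XX_anti_far:
  assumes "i \<in> {1..2 * N - 1}" "i' \<in> {1..2 * N - 1}" "i' + 1 < i \<or> i + 1 < i'"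
  shows "V (XF s i e) m (V (XF s' i' e') n v) + V (XF s' i' e') n (V (XF s i e) m v) = 0"
  by (rule anti_one[OF XX_far(1-4)[OF assms] refl XX_far(5)[OF assms]])

text \<open>As a_ii = 0, only the c fields contract, with a simple zero at the ratio of their
  dilations.\<close>

lemma XX_anti_same:
  assumes "i \<in> {1..2 * N - 1}"
  shows "V (XF s i e) m (V (XF s i e') n v) + V (XF s i e') n (V (XF s i e) m v) = 0"
proof (rule anti_lin[OF XX_qpair[OF assms assms]])
  note d = same_data(1)[OF assms] same_data(2)[of i]
  have y: "ypair s i s i = 1" by (simp add: ypair_def ysgn_def)
  show "contr (XF s i e) (XF s i e') (1 - fps_const (qpow h (of_int (yshift s i e' - yshift s i e))) * fps_X)"
    "contr (XF s i e') (XF s i e) (1 - fps_const (inverse (qpow h (of_int (yshift s i e' - yshift s i e)))) * fps_X)"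
    using XX_contr[OF assms assms, where s = s and e = e and s' = s and e' = e'] d(1) y by (simp_all add: pw_def qpow_minus[symmetric])
  show "sgi s * sgi s * cartan N i i + ypair s i s i = 1" using d(1) y by simp
  show "phase (XF s i e') (XF s i e) = qpow h (of_int (yshift s i e' - yshift s i e))"
    unfolding phase_XX[OF assms assms] d(2) y by simp
qed simp

text \<open>With opposite signs the Cartan entry -1 becomes a simple zero, and the two values of
  \<kappa> cancel, which places it at z = w.\<close>

lemma XX_anti_next:
  assumes "i \<in> {1..2 * N - 1}" "i' \<in> {1..2 * N - 1}" "i = i' + 1 \<or> i' = i + 1" "half i \<noteq> half i'" "s \<noteq> s'"
  shows "V (XF s i e) m (V (XF s' i' e') n v) + V (XF s' i' e') n (V (XF s i e) m v) = 0"
proof (rule anti_lin[OF XX_qpair[OF assms(1,2)], where a = 1])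
  note d = next_data[OF assms(1-4)]
  have y: "ypair s i s' i' = 0" using assms(4) by (simp add: ypair_def)
  have ss: "sgi s * sgi s' = - 1" "sg s + sg s' = 0" using assms(5) by (cases s; cases s'; simp)+
  show "contr (XF s i e) (XF s' i' e') (1 - fps_const 1 * fps_X)" "contr (XF s' i' e') (XF s i e) (1 - fps_const (inverse 1) * fps_X)"
    using XX_contr[OF assms(1,2), where s = s and e = e and s' = s' and e' = e'] d(1) y ss by (simp_all add: pw_def)
  show "sgi s * sgi s' * cartan N i i' + ypair s i s' i' = 1" using d(1) y ss by simp
  show "phase (XF s' i' e') (XF s i e) = 1"
    unfolding phase_XX[OF assms(1,2)] d(2) y by simp
qed simp

text \<open>The noncontracting neighbour of \<open>i\<close>: the two currents involve different fields \<open>c\<^sup>k\<close>.\<close>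

lemma XX_next:
  assumes "i \<in> {1..2 * N - 1}" "i' \<in> {1..2 * N - 1}" "i = i' + 1 \<or> i' = i + 1" "half i \<noteq> half i'"
  shows "qpair (XF s i e) (XF s i' e') = of_int (- 1)" "qpair (XF s i' e') (XF s i e) = of_int (- 1)"
    "contr (XF s i e) (XF s i' e') (geo (qpow h (- sg s)))" "contr (XF s i' e') (XF s i e) (geo (qpow h (- sg s)))"
    "phase (XF s i' e') (XF s i e) = 1"
proof -
  note d = next_data[OF assms]
  have y: "ypair s i s i' = 0" using assms(4) by (simp add: ypair_def)
  show "qpair (XF s i e) (XF s i' e') = of_int (- 1)" "qpair (XF s i' e') (XF s i e) = of_int (- 1)"
    unfolding XX_qpair[OF assms(1,2)] using d(1) y by simp_all
  show "contr (XF s i e) (XF s i' e') (geo (qpow h (- sg s)))" "contr (XF s i' e') (XF s i e) (geo (qpow h (- sg s)))"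
    using XX_contr[OF assms(1,2), where s = s and e = e and s' = s and e' = e'] d(1) y by (simp_all add: pw_def)
  show "phase (XF s i' e') (XF s i e) = 1"
    unfolding phase_XX[OF assms(1,2)] d(2) y by simp
qed

lemma XX_next_rel:
  assumes "i \<in> {1..2 * N - 1}" "i' \<in> {1..2 * N - 1}" "i = i' + 1 \<or> i' = i + 1" "half i \<noteq> half i'"
  shows "V (XF s i e) (m - 1) (V (XF s i' e') n v) - cscale (qpow h (- sg s)) (V (XF s i e) m (V (XF s i' e') (n - 1) v))
    + (cscale (qpow h (- sg s)) (V (XF s i' e') n (V (XF s i e) (m - 1) v)) - V (XF s i' e') (n - 1) (V (XF s i e) m v)) = 0"
proof -
  note d = XX_next[OF assms, where s = s and e = e and e' = e']
  have "V (XF s i e) (m - 1) (V (XF s i' e') n v) - cscale (qpow h (- sg s)) (V (XF s i e) m (V (XF s i' e') (n - 1) v)) =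
     Ins (XF s i' e') (V (XF s i e) (m - 1)) n v"
    using VV_geo_left[OF d(3), of "m - 1" n v] by simp
  moreover have "V (XF s i' e') (n - 1) (V (XF s i e) m v) - cscale (qpow h (- sg s)) (V (XF s i' e') n (V (XF s i e) (m - 1) v)) =
     Ins (XF s i' e') (V (XF s i e) (m - 1)) n v"
    using VV_geo_right[OF d(1,2,4), of "n - 1" m v] d(5) by simp
  ultimately show ?thesis by (rule add_diff_eq_0)
qed

text \<open>The contracting neighbour of \<open>i\<close>, with the same field \<open>c\<^sup>k\<close>.  The factor of \<open>Y\<close> cancels the numerator
  of the contraction in one of the two orders; \<open>regular\<close> says that this is the order with \<open>i\<close> to the left.\<close>

definition regular :: "pm \<Rightarrow> nat \<Rightarrow> int \<Rightarrow> nat \<Rightarrow> int \<Rightarrow> bool" where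
  "regular s i e i' e' \<longleftrightarrow> yshift s i' e' - yshift s i e = - sgi s"

lemma yshift_near:
  assumes "i \<noteq> i'" "half i = half i'" "e \<in> terms s i" "e' \<in> terms s i'"
  shows "yshift s i' e' - yshift s i e \<in> {1, - 1}"
proof -
  have "ctype s i \<noteq> ctype s i'" using assms(1,2) unfolding half_eq ctype_def by auto
  then show ?thesis using assms(3,4) by (auto simp: yshift_def terms_def)
qed

lemma XX_near:
  assumes "i \<in> {1..2 * N - 1}" "i' \<in> {1..2 * N - 1}" "i \<noteq> i'" "half i = half i'" "e \<in> terms s i" "e' \<in> terms s i'"
  shows "qpair (XF s i e) (XF s i' e') = of_int 0" "qpair (XF s i' e') (XF s i e) = of_int 0"
    "regular s i e i' e' \<Longrightarrow> contr (XF s i e) (XF s i' e') 1"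
    "regular s i e i' e' \<Longrightarrow> contr (XF s i' e') (XF s i e) ((1 - fps_const (qpow h (- sg s)) * fps_X) * geo (qpow h (sg s)))"
    "regular s i e i' e' \<Longrightarrow> phase (XF s i' e') (XF s i e) = - qpow h (sg s)"
    "\<not> regular s i e i' e' \<Longrightarrow> contr (XF s i e) (XF s i' e') ((1 - fps_const (qpow h (- sg s)) * fps_X) * geo (qpow h (sg s)))"
    "\<not> regular s i e i' e' \<Longrightarrow> contr (XF s i' e') (XF s i e) 1"
    "\<not> regular s i e i' e' \<Longrightarrow> phase (XF s i' e') (XF s i e) = - qpow h (- sg s)"
proof -
  note d = near_data[OF assms(1-4)]
  have "ctype s i \<noteq> ctype s i'" using assms(3,4) unfolding half_eq ctype_def by auto
  then have y: "ypair s i s i' = - 1" using assms(4) by (auto simp: ypair_def ysgn_def)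
  show "qpair (XF s i e) (XF s i' e') = of_int 0" "qpair (XF s i' e') (XF s i e) = of_int 0"
    unfolding XX_qpair[OF assms(1,2)] using d(1) y by simp_all
  note c = XX_contr[OF assms(1,2), where s = s and e = e and s' = s and e' = e', unfolded d(1) y]
  note p = phase_XX[OF assms(1,2), of s e' s e, unfolded d(2) y]
  have g: "(1 - fps_const (qpow h x) * fps_X) * geo (qpow h x) = 1" for x by (rule geo_mult)
  have sh: "- (sg s + sg s) / 2 = - sg s" by simp
  {
    assume "regular s i e i' e'"
    then have r: "yshift s i' e' - yshift s i e = - sgi s" by (simp add: regular_def)
    show "contr (XF s i e) (XF s i' e') 1"
      using c(1) unfolding r sh by (simp add: pw_def sg_sgi g)
    show "contr (XF s i' e') (XF s i e) ((1 - fps_const (qpow h (- sg s)) * fps_X) * geo (qpow h (sg s)))"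
      using c(2) unfolding r sh by (simp add: pw_def sg_sgi)
    show "phase (XF s i' e') (XF s i e) = - qpow h (sg s)"
      using p unfolding r by (simp add: sg_sgi)
  next
    assume "\<not> regular s i e i' e'"
    then have r: "yshift s i' e' - yshift s i e = sgi s"
      using yshift_near[OF assms(3-6)] unfolding regular_def by (cases s) auto
    show "contr (XF s i e) (XF s i' e') ((1 - fps_const (qpow h (- sg s)) * fps_X) * geo (qpow h (sg s)))"
      using c(1) unfolding r sh by (simp add: pw_def sg_sgi)
    show "contr (XF s i' e') (XF s i e) 1"
      using c(2) unfolding r sh by (simp add: pw_def sg_sgi g)
    show "phase (XF s i' e') (XF s i e) = - qpow h (- sg s)"
      using p unfolding r by (simp add: sg_sgi)
  }
qed

lemma XX_near_rel:
  assumes "i \<in> {1..2 * N - 1}" "i' \<in> {1..2 * N - 1}" "i \<noteq> i'" "half i = half i'" "e \<in> terms s i" "e' \<in> terms s i'"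
  shows "V (XF s i e) (m - 1) (V (XF s i' e') n v) - cscale (qpow h (sg s)) (V (XF s i e) m (V (XF s i' e') (n - 1) v))
    + (cscale (qpow h (sg s)) (V (XF s i' e') n (V (XF s i e) (m - 1) v)) - V (XF s i' e') (n - 1) (V (XF s i e) m v)) = 0"
proof -
  note d = XX_near[OF assms]
  let ?X = "V (XF s i e)" and ?Y = "V (XF s i' e')" and ?u = "qpow h (sg s)" and ?I = "\<lambda>m n. Ins (XF s i' e') (V (XF s i e) m) n v"
  have u: "?u * qpow h (- sg s) = 1" "qpow h (- sg s) * ?u = 1" by (simp_all add: qpow_add[symmetric])
  show ?thesis
  proof (cases "regular s i e i' e'")
    case True
    have F: "?X m (?Y n v) = ?I m n" for m n by (rule VV_one_left[OF d(3)[OF True]])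
    have G: "?Y (n - 1) (?X m v) - cscale ?u (?Y n (?X (m - 1) v)) = cscale (- ?u) (?I m (n - 1)) + ?I (m - 1) n"
      using VV_ratio_right[OF d(1,2) d(4)[OF True], of "n - 1" m v] u
      by (simp add: d(5)[OF True] fv.scale_right_diff_distrib)
    have "?X (m - 1) (?Y n v) - cscale ?u (?X m (?Y (n - 1) v)) + (cscale ?u (?Y n (?X (m - 1) v)) - ?Y (n - 1) (?X m v)) =
       (?I (m - 1) n - cscale ?u (?I m (n - 1))) - (?Y (n - 1) (?X m v) - cscale ?u (?Y n (?X (m - 1) v)))"
      unfolding F by simp
    also have "\<dots> = 0" unfolding G by simp
    finally show ?thesis .
  next
    case False
    have G: "?Y n (?X m v) = cscale (- qpow h (- sg s)) (?I m n)" for m n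
      using VV_one_right[OF d(1,2) d(7)[OF False], of n m v] by (simp add: d(8)[OF False])
    have F: "?X (m - 1) (?Y n v) - cscale ?u (?X m (?Y (n - 1) v)) = ?I (m - 1) n - cscale (qpow h (- sg s)) (?I m (n - 1))"
      using VV_ratio_left[OF d(6)[OF False], of "m - 1" n v] by simp
    show ?thesis unfolding F G using u by simp
  qed
qed

subsection \<open>The relations (R6) and (R7)\<close>

lemma X_cur_X_cur:
  assumes "i \<in> {1..2 * N - 1}" "i' \<in> {1..2 * N - 1}"
  shows "X_cur h N s i m (X_cur h N s' i' n v) = (\<Sum>e\<in>terms s i. \<Sum>e'\<in>terms s' i'.
    cscale (xcoef s i e * xcoef s' i' e') (V (XF s i e) (m + xexp s i) (V (XF s' i' e') (n + xexp s' i') v)))"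
  unfolding X_cur_expand[OF assms(1)] X_cur_expand[OF assms(2)]
  by (simp add: clin_sum clin_scale fv.scale_sum_right)

text \<open>Summed in the same order and with the same coefficients as \<open>X_cur_X_cur\<close>,
  so that relations between single terms add up.\<close>

lemma X_cur_X_cur':
  assumes "i \<in> {1..2 * N - 1}" "i' \<in> {1..2 * N - 1}"
  shows "X_cur h N s' i' n (X_cur h N s i m v) = (\<Sum>e\<in>terms s i. \<Sum>e'\<in>terms s' i'.
    cscale (xcoef s i e * xcoef s' i' e') (V (XF s' i' e') (n + xexp s' i') (V (XF s i e) (m + xexp s i) v)))"
  unfolding X_cur_X_cur[OF assms(2,1)] by (subst sum.swap) (simp add: mult.commute)

lemma X_X_anti:
  assumes "i \<in> {1..2 * N - 1}" "i' \<in> {1..2 * N - 1}"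
    and "\<And>e e' m n. V (XF s i e) m (V (XF s' i' e') n v) + V (XF s' i' e') n (V (XF s i e) m v) = 0"
  shows "X_cur h N s i m (X_cur h N s' i' n v) + X_cur h N s' i' n (X_cur h N s i m v) = 0"
  unfolding X_cur_X_cur[OF assms(1,2)] X_cur_X_cur'[OF assms(1,2)]
  by (simp add: sum.distrib[symmetric] fv.scale_right_distrib[symmetric] assms(3))

lemma index_cases:
  fixes i i' :: nat
  obtains "i' + 1 < i \<or> i + 1 < i'" | "i = i'" | "i \<noteq> i'" "half i = half i'"
    | "i = i' + 1 \<or> i' = i + 1" "half i \<noteq> half i'"
  by fastforce

lemma X_X_zero_rel:
  assumes "i \<in> {1..2 * N - 1}" "i' \<in> {1..2 * N - 1}" "cartan N i i' = 0"
  shows "X_cur h N s i m (X_cur h N s i' n v) + X_cur h N s i' n (X_cur h N s i m v) = 0"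
proof (rule X_X_anti[OF assms(1,2)])
  fix e e' m n
  show "V (XF s i e) m (V (XF s i' e') n v) + V (XF s i' e') n (V (XF s i e) m v) = 0"
  proof (cases rule: index_cases[of i' i])
    case 1
    then show ?thesis by (rule XX_anti_far[OF assms(1,2)])
  next
    case 2
    then show ?thesis using XX_anti_same[OF assms(1)] by simp
  next
    case 3
    then show ?thesis using near_data[OF assms(1,2)] assms(3) by simp
  next
    case 4
    then show ?thesis using next_data[OF assms(1,2)] assms(3) by simp
  qed
qed

lemma X_X_rel:
  fixes s :: pm
  assumes i: "i \<in> {1..2 * N - 1}" "i' \<in> {1..2 * N - 1}"
  defines "qa \<equiv> qpow h (sg s * of_int (cartan N i i'))"
  shows "X_cur h N s i (m - 1) (X_cur h N s i' n v) - cscale qa (X_cur h N s i m (X_cur h N s i' (n - 1) v))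
        + (cscale qa (X_cur h N s i' n (X_cur h N s i (m - 1) v)) - X_cur h N s i' (n - 1) (X_cur h N s i m v)) = 0"
proof (cases "cartan N i i' = 0")
  case True
  \<comment> \<open>For a vanishing Cartan entry, (R7) is a difference of two instances of
    (R6).\<close>
  have a: "X_cur h N s i' n (X_cur h N s i m v) = - X_cur h N s i m (X_cur h N s i' n v)" for m n
    using X_X_zero_rel[OF i True, of s m n v] by (simp add: eq_neg_iff_add_eq_0 add.commute)
  show ?thesis unfolding a qa_def True by simp
next
  case False
  have rel: "V (XF s i e) (m - 1) (V (XF s i' e') n v) - cscale qa (V (XF s i e) m (V (XF s i' e') (n - 1) v))
    + (cscale qa (V (XF s i' e') n (V (XF s i e) (m - 1) v)) - V (XF s i' e') (n - 1) (V (XF s i e) m v)) = 0"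
    if "e \<in> terms s i" "e' \<in> terms s i'" for e e' m n
  proof (cases rule: index_cases[of i' i])
    case 1
    then show ?thesis using far_data[OF i] False by simp
  next
    case 2
    then show ?thesis using same_data(1)[OF i(1)] False by simp
  next
    case 3
    then have "qa = qpow h (sg s)" using near_data[OF i] by (simp add: qa_def)
    then show ?thesis using XX_near_rel[OF i 3 that] by simp
  next
    case 4
    then have "qa = qpow h (- sg s)" using next_data[OF i] by (simp add: qa_def)
    then show ?thesis using XX_next_rel[OF i 4] by simp
  qed
  have "X_cur h N s i (m - 1) (X_cur h N s i' n v) - cscale qa (X_cur h N s i m (X_cur h N s i' (n - 1) v))
        + (cscale qa (X_cur h N s i' n (X_cur h N s i (m - 1) v)) - X_cur h N s i' (n - 1) (X_cur h N s i m v)) =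
     (\<Sum>e\<in>terms s i. \<Sum>e'\<in>terms s i'. cscale (xcoef s i e * xcoef s i' e')
       (V (XF s i e) (m + xexp s i - 1) (V (XF s i' e') (n + xexp s i') v) - cscale qa (V (XF s i e) (m + xexp s i) (V (XF s i' e') (n + xexp s i' - 1) v))
    + (cscale qa (V (XF s i' e') (n + xexp s i') (V (XF s i e) (m + xexp s i - 1) v)) - V (XF s i' e') (n + xexp s i' - 1) (V (XF s i e) (m + xexp s i) v))))"
    unfolding X_cur_X_cur[OF i] X_cur_X_cur'[OF i]
    by (simp add: sum.distrib[symmetric] sum_subtractf[symmetric] fv.scale_right_distrib fv.scale_right_diff_distrib
        fv.scale_sum_right mult_ac algebra_simps)
  also have "\<dots> = 0" by (intro sum.neutral ballI) (simp add: rel)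
  finally show ?thesis .
qed

end

lemma qpow_powi: "qpow h x powi k = qpow h (x * of_int k)"
proof (cases "k \<ge> 0")
  case True
  then obtain n where "k = int n" by (metis nonneg_int_cases)
  then show ?thesis by (simp add: qpow_mult_nat)
next
  case False
  then obtain n where "k = - int n" by (metis int_cases4 of_nat_0_le_iff)
  then show ?thesis by (simp add: power_int_minus qpow_mult_nat[symmetric] qpow_minus)
qed

context currents
begin

subsection \<open>The relation (R5)\<close>

text \<open>The exponent of z in an odd current is, up to signs, a sum of two neighbouring a
  eigenvalues plus one c eigenvalue; \<open>states\<close> makes both integers.\<close>

lemma integral_XF:
  assumes "i \<in> {1..2 * N - 1}" "v \<in> fock N"
  shows "integral (XF s i e) v"
  unfolding integral_def
proof
  fix k assume "k \<in> Poly_Mapping.keys v"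
  then have k: "k \<in> states N" using assms(2) by (auto simp: fock_def)
  obtain p M where pM: "k = (p, M)" by (cases k)
  have i: "i \<noteq> 2 * N" "i \<in> {1..2 * N}" "i + 1 \<in> {1..2 * N}" using assms by auto
  have "(\<Sum>b\<in>bosons N. XF s i e (LogZ b) * p b) = sg s * (\<Sum>j = 1..2 * N. Acoef h N i 0 (Ab j) * p (Ab j)) +
     (\<Sum>l = 1..N. (of_int (ysgn s i) * p (Cb l)) * of_bool (l = half i))"
    unfolding sum_bosons by (simp add: sum_distrib_left mult_ac)
  also have "(\<Sum>j = 1..2 * N. Acoef h N i 0 (Ab j) * p (Ab j)) =
     (\<Sum>j = 1..2 * N. of_bool (j = i) * ((- 1) ^ (i + 1) * p (Ab j))) + (\<Sum>j = 1..2 * N. of_bool (j = i + 1) * ((- 1) ^ (i + 1) * p (Ab j)))"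
    unfolding sum.distrib[symmetric] by (rule sum.cong[OF refl]) (simp add: Acoef_Ab i ring_distribs)
  also have "\<dots> = (- 1) ^ (i + 1) * (p (Ab i) + p (Ab (i + 1)))"
    unfolding sum_pick[OF i(2)] sum_pick[OF i(3)] by (simp add: distrib_left)
  finally have "(\<Sum>b\<in>bosons N. XF s i e (LogZ b) * p b) = sg s * ((- 1) ^ (i + 1) * (p (Ab i) + p (Ab (i + 1)))) + of_int (ysgn s i) * p (Cb (half i))"
    unfolding sum_Cb[OF half_range[OF assms(1)]] .
  moreover have "p (Ab i) + p (Ab (i + 1)) \<in> \<int>" "p (Cb (half i)) \<in> \<int>"
    using k assms(1) half_range[OF assms(1)] by (auto simp: states_def pM)
  moreover have "sg s \<in> \<int>" by (cases s) auto
  ultimately show "(\<Sum>b\<in>bosons N. XF s i e (LogZ b) * fst k b) \<in> \<int>"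
    by (simp add: pM Ints_add Ints_mult Ints_power)
qed

text \<open>Each pair of terms contributes a delta function at z = w, and the residues cancel in the
  sum. If both factors Y are single exponentials the residue is 0. If both are differences, equal
  dilations have residue 0, while the two mixed pairs have the same fused field and opposite
  residues.\<close>

lemma X_plus_X_minus_near:
  assumes i: "i \<in> {1..2 * N - 1}" "i' \<in> {1..2 * N - 1}" "i \<noteq> i'" "half i = half i'" and v: "v \<in> fock N"
  shows "X_cur h N Plus i m (X_cur h N Minus i' n v) + X_cur h N Minus i' n (X_cur h N Plus i m v) = 0"
proof -
  note d = near_data[OF i]
  have ct: "ctype Plus i = ctype Minus i'" using i(3,4) unfolding half_eq ctype_def by auto
  have y: "ypair Plus i Minus i' = 1" using i(4) ct by (simp add: ypair_def ysgn_def)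
  define U where "U e e' M = V (\<lambda>y. XF Plus i e y + XF Minus i' e' y) M v" for e e' M
  have FG: "V (XF Plus i e) m (V (XF Minus i' e') n v) + V (XF Minus i' e') n (V (XF Plus i e) m v) =
     cscale ((qpow h (of_int (yshift Plus i e)) - qpow h (of_int (yshift Minus i' e'))) * eta i i') (U e e' (m + n))" for e e' m n
  proof -
    let ?x = "of_int (yshift Minus i' e' - yshift Plus i e)"
    have "V (XF Plus i e) m (V (XF Minus i' e') n v) + V (XF Minus i' e') n (V (XF Plus i e) m v) =
      cscale ((1 - qpow h ?x) * exp (zpair (XF Plus i e) (XF Minus i' e'))) (U e e' (m + n))"
      unfolding U_def
    proof (rule delta_ratio[OF XX_qpair[OF i(1,2)]])
      show "contr (XF Plus i e) (XF Minus i' e') ((1 - fps_const (qpow h ?x) * fps_X) * geo 1)"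
        "contr (XF Minus i' e') (XF Plus i e) ((1 - fps_const (inverse (qpow h ?x)) * fps_X) * geo 1)"
        using XX_contr[OF i(1,2), where s = Plus and e = e and s' = Minus and e' = e'] d(1) y
        by (simp_all add: pw_def mult.commute qpow_minus[symmetric])
      show "sgi Plus * sgi Minus * cartan N i i' + ypair Plus i Minus i' = 0" using d(1) y by simp
      show "phase (XF Minus i' e') (XF Plus i e) = - qpow h ?x"
        unfolding phase_XX[OF i(1,2)] d(2) y by simp
      show "integral (XF Minus i' e') v" by (rule integral_XF[OF i(2) v])
    qed simp
    moreover have "(1 - qpow h ?x) * exp (zpair (XF Plus i e) (XF Minus i' e')) =
      (qpow h (of_int (yshift Plus i e)) - qpow h (of_int (yshift Minus i' e'))) * eta i i'"
      unfolding exp_zpair_XX[OF i(1,2)] y by (simp add: qpow_diff field_simps)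
    ultimately show ?thesis by simp
  qed
  have "X_cur h N Plus i m (X_cur h N Minus i' n v) + X_cur h N Minus i' n (X_cur h N Plus i m v) =
    (\<Sum>e\<in>terms Plus i. \<Sum>e'\<in>terms Minus i'. cscale (xcoef Plus i e * xcoef Minus i' e')
      (V (XF Plus i e) (m + xexp Plus i) (V (XF Minus i' e') (n + xexp Minus i') v) +
       V (XF Minus i' e') (n + xexp Minus i') (V (XF Plus i e) (m + xexp Plus i) v)))"
    unfolding X_cur_X_cur[OF i(1,2)] X_cur_X_cur'[OF i(1,2)] by (simp add: sum.distrib fv.scale_right_distrib)
  also have "\<dots> = 0"
  proof (cases "ctype Plus i")
    case True
    then show ?thesis using ct unfolding FG by (simp add: terms_def yshift_def)
  next
    case False
    then have False': "\<not> ctype Minus i'" using ct by simp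
    have "(\<lambda>y. XF Plus i 1 y + XF Minus i' (- 1) y) = (\<lambda>y. XF Plus i (- 1) y + XF Minus i' 1 y)"
    proof
      fix y show "XF Plus i 1 y + XF Minus i' (- 1) y = XF Plus i (- 1) y + XF Minus i' 1 y"
        using i(4) False False' by (cases y) (simp_all add: yshift_def ysgn_def)
    qed
    then have U: "U 1 (- 1) M = U (- 1) 1 M" for M by (simp add: U_def)
    have "cscale a (cscale b w) + cscale a (cscale (- b) w) = 0" for a b w
      by (simp add: fv.scale_left_distrib[symmetric])
    then show ?thesis unfolding FG using False False'
      by (simp add: terms_def yshift_def xcoef_def U fv.scale_left_distrib[symmetric])
         (rule poly_mapping_eqI, simp add: field_simps)
  qed
  finally show ?thesis .
qed

definition sgn_pm :: "int \<Rightarrow> pm" where "sgn_pm x = (if x = 1 then Plus else Minus)"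

text \<open>At the pole z = q^x w the c fields and the factors F cancel, and H^i(q^x w; -1/2) -
  H^i(w; 1/2) is the exponent of \<psi>^+ or \<psi>^-, according to the sign of x, dilated by half a
  step.\<close>

lemma fused_field:
  assumes "i \<in> {1..2 * N - 1}" "e \<in> terms Plus i" "e' \<in> terms Minus i"
  defines "x \<equiv> yshift Minus i e' - yshift Plus i e"
  shows "(\<lambda>y. bdilate h (of_int x) (XF Plus i e) y + XF Minus i e' y) = bdilate h (of_int x / 2) (Hpm h N (sgn_pm x) i)"
    and "x \<in> {1, - 1}"
proof -
  have ct: "ctype Plus i \<longleftrightarrow> \<not> ctype Minus i" by (simp add: ctype_def)
  show x: "x \<in> {1, - 1}" using assms(2,3) ct by (auto simp: x_def terms_def yshift_def)
  have ys: "ysgn Plus i = - ysgn Minus i" using ct by (simp add: ysgn_def)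
  have sx: "sg (sgn_pm x) = of_int x" using x by (auto simp: sgn_pm_def)
  \<comment> \<open>x is the dilation that aligns the two c fields, so the constants of their zero
    modes cancel.\<close>
  have zero: "ysgn Plus i * yshift Plus i e + x * ysgn Plus i + ysgn Minus i * yshift Minus i e' = 0"
    unfolding x_def ys by (simp add: algebra_simps)
  show "(\<lambda>y. bdilate h (of_int x) (XF Plus i e) y + XF Minus i e' y) = bdilate h (of_int x / 2) (Hpm h N (sgn_pm x) i)"
  proof
    fix y
    show "bdilate h (of_int x) (XF Plus i e) y + XF Minus i e' y = bdilate h (of_int x / 2) (Hpm h N (sgn_pm x) i) y"
    proof (cases y)
      case (QQ b)
      then show ?thesis by (simp add: ys)
    next
      case (LogZ b)
      then show ?thesis by (simp add: ys)
    next
      case (Zero b)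
      have "of_int (ysgn Plus i) * of_int (yshift Plus i e) + of_int x * of_int (ysgn Plus i) + of_int (ysgn Minus i) * of_int (yshift Minus i e') = (0 :: complex)"
        using arg_cong[OF zero, of "of_int :: int \<Rightarrow> complex"] by simp
      then have "h * of_bool (b = Cb (half i)) * (of_int (ysgn Plus i) * of_int (yshift Plus i e) + of_int x * of_int (ysgn Plus i) + of_int (ysgn Minus i) * of_int (yshift Minus i e')) = (0 :: complex)"
        by simp
      then show ?thesis using Zero by (simp add: sx algebra_simps)
    next
      case (Mode b n)
      show ?thesis
      proof (cases "n = 0")
        case True
        then show ?thesis using Mode by (simp add: Hpm_def)
      next
        case False
        let ?A = "Acoef h N i n b / qnum h (of_int n)" and ?B = "of_bool (b = Cb (half i)) / qnum h (of_int n)"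
        have e1: "qpow h (- of_int x * of_int n) * qpow h (- of_int (yshift Plus i e) * of_int n) = qpow h (- of_int (yshift Minus i e') * of_int n)"
          unfolding qpow_add[symmetric] x_def by (simp add: algebra_simps)
        have e2: "qpow h (- (of_int x / 2) * of_int n) * qpow h (- (of_int x / 2) * of_int n) = qpow h (- of_int x * of_int n)"
          "qpow h (- (of_int x / 2) * of_int n) * qpow h (of_int x / 2 * of_int n) = 1"
          unfolding qpow_add[symmetric] by (simp_all add: algebra_simps)
        have "bdilate h (of_int x) (XF Plus i e) y + XF Minus i e' y =
           - ?A * (qpow h (- of_int x * of_int n) * qpow h (- 1 / 2 * of_int \<bar>n\<bar>)) + ?A * qpow h (1 / 2 * of_int \<bar>n\<bar>)
           - of_int (ysgn Plus i) * ?B * (qpow h (- of_int x * of_int n) * qpow h (- of_int (yshift Plus i e) * of_int n))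
           - of_int (ysgn Minus i) * ?B * qpow h (- of_int (yshift Minus i e') * of_int n)"
          using Mode False by (simp add: algebra_simps)
        also have "\<dots> = - ?A * (qpow h (- of_int x * of_int n) * qpow h (- 1 / 2 * of_int \<bar>n\<bar>)) + ?A * qpow h (1 / 2 * of_int \<bar>n\<bar>)"
          unfolding e1 ys by simp
        also have "\<dots> = bdilate h (of_int x / 2) (Hpm h N (sgn_pm x) i) y"
        proof -
          have "bdilate h (of_int x / 2) (Hpm h N (sgn_pm x) i) y =
             - ?A * (qpow h (- (of_int x / 2) * of_int n) * qpow h (- (of_int x / 2) * of_int n) * qpow h (- 1 / 2 * of_int \<bar>n\<bar>))
             + ?A * (qpow h (- (of_int x / 2) * of_int n) * qpow h (of_int x / 2 * of_int n) * qpow h (1 / 2 * of_int \<bar>n\<bar>))"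
            using Mode False by (simp add: Hpm_def sx algebra_simps)
          then show ?thesis unfolding e2 by simp
        qed
        finally show ?thesis .
      qed
    qed
  qed
qed

text \<open>The exponent collects the position of the delta function, the remaining zero mode
  constant and the half step from \<open>fused_field\<close>.\<close>

lemma XX_delta:
  assumes i: "i \<in> {1..2 * N - 1}" "e \<in> terms Plus i" "e' \<in> terms Minus i" and v: "v \<in> fock N"
  defines "x \<equiv> yshift Minus i e' - yshift Plus i e"
  shows "V (XF Plus i e) m (V (XF Minus i e') n v) + V (XF Minus i e') n (V (XF Plus i e) m v) =
     cscale (qpow h (- of_int x * of_int m - of_int (yshift Minus i e') + of_int x / 2 * of_int (m + n + 1))) (V (Hpm h N (sgn_pm x) i) (m + n + 1) v)"
proof -
  have ct: "ctype Plus i \<longleftrightarrow> \<not> ctype Minus i" by (simp add: ctype_def)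
  have y: "ypair Plus i Minus i = - 1" using ct by (simp add: ypair_def ysgn_def)
  note c = same_data(1)[OF i(1)]
  have q: "qpair (XF Plus i e) (XF Minus i e') = - 1" unfolding XX_qpair[OF i(1,1)] c y by simp
  have "V (XF Plus i e) m (V (XF Minus i e') n v) + V (XF Minus i e') n (V (XF Plus i e) m v) =
    cscale (qpow h (- of_int x * of_int m) * exp (zpair (bdilate h (of_int x) (XF Plus i e)) (XF Minus i e')))
      (V (\<lambda>y. bdilate h (of_int x) (XF Plus i e) y + XF Minus i e' y) (m + n + 1) v)"
  proof (rule delta_geo[OF XX_qpair[OF i(1,1)]])
    show "contr (XF Plus i e) (XF Minus i e') (geo (qpow h (of_int x)))" "contr (XF Minus i e') (XF Plus i e) (geo (qpow h (- of_int x)))"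
      using XX_contr[OF i(1,1), where s = Plus and e = e and s' = Minus and e' = e'] c y by (simp_all add: pw_def x_def)
    show "sgi Plus * sgi Minus * cartan N i i + ypair Plus i Minus i = - 1" using c y by simp
    show "phase (XF Minus i e') (XF Plus i e) = qpow h (- of_int x)"
      unfolding phase_XX[OF i(1,1)] same_data(2) y by (simp add: x_def)
    show "integral (XF Minus i e') v" by (rule integral_XF[OF i(1) v])
  qed
  also have "exp (zpair (bdilate h (of_int x) (XF Plus i e)) (XF Minus i e')) = qpow h (- of_int (yshift Minus i e'))"
  proof -
    have "zpair (bdilate h (of_int x) (XF Plus i e)) (XF Minus i e') = zpair (XF Plus i e) (XF Minus i e') + of_int x * h * qpair (XF Plus i e) (XF Minus i e')"
      unfolding zpair_def qpair_def sum_distrib_left sum.distrib[symmetric] by (rule sum.cong[OF refl]) (simp add: ring_distribs mult_ac)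
    moreover have "eta i i = 1" by (simp add: eta_def)
    ultimately have "exp (zpair (bdilate h (of_int x) (XF Plus i e)) (XF Minus i e')) =
       exp (zpair (XF Plus i e) (XF Minus i e')) * qpow h (- of_int x)"
      unfolding q exp_add qpow_def by (simp add: exp_diff exp_minus divide_inverse mult.commute)
    also have "\<dots> = qpow h (- of_int (yshift Minus i e'))"
      unfolding exp_zpair_XX[OF i(1,1)] y \<open>eta i i = 1\<close> by (simp add: qpow_add[symmetric] x_def)
    finally show ?thesis .
  qed
  also have "V (\<lambda>y. bdilate h (of_int x) (XF Plus i e) y + XF Minus i e' y) (m + n + 1) v =
     cscale (qpow h (of_int x / 2 * of_int (m + n + 1))) (V (Hpm h N (sgn_pm x) i) (m + n + 1) v)"
    using fused_field(1)[OF i] by (simp add: x_def V_bdilate)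
  finally show ?thesis by (simp add: qpow_add[symmetric] algebra_simps)
qed

text \<open>Exactly one of the two currents has a difference as its factor Y. Its two terms put the
  pole at z = q w and z = w / q, which yields \<psi>^+ and \<psi>^- with opposite signs and the
  coefficient 1 / (q - 1/q).\<close>

lemma X_plus_X_minus_same:
  assumes i: "i \<in> {1..2 * N - 1}" and v: "v \<in> fock N"
  shows "X_cur h N Plus i m (X_cur h N Minus i n v) + X_cur h N Minus i n (X_cur h N Plus i m v) =
    cscale (1 / qd) (cscale (qpow h (- of_int (m + 1) + of_int (m + n + 2) / 2)) (psi_cur h N Plus i (m + n + 2) v)
       - cscale (qpow h (of_int (m + 1) - of_int (m + n + 2) / 2)) (psi_cur h N Minus i (m + n + 2) v))"
proof -
  have ct: "ctype Plus i \<longleftrightarrow> \<not> ctype Minus i" by (simp add: ctype_def)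
  have "X_cur h N Plus i m (X_cur h N Minus i n v) + X_cur h N Minus i n (X_cur h N Plus i m v) =
    (\<Sum>e\<in>terms Plus i. \<Sum>e'\<in>terms Minus i. cscale (xcoef Plus i e * xcoef Minus i e')
      (V (XF Plus i e) (m + xexp Plus i) (V (XF Minus i e') (n + xexp Minus i) v) +
       V (XF Minus i e') (n + xexp Minus i) (V (XF Plus i e) (m + xexp Plus i) v)))"
    unfolding X_cur_X_cur[OF i i, where s = Plus] X_cur_X_cur'[OF i i, where s = Plus] by (simp add: sum.distrib fv.scale_right_distrib)
  also have "\<dots> = (\<Sum>e\<in>terms Plus i. \<Sum>e'\<in>terms Minus i. cscale (xcoef Plus i e * xcoef Minus i e')
     (let x = yshift Minus i e' - yshift Plus i e in
       cscale (qpow h (- of_int x * of_int (m + 1) + of_int x / 2 * of_int (m + n + 2))) (V (Hpm h N (sgn_pm x) i) (m + n + 2) v)))"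
  proof (intro sum.cong refl)
    fix e e' assume e: "e \<in> terms Plus i" "e' \<in> terms Minus i"
    define x where "x = yshift Minus i e' - yshift Plus i e"
    have "xexp Plus i + xexp Minus i = 1" using ct by (simp add: xexp_def)
    then have m1: "m + xexp Plus i + (n + xexp Minus i) + 1 = m + n + 2" by simp
    \<comment> \<open>The index shift due to 1 / z and the dilation constant compensate, so both
      parities of i give the same exponent.\<close>
    have m2: "- of_int x * of_int (m + xexp Plus i) - of_int (yshift Minus i e') = (- of_int x * of_int (m + 1) :: complex)"
      using ct by (cases "ctype Plus i") (simp_all add: xexp_def x_def yshift_def algebra_simps)
    show "cscale (xcoef Plus i e * xcoef Minus i e')
      (V (XF Plus i e) (m + xexp Plus i) (V (XF Minus i e') (n + xexp Minus i) v) +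
       V (XF Minus i e') (n + xexp Minus i) (V (XF Plus i e) (m + xexp Plus i) v)) =
      cscale (xcoef Plus i e * xcoef Minus i e') (let x = yshift Minus i e' - yshift Plus i e in
       cscale (qpow h (- of_int x * of_int (m + 1) + of_int x / 2 * of_int (m + n + 2))) (V (Hpm h N (sgn_pm x) i) (m + n + 2) v))"
      unfolding XX_delta[OF i e v] Let_def x_def[symmetric] m1 m2 ..
  qed
  also have "\<dots> = cscale (1 / qd) (cscale (qpow h (- of_int (m + 1) + of_int (m + n + 2) / 2)) (psi_cur h N Plus i (m + n + 2) v)
       - cscale (qpow h (of_int (m + 1) - of_int (m + n + 2) / 2)) (psi_cur h N Minus i (m + n + 2) v))"
  proof -
    define p r where "p = (of_int (m + 1) :: complex)" and "r = (of_int (m + n + 2) :: complex)"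
    show ?thesis
      unfolding p_def[symmetric] r_def[symmetric] using ct
      by (cases "ctype Plus i")
         (simp_all add: terms_def yshift_def xcoef_def sgn_pm_def psi_cur_def fv.scale_right_diff_distrib)
  qed
  finally show ?thesis .
qed

lemma X_plus_X_minus_rel:
  assumes i: "i \<in> {1..2 * N - 1}" "i' \<in> {1..2 * N - 1}" and v: "v \<in> fock N"
  shows "sbracket 1 1 1 (X_cur h N Plus i m) (X_cur h N Minus i' n) v =
      cscale (of_bool (i = i') / (qpow h 1 - qpow h (- 1)))
        (delta_times (qpow h 1) (dilate (qpow h (1 / 2)) (psi_cur h N Plus i)) (m + 1) (n + 1) v
         - delta_times (qpow h (- 1)) (dilate (qpow h (- 1 / 2)) (psi_cur h N Minus i)) (m + 1) (n + 1) v)"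
proof -
  have sb: "sbracket 1 1 1 (X_cur h N Plus i m) (X_cur h N Minus i' n) v =
     X_cur h N Plus i m (X_cur h N Minus i' n v) + X_cur h N Minus i' n (X_cur h N Plus i m v)"
    by (simp add: sbracket_def)
  show ?thesis
  proof (cases "i = i'")
    case False
    have "X_cur h N Plus i m (X_cur h N Minus i' n v) + X_cur h N Minus i' n (X_cur h N Plus i m v) = 0"
    proof (cases rule: index_cases[of i' i])
      case 1
      then show ?thesis by (intro X_X_anti[OF i] XX_anti_far[OF i])
    next
      case 2
      then show ?thesis using False by simp
    next
      case 3
      then show ?thesis using X_plus_X_minus_near[OF i _ _ v] by simp
    next
      case 4
      then show ?thesis by (intro X_X_anti[OF i] XX_anti_next[OF i]) auto
    qed
    then show ?thesis using False sb by simp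
  next
    case True
    have d1: "delta_times (qpow h 1) (dilate (qpow h (1 / 2)) D) (m + 1) (n + 1) v =
       cscale (qpow h (- of_int (m + 1) + of_int (m + n + 2) / 2)) (D (m + n + 2) v)" for D :: fdist
      by (simp add: delta_times_def dilate_def qpow_powi qpow_add[symmetric] algebra_simps add_divide_distrib)
    have d2: "delta_times (qpow h (- 1)) (dilate (qpow h (- 1 / 2)) D) (m + 1) (n + 1) v =
       cscale (qpow h (of_int (m + 1) - of_int (m + n + 2) / 2)) (D (m + n + 2) v)" for D :: fdist
      by (simp add: delta_times_def dilate_def qpow_powi qpow_add[symmetric] algebra_simps add_divide_distrib diff_divide_distrib)
    show ?thesis
      unfolding sb unfolding d1 d2 True[symmetric] X_plus_X_minus_same[OF i(1) v] qd_def by simp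
  qed
qed

end

subsection \<open>The Serre relations\<close>

lemma Sum_any_nested:
  fixes f :: "int \<Rightarrow> int \<Rightarrow> fvec"
  assumes "finite B" "\<And>a b. f a b \<noteq> 0 \<Longrightarrow> (a, b) \<in> B"
  shows "Sum_any (\<lambda>a. Sum_any (f a)) = (\<Sum>(a, b)\<in>B. f a b)"
    and "Sum_any (\<lambda>b. Sum_any (\<lambda>a. f a b)) = (\<Sum>(a, b)\<in>B. f a b)"
proof -
  have fin: "finite {(a, b). f a b \<noteq> 0}"
    by (rule finite_subset[OF _ assms(1)]) (use assms(2) in auto)
  have "Sum_any (\<lambda>(a, b). f a b) = (\<Sum>(a, b)\<in>B. f a b)"
    by (rule Sum_any_supp[OF assms(1)]) (use assms(2) in auto)
  then show 1: "Sum_any (\<lambda>a. Sum_any (f a)) = (\<Sum>(a, b)\<in>B. f a b)"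
    by (simp add: Sum_any_pair[OF fin])
  show "Sum_any (\<lambda>b. Sum_any (\<lambda>a. f a b)) = (\<Sum>(a, b)\<in>B. f a b)"
    using Sum_any_swap[OF fin] 1 by simp
qed

context free_bosons
begin

lemma Ins_minus: "Ins \<Psi> (\<lambda>v. - W v) n v = - Ins \<Psi> W n v"
proof -
  have "Ins \<Psi> (\<lambda>v. - W v) n v = Sum_any (\<lambda>j. cscale (- 1) (Em \<Psi> (n - j) (W (Ap \<Psi> j v))))"
    unfolding Ins_def by (simp add: clin_minus)
  then show ?thesis unfolding cscale_Sum_any[symmetric] by (simp add: Ins_def)
qed

lemma Ins_add: "clin W \<Longrightarrow> clin W' \<Longrightarrow> Ins \<Psi> (\<lambda>v. W v + W' v) n v = Ins \<Psi> W n v + Ins \<Psi> W' n v"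
  unfolding Ins_def by (simp add: clin_add Sum_any.distrib Ins_finite)

lemma Ins_cscale: "Ins \<Psi> (\<lambda>v. cscale x (W v)) n v = cscale x (Ins \<Psi> W n v)"
  unfolding Ins_def by (simp add: clin_scale cscale_Sum_any)

lemma Ins_diff: "clin W \<Longrightarrow> clin W' \<Longrightarrow> Ins \<Psi> (\<lambda>v. W v - W' v) n v = Ins \<Psi> W n v - Ins \<Psi> W' n v"
  unfolding Ins_def by (simp add: clin_diff Sum_any_diff Ins_finite)

text \<open>The bound on a only has to work for the finitely many nonzero
  \<open>Ap \<Psi> j v\<close>, so a minimum over j suffices for all b and n.\<close>

lemma Ins_below_uniform:
  fixes W :: "int \<Rightarrow> 'b \<Rightarrow> fop"
  assumes W: "\<And>a b. clin (W a b)" and below: "\<And>u. \<exists>B. \<forall>a<B. \<forall>b. W a b u = 0"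
  obtains B where "\<And>a b n. a < B \<Longrightarrow> Ins \<Psi> (W a b) n v = 0"
proof -
  define J where "J = {j. Ap \<Psi> j v \<noteq> 0}"
  have J: "finite J" "\<And>j. j \<notin> J \<Longrightarrow> Ap \<Psi> j v = 0" by (simp_all add: J_def Ap_finite)
  have "\<forall>j. \<exists>B. \<forall>a<B. \<forall>b. W a b (Ap \<Psi> j v) = 0" using below by blast
  then obtain B where B: "\<And>j a b. a < B j \<Longrightarrow> W a b (Ap \<Psi> j v) = 0" unfolding choice_iff by blast
  define M where "M = Min (insert 0 (B ` J))"
  have "Ins \<Psi> (W a b) n v = 0" if "a < M" for a b n
  proof -
    have "W a b (Ap \<Psi> j v) = 0" if "j \<in> J" for j
    proof (rule B)
      have "M \<le> B j" unfolding M_def by (rule Min_le) (use J that in auto)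
      then show "a < B j" using \<open>a < M\<close> by simp
    qed
    then show ?thesis by (simp add: Ins_sum[OF W J] clin_zero)
  qed
  then show ?thesis by (rule that)
qed

end

context currents
begin

definition V_bracket :: "complex \<Rightarrow> pm \<Rightarrow> nat \<Rightarrow> int \<Rightarrow> int \<Rightarrow> nat \<Rightarrow> int \<Rightarrow> int \<Rightarrow> fop" where
  "V_bracket t s i e m i' e' m' v = V (XF s i e) m (V (XF s i' e') m' v) + cscale t (V (XF s i' e') m' (V (XF s i e) m v))"

lemma clin_V_bracket: "clin (V_bracket t s i e m i' e' m')"
  unfolding V_bracket_def[abs_def]
  by (rule clin_plus[OF clin_comp[OF clin_V clin_V] clin_cscale[OF clin_comp[OF clin_V clin_V]]])

end

text \<open>X has index l, and its neighbours C and D have indices \<open>ic\<close> and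
  \<open>jd\<close>. One term of C and one of D are fixed, while the terms of the two X remain
  free.\<close>

locale serre = currents +
  fixes s :: pm and l ic jd :: nat and ec ed :: int
  assumes l: "l \<in> {1..2 * N - 1}" and ic: "ic \<in> {1..2 * N - 1}" and jd: "jd \<in> {1..2 * N - 1}"
    and near: "l \<noteq> ic" "half l = half ic" and nex: "l = jd + 1 \<or> jd = l + 1" "half l \<noteq> half jd"
    and far: "jd + 1 < ic \<or> ic + 1 < jd" and ec: "ec \<in> terms s ic"
begin

abbreviation u :: complex where "u \<equiv> qpow h (sg s)"
abbreviation w :: complex where "w \<equiv> qpow h (- sg s)"
abbreviation X :: "int \<Rightarrow> int \<Rightarrow> fop" where "X e \<equiv> V (XF s l e)"
abbreviation D :: "int \<Rightarrow> fop" where "D \<equiv> V (XF s jd ed)"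
abbreviation \<Psi> :: bfield where "\<Psi> \<equiv> XF s ic ec"
abbreviation reg :: "int \<Rightarrow> bool" where "reg e \<equiv> regular s l e ic ec"

lemma uw: "u * w = 1" "w * u = 1" "u * (w * x) = x" "w * (u * x) = x"
  by (simp_all add: qpow_add[symmetric] mult.assoc[symmetric])

text \<open>Both contractions between \<open>X e\<close> and \<open>\<Psi>\<close> are multiples of one expansion \<open>dl e\<close> of
  \<open>1 / (u z' - z)\<close> or \<open>1 / (z' - u z)\<close>, with numerators \<open>u z' - z\<close> and \<open>z' - u z\<close>.\<close>

definition dl :: "int \<Rightarrow> int \<Rightarrow> complex" where
  "dl e A = (if reg e then (if A \<ge> 0 then - (u ^ nat A) else 0) else (if A \<le> - 1 then u ^ nat (- 1 - A) else 0))"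

text \<open>The normalisation for which \<open>Lc e 0 = 1\<close> in both cases.\<close>

definition cc :: "int \<Rightarrow> complex" where "cc e = (if reg e then 1 else w)"

definition Lc :: "int \<Rightarrow> int \<Rightarrow> complex" where "Lc e A = cc e * (u * dl e (A - 1) - dl e A)"
definition Rc :: "int \<Rightarrow> int \<Rightarrow> complex" where "Rc e A = - cc e * (dl e (A - 1) - u * dl e A)"

text \<open>The half line includes 0 so as to hold the support of \<open>dl\<close> and of its shift
  by one; it thus serves both orders of the contraction.\<close>

definition reg_set :: "int \<Rightarrow> int set" where "reg_set e = (if reg e then {0..} else {..0})"

lemma dl_supp: "A \<notin> reg_set e \<Longrightarrow> dl e A = 0" "A \<notin> reg_set e \<Longrightarrow> dl e (A - 1) = 0"
  by (auto simp: dl_def reg_set_def split: if_splits)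

lemma Lc_supp: "A \<notin> reg_set e \<Longrightarrow> Lc e A = 0" and Rc_supp: "A \<notin> reg_set e \<Longrightarrow> Rc e A = 0"
  by (simp_all add: Lc_def Rc_def dl_supp)

lemma Lc_reg: "reg e \<Longrightarrow> Lc e A = (if A = 0 then 1 else 0)"
proof -
  assume r: "reg e"
  consider "A < 0" | "A = 0" | "A > 0" by linarith
  then show ?thesis
  proof cases
    case 3
    then have "nat A = Suc (nat (A - 1))" by simp
    then show ?thesis using 3 r by (simp add: Lc_def cc_def dl_def)
  qed (use r in \<open>simp_all add: Lc_def cc_def dl_def\<close>)
qed

lemma Rc_nreg: "\<not> reg e \<Longrightarrow> Rc e A = (if A = 0 then - w else 0)"
proof -
  assume r: "\<not> reg e"
  consider "A < 0" | "A = 0" | "A > 0" by linarith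
  then show ?thesis
  proof cases
    case 1
    then have "nat (- 1 - (A - 1)) = Suc (nat (- 1 - A))" by simp
    then show ?thesis using 1 r by (simp add: Rc_def cc_def dl_def)
  qed (use r in \<open>simp_all add: Rc_def cc_def dl_def\<close>)
qed

lemma Lc_nreg: "\<not> reg e \<Longrightarrow> Lc e (- int k) = fps_nth ((1 - fps_const w * fps_X) * geo u) k"
  by (cases k) (simp_all add: left_diff_distrib mult.assoc Lc_def cc_def dl_def uw algebra_simps nat_add_distrib)

lemma Rc_reg: "reg e \<Longrightarrow> Rc e (int k) = - u * fps_nth ((1 - fps_const w * fps_X) * geo u) k"
  by (cases k) (simp_all add: left_diff_distrib mult.assoc Rc_def cc_def dl_def uw algebra_simps nat_add_distrib)

text \<open>In one case the contraction is 1 and in the other a ratio; expressing both through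
  \<open>dl\<close> gives the later algebra a single form.\<close>

lemma left_X:
  assumes "e \<in> terms s l" "clin W"
  shows "X e m (Ins \<Psi> W n v) = Sum_any (\<lambda>A. cscale (Lc e A) (Ins \<Psi> (\<lambda>v. X e (m - A) (W v)) (n + A) v))"
proof -
  note d = XX_near[OF l ic near assms(1) ec]
  show ?thesis
  proof (cases "reg e")
    case True
    have "X e m (Ins \<Psi> W n v) = Ins \<Psi> (\<lambda>v. X e m (W v)) n v"
      unfolding V_Ins[OF d(3)[OF True] assms(2)] Sum_any_fps_one by simp
    also have "\<dots> = (\<Sum>A\<in>{0}. cscale (Lc e A) (Ins \<Psi> (\<lambda>v. X e (m - A) (W v)) (n + A) v))"
      by (simp add: Lc_reg[OF True])
    also have "\<dots> = Sum_any (\<lambda>A. cscale (Lc e A) (Ins \<Psi> (\<lambda>v. X e (m - A) (W v)) (n + A) v))"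
      by (rule Sum_any_supp[symmetric]) (auto simp: Lc_reg[OF True])
    finally show ?thesis .
  next
    case False
    have "Sum_any (\<lambda>A. cscale (Lc e A) (Ins \<Psi> (\<lambda>v. X e (m - A) (W v)) (n + A) v)) =
       Sum_any (\<lambda>A. cscale (Lc e (0 - A)) (Ins \<Psi> (\<lambda>v. X e (m - (0 - A)) (W v)) (n + (0 - A)) v))"
      by (rule Sum_any_shift(3)[symmetric])
    also have "\<dots> = Sum_any (\<lambda>k::nat. cscale (Lc e (0 - int k)) (Ins \<Psi> (\<lambda>v. X e (m - (0 - int k)) (W v)) (n + (0 - int k)) v))"
      by (rule Sum_any_nat_int[symmetric]) (simp add: Lc_supp reg_set_def False)
    also have "\<dots> = X e m (Ins \<Psi> W n v)"
      unfolding V_Ins[OF d(6)[OF False] assms(2)] by (simp add: Lc_nreg[OF False])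
    finally show ?thesis by simp
  qed
qed

lemma right_X:
  assumes "e \<in> terms s l" "clin W"
  shows "Ins \<Psi> W n (X e m v) = Sum_any (\<lambda>A. cscale (Rc e A) (Ins \<Psi> (\<lambda>v. W (X e (m - A) v)) (n + A) v))"
proof -
  note d = XX_near[OF l ic near assms(1) ec]
  show ?thesis
  proof (cases "reg e")
    case False
    have "Ins \<Psi> W n (X e m v) = cscale (- w) (Ins \<Psi> (\<lambda>v. W (X e m v)) n v)"
      unfolding Ins_V[OF d(7)[OF False] d(1,2) assms(2)] fv.scale_scale[symmetric] cscale_Sum_any[symmetric] Sum_any_fps_one
      by (simp add: d(8)[OF False])
    also have "\<dots> = (\<Sum>A\<in>{0}. cscale (Rc e A) (Ins \<Psi> (\<lambda>v. W (X e (m - A) v)) (n + A) v))"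
      by (simp add: Rc_nreg[OF False])
    also have "\<dots> = Sum_any (\<lambda>A. cscale (Rc e A) (Ins \<Psi> (\<lambda>v. W (X e (m - A) v)) (n + A) v))"
      by (rule Sum_any_supp[symmetric]) (auto simp: Rc_nreg[OF False])
    finally show ?thesis .
  next
    case True
    have "Sum_any (\<lambda>A. cscale (Rc e A) (Ins \<Psi> (\<lambda>v. W (X e (m - A) v)) (n + A) v)) =
       Sum_any (\<lambda>k::nat. cscale (Rc e (int k)) (Ins \<Psi> (\<lambda>v. W (X e (m - int k) v)) (n + int k) v))"
      by (rule Sum_any_nat_int[symmetric]) (simp add: Rc_supp reg_set_def True)
    also have "\<dots> = Ins \<Psi> W n (X e m v)"
      unfolding Ins_V[OF d(4)[OF True] d(1,2) assms(2)] by (simp add: Rc_reg[OF True] d(5)[OF True])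
    finally show ?thesis by simp
  qed
qed

lemma left_D: "clin W \<Longrightarrow> D m (Ins \<Psi> W n v) = Ins \<Psi> (\<lambda>v. D m (W v)) n v"
proof -
  assume W: "clin W"
  have far': "ic + 1 < jd \<or> jd + 1 < ic" using far by auto
  note d = XX_far[OF jd ic far', where s = s and e = ed and s' = s and e' = ec]
  show ?thesis unfolding V_Ins[OF d(3) W] Sum_any_fps_one by simp
qed

lemma right_D: "clin W \<Longrightarrow> Ins \<Psi> W n (D m v) = - Ins \<Psi> (\<lambda>v. W (D m v)) n v"
proof -
  assume W: "clin W"
  have far': "ic + 1 < jd \<or> jd + 1 < ic" using far by auto
  note d = XX_far[OF jd ic far', where s = s and e = ed and s' = s and e' = ec]
  show ?thesis
    unfolding Ins_V[OF d(4) d(1,2) W] fv.scale_scale[symmetric] cscale_Sum_any[symmetric] Sum_any_fps_one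
    by (simp add: d(5))
qed

text \<open>In the regular case only A = 0 contributes; otherwise A \<le> 0, and n + A is bounded
  below by \<open>Ins_below\<close>.\<close>

lemma Lc_finite:
  assumes "\<And>A. clin (W A)"
  shows "finite {A. cscale (Lc e A) (Ins \<Psi> (W A) (n + A) v) \<noteq> 0}"
proof (cases "reg e")
  case True
  then show ?thesis by (intro finite_subset[OF _ finite.insertI[OF finite.emptyI], of _ 0]) (auto simp: Lc_reg split: if_splits)
next
  case False
  obtain B where B: "\<And>W n. clin W \<Longrightarrow> n < B \<Longrightarrow> Ins \<Psi> W n v = 0" by (rule Ins_below[of \<Psi> v]) blast
  have "A \<in> {B - n..0}" if "cscale (Lc e A) (Ins \<Psi> (W A) (n + A) v) \<noteq> 0" for A
  proof -
    have "A \<le> 0" using that Lc_supp[of A e] False by (auto simp: reg_set_def)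
    moreover have "\<not> n + A < B" using that B[OF assms] by auto
    ultimately show ?thesis by auto
  qed
  then show ?thesis by (rule finite_subset[OF _ finite_atLeastAtMost_int, OF subsetI]) auto
qed

text \<open>Operators \<open>G m\<close> that move through an insertion of \<open>\<Psi>\<close> in the same way as \<open>X e m\<close>, up to a sign.\<close>

definition leftop :: "(int \<Rightarrow> fop) \<Rightarrow> int \<Rightarrow> bool" where
  "leftop G e \<longleftrightarrow> (\<forall>m. clin (G m)) \<and> (\<forall>W m n v. clin W \<longrightarrow>
    G m (Ins \<Psi> W n v) = Sum_any (\<lambda>A. cscale (Lc e A) (Ins \<Psi> (\<lambda>v. G (m - A) (W v)) (n + A) v)))"

definition rightop :: "(int \<Rightarrow> fop) \<Rightarrow> int \<Rightarrow> complex \<Rightarrow> bool" where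
  "rightop G e x \<longleftrightarrow> (\<forall>m. clin (G m)) \<and> (\<forall>W m n v. clin W \<longrightarrow>
    Ins \<Psi> W n (G m v) = cscale x (Sum_any (\<lambda>A. cscale (Rc e A) (Ins \<Psi> (\<lambda>v. W (G (m - A) v)) (n + A) v))))"

lemma clin_XD: "clin (\<lambda>v. X e m (D n v))" and clin_DX: "clin (\<lambda>v. D n (X e m v))"
  by (rule clin_comp[OF clin_V clin_V])+

lemma leftop_X: "e \<in> terms s l \<Longrightarrow> leftop (X e) e"
  by (simp add: leftop_def left_X)

lemma leftop_XD: "e \<in> terms s l \<Longrightarrow> leftop (\<lambda>m v. X e m (D n v)) e"
  unfolding leftop_def by (simp add: clin_XD left_D left_X clin_comp[OF clin_V])

lemma leftop_DX: "e \<in> terms s l \<Longrightarrow> leftop (\<lambda>m v. D n (X e m v)) e"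
  unfolding leftop_def
proof (intro conjI allI impI)
  fix W m k v assume e: "e \<in> terms s l" and W: "clin W"
  have WX: "clin (\<lambda>v. X e a (W v))" for a by (rule clin_comp[OF clin_V W])
  show "D n (X e m (Ins \<Psi> W k v)) = Sum_any (\<lambda>A. cscale (Lc e A) (Ins \<Psi> (\<lambda>v. D n (X e (m - A) (W v))) (k + A) v))"
    unfolding left_X[OF e W] by (subst clin_Sum_any[OF clin_V Lc_finite[OF WX]]) (simp add: clin_scale left_D[OF WX])
qed (rule clin_DX)

lemma rightop_X: "e \<in> terms s l \<Longrightarrow> rightop (X e) e 1"
  by (simp add: rightop_def right_X)

lemma rightop_XD: "e \<in> terms s l \<Longrightarrow> rightop (\<lambda>m v. X e m (D n v)) e (- 1)"
  unfolding rightop_def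
proof (intro conjI allI impI)
  fix W m k v assume e: "e \<in> terms s l" and W: "clin W"
  have WX: "clin (\<lambda>v. W (X e a v))" for a by (rule clin_comp[OF W clin_V])
  show "Ins \<Psi> W k (X e m (D n v)) = cscale (- 1) (Sum_any (\<lambda>A. cscale (Rc e A) (Ins \<Psi> (\<lambda>v. W (X e (m - A) (D n v))) (k + A) v)))"
    unfolding right_X[OF e W] right_D[OF WX] by (simp add: cscale_Sum_any)
qed (rule clin_XD)

lemma rightop_DX: "e \<in> terms s l \<Longrightarrow> rightop (\<lambda>m v. D n (X e m v)) e (- 1)"
  unfolding rightop_def
proof (intro conjI allI impI)
  fix W m k v assume e: "e \<in> terms s l" and W: "clin W"
  have WD: "clin (\<lambda>v. W (D a v))" for a by (rule clin_comp[OF W clin_V])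
  show "Ins \<Psi> W k (D n (X e m v)) = cscale (- 1) (Sum_any (\<lambda>A. cscale (Rc e A) (Ins \<Psi> (\<lambda>v. W (D n (X e (m - A) v))) (k + A) v)))"
    unfolding right_D[OF W] right_X[OF e WD] by simp
qed (rule clin_DX)

lemma Rc_finite:
  assumes "clin W" "\<And>v. \<exists>B. \<forall>m<B. G m v = 0" "\<And>m. clin (G m)"
  shows "finite {A. cscale (Rc e A) (Ins \<Psi> (\<lambda>v. W (G (m - A) v)) (n + A) v) \<noteq> 0}"
proof (cases "reg e")
  case False
  then show ?thesis by (intro finite_subset[OF _ finite.insertI[OF finite.emptyI], of _ 0]) (auto simp: Rc_nreg split: if_splits)
next
  case True
  obtain B where B: "\<And>a (b::int) n. a < B \<Longrightarrow> Ins \<Psi> (\<lambda>v. W (G a v)) n v = 0"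
  proof (rule Ins_below_uniform[of "\<lambda>a b v. W (G a v)" \<Psi> v])
    show "clin (\<lambda>v. W (G a v))" for a by (rule clin_comp[OF assms(1,3)])
    fix x
    obtain B where "\<forall>m<B. G m x = 0" using assms(2) by blast
    then have "\<forall>a<B. \<forall>b::int. W (G a x) = 0" by (simp add: clin_zero[OF assms(1)])
    then show "\<exists>B. \<forall>a<B. \<forall>b::int. W (G a x) = 0" by blast
  qed blast
  have "A \<in> {0..m - B}" if "cscale (Rc e A) (Ins \<Psi> (\<lambda>v. W (G (m - A) v)) (n + A) v) \<noteq> 0" for A
  proof -
    have "A \<ge> 0" using that Rc_supp[of A e] True by (auto simp: reg_set_def)
    moreover have "\<not> m - A < B" using that B by auto
    ultimately show ?thesis by auto
  qed
  then show ?thesis by (rule finite_subset[OF _ finite_atLeastAtMost_int, OF subsetI]) auto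
qed

lemma V_Psi_Ins: "V \<Psi> n v = Ins \<Psi> (\<lambda>v. v) n v"
  by (rule V_Ins_id)

lemma leftopD: "leftop G e \<Longrightarrow> clin W \<Longrightarrow>
    G m (Ins \<Psi> W n v) = Sum_any (\<lambda>A. cscale (Lc e A) (Ins \<Psi> (\<lambda>v. G (m - A) (W v)) (n + A) v))"
  and rightopD: "rightop G e x \<Longrightarrow> clin W \<Longrightarrow>
    Ins \<Psi> W n (G m v) = cscale x (Sum_any (\<lambda>A. cscale (Rc e A) (Ins \<Psi> (\<lambda>v. W (G (m - A) v)) (n + A) v)))"
  unfolding leftop_def rightop_def by blast+

text \<open>Two operators move into the insertion one after the other; the letters L and R record on
  which side of C each of them starts.\<close>

lemma word_LL:
  assumes "leftop G e" "leftop G' e'"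
  shows "G m (G' m' (V \<Psi> n v)) = Sum_any (\<lambda>A'. Sum_any (\<lambda>A. cscale (Lc e A * Lc e' A') (Ins \<Psi> (\<lambda>v. G (m - A) (G' (m' - A') v)) (n + A' + A) v)))"
proof -
  have G: "clin (G a)" "clin (G' a)" for a using assms by (simp_all add: leftop_def)
  show ?thesis
    unfolding V_Psi_Ins leftopD[OF assms(2) clin_ident(1)] clin_Sum_any[OF G(1) Lc_finite[OF G(2)]] clin_scale[OF G(1)]
    unfolding leftopD[OF assms(1) G(2)] cscale_Sum_any fv.scale_scale
    by (simp only: mult.commute)
qed

lemma word_LR:
  assumes "leftop G e" "rightop G' e' x" "\<And>v. \<exists>B. \<forall>m<B. G' m v = 0"
  shows "G m (V \<Psi> n (G' m' v)) = cscale x (Sum_any (\<lambda>A'. Sum_any (\<lambda>A. cscale (Lc e A * Rc e' A') (Ins \<Psi> (\<lambda>v. G (m - A) (G' (m' - A') v)) (n + A' + A) v))))"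
proof -
  have G: "clin (G a)" "clin (G' a)" for a using assms by (simp_all add: leftop_def rightop_def)
  show ?thesis
    unfolding V_Psi_Ins rightopD[OF assms(2) clin_ident(1)] clin_scale[OF G(1)] clin_Sum_any[OF G(1) Rc_finite[OF clin_ident(1) assms(3) G(2)]]
    unfolding leftopD[OF assms(1) G(2)] cscale_Sum_any fv.scale_scale
    by (simp only: mult.commute)
qed

lemma word_RR:
  assumes "rightop G e x" "rightop G' e' x'"
  shows "V \<Psi> n (G m (G' m' v)) = cscale (x * x') (Sum_any (\<lambda>A. Sum_any (\<lambda>A'. cscale (Rc e A * Rc e' A') (Ins \<Psi> (\<lambda>v. G (m - A) (G' (m' - A') v)) (n + A + A') v))))"
proof -
  have G: "clin (G a)" "clin (G' a)" for a using assms by (simp_all add: rightop_def)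
  show ?thesis
    unfolding V_Psi_Ins rightopD[OF assms(1) clin_ident(1)] rightopD[OF assms(2) G(1)] cscale_Sum_any fv.scale_scale
    by (simp only: mult_ac)
qed

section \<open>The cubic relation between X, X and D\<close>

lemma anti_X: "X e m (X e' n v) = - X e' n (X e m v)"
  using XX_anti_same[OF l, of s e m e' n v] by (simp add: eq_neg_iff_add_eq_0)

lemma next_X:
  "X e (m - 1) (D n v) - cscale w (X e m (D (n - 1) v)) + (cscale w (D n (X e (m - 1) v)) - D (n - 1) (X e m v)) = 0"
  by (rule XX_next_rel[OF l jd nex])

text \<open>Each side collects the terms of the cubic expression multiplied by one of the two
  variables. Their difference is a combination of exchange relations of one X with D, multiplied by
  the other X on either side.\<close>

lemma cubic:
  "X e (a - 1) (X e' b (D n v)) + D n (X e (a - 1) (X e' b v)) + cscale u (X e (a - 1) (D n (X e' b v))) - cscale w (X e' b (D n (X e (a - 1) v)))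
   = X e a (X e' (b - 1) (D n v)) + D n (X e a (X e' (b - 1) v)) + cscale w (X e a (D n (X e' (b - 1) v))) - cscale u (X e' (b - 1) (D n (X e a v)))"
proof (rule poly_mapping_eqI)
  fix k
  let ?f = "\<lambda>v :: fvec. Poly_Mapping.lookup v k"
  have 1: "?f (X e a (X e' (b - 1) (D n v)) - cscale w (X e a (X e' b (D (n - 1) v))) + (cscale w (X e a (D n (X e' (b - 1) v))) - X e a (D (n - 1) (X e' b v)))) = 0"
    using arg_cong[OF next_X[of e' b n v], of "X e a"] by (simp add: clin_add clin_diff clin_scale clin_zero)
  have 2: "?f (X e' (b - 1) (D n (X e a v)) - cscale w (X e' b (D (n - 1) (X e a v))) + (cscale w (D n (X e' (b - 1) (X e a v))) - D (n - 1) (X e' b (X e a v)))) = 0"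
    using next_X[of e' b n "X e a v"] by simp
  have 3: "?f (X e' b (X e (a - 1) (D n v)) - cscale w (X e' b (X e a (D (n - 1) v))) + (cscale w (X e' b (D n (X e (a - 1) v))) - X e' b (D (n - 1) (X e a v)))) = 0"
    using arg_cong[OF next_X[of e a n v], of "X e' b"] by (simp add: clin_add clin_diff clin_scale clin_zero)
  have 4: "?f (X e (a - 1) (D n (X e' b v)) - cscale w (X e a (D (n - 1) (X e' b v))) + (cscale w (D n (X e (a - 1) (X e' b v))) - D (n - 1) (X e a (X e' b v)))) = 0"
    using next_X[of e a n "X e' b v"] by simp
  have anti: "?f (X e' b' (X e a' v')) = - ?f (X e a' (X e' b' v'))" "?f (D n' (X e' b' (X e a' v'))) = - ?f (D n' (X e a' (X e' b' v')))" for a' b' n' v'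
    by (simp_all add: anti_X[of e' b' e] clin_minus)
  define E1 E2 E3 E4 where "E1 = ?f (X e a (X e' (b - 1) (D n v)) - cscale w (X e a (X e' b (D (n - 1) v))) + (cscale w (X e a (D n (X e' (b - 1) v))) - X e a (D (n - 1) (X e' b v))))"
    and "E2 = ?f (X e' (b - 1) (D n (X e a v)) - cscale w (X e' b (D (n - 1) (X e a v))) + (cscale w (D n (X e' (b - 1) (X e a v))) - D (n - 1) (X e' b (X e a v))))"
    and "E3 = ?f (X e' b (X e (a - 1) (D n v)) - cscale w (X e' b (X e a (D (n - 1) v))) + (cscale w (X e' b (D n (X e (a - 1) v))) - X e' b (D (n - 1) (X e a v))))"
    and "E4 = ?f (X e (a - 1) (D n (X e' b v)) - cscale w (X e a (D (n - 1) (X e' b v))) + (cscale w (D n (X e (a - 1) (X e' b v))) - D (n - 1) (X e a (X e' b v))))"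
  \<comment> \<open>In E1 and E3 the extra X stands on the left, in E2 and E4 on the right; the
    coefficients -1, u, -1, u eliminate every word with \<open>D (n - 1)\<close>.\<close>
  have "?f (X e (a - 1) (X e' b (D n v)) + D n (X e (a - 1) (X e' b v)) + cscale u (X e (a - 1) (D n (X e' b v))) - cscale w (X e' b (D n (X e (a - 1) v))))
    - ?f (X e a (X e' (b - 1) (D n v)) + D n (X e a (X e' (b - 1) v)) + cscale w (X e a (D n (X e' (b - 1) v))) - cscale u (X e' (b - 1) (D n (X e a v))))
    = - E1 + u * E2 - E3 + u * E4"
    unfolding E1_def E2_def E3_def E4_def
    by (simp add: lookup_add lookup_minus anti right_diff_distrib distrib_left uw)
  also have "\<dots> = 0" using 1 2 3 4 by (simp add: E1_def E2_def E3_def E4_def)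
  finally show "?f (X e (a - 1) (X e' b (D n v)) + D n (X e (a - 1) (X e' b v)) + cscale u (X e (a - 1) (D n (X e' b v))) - cscale w (X e' b (D n (X e (a - 1) v))))
    = ?f (X e a (X e' (b - 1) (D n v)) + D n (X e a (X e' (b - 1) v)) + cscale w (X e a (D n (X e' (b - 1) v))) - cscale u (X e' (b - 1) (D n (X e a v))))"
    by simp
qed

text \<open>The dilations of the two terms lie on opposite sides of that of C, hence two steps
  apart; this double step is \<open>w * w\<close>.\<close>

lemma XX_same:
  assumes "reg e" "\<not> reg e'" "e' \<in> terms s l"
  shows "X e a (X e' b v) = Ins (XF s l e') (X e a) b v - cscale (w * w) (Ins (XF s l e') (X e (a + 1)) (b - 1) v)"
proof -
  have "yshift s l e' - yshift s l e = - 2 * sgi s"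
    using assms(1,2) yshift_near[OF near assms(3) ec] by (cases s) (auto simp: regular_def)
  moreover have "qpow h (- 2 * sg s) = w * w" by (simp add: qpow_add[symmetric])
  ultimately have q: "qpow h (of_int (yshift s l e' - yshift s l e)) = w * w" by (simp add: sg_sgi)
  have y: "ypair s l s l = 1" by (simp add: ypair_def ysgn_def)
  have "contr (XF s l e) (XF s l e') (1 - fps_const (w * w) * fps_X)"
    using XX_contr(1)[OF l l, where s = s and e = e and s' = s and e' = e'] same_data(1)[OF l]
    unfolding q y by (simp add: pw_def)
  then show ?thesis by (rule VV_lin_left)
qed

text \<open>The zero of the contraction of \<open>X e\<close> with \<open>X e'\<close> cancels the product of the poles of their contractions
  with \<open>D\<close>; otherwise \<open>a\<close> would only be bounded in terms of \<open>b\<close>.\<close>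

lemma XDX_below:
  assumes e: "reg e" "\<not> reg e'" "e' \<in> terms s l"
  shows "\<exists>B. \<forall>a<B. \<forall>b. X e a (D n (X e' b v)) = 0"
proof -
  let ?D = "XF s jd ed" and ?X' = "XF s l e'"
  define I where "I a b = Ins ?X' (X e a) b" for a b
  have I: "clin (I a b)" for a b unfolding I_def by (rule clin_Ins[OF clin_V])
  have I_a: "\<exists>B. \<forall>a<B. \<forall>b. I a b x = 0" for x
  proof -
    have "\<exists>B. \<forall>a<B. \<forall>b::unit. X e a y = 0" for y
      by (rule V_below[of "XF s l e" y]) blast
    then obtain B where "\<And>a (b::unit) n. a < B \<Longrightarrow> Ins ?X' (X e a) n x = 0"
      by (rule Ins_below_uniform[of "\<lambda>a (b::unit). X e a" ?X' x, OF clin_V]) blast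
    then show ?thesis by (auto simp: I_def)
  qed
  have I_b: "\<exists>B. \<forall>b<B. \<forall>a. I a b x = 0" for x
  proof -
    obtain B where "\<And>W n. clin W \<Longrightarrow> n < B \<Longrightarrow> Ins ?X' W n x = 0" by (rule Ins_below[of ?X' x]) blast
    from this[OF clin_V] show ?thesis by (auto simp: I_def)
  qed
  obtain B1 where B1: "\<And>a b k. a < B1 \<Longrightarrow> Ins ?D (I a b) k v = 0"
    by (rule Ins_below_uniform[of I ?D v, OF I I_a]) blast
  obtain B2 where B2: "\<And>b a k. b < B2 \<Longrightarrow> Ins ?D (I a b) k v = 0"
    by (rule Ins_below_uniform[of "\<lambda>b a. I a b" ?D v, OF I I_b]) blast
  obtain B3 where B3: "\<And>W k. clin W \<Longrightarrow> k < B3 \<Longrightarrow> Ins ?D W k v = 0" by (rule Ins_below[of ?D v]) blast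
  \<comment> \<open>a < B1 kills the terms \<open>J l 0\<close>. The second bound also kills
    \<open>J 0 k\<close>: either n + 1 - k < B3, or k is small enough for a + k < B1.\<close>
  have "X e a (D n (X e' b v)) = 0" if a: "a < min B1 (B1 - (n + 1 - B3))" for a b
  proof -
    define J where "J l k = cscale (w ^ k * w ^ l) (Ins ?D (I (a + int k) (b - 1 - int l)) (n + 1 + int l - int k) v)" for l k :: nat
    have geo: "fps_nth (geo w) k = w ^ k" for k by simp
    have z: "J l 0 = 0" for l using B1 a by (simp add: J_def)
    have z': "J 0 k = 0" for k
    proof (cases "n + 1 - int k < B3")
      case True
      then show ?thesis using B3[OF I] by (simp add: J_def)
    next
      case False
      then have "a + int k < B1" using a by simp
      then show ?thesis using B1 by (simp add: J_def)
    qed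
    have fin: "finite {k. J l k \<noteq> 0}" for l
      unfolding J_def by (rule finite_supp_cscale[OF Ins_nat_finite[OF I]])
    have fin': "finite {l. Sum_any (J l) \<noteq> 0}"
    proof (rule finite_subset)
      show "{l. Sum_any (J l) \<noteq> 0} \<subseteq> {..nat (b - 1 - B2)}"
      proof
        fix l assume "l \<in> {l. Sum_any (J l) \<noteq> 0}"
        then obtain k where "J l k \<noteq> 0" by (auto elim: Sum_any.not_neutral_obtains_not_neutral)
        then have "\<not> b - 1 - int l < B2" using B2 by (auto simp: J_def)
        then show "l \<in> {..nat (b - 1 - B2)}" by simp
      qed
    qed simp
    \<comment> \<open>The two terms of \<open>XX_same\<close> turn the double geometric sum into
      differences along the diagonal, which telescope to the boundary l = 0 or k = 0.\<close>
    have col: "cscale (w ^ l) (X e a (Ins ?D (X e' (b - 1 - int l)) (n + 1 + int l) v)) = Sum_any (J l) - Sum_any (J (Suc l))" for l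
    proof -
      have "cscale (w ^ l) (X e a (Ins ?D (X e' (b - 1 - int l)) (n + 1 + int l) v)) = Sum_any (\<lambda>k. J l k - J (Suc l) (Suc k))"
        unfolding V_Ins[OF XX_next(3)[OF l jd nex] clin_V] geo cscale_Sum_any
      proof (rule Sum_any.cong)
        fix k
        have XX: "Ins ?D (\<lambda>v. X e (a + int k) (X e' (b - 1 - int l) v)) m v =
           Ins ?D (I (a + int k) (b - 1 - int l)) m v - cscale (w * w) (Ins ?D (I (a + int k + 1) (b - 1 - int l - 1)) m v)" for m
          unfolding XX_same[OF e] I_def[symmetric] Ins_diff[OF I clin_cscale[OF I]] Ins_cscale ..
        show "cscale (w ^ l) (cscale (w ^ k) (Ins ?D (\<lambda>v. X e (a + int k) (X e' (b - 1 - int l) v)) (n + 1 + int l - int k) v)) =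
            J l k - J (Suc l) (Suc k)"
          unfolding XX J_def fv.scale_right_diff_distrib fv.scale_scale by (simp add: algebra_simps)
      qed
      also have "\<dots> = Sum_any (J l) - Sum_any (\<lambda>k. J (Suc l) (Suc k))"
        by (rule Sum_any_diff[OF fin finite_supp_Suc[OF fin]])
      also have "Sum_any (\<lambda>k. J (Suc l) (Suc k)) = Sum_any (J (Suc l))"
        using Sum_any_Suc[OF fin, of "Suc l"] z by simp
      finally show ?thesis .
    qed
    note d = XX_next[OF l jd nex, where s = s and e = e' and e' = ed]
    have "D n (X e' b v) = Sum_any (\<lambda>l. cscale (w ^ l) (Ins ?D (X e' (b - 1 - int l)) (n + 1 + int l) v))"
      using VV_right[OF d(4,1,2), of n b v] d(5) by simp
    then have "X e a (D n (X e' b v)) = Sum_any (\<lambda>l. Sum_any (J l) - Sum_any (J (Suc l)))"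
      by (simp only: clin_Sum_any[OF clin_V finite_supp_cscale[OF Ins_right_finite]] clin_scale[OF clin_V] col)
    also have "\<dots> = 0"
      unfolding Sum_any_diff[OF fin' finite_supp_Suc[OF fin']] using Sum_any_Suc[OF fin'] z' by simp
    finally show ?thesis .
  qed
  then show ?thesis by blast
qed

text \<open>The index pairs at which a word can have a nonzero term, given that the coefficients
  live on \<open>reg_set\<close>; finiteness of this set justifies all rearrangements below.\<close>

definition supp :: "int \<Rightarrow> int \<Rightarrow> (int \<Rightarrow> int \<Rightarrow> fop) \<Rightarrow> int \<Rightarrow> int \<Rightarrow> int \<Rightarrow> fvec \<Rightarrow> (int \<times> int) set" where
  "supp e1 e2 W m1 m2 k v = {(A1, A2). A1 \<in> reg_set e1 \<and> A2 \<in> reg_set e2 \<and> Ins \<Psi> (W (m1 - A1) (m2 - A2)) (k + A1 + A2) v \<noteq> 0}"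

lemma supp_swap: "supp e1 e2 W m1 m2 k v = prod.swap ` supp e2 e1 (\<lambda>a b. W b a) m2 m1 k v"
  by (auto simp: supp_def image_iff add_ac)

lemma supp_finite_nn:
  assumes "\<not> reg e1" "\<not> reg e2" "\<And>a b. clin (W a b)"
  shows "finite (supp e1 e2 W m1 m2 k v)"
proof -
  obtain B where B: "\<And>W n. clin W \<Longrightarrow> n < B \<Longrightarrow> Ins \<Psi> W n v = 0" by (rule Ins_below[of \<Psi> v]) blast
  have "supp e1 e2 W m1 m2 k v \<subseteq> {B - k..0} \<times> {B - k..0}"
  proof
    fix A assume "A \<in> supp e1 e2 W m1 m2 k v"
    then obtain A1 A2 where A: "A = (A1, A2)" "A1 \<le> 0" "A2 \<le> 0" "Ins \<Psi> (W (m1 - A1) (m2 - A2)) (k + A1 + A2) v \<noteq> 0"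
      using assms by (auto simp: supp_def reg_set_def)
    then have "\<not> k + A1 + A2 < B" using B[OF assms(3)] by blast
    then show "A \<in> {B - k..0} \<times> {B - k..0}" using A by auto
  qed
  then show ?thesis by (rule finite_subset) simp
qed

text \<open>The uniform bound on the first index limits A1, and the lower bound on the index of the
  insertion then limits A2.\<close>

lemma supp_finite_rn:
  assumes "reg e1" "\<not> reg e2" "\<And>a b. clin (W a b)" "\<And>x. \<exists>B. \<forall>a<B. \<forall>b. W a b x = 0"
  shows "finite (supp e1 e2 W m1 m2 k v)"
proof -
  obtain B where B: "\<And>W n. clin W \<Longrightarrow> n < B \<Longrightarrow> Ins \<Psi> W n v = 0" by (rule Ins_below[of \<Psi> v]) blast
  obtain B' where B': "\<And>a b n. a < B' \<Longrightarrow> Ins \<Psi> (W a b) n v = 0"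
    by (rule Ins_below_uniform[of W \<Psi> v, OF assms(3,4)]) blast
  have "supp e1 e2 W m1 m2 k v \<subseteq> {0..m1 - B'} \<times> {B - k - (m1 - B')..0}"
  proof
    fix A assume "A \<in> supp e1 e2 W m1 m2 k v"
    then obtain A1 A2 where A: "A = (A1, A2)" "A1 \<ge> 0" "A2 \<le> 0" "Ins \<Psi> (W (m1 - A1) (m2 - A2)) (k + A1 + A2) v \<noteq> 0"
      using assms by (auto simp: supp_def reg_set_def)
    then have "\<not> k + A1 + A2 < B" "\<not> m1 - A1 < B'" using B[OF assms(3)] B' by blast+
    then show "A \<in> {0..m1 - B'} \<times> {B - k - (m1 - B')..0}" using A by auto
  qed
  then show ?thesis by (rule finite_subset) simp
qed

lemma supp_finite_rr:
  assumes "reg e1" "reg e2" "\<And>a b. clin (W a b)" "\<And>x. finite {(a, b). a \<le> m1 \<and> b \<le> m2 \<and> W a b x \<noteq> 0}"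
  shows "finite (supp e1 e2 W m1 m2 k v)"
proof -
  define J where "J = {j. Ap \<Psi> j v \<noteq> 0}"
  have J: "finite J" "\<And>j. j \<notin> J \<Longrightarrow> Ap \<Psi> j v = 0" by (simp_all add: J_def Ap_finite)
  have "supp e1 e2 W m1 m2 k v \<subseteq> (\<Union>j\<in>J. (\<lambda>(a, b). (m1 - a, m2 - b)) ` {(a, b). a \<le> m1 \<and> b \<le> m2 \<and> W a b (Ap \<Psi> j v) \<noteq> 0})"
  proof
    fix A assume "A \<in> supp e1 e2 W m1 m2 k v"
    then obtain A1 A2 where A: "A = (A1, A2)" "A1 \<ge> 0" "A2 \<ge> 0" "Ins \<Psi> (W (m1 - A1) (m2 - A2)) (k + A1 + A2) v \<noteq> 0"
      using assms by (auto simp: supp_def reg_set_def)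
    have "Ins \<Psi> (W (m1 - A1) (m2 - A2)) (k + A1 + A2) v = 0" if "\<forall>j\<in>J. W (m1 - A1) (m2 - A2) (Ap \<Psi> j v) = 0"
      using that by (simp add: Ins_sum[OF assms(3) J] clin_zero)
    then obtain j where "j \<in> J" "W (m1 - A1) (m2 - A2) (Ap \<Psi> j v) \<noteq> 0" using A(4) by blast
    then show "A \<in> (\<Union>j\<in>J. (\<lambda>(a, b). (m1 - a, m2 - b)) ` {(a, b). a \<le> m1 \<and> b \<le> m2 \<and> W a b (Ap \<Psi> j v) \<noteq> 0})"
      using A by (intro UN_I[of j] image_eqI[of _ _ "(m1 - A1, m2 - A2)"]) auto
  qed
  then show ?thesis by (rule finite_subset) (use J(1) assms(4) in auto)
qed

text \<open>Half lines in opposite directions call for a bound on the regular index that is uniform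
  in the other; two regular indices range over a quadrant, where successive bounds are
  enough.\<close>

lemma supp_finite:
  assumes "\<And>a b. clin (W a b)"
    and "reg e1 \<Longrightarrow> \<not> reg e2 \<Longrightarrow> \<forall>x. \<exists>B. \<forall>a<B. \<forall>b. W a b x = 0"
    and "\<not> reg e1 \<Longrightarrow> reg e2 \<Longrightarrow> \<forall>x. \<exists>B. \<forall>b<B. \<forall>a. W a b x = 0"
    and "reg e1 \<Longrightarrow> reg e2 \<Longrightarrow> \<forall>x. finite {(a, b). a \<le> m1 \<and> b \<le> m2 \<and> W a b x \<noteq> 0}"
  shows "finite (supp e1 e2 W m1 m2 k v)"
proof (cases "reg e1"; cases "reg e2")
  assume r: "reg e1" "reg e2"
  show ?thesis by (rule supp_finite_rr[OF r assms(1)]) (use assms(4)[OF r] in blast)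
next
  assume r: "reg e1" "\<not> reg e2"
  show ?thesis by (rule supp_finite_rn[OF r assms(1)]) (use assms(2)[OF r] in blast)
next
  assume r: "\<not> reg e1" "reg e2"
  show ?thesis unfolding supp_swap[of e1]
    by (rule finite_imageI, rule supp_finite_rn[OF r(2,1) assms(1)]) (use assms(3)[OF r] in blast)
next
  assume r: "\<not> reg e1" "\<not> reg e2"
  show ?thesis by (rule supp_finite_nn[OF r assms(1)])
qed

lemma X_below: "\<exists>B. \<forall>m<B. X e m v = 0"
  by (rule V_below[of "XF s l e" v]) blast

lemma DX_below: "\<exists>B. \<forall>m<B. D n (X e m v) = 0"
  using X_below[of e v] by (metis clin_V clin_zero)

lemma below_below:
  assumes "\<And>v. \<exists>B. \<forall>m<B. G m v = 0" "\<And>v. \<exists>B. \<forall>m<B. G' m v = 0" "\<And>m. clin (G m)"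
  shows "finite {(a::int, b::int). a \<le> m1 \<and> b \<le> m2 \<and> G a (G' b v) \<noteq> (0::fvec)}"
proof -
  obtain B where B: "\<And>b. b < B \<Longrightarrow> G' b v = 0" using assms(2) by blast
  have "\<forall>b. \<exists>B. \<forall>a<B. G a (G' b v) = 0" using assms(1) by blast
  then obtain B' where B': "\<And>b a. a < B' b \<Longrightarrow> G a (G' b v) = 0" unfolding choice_iff by blast
  have "{(a, b). a \<le> m1 \<and> b \<le> m2 \<and> G a (G' b v) \<noteq> 0} \<subseteq> (\<lambda>(b, a). (a, b)) ` (SIGMA b:{B..m2}. {B' b..m1})"
  proof clarify
    fix a b assume *: "a \<le> m1" "b \<le> m2" "G a (G' b v) \<noteq> 0"
    then have "\<not> b < B" "\<not> a < B' b" using B B' clin_zero[OF assms(3)] by force+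
    then show "(a, b) \<in> (\<lambda>(b, a). (a, b)) ` (SIGMA b:{B..m2}. {B' b..m1})"
      using * by (intro image_eqI[of _ _ "(b, a)"]) auto
  qed
  then show ?thesis by (rule finite_subset) simp
qed

definition WP :: "int \<Rightarrow> int \<Rightarrow> int \<Rightarrow> int \<Rightarrow> int \<Rightarrow> fop" where "WP n e1 e2 a b v = X e1 a (X e2 b (D n v))"
definition WQ :: "int \<Rightarrow> int \<Rightarrow> int \<Rightarrow> int \<Rightarrow> int \<Rightarrow> fop" where "WQ n e1 e2 a b v = D n (X e1 a (X e2 b v))"
definition WH :: "int \<Rightarrow> int \<Rightarrow> int \<Rightarrow> int \<Rightarrow> int \<Rightarrow> fop" where "WH n e1 e2 a b v = X e1 a (D n (X e2 b v))"

lemma clin_WP: "clin (WP n e1 e2 a b)" and clin_WQ: "clin (WQ n e1 e2 a b)" and clin_WH: "clin (WH n e1 e2 a b)"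
  unfolding WP_def[abs_def] WQ_def[abs_def] WH_def[abs_def]
  by (rule clin_comp[OF clin_V clin_comp[OF clin_V clin_V]])+

lemma WP_swap: "WP n e2 e1 b a v = - WP n e1 e2 a b v"
  by (simp add: WP_def anti_X[of e2 b e1])

lemma WQ_swap: "WQ n e2 e1 b a v = - WQ n e1 e2 a b v"
  by (simp add: WQ_def anti_X[of e2 b e1] clin_minus)

text \<open>The index of the X acting first is bounded below uniformly in the other one; since the
  two X anticommute, either can be brought to that place.\<close>

lemma supp_finite_WP: "finite (supp e1 e2 (WP n e1 e2) m1 m2 k v)"
proof (rule supp_finite[OF clin_WP])
  have "\<exists>B. \<forall>a<B. \<forall>b. WP n e2 e1 b a x = 0" for e1 e2 x
  proof -
    obtain B where "\<forall>m<B. X e1 m (D n x) = 0" using X_below by blast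
    then have "\<forall>a<B. \<forall>b. WP n e2 e1 b a x = 0" by (simp add: WP_def clin_zero)
    then show ?thesis by blast
  qed
  from this[of e2 e1] this[of e1 e2] show "\<forall>x. \<exists>B. \<forall>b<B. \<forall>a. WP n e1 e2 a b x = 0" "\<forall>x. \<exists>B. \<forall>a<B. \<forall>b. WP n e1 e2 a b x = 0"
    by (simp_all add: WP_swap[of n e2 e1])
  show "\<forall>x. finite {(a, b). a \<le> m1 \<and> b \<le> m2 \<and> WP n e1 e2 a b x \<noteq> 0}"
    using below_below[of "X e1" "\<lambda>b v. X e2 b (D n v)"] by (simp add: WP_def X_below)
qed

lemma supp_finite_WQ: "finite (supp e1 e2 (WQ n e1 e2) m1 m2 k v)"
proof (rule supp_finite[OF clin_WQ])
  have "\<exists>B. \<forall>a<B. \<forall>b. WQ n e2 e1 b a x = 0" for e1 e2 x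
  proof -
    obtain B where "\<forall>m<B. X e1 m x = 0" using X_below by blast
    then have "\<forall>a<B. \<forall>b. WQ n e2 e1 b a x = 0" by (simp add: WQ_def clin_zero)
    then show ?thesis by blast
  qed
  from this[of e2 e1] this[of e1 e2] show "\<forall>x. \<exists>B. \<forall>b<B. \<forall>a. WQ n e1 e2 a b x = 0" "\<forall>x. \<exists>B. \<forall>a<B. \<forall>b. WQ n e1 e2 a b x = 0"
    by (simp_all add: WQ_swap[of n e2 e1])
  show "\<forall>x. finite {(a, b). a \<le> m1 \<and> b \<le> m2 \<and> WQ n e1 e2 a b x \<noteq> 0}"
    using below_below[of "\<lambda>a v. D n (X e1 a v)" "X e2"] by (simp add: WQ_def X_below DX_below clin_DX)
qed

text \<open>With D between them the two X cannot be exchanged, so the bound for the left one comes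
  from \<open>XDX_below\<close>.\<close>

lemma supp_finite_WH:
  assumes "e2 \<in> terms s l"
  shows "finite (supp e1 e2 (WH n e1 e2) m1 m2 k v)"
proof (rule supp_finite[OF clin_WH])
  show "\<forall>x. \<exists>B. \<forall>b<B. \<forall>a. WH n e1 e2 a b x = 0"
  proof
    fix x
    obtain B where "\<forall>m<B. X e2 m x = 0" using X_below by blast
    then have "\<forall>b<B. \<forall>a. WH n e1 e2 a b x = 0" by (simp add: WH_def clin_zero)
    then show "\<exists>B. \<forall>b<B. \<forall>a. WH n e1 e2 a b x = 0" by blast
  qed
  show "\<forall>x. \<exists>B. \<forall>a<B. \<forall>b. WH n e1 e2 a b x = 0" if "reg e1" "\<not> reg e2"
    using XDX_below[OF that assms] by (simp add: WH_def)
  show "\<forall>x. finite {(a, b). a \<le> m1 \<and> b \<le> m2 \<and> WH n e1 e2 a b x \<noteq> 0}"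
    using below_below[of "X e1" "\<lambda>b v. D n (X e2 b v)"] by (simp add: WH_def X_below DX_below)
qed

definition word_term :: "int \<Rightarrow> int \<Rightarrow> int \<Rightarrow> fvec \<Rightarrow> (int \<Rightarrow> int \<Rightarrow> fop) \<Rightarrow> int \<times> int \<Rightarrow> fvec" where
  "word_term m1 m2 k v W A = Ins \<Psi> (W (m1 - fst A) (m2 - snd A)) (k + fst A + snd A) v"

text \<open>Any finite S containing the support will do, so all words of the commutator can be
  summed over one common set.\<close>

lemma word_sum:
  assumes "finite S" "supp e1 e2 W m1 m2 k v \<subseteq> S" "\<And>A. A \<notin> reg_set e1 \<Longrightarrow> \<alpha> A = 0" "\<And>A. A \<notin> reg_set e2 \<Longrightarrow> \<beta> A = 0"
  shows "Sum_any (\<lambda>A1. Sum_any (\<lambda>A2. cscale (\<alpha> A1 * \<beta> A2) (Ins \<Psi> (W (m1 - A1) (m2 - A2)) (k + A1 + A2) v))) =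
      (\<Sum>A\<in>S. cscale (\<alpha> (fst A) * \<beta> (snd A)) (word_term m1 m2 k v W A))"
    and "Sum_any (\<lambda>A1. Sum_any (\<lambda>A2. cscale (\<beta> A2 * \<alpha> A1) (Ins \<Psi> (W (m1 - A1) (m2 - A2)) (k + A1 + A2) v))) =
      (\<Sum>A\<in>S. cscale (\<alpha> (fst A) * \<beta> (snd A)) (word_term m1 m2 k v W A))"
    and "Sum_any (\<lambda>A2. Sum_any (\<lambda>A1. cscale (\<alpha> A1 * \<beta> A2) (Ins \<Psi> (W (m1 - A1) (m2 - A2)) (k + A2 + A1) v))) =
      (\<Sum>A\<in>S. cscale (\<alpha> (fst A) * \<beta> (snd A)) (word_term m1 m2 k v W A))"
proof -
  have *: "(A1, A2) \<in> S" if "cscale (\<alpha> A1 * \<beta> A2) (Ins \<Psi> (W (m1 - A1) (m2 - A2)) (k + A1 + A2) v) \<noteq> 0" for A1 A2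
  proof -
    have "A1 \<in> reg_set e1" "A2 \<in> reg_set e2" using that assms(3,4) by auto
    then have "(A1, A2) \<in> supp e1 e2 W m1 m2 k v" using that by (auto simp: supp_def)
    then show ?thesis using assms(2) by blast
  qed
  have S: "(\<Sum>A\<in>S. cscale (\<alpha> (fst A) * \<beta> (snd A)) (word_term m1 m2 k v W A)) =
      (\<Sum>(A1, A2)\<in>S. cscale (\<alpha> A1 * \<beta> A2) (Ins \<Psi> (W (m1 - A1) (m2 - A2)) (k + A1 + A2) v))"
    by (simp add: word_term_def case_prod_unfold)
  show 1: "Sum_any (\<lambda>A1. Sum_any (\<lambda>A2. cscale (\<alpha> A1 * \<beta> A2) (Ins \<Psi> (W (m1 - A1) (m2 - A2)) (k + A1 + A2) v))) =
      (\<Sum>A\<in>S. cscale (\<alpha> (fst A) * \<beta> (snd A)) (word_term m1 m2 k v W A))"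
    unfolding S by (rule Sum_any_nested(1)[OF assms(1) *])
  then show "Sum_any (\<lambda>A1. Sum_any (\<lambda>A2. cscale (\<beta> A2 * \<alpha> A1) (Ins \<Psi> (W (m1 - A1) (m2 - A2)) (k + A1 + A2) v))) =
      (\<Sum>A\<in>S. cscale (\<alpha> (fst A) * \<beta> (snd A)) (word_term m1 m2 k v W A))"
    by (simp only: mult.commute)
  have "Sum_any (\<lambda>A2. Sum_any (\<lambda>A1. cscale (\<alpha> A1 * \<beta> A2) (Ins \<Psi> (W (m1 - A1) (m2 - A2)) (k + A1 + A2) v))) =
      (\<Sum>A\<in>S. cscale (\<alpha> (fst A) * \<beta> (snd A)) (word_term m1 m2 k v W A))"
    unfolding S by (rule Sum_any_nested(2)[OF assms(1) *])
  then show "Sum_any (\<lambda>A2. Sum_any (\<lambda>A1. cscale (\<alpha> A1 * \<beta> A2) (Ins \<Psi> (W (m1 - A1) (m2 - A2)) (k + A2 + A1) v))) =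
      (\<Sum>A\<in>S. cscale (\<alpha> (fst A) * \<beta> (snd A)) (word_term m1 m2 k v W A))"
    by (simp only: add_ac)
qed

lemma abs_WP: "(\<lambda>v. X e1 a (X e2 b (D n v))) = WP n e1 e2 a b"
  and abs_WQ: "(\<lambda>v. D n (X e1 a (X e2 b v))) = WQ n e1 e2 a b"
  and abs_WH: "(\<lambda>v. X e1 a (D n (X e2 b v))) = WH n e1 e2 a b"
  by (simp_all add: fun_eq_iff WP_def WQ_def WH_def)

lemma fun_WP_swap: "WP n e2 e1 b a = (\<lambda>v. - WP n e1 e2 a b v)"
  and fun_WQ_swap: "WQ n e2 e1 b a = (\<lambda>v. - WQ n e1 e2 a b v)"
  using WP_swap WQ_swap by blast+

lemma word_term_WP_swap: "word_term m1 m2 k v (\<lambda>a b. WP n e2 e1 b a) A = - word_term m1 m2 k v (WP n e1 e2) A"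
  and word_term_WQ_swap: "word_term m1 m2 k v (\<lambda>a b. WQ n e2 e1 b a) A = - word_term m1 m2 k v (WQ n e1 e2) A"
  by (simp_all only: word_term_def fun_WP_swap[of n e2 e1] fun_WQ_swap[of n e2 e1] Ins_minus)

lemma supp_WP_swap: "supp e1 e2 (\<lambda>a b. WP n e2 e1 b a) m1 m2 k v = supp e1 e2 (WP n e1 e2) m1 m2 k v"
  and supp_WQ_swap: "supp e1 e2 (\<lambda>a b. WQ n e2 e1 b a) m1 m2 k v = supp e1 e2 (WQ n e1 e2) m1 m2 k v"
  by (simp_all add: supp_def fun_WP_swap[of n e2 e1] fun_WQ_swap[of n e2 e1] Ins_minus)

text \<open>These are the eight words of the commutator. A sign -1 appears exactly when D stands
  right of C and has to be moved past it.\<close>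

lemma words:
  fixes v :: fvec and e1 e2 m1 m2 :: int and S :: "(int \<times> int) set"
  assumes e: "e1 \<in> terms s l" "e2 \<in> terms s l"
    and S: "finite S" "supp e1 e2 (WP n e1 e2) m1 m2 k v \<subseteq> S" "supp e1 e2 (WQ n e1 e2) m1 m2 k v \<subseteq> S"
      "supp e1 e2 (WH n e1 e2) m1 m2 k v \<subseteq> S" "supp e1 e2 (\<lambda>a b. WH n e2 e1 b a) m1 m2 k v \<subseteq> S"
  defines "F \<equiv> word_term m1 m2 k v" and "L1 \<equiv> \<lambda>A. Lc e1 (fst A)" and "R1 \<equiv> \<lambda>A. Rc e1 (fst A)"
    and "L2 \<equiv> \<lambda>A. Lc e2 (snd A)" and "R2 \<equiv> \<lambda>A. Rc e2 (snd A)"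
  shows "X e1 m1 (V \<Psi> k (X e2 m2 (D n v))) = cscale (- 1) (\<Sum>A\<in>S. cscale (L1 A * R2 A) (F (WP n e1 e2) A))"
    and "X e1 m1 (V \<Psi> k (D n (X e2 m2 v))) = cscale (- 1) (\<Sum>A\<in>S. cscale (L1 A * R2 A) (F (WH n e1 e2) A))"
    and "V \<Psi> k (X e1 m1 (X e2 m2 (D n v))) = cscale (1 * - 1) (\<Sum>A\<in>S. cscale (R1 A * R2 A) (F (WP n e1 e2) A))"
    and "V \<Psi> k (X e1 m1 (D n (X e2 m2 v))) = cscale (1 * - 1) (\<Sum>A\<in>S. cscale (R1 A * R2 A) (F (WH n e1 e2) A))"
    and "X e2 m2 (D n (X e1 m1 (V \<Psi> k v))) = (\<Sum>A\<in>S. cscale (L1 A * L2 A) (F (\<lambda>a b. WH n e2 e1 b a) A))"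
    and "X e2 m2 (D n (V \<Psi> k (X e1 m1 v))) = cscale 1 (\<Sum>A\<in>S. cscale (R1 A * L2 A) (F (\<lambda>a b. WH n e2 e1 b a) A))"
    and "D n (X e2 m2 (X e1 m1 (V \<Psi> k v))) = (\<Sum>A\<in>S. cscale (L1 A * L2 A) (F (\<lambda>a b. WQ n e2 e1 b a) A))"
    and "D n (X e2 m2 (V \<Psi> k (X e1 m1 v))) = cscale 1 (\<Sum>A\<in>S. cscale (R1 A * L2 A) (F (\<lambda>a b. WQ n e2 e1 b a) A))"
proof -
  note x = leftop_X[OF e(1)] rightop_X[OF e(1)] leftop_XD[OF e(2), of n] leftop_DX[OF e(2), of n] rightop_XD[OF e(2), of n] rightop_DX[OF e(2), of n]
  note d = F_def L1_def L2_def R1_def R2_def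
  note LR = word_LR[OF x(1,5) X_below] word_LR[OF x(1,6) DX_below] word_LR[OF x(3,2) X_below] word_LR[OF x(4,2) X_below]
  note S' = S(3)[folded supp_WQ_swap]
  show "X e1 m1 (V \<Psi> k (X e2 m2 (D n v))) = cscale (- 1) (\<Sum>A\<in>S. cscale (L1 A * R2 A) (F (WP n e1 e2) A))"
    unfolding LR(1) d abs_WP by (subst word_sum(3)[OF S(1,2) Lc_supp Rc_supp]) simp_all
  show "X e1 m1 (V \<Psi> k (D n (X e2 m2 v))) = cscale (- 1) (\<Sum>A\<in>S. cscale (L1 A * R2 A) (F (WH n e1 e2) A))"
    unfolding LR(2) d abs_WH by (subst word_sum(3)[OF S(1,4) Lc_supp Rc_supp]) simp_all
  show "V \<Psi> k (X e1 m1 (X e2 m2 (D n v))) = cscale (1 * - 1) (\<Sum>A\<in>S. cscale (R1 A * R2 A) (F (WP n e1 e2) A))"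
    unfolding word_RR[OF x(2,5)] d abs_WP by (subst word_sum(1)[OF S(1,2) Rc_supp Rc_supp]) simp_all
  show "V \<Psi> k (X e1 m1 (D n (X e2 m2 v))) = cscale (1 * - 1) (\<Sum>A\<in>S. cscale (R1 A * R2 A) (F (WH n e1 e2) A))"
    unfolding word_RR[OF x(2,6)] d abs_WH by (subst word_sum(1)[OF S(1,4) Rc_supp Rc_supp]) simp_all
  show "X e2 m2 (D n (X e1 m1 (V \<Psi> k v))) = (\<Sum>A\<in>S. cscale (L1 A * L2 A) (F (\<lambda>a b. WH n e2 e1 b a) A))"
    unfolding word_LL[OF x(3,1)] d abs_WH by (subst word_sum(2)[OF S(1,5) Lc_supp Lc_supp]) simp_all
  show "X e2 m2 (D n (V \<Psi> k (X e1 m1 v))) = cscale 1 (\<Sum>A\<in>S. cscale (R1 A * L2 A) (F (\<lambda>a b. WH n e2 e1 b a) A))"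
    unfolding LR(3) d abs_WH by (subst word_sum(2)[OF S(1,5) Rc_supp Lc_supp]) simp_all
  show "D n (X e2 m2 (X e1 m1 (V \<Psi> k v))) = (\<Sum>A\<in>S. cscale (L1 A * L2 A) (F (\<lambda>a b. WQ n e2 e1 b a) A))"
    unfolding word_LL[OF x(4,1)] d abs_WQ by (subst word_sum(2)[OF S(1) S' Lc_supp Lc_supp]) simp_all
  show "D n (X e2 m2 (V \<Psi> k (X e1 m1 v))) = cscale 1 (\<Sum>A\<in>S. cscale (R1 A * L2 A) (F (\<lambda>a b. WQ n e2 e1 b a) A))"
    unfolding LR(4) d abs_WQ by (subst word_sum(2)[OF S(1) S' Rc_supp Lc_supp]) simp_all
qed

section \<open>Cancellation in the symmetrised commutator\<close>

abbreviation "brC t k e m \<equiv> V_bracket t s l e m ic ec k"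
abbreviation "brD t n e m \<equiv> V_bracket t s l e m jd ed n"

definition br_comm :: "complex \<Rightarrow> complex \<Rightarrow> int \<Rightarrow> int \<Rightarrow> int \<Rightarrow> int \<Rightarrow> int \<Rightarrow> int \<Rightarrow> fop" where
  "br_comm t t' k n e1 m1 e2 m2 v = brC t k e1 m1 (brD t' n e2 m2 v) - brD t' n e2 m2 (brC t k e1 m1 v)"

text \<open>The words C X D X and D X C X carry t t', which is 1; the remaining powers of t and t'
  are kept symbolic until symmetrisation.\<close>

lemma br_comm_expand:
  fixes v :: fvec and e1 e2 m1 m2 :: int and S :: "(int \<times> int) set"
  assumes e: "e1 \<in> terms s l" "e2 \<in> terms s l" and t: "t * t' = 1"
    and S: "finite S" "supp e1 e2 (WP n e1 e2) m1 m2 k v \<subseteq> S" "supp e1 e2 (WQ n e1 e2) m1 m2 k v \<subseteq> S"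
      "supp e1 e2 (WH n e1 e2) m1 m2 k v \<subseteq> S" "supp e1 e2 (\<lambda>a b. WH n e2 e1 b a) m1 m2 k v \<subseteq> S"
  shows "br_comm t t' k n e1 m1 e2 m2 v = (\<Sum>A\<in>S.
     cscale (- (Lc e1 (fst A) * Rc e2 (snd A) + t * (Rc e1 (fst A) * Rc e2 (snd A)))) (word_term m1 m2 k v (WP n e1 e2) A)
   + cscale (- (t' * (Lc e1 (fst A) * Rc e2 (snd A)) + Rc e1 (fst A) * Rc e2 (snd A))) (word_term m1 m2 k v (WH n e1 e2) A)
   + cscale (- (Lc e1 (fst A) * Lc e2 (snd A) + t * (Rc e1 (fst A) * Lc e2 (snd A)))) (word_term m1 m2 k v (\<lambda>a b. WH n e2 e1 b a) A)
   + cscale (t' * (Lc e1 (fst A) * Lc e2 (snd A)) + Rc e1 (fst A) * Lc e2 (snd A)) (word_term m1 m2 k v (WQ n e1 e2) A))"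
proof -
  note w = words[OF e S]
  have "br_comm t t' k n e1 m1 e2 m2 v =
      X e1 m1 (V \<Psi> k (X e2 m2 (D n v))) + cscale t' (X e1 m1 (V \<Psi> k (D n (X e2 m2 v))))
    + cscale t (V \<Psi> k (X e1 m1 (X e2 m2 (D n v)))) + V \<Psi> k (X e1 m1 (D n (X e2 m2 v)))
    - X e2 m2 (D n (X e1 m1 (V \<Psi> k v))) - cscale t (X e2 m2 (D n (V \<Psi> k (X e1 m1 v))))
    - cscale t' (D n (X e2 m2 (X e1 m1 (V \<Psi> k v)))) - D n (X e2 m2 (V \<Psi> k (X e1 m1 v)))"
    using t by (simp add: br_comm_def V_bracket_def clin_add clin_scale fv.scale_right_distrib mult.commute[of t' t])
  also have "\<dots> = (\<Sum>A\<in>S.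
     cscale (- (Lc e1 (fst A) * Rc e2 (snd A) + t * (Rc e1 (fst A) * Rc e2 (snd A)))) (word_term m1 m2 k v (WP n e1 e2) A)
   + cscale (- (t' * (Lc e1 (fst A) * Rc e2 (snd A)) + Rc e1 (fst A) * Rc e2 (snd A))) (word_term m1 m2 k v (WH n e1 e2) A)
   + cscale (- (Lc e1 (fst A) * Lc e2 (snd A) + t * (Rc e1 (fst A) * Lc e2 (snd A)))) (word_term m1 m2 k v (\<lambda>a b. WH n e2 e1 b a) A)
   + cscale (t' * (Lc e1 (fst A) * Lc e2 (snd A)) + Rc e1 (fst A) * Lc e2 (snd A)) (word_term m1 m2 k v (WQ n e1 e2) A))"
    unfolding w fv.scale_sum_right sum.distrib[symmetric] sum_subtractf[symmetric] word_term_WQ_swap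
    by (rule sum.cong[OF refl], rule poly_mapping_eqI) (simp add: lookup_add lookup_minus algebra_simps)
  finally show ?thesis .
qed

lemma bij_add_pair: "bij (\<lambda>A :: int \<times> int. (fst A + a, snd A + b))"
proof (rule o_bij)
  show "(\<lambda>A. (fst A - a, snd A - b)) \<circ> (\<lambda>A. (fst A + a, snd A + b)) = id"
    "(\<lambda>A. (fst A + a, snd A + b)) \<circ> (\<lambda>A. (fst A - a, snd A - b)) = id" by auto
qed

definition cubic_word :: "complex \<Rightarrow> complex \<Rightarrow> int \<Rightarrow> int \<Rightarrow> int \<Rightarrow> int \<Rightarrow> int \<Rightarrow> fop" where
  "cubic_word x y n e1 e2 a b v = WP n e1 e2 a b v + WQ n e1 e2 a b v + cscale x (WH n e1 e2 a b v) - cscale y (WH n e2 e1 b a v)"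

lemma cubic_word_shift: "cubic_word u w n e1 e2 (a - 1) b = cubic_word w u n e1 e2 a (b - 1)"
  unfolding cubic_word_def[abs_def] WP_def WQ_def WH_def using cubic by blast

lemma word_term_cubic: "word_term m1 m2 k v (cubic_word x y n e1 e2) A = word_term m1 m2 k v (WP n e1 e2) A + word_term m1 m2 k v (WQ n e1 e2) A
   + cscale x (word_term m1 m2 k v (WH n e1 e2) A) - cscale y (word_term m1 m2 k v (\<lambda>a b. WH n e2 e1 b a) A)"
proof -
  have "Ins \<Psi> (cubic_word x y n e1 e2 a b) j v = Ins \<Psi> (WP n e1 e2 a b) j v + Ins \<Psi> (WQ n e1 e2 a b) j v
     + cscale x (Ins \<Psi> (WH n e1 e2 a b) j v) - cscale y (Ins \<Psi> (WH n e2 e1 b a) j v)" for a b j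
    unfolding cubic_word_def[abs_def]
    by (simp only: Ins_diff Ins_add Ins_cscale clin_plus clin_cscale clin_WP clin_WQ clin_WH)
  then show ?thesis by (simp add: word_term_def)
qed

text \<open>Removing the unit shift from \<open>dl\<close> by reindexing lowers the index of one X
  or of the other; \<open>cubic_word_shift\<close> says that the two results agree.\<close>

lemma cubic_word_sum:
  "Sum_any (\<lambda>A. cscale (dl e1 (fst A - 1) * dl e2 (snd A)) (word_term m1 m2 k v (cubic_word u w n e1 e2) A)) =
   Sum_any (\<lambda>A. cscale (dl e1 (fst A) * dl e2 (snd A - 1)) (word_term m1 m2 k v (cubic_word w u n e1 e2) A))"
  (is "Sum_any ?f = Sum_any ?g")
proof -
  have "Sum_any ?f = Sum_any (\<lambda>A. ?f (fst A + 1, snd A + 0))"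
    by (rule Sum_any_reindex[OF bij_add_pair, symmetric])
  also have "\<dots> = Sum_any (\<lambda>A. ?g (fst A + 0, snd A + 1))"
  proof (rule Sum_any.cong)
    fix A :: "int \<times> int"
    show "?f (fst A + 1, snd A + 0) = ?g (fst A + 0, snd A + 1)"
      using cubic_word_shift[of n e1 e2 "m1 - fst A" "m2 - snd A"] by (simp add: word_term_def algebra_simps)
  qed
  also have "\<dots> = Sum_any ?g"
    by (rule Sum_any_reindex[OF bij_add_pair])
  finally show ?thesis .
qed

text \<open>In the symmetrised commutator every word in \<open>X e1\<close>, \<open>X e2\<close>, \<open>D\<close> carries a combination of products of \<open>Lc\<close>
  and \<open>Rc\<close>.  As \<open>t + t' = u + w\<close>, the products of \<open>dl\<close> with equal shifts cancel in it.\<close>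

lemma coef_P: "Rc e1 a * Lc e2 b - Lc e1 a * Rc e2 b =
    - (cc e1 * cc e2 * (u * u - 1)) * (dl e1 (a - 1) * dl e2 b - dl e1 a * dl e2 (b - 1))"
  unfolding Lc_def Rc_def by (simp add: algebra_simps)

lemma coef_H: "- ((u + w) * (Lc e1 a * Rc e2 b) + Rc e1 a * Rc e2 b + Lc e1 a * Lc e2 b) =
    - (cc e1 * cc e2 * (u * u - 1)) * (dl e1 (a - 1) * dl e2 b * u - dl e1 a * dl e2 (b - 1) * w)"
proof -
  have "- ((u + w) * (c * (u * x' - x) * (- d * (y' - u * y))) + - c * (x' - u * x) * (- d * (y' - u * y)) + c * (u * x' - x) * (d * (u * y' - y)))
     = - (c * d * (u * u - 1)) * (x' * y * u - x * y' * w)" if "u * w = 1" for c d x x' y y' u w :: complex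
    using that by algebra
  from this[OF uw(1)] show ?thesis unfolding Lc_def Rc_def .
qed

lemma coef_K: "- ((u + w) * (Rc e1 a * Lc e2 b) + Rc e1 a * Rc e2 b + Lc e1 a * Lc e2 b) =
    - (cc e1 * cc e2 * (u * u - 1)) * (dl e1 a * dl e2 (b - 1) * u - dl e1 (a - 1) * dl e2 b * w)"
  using coef_H[of e2 b e1 a] by (simp only: mult_ac)

lemma br_comm_symmetrised:
  fixes v :: fvec
  assumes e: "e1 \<in> terms s l" "e2 \<in> terms s l" and t: "t * t' = 1" "t + t' = u + w"
  shows "br_comm t t' k n e1 m1 e2 m2 v + br_comm t t' k n e2 m2 e1 m1 v = 0"
proof -
  define S where "S = supp e1 e2 (WP n e1 e2) m1 m2 k v \<union> supp e1 e2 (WQ n e1 e2) m1 m2 k v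
      \<union> supp e1 e2 (WH n e1 e2) m1 m2 k v \<union> supp e1 e2 (\<lambda>a b. WH n e2 e1 b a) m1 m2 k v"
  have fin: "finite S"
    unfolding S_def supp_swap[of e1 e2 "\<lambda>a b. WH n e2 e1 b a"]
    by (intro finite_UnI finite_imageI supp_finite_WP supp_finite_WQ supp_finite_WH e)
  let ?F = "word_term m1 m2 k v"
  let ?L1 = "\<lambda>A. Lc e1 (fst A)" and ?R1 = "\<lambda>A. Rc e1 (fst A)" and ?L2 = "\<lambda>A. Lc e2 (snd A)" and ?R2 = "\<lambda>A. Rc e2 (snd A)"
  let ?P = "WP n e1 e2" and ?Q = "WQ n e1 e2" and ?H = "WH n e1 e2" and ?K = "\<lambda>a b. WH n e2 e1 b a"
  have 1: "br_comm t t' k n e1 m1 e2 m2 v = (\<Sum>A\<in>S.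
     cscale (- (?L1 A * ?R2 A + t * (?R1 A * ?R2 A))) (?F ?P A)
   + cscale (- (t' * (?L1 A * ?R2 A) + ?R1 A * ?R2 A)) (?F ?H A)
   + cscale (- (?L1 A * ?L2 A + t * (?R1 A * ?L2 A))) (?F ?K A)
   + cscale (t' * (?L1 A * ?L2 A) + ?R1 A * ?L2 A) (?F ?Q A))"
    by (rule br_comm_expand[OF e t(1) fin]) (auto simp: S_def)
  \<comment> \<open>Interchanging the roles of 1 and 2 transposes the index set, so both commutators
    can be written over the same S.\<close>
  have word_term_swap: "word_term m2 m1 k v W (prod.swap A) = ?F (\<lambda>a b. W b a) A" for W A
    by (simp add: word_term_def add_ac)
  have "br_comm t t' k n e2 m2 e1 m1 v = (\<Sum>A\<in>prod.swap ` S.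
     cscale (- (Lc e2 (fst A) * Rc e1 (snd A) + t * (Rc e2 (fst A) * Rc e1 (snd A)))) (word_term m2 m1 k v (WP n e2 e1) A)
   + cscale (- (t' * (Lc e2 (fst A) * Rc e1 (snd A)) + Rc e2 (fst A) * Rc e1 (snd A))) (word_term m2 m1 k v (WH n e2 e1) A)
   + cscale (- (Lc e2 (fst A) * Lc e1 (snd A) + t * (Rc e2 (fst A) * Lc e1 (snd A)))) (word_term m2 m1 k v (\<lambda>a b. WH n e1 e2 b a) A)
   + cscale (t' * (Lc e2 (fst A) * Lc e1 (snd A)) + Rc e2 (fst A) * Lc e1 (snd A)) (word_term m2 m1 k v (WQ n e2 e1) A))"
    by (rule br_comm_expand[OF e(2,1) t(1)])
       (use fin in \<open>auto simp: S_def supp_swap[of e2 e1] supp_WP_swap[of e1 e2] supp_WQ_swap[of e1 e2]\<close>)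
  also have "\<dots> = (\<Sum>A\<in>S.
     cscale (?L2 A * ?R1 A + t * (?R2 A * ?R1 A)) (?F ?P A)
   + cscale (- (t' * (?L2 A * ?R1 A) + ?R2 A * ?R1 A)) (?F ?K A)
   + cscale (- (?L2 A * ?L1 A + t * (?R2 A * ?L1 A))) (?F ?H A)
   + cscale (- (t' * (?L2 A * ?L1 A) + ?R2 A * ?L1 A)) (?F ?Q A))"
    unfolding sum.reindex[OF inj_swap] o_def word_term_swap word_term_WP_swap[of _ _ _ _ n e2 e1] word_term_WQ_swap[of _ _ _ _ n e2 e1] fst_swap snd_swap
    by (intro sum.cong[OF refl] poly_mapping_eqI) (simp add: lookup_add algebra_simps)
  finally have 2: "br_comm t t' k n e2 m2 e1 m1 v = \<dots>" .
  have "br_comm t t' k n e1 m1 e2 m2 v + br_comm t t' k n e2 m2 e1 m1 v = (\<Sum>A\<in>S.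
     cscale (?R1 A * ?L2 A - ?L1 A * ?R2 A) (?F ?P A + ?F ?Q A)
   + cscale (- ((t + t') * (?L1 A * ?R2 A) + ?R1 A * ?R2 A + ?L1 A * ?L2 A)) (?F ?H A)
   + cscale (- ((t + t') * (?R1 A * ?L2 A) + ?R1 A * ?R2 A + ?L1 A * ?L2 A)) (?F ?K A))"
    unfolding 1 2 sum.distrib[symmetric]
    by (intro sum.cong[OF refl] poly_mapping_eqI) (simp add: lookup_add algebra_simps)
  also have "\<dots> = cscale (- (cc e1 * cc e2 * (u * u - 1))) (\<Sum>A\<in>S.
     cscale (dl e1 (fst A - 1) * dl e2 (snd A)) (?F (cubic_word u w n e1 e2) A) - cscale (dl e1 (fst A) * dl e2 (snd A - 1)) (?F (cubic_word w u n e1 e2) A))"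
    unfolding t(2) coef_P coef_H coef_K word_term_cubic fv.scale_sum_right
    by (intro sum.cong[OF refl] poly_mapping_eqI) (simp add: lookup_add lookup_minus algebra_simps)
  also have "(\<Sum>A\<in>S.
     cscale (dl e1 (fst A - 1) * dl e2 (snd A)) (?F (cubic_word u w n e1 e2) A) - cscale (dl e1 (fst A) * dl e2 (snd A - 1)) (?F (cubic_word w u n e1 e2) A)) = 0"
  proof -
    \<comment> \<open>Outside S a cubic word can be nonzero only where an index leaves
      \<open>reg_set\<close>, and there the factor \<open>dl\<close> vanishes.\<close>
    have zero: "?F (cubic_word x y n e1 e2) A = 0" if "A \<notin> S" "fst A \<in> reg_set e1" "snd A \<in> reg_set e2" for A x y
      using that unfolding word_term_cubic by (cases A) (auto simp: S_def supp_def word_term_def)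
    have "Sum_any (\<lambda>A. cscale (dl e1 (fst A - 1) * dl e2 (snd A)) (?F (cubic_word u w n e1 e2) A)) =
       (\<Sum>A\<in>S. cscale (dl e1 (fst A - 1) * dl e2 (snd A)) (?F (cubic_word u w n e1 e2) A))"
      by (rule Sum_any_supp[OF fin]) (metis zero dl_supp fv.scale_zero_left fv.scale_zero_right mult_zero_left mult_zero_right)
    moreover have "Sum_any (\<lambda>A. cscale (dl e1 (fst A) * dl e2 (snd A - 1)) (?F (cubic_word w u n e1 e2) A)) =
       (\<Sum>A\<in>S. cscale (dl e1 (fst A) * dl e2 (snd A - 1)) (?F (cubic_word w u n e1 e2) A))"
      by (rule Sum_any_supp[OF fin]) (metis zero dl_supp fv.scale_zero_left fv.scale_zero_right mult_zero_left mult_zero_right)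
    ultimately show ?thesis using cubic_word_sum[of e1 e2 m1 m2 k v n] by (simp add: sum_subtractf)
  qed
  finally show ?thesis by simp
qed

end

context currents
begin

section \<open>From vertex operators back to the currents\<close>

definition X_bracket :: "complex \<Rightarrow> pm \<Rightarrow> nat \<Rightarrow> int \<Rightarrow> nat \<Rightarrow> int \<Rightarrow> fop" where
  "X_bracket t s l k i m v = X_cur h N s l k (X_cur h N s i m v) + cscale t (X_cur h N s i m (X_cur h N s l k v))"

lemma sbracket_X: "sbracket 1 1 t (X_cur h N s l k) (X_cur h N s i m) = X_bracket t s l k i m"
  by (simp add: fun_eq_iff sbracket_def X_bracket_def)

lemma X_bracket_expand:
  assumes "l \<in> {1..2 * N - 1}" "i \<in> {1..2 * N - 1}"
  shows "X_bracket t s l k i m v = (\<Sum>e'\<in>terms s i. \<Sum>e\<in>terms s l.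
    cscale (xcoef s l e * xcoef s i e') (V_bracket t s l e (k + xexp s l) i e' (m + xexp s i) v))"
  unfolding X_bracket_def X_cur_X_cur[OF assms] X_cur_X_cur'[OF assms] fv.scale_sum_right sum.distrib[symmetric]
  by (subst sum.swap) (simp add: V_bracket_def fv.scale_right_distrib mult_ac)

lemma X_bracket_commutator:
  assumes l: "l \<in> {1..2 * N - 1}" and ij: "i \<in> {1..2 * N - 1}" "j \<in> {1..2 * N - 1}"
  shows "X_bracket t s l k1 i m (X_bracket t' s l k2 j n v) - X_bracket t' s l k2 j n (X_bracket t s l k1 i m v) =
    (\<Sum>ec\<in>terms s i. \<Sum>ed\<in>terms s j. \<Sum>e1\<in>terms s l. \<Sum>e2\<in>terms s l.
      cscale (xcoef s l e1 * xcoef s i ec * (xcoef s l e2 * xcoef s j ed))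
       (V_bracket t s l e1 (k1 + xexp s l) i ec (m + xexp s i) (V_bracket t' s l e2 (k2 + xexp s l) j ed (n + xexp s j) v)
      - V_bracket t' s l e2 (k2 + xexp s l) j ed (n + xexp s j) (V_bracket t s l e1 (k1 + xexp s l) i ec (m + xexp s i) v)))"
proof -
  let ?x = "\<lambda>e1 e2 ec ed. xcoef s l e1 * xcoef s i ec * (xcoef s l e2 * xcoef s j ed)"
  let ?C = "\<lambda>e ec. V_bracket t s l e (k1 + xexp s l) i ec (m + xexp s i)"
  let ?D = "\<lambda>e ed. V_bracket t' s l e (k2 + xexp s l) j ed (n + xexp s j)"
  have "X_bracket t s l k1 i m (X_bracket t' s l k2 j n v) = (\<Sum>ec\<in>terms s i. \<Sum>e1\<in>terms s l. \<Sum>ed\<in>terms s j. \<Sum>e2\<in>terms s l.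
      cscale (?x e1 e2 ec ed) (?C e1 ec (?D e2 ed v)))"
    unfolding X_bracket_expand[OF l ij(1)] X_bracket_expand[OF l ij(2)]
    by (simp add: clin_sum[OF clin_V_bracket] clin_scale[OF clin_V_bracket] fv.scale_sum_right)
  also have "\<dots> = (\<Sum>ec\<in>terms s i. \<Sum>ed\<in>terms s j. \<Sum>e1\<in>terms s l. \<Sum>e2\<in>terms s l.
      cscale (?x e1 e2 ec ed) (?C e1 ec (?D e2 ed v)))"
    by (rule sum.cong[OF refl], rule sum.swap)
  finally have 1: "X_bracket t s l k1 i m (X_bracket t' s l k2 j n v) = \<dots>" .
  have "X_bracket t' s l k2 j n (X_bracket t s l k1 i m v) = (\<Sum>ed\<in>terms s j. \<Sum>e2\<in>terms s l. \<Sum>ec\<in>terms s i. \<Sum>e1\<in>terms s l.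
      cscale (?x e1 e2 ec ed) (?D e2 ed (?C e1 ec v)))"
    unfolding X_bracket_expand[OF l ij(1)] X_bracket_expand[OF l ij(2)]
    by (simp add: clin_sum[OF clin_V_bracket] clin_scale[OF clin_V_bracket] fv.scale_sum_right mult_ac)
  also have "\<dots> = (\<Sum>ed\<in>terms s j. \<Sum>ec\<in>terms s i. \<Sum>e2\<in>terms s l. \<Sum>e1\<in>terms s l.
      cscale (?x e1 e2 ec ed) (?D e2 ed (?C e1 ec v)))"
    by (rule sum.cong[OF refl], rule sum.swap)
  also have "\<dots> = (\<Sum>ec\<in>terms s i. \<Sum>ed\<in>terms s j. \<Sum>e2\<in>terms s l. \<Sum>e1\<in>terms s l.
      cscale (?x e1 e2 ec ed) (?D e2 ed (?C e1 ec v)))"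
    by (rule sum.swap)
  also have "\<dots> = (\<Sum>ec\<in>terms s i. \<Sum>ed\<in>terms s j. \<Sum>e1\<in>terms s l. \<Sum>e2\<in>terms s l.
      cscale (?x e1 e2 ec ed) (?D e2 ed (?C e1 ec v)))"
    by (rule sum.cong[OF refl], rule sum.cong[OF refl], rule sum.swap)
  finally have 2: "X_bracket t' s l k2 j n (X_bracket t s l k1 i m v) = \<dots>" .
  show ?thesis
    unfolding 1 2 sum_subtractf[symmetric] fv.scale_right_diff_distrib ..
qed

lemma X_bracket_serre:
  assumes l: "l \<in> {1..2 * N - 1}" and ij: "i \<in> {1..2 * N - 1}" "j \<in> {1..2 * N - 1}"
    and near: "l \<noteq> i" "half l = half i" and nex: "l = j + 1 \<or> j = l + 1" "half l \<noteq> half j"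
    and far: "j + 1 < i \<or> i + 1 < j"
  shows "(X_bracket (qpow h 1) s l k1 i m (X_bracket (qpow h (- 1)) s l k2 j n v) - X_bracket (qpow h (- 1)) s l k2 j n (X_bracket (qpow h 1) s l k1 i m v))
    + (X_bracket (qpow h 1) s l k2 i m (X_bracket (qpow h (- 1)) s l k1 j n v) - X_bracket (qpow h (- 1)) s l k1 j n (X_bracket (qpow h 1) s l k2 i m v)) = 0"
proof -
  define c where "c ec ed e1 k e2 k' = 
      V_bracket (qpow h 1) s l e1 (k + xexp s l) i ec (m + xexp s i) (V_bracket (qpow h (- 1)) s l e2 (k' + xexp s l) j ed (n + xexp s j) v)
      - V_bracket (qpow h (- 1)) s l e2 (k' + xexp s l) j ed (n + xexp s j) (V_bracket (qpow h 1) s l e1 (k + xexp s l) i ec (m + xexp s i) v)"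
    for ec ed e1 e2 k k'
  let ?x = "\<lambda>e1 e2 ec ed. xcoef s l e1 * xcoef s i ec * (xcoef s l e2 * xcoef s j ed)"
  have c: "c ec ed e1 k1 e2 k2 + c ec ed e2 k2 e1 k1 = 0"
    if "ec \<in> terms s i" "ed \<in> terms s j" "e1 \<in> terms s l" "e2 \<in> terms s l" for ec ed e1 e2
  proof -
    interpret serre h N s l i j ec ed
      by unfold_locales (fact l ij near nex far that)+
    \<comment> \<open>u is q or 1/q depending on s, so u + w is q + 1/q in both cases.\<close>
    have "qpow h 1 * qpow h (- 1) = 1" "qpow h 1 + qpow h (- 1) = qpow h (sg s) + qpow h (- sg s)"
      by (simp add: qpow_add[symmetric], cases s, simp_all)
    from br_comm_symmetrised[OF that(3,4) this] show ?thesis by (simp add: br_comm_def c_def)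
  qed
  \<comment> \<open>Exchanging k1 and k2 is accompanied by exchanging the summation labels e1 and
    e2, so the two commutators pair term by term.\<close>
  have "(\<Sum>ec\<in>terms s i. \<Sum>ed\<in>terms s j. \<Sum>e1\<in>terms s l. \<Sum>e2\<in>terms s l. cscale (?x e1 e2 ec ed) (c ec ed e1 k2 e2 k1)) =
     (\<Sum>ec\<in>terms s i. \<Sum>ed\<in>terms s j. \<Sum>e1\<in>terms s l. \<Sum>e2\<in>terms s l. cscale (?x e1 e2 ec ed) (c ec ed e2 k2 e1 k1))"
    by (rule sum.cong[OF refl], rule sum.cong[OF refl], subst sum.swap) (simp only: mult_ac)
  then show ?thesis
    unfolding X_bracket_commutator[OF l ij] c_def[symmetric]
    by (simp add: sum.distrib[symmetric] fv.scale_right_distrib[symmetric] c)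
qed

lemma X_serre_rel:
  fixes s :: pm and l :: nat and m n :: int and v :: fvec
  assumes l: "l \<in> {2..2 * N - 2}"
  defines "S \<equiv> \<lambda>k1 k2. sbracket 0 0 1
             (sbracket 1 1 (qpow h ((- 1) ^ l)) (X_cur h N s l k1) (X_cur h N s (l - 1) m))
             (sbracket 1 1 (qpow h ((- 1) ^ (l + 1))) (X_cur h N s l k2) (X_cur h N s (l + 1) n)) v"
  shows "S m1 m2 + S m2 m1 = 0"
proof -
  have S: "S k1 k2 = X_bracket (qpow h ((- 1) ^ l)) s l k1 (l - 1) m (X_bracket (qpow h ((- 1) ^ (l + 1))) s l k2 (l + 1) n v)
    - X_bracket (qpow h ((- 1) ^ (l + 1))) s l k2 (l + 1) n (X_bracket (qpow h ((- 1) ^ l)) s l k1 (l - 1) m v)" for k1 k2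
    unfolding S_def sbracket_X by (simp add: sbracket_def)
  have r: "l \<in> {1..2 * N - 1}" "l - 1 \<in> {1..2 * N - 1}" "l + 1 \<in> {1..2 * N - 1}" using l by auto
  show ?thesis
  \<comment> \<open>The neighbour sharing c^k is l - 1 for even l and l + 1 for odd l; in both cases
    its bracket is the one with parameter q. For odd l the commutator occurs with the opposite
    sign.\<close>
  proof (cases "even l")
    case True
    then have hf: "l \<noteq> l - 1" "half l = half (l - 1)" "l = (l + 1) + 1 \<or> l + 1 = l + 1" "half l \<noteq> half (l + 1)"
      "(l + 1) + 1 < l - 1 \<or> (l - 1) + 1 < l + 1" using l by (auto simp: half_def elim!: evenE)
    show ?thesis using X_bracket_serre[OF r hf, of s m1 m m2 n v] True by (simp add: S)
  next
    case False
    then have hf: "l \<noteq> l + 1" "half l = half (l + 1)" "l = (l - 1) + 1 \<or> l - 1 = l + 1" "half l \<noteq> half (l - 1)"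
      "(l - 1) + 1 < l + 1 \<or> (l + 1) + 1 < l - 1" using l by (auto simp: half_def elim!: oddE)
    show ?thesis using X_bracket_serre[OF r(1,3,2) hf, of s m1 n m2 m v] False by (simp add: S algebra_simps)
  qed
qed

end

theorem theorem1:
  fixes N :: nat and q h :: complex
  assumes "N \<ge> 1"
    and "q \<noteq> 0"
    and "\<And>n :: nat. n > 0 \<Longrightarrow> q ^ n \<noteq> 1"
    and "exp h = q"
  shows "drinfeld_currents h N 1 (fock N) (psi_cur h N) (X_cur h N)"
proof -
  interpret currents h N
    using assms by unfold_locales auto
  show ?thesis
    unfolding drinfeld_currents_def Let_def mult_1_right
    by (intro conjI allI impI; (rule psi_endo X_cur_endo psi_psi_rel psi_plus_psi_minus_rel psi_plus_X_rel psi_minus_X_rel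
        X_plus_X_minus_rel X_X_zero_rel X_X_rel X_serre_rel; assumption))
qed

end
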